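(* Let $\mathcal{A}$ be a 2-category with finite products. Let $(\mathcal{R},\phi,\eta,\mu)$ be an rc lax monoidal monad on an rc monoidal object $(\mathcal{C},\otimes,I,\alpha,\lambda,\rho)$ in $\mathcal{A}$ (i.e. a monad in $\mathbf{Mon}_l(\mathcal{A})$ such that $\mathcal{C}$, $\otimes$ and $\mathcal{R}$ are rc), and suppose that the monad $(\mathcal{R},\eta,\mu)$ in $\mathcal{A}$ admits an Eilenberg–Moore object $\mathcal{C}^{\mathcal{R}}$ in $\mathcal{A}$. Then $(\mathcal{R},\phi,\eta,\mu)$ admits the standard Eilenberg–Moore object $(\mathcal{C}^{\mathcal{R}},\ddot{\otimes},\ddot{I},\ddot{\alpha},\ddot{\lambda},\ddot{\rho})$ in $\mathbf{Mon}_l(\mathcal{A})$. The forgetful 1-cell $U^{\mathcal{R}}:\mathcal{C}^{\mathcal{R}}\to\mathcal{C}$ is lax monoidal with coherence morphism $\ddot{\mathbf u}$, and its left adjoint $(F^{\mathcal{R}},\ddot{\mathbf v})$ is strong monoidal. They give rise to a monoidal adjunction $((F^{\mathcal{R}},\ddot{\mathbf v})\dashv(U^{\mathcal{R}},\ddot{\mathbf u}),\eta,\varepsilon^{\mathcal{R}})$.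
   Context: All limits are strict 2-limits. Notation: for a 2-cell $\tau$ and composable 1-cells, $\tau_F$ is precomposition and $G(\tau)$ postcomposition whiskering. rc: a 0-cell $\mathcal{E}$ of $\mathcal{A}$ is rc if for every 0-cell $\mathcal{X}$ the category $\mathcal{A}(\mathcal{X},\mathcal{E})$ has reflexive coequalizers and every precomposition functor $\mathcal{A}(\mathcal{X},\mathcal{E})\to\mathcal{A}(\mathcal{Y},\mathcal{E})$ preserves them. A 1-cell between such 0-cells is rc if all postcomposition functors with it preserve reflexive coequalizers. A monoidal object is rc if its underlying 0-cell and its tensor are rc; a monad is rc if its 0-cell and its 1-cell are rc. A monoidal object in $\mathcal{A}$ is a 0-cell $\mathcal{C}$ with 1-cells $\otimes:\mathcal{C}\times\mathcal{C}\to\mathcal{C}$, $I:1\to\mathcal{C}$ and invertible 2-cells $\alpha_{A,B,C}:A\otimes(B\otimes C)\to(A\otimes B)\otimes C$, $\lambda_A:I\otimes A\to A$, $\rho_A:A\otimes I\to A$ satisfying the usual pentagon and triangle axioms. (Formulas with variables are read with variables denoting product projections.) Lax, oplax, strong and strict monoidal 1-cells and monoidal 2-cells are defined as for monoidal functors and monoidal transformations; $\mathbf{Mon}_l(\mathcal{A})$ is the 2-category of monoidal objects, lax monoidal 1-cells $(F,\phi,\bar\phi)$ and monoidal 2-cells. For a monad $(\mathcal{C},\mathcal{R},\eta,\mu)$ a subequalizing of $\mathcal{R}$ on $\mathcal{X}$ is a 1-cell $u:\mathcal{X}\to\mathcal{C}$ with a 2-cell $\nu:\mathcal{R}u\to u$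 such that $\nu\circ\eta_u=1_u$ and $\nu\circ\mathcal{R}(\nu)=\nu\circ\mu_u$; morphisms are 2-cells commuting with the $\nu$'s. The Eilenberg–Moore object is a universal subequalizing $(\mathcal{C}^{\mathcal{R}},U^{\mathcal{R}},\beta)$, i.e. it induces isomorphisms of categories, natural in $\mathcal{X}$, between $\mathcal{A}(\mathcal{X},\mathcal{C}^{\mathcal{R}})$ and the category of subequalizings on $\mathcal{X}$. $F^{\mathcal{R}}$ is determined by $U^{\mathcal{R}}F^{\mathcal{R}}=\mathcal{R}$, $\beta_{F^{\mathcal{R}}}=\mu$, and $F^{\mathcal{R}}\dashv U^{\mathcal{R}}$ with unit $\eta$ and counit $\varepsilon^{\mathcal{R}}$, where $U^{\mathcal{R}}(\varepsilon^{\mathcal{R}})=\beta$. The same definitions apply in the 2-category $\mathbf{Mon}_l(\mathcal{A})$. "Standard" means that the underlying Eilenberg–Moore object in $\mathcal{A}$ is $(\mathcal{C}^{\mathcal{R}},U^{\mathcal{R}},\beta)$, with the following structure. Let $A,B,C$ denote projections from powers of $\mathcal{C}^{\mathcal{R}}$ (also composed with $U^{\mathcal{R}}$), with structure maps $a=\beta_A:\mathcal{R}(A)\to A$, $b=\beta_B$, $c=\beta_C$. - $\ddot I=F^{\mathcal{R}}(I)$. - $q_{A,B}:\mathcal{R}(A\otimes B)\to A\ddot\otimes B$ is the (reflexive) coequalizer in $\mathcal{A}(\mathcal{C}^{\mathcal{R}}\times\mathcal{C}^{\mathcal{R}},\mathcal{C})$ of $\mu\circ\mathcal{R}(\phi_{A,B})$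 and $\mathcal{R}(a\otimes b):\mathcal{R}(\mathcal{R}(A)\otimes\mathcal{R}(B))\to\mathcal{R}(A\otimes B)$; the structure map $a\bar\otimes b:\mathcal{R}(A\ddot\otimes B)\to A\ddot\otimes B$ is the unique 2-cell with $(a\bar\otimes b)\circ\mathcal{R}(q_{A,B})=q_{A,B}\circ\mu_{A\otimes B}$. This subequalizing defines $\ddot\otimes:\mathcal{C}^{\mathcal{R}}\times\mathcal{C}^{\mathcal{R}}\to\mathcal{C}^{\mathcal{R}}$. - $\ddot\lambda_A$ is the unique 2-cell with $\ddot\lambda_A\circ q_{\mathcal{R}(I),A}=a\circ\mu_A\circ\mathcal{R}^2(\lambda_A)\circ\mathcal{R}(\phi)\circ\mathcal{R}(1\otimes\eta)$; $\ddot\rho_A$ is defined symmetrically. - With $q_{A;B,C}=q_{A,B\ddot\otimes C}\circ\mathcal{R}(1\otimes q_{B,C})\circ\mathcal{R}(1\otimes\eta)$ and $q_{A,B;C}=q_{A\ddot\otimes B,C}\circ\mathcal{R}(q_{A,B}\otimes1)\circ\mathcal{R}(\eta\otimes1)$ (which are coequalizers), $\ddot\alpha$ is the unique 2-cell with $\ddot\alpha\circ q_{A;B,C}=q_{A,B;C}\circ\mathcal{R}(\alpha)$. - $\ddot{\mathbf u}_{A,B}=q_{A,B}\circ\eta_{A\otimes B}:U^{\mathcal{R}}(A)\otimes U^{\mathcal{R}}(B)\to U^{\mathcal{R}}(A\ddot\otimes B)$, and $\bar{\ddot{\mathbf u}}=\eta_I:I\to\mathcal{R}(I)=U^{\mathcal{R}}(\ddot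 I)$. - $\ddot{\mathbf v}$ is the inverse of the oplax monoidal structure on $F^{\mathcal{R}}$ induced by $(U^{\mathcal{R}},\ddot{\mathbf u})$ through the adjunction. *)

theory Defs
  imports Main
begin

section \<open>Strict 2-categories\<close>

record ('o, 'a, 't) two_cat =
  Zero :: "'o set"
  One :: "'a set"
  Two :: "'t set"
  Src :: "'a \<Rightarrow> 'o"
  Trg :: "'a \<Rightarrow> 'o"
  Dom :: "'t \<Rightarrow> 'a"
  Cod :: "'t \<Rightarrow> 'a"
  Id1 :: "'o \<Rightarrow> 'a"
  Comp1 :: "'a \<Rightarrow> 'a \<Rightarrow> 'a"  (infixr "\<odot>\<index>" 75)
  Id2 :: "'a \<Rightarrow> 't"
  Vcomp :: "'t \<Rightarrow> 't \<Rightarrow> 't"  (infixr "\<cdot>\<index>" 70)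
  Hcomp :: "'t \<Rightarrow> 't \<Rightarrow> 't"  (infixr "\<star>\<index>" 75)

text \<open>All compositions are written in applicative order: in \<open>g \<odot> f\<close>, \<open>s \<cdot> t\<close> and \<open>s \<star> t\<close>
  the right-hand argument comes first.\<close>

context
  fixes K :: "('o, 'a, 't, 'z) two_cat_scheme" (structure)
begin

definition one_cell :: "'a \<Rightarrow> 'o \<Rightarrow> 'o \<Rightarrow> bool" where
  "one_cell f X Y \<longleftrightarrow> f \<in> One K \<and> Src K f = X \<and> Trg K f = Y"

definition two_cell :: "'t \<Rightarrow> 'a \<Rightarrow> 'a \<Rightarrow> bool" where
  "two_cell s f g \<longleftrightarrow> s \<in> Two K \<and> Dom K s = f \<and> Cod K s = g"

end

locale two_category =
  fixes K :: "('o, 'a, 't, 'z) two_cat_scheme" (structure)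
  assumes src_zero: "f \<in> One K \<Longrightarrow> Src K f \<in> Zero K"
    and trg_zero: "f \<in> One K \<Longrightarrow> Trg K f \<in> Zero K"
    and dom_one: "s \<in> Two K \<Longrightarrow> Dom K s \<in> One K"
    and cod_one: "s \<in> Two K \<Longrightarrow> Cod K s \<in> One K"
    and src_cod: "s \<in> Two K \<Longrightarrow> Src K (Cod K s) = Src K (Dom K s)"
    and trg_cod: "s \<in> Two K \<Longrightarrow> Trg K (Cod K s) = Trg K (Dom K s)"
    and id1_cell: "X \<in> Zero K \<Longrightarrow> one_cell K (Id1 K X) X X"
    and comp1_cell: "\<lbrakk>one_cell K f X Y; one_cell K g Y Z\<rbrakk> \<Longrightarrow> one_cell K (g \<odot> f) X Z"
    and comp1_id_left: "one_cell K f X Y \<Longrightarrow> Id1 K Y \<odot> f = f"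
    and comp1_id_right: "one_cell K f X Y \<Longrightarrow> f \<odot> Id1 K X = f"
    and comp1_assoc: "\<lbrakk>one_cell K f W X; one_cell K g X Y; one_cell K h Y Z\<rbrakk>
          \<Longrightarrow> (h \<odot> g) \<odot> f = h \<odot> (g \<odot> f)"
    and id2_cell: "f \<in> One K \<Longrightarrow> two_cell K (Id2 K f) f f"
    and vcomp_cell: "\<lbrakk>two_cell K s f g; two_cell K t g h\<rbrakk> \<Longrightarrow> two_cell K (t \<cdot> s) f h"
    and vcomp_id_left: "two_cell K s f g \<Longrightarrow> Id2 K g \<cdot> s = s"
    and vcomp_id_right: "two_cell K s f g \<Longrightarrow> s \<cdot> Id2 K f = s"
    and vcomp_assoc: "\<lbrakk>two_cell K r e f; two_cell K s f g; two_cell K t g h\<rbrakk>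
          \<Longrightarrow> (t \<cdot> s) \<cdot> r = t \<cdot> (s \<cdot> r)"
    and hcomp_cell: "\<lbrakk>two_cell K s f f'; two_cell K t g g'; Trg K f = Src K g\<rbrakk>
          \<Longrightarrow> two_cell K (t \<star> s) (g \<odot> f) (g' \<odot> f')"
    and hcomp_id_left: "\<lbrakk>two_cell K s f g; Trg K f = Y\<rbrakk> \<Longrightarrow> Id2 K (Id1 K Y) \<star> s = s"
    and hcomp_id_right: "\<lbrakk>two_cell K s f g; Src K f = X\<rbrakk> \<Longrightarrow> s \<star> Id2 K (Id1 K X) = s"
    and hcomp_assoc: "\<lbrakk>two_cell K r f f'; two_cell K s g g'; two_cell K t h h';
            Trg K f = Src K g; Trg K g = Src K h\<rbrakk>
          \<Longrightarrow> (t \<star> s) \<star> r = t \<star> (s \<star> r)"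
    and hcomp_id2: "\<lbrakk>one_cell K f X Y; one_cell K g Y Z\<rbrakk>
          \<Longrightarrow> Id2 K g \<star> Id2 K f = Id2 K (g \<odot> f)"
    and interchange: "\<lbrakk>two_cell K s f f'; two_cell K s' f' f'';
            two_cell K t g g'; two_cell K t' g' g''; Trg K f = Src K g\<rbrakk>
          \<Longrightarrow> (t' \<cdot> t) \<star> (s' \<cdot> s) = (t' \<star> s') \<cdot> (t \<star> s)"

text \<open>Whiskering: \<open>G \<rhd> \<tau>\<close> is postcomposition with \<open>G\<close>, \<open>\<tau> \<lhd> F\<close> is precomposition with \<open>F\<close>.\<close>

definition post_whisker :: "('o, 'a, 't, 'z) two_cat_scheme \<Rightarrow> 'a \<Rightarrow> 't \<Rightarrow> 't"
    (infixr "\<rhd>\<index>" 73) where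
  "G \<rhd>\<^bsub>K\<^esub> s = Id2 K G \<star>\<^bsub>K\<^esub> s"

definition pre_whisker :: "('o, 'a, 't, 'z) two_cat_scheme \<Rightarrow> 't \<Rightarrow> 'a \<Rightarrow> 't"
    (infixl "\<lhd>\<index>" 74) where
  "s \<lhd>\<^bsub>K\<^esub> F = s \<star>\<^bsub>K\<^esub> Id2 K F"


section \<open>Notions in an arbitrary 2-category\<close>

record ('o, 'a, 't) monad_data =
  Mobj :: 'o
  Mend :: 'a
  Meta :: 't
  Mmu :: 't

record ('o, 'a, 't) em_data =
  Eobj :: 'o
  Eu :: 'a
  Ebeta :: 't

context
  fixes K :: "('o, 'a, 't, 'z) two_cat_scheme" (structure)
begin

definition inverse_cells :: "'t \<Rightarrow> 't \<Rightarrow> bool" where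
  "inverse_cells s t \<longleftrightarrow> (\<exists>f g. two_cell K s f g \<and> two_cell K t g f \<and>
     t \<cdot> s = Id2 K f \<and> s \<cdot> t = Id2 K g)"

definition invertible :: "'t \<Rightarrow> bool" where
  "invertible s \<longleftrightarrow> (\<exists>t. inverse_cells s t)"

definition unique_two_cell :: "('t \<Rightarrow> bool) \<Rightarrow> 'a \<Rightarrow> 'a \<Rightarrow> 't \<Rightarrow> bool" where
  "unique_two_cell P f g x \<longleftrightarrow> two_cell K x f g \<and> P x \<and>
     (\<forall>y. two_cell K y f g \<and> P y \<longrightarrow> y = x)"

definition monad :: "('o, 'a, 't) monad_data \<Rightarrow> bool" where
  "monad T \<longleftrightarrow> (let C = Mobj T; R = Mend T; \<eta> = Meta T; \<mu> = Mmu T in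
     C \<in> Zero K \<and> one_cell K R C C \<and>
     two_cell K \<eta> (Id1 K C) R \<and> two_cell K \<mu> (R \<odot> R) R \<and>
     \<mu> \<cdot> (R \<rhd> \<eta>) = Id2 K R \<and> \<mu> \<cdot> (\<eta> \<lhd> R) = Id2 K R \<and>
     \<mu> \<cdot> (R \<rhd> \<mu>) = \<mu> \<cdot> (\<mu> \<lhd> R))"

definition adjunction :: "'a \<Rightarrow> 'a \<Rightarrow> 't \<Rightarrow> 't \<Rightarrow> bool" where
  "adjunction F U \<eta> \<epsilon> \<longleftrightarrow> (\<exists>X Y. one_cell K F X Y \<and> one_cell K U Y X \<and>
     two_cell K \<eta> (Id1 K X) (U \<odot> F) \<and> two_cell K \<epsilon> (F \<odot> U) (Id1 K Y) \<and>
     (\<epsilon> \<lhd> F) \<cdot> (F \<rhd> \<eta>) = Id2 K F \<and> (U \<rhd> \<epsilon>) \<cdot> (\<eta> \<lhd> U) = Id2 K U)"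

definition subequalizing :: "('o, 'a, 't) monad_data \<Rightarrow> 'o \<Rightarrow> 'a \<Rightarrow> 't \<Rightarrow> bool" where
  "subequalizing T X u \<nu> \<longleftrightarrow> (let R = Mend T in
     one_cell K u X (Mobj T) \<and> two_cell K \<nu> (R \<odot> u) u \<and>
     \<nu> \<cdot> (Meta T \<lhd> u) = Id2 K u \<and> \<nu> \<cdot> (R \<rhd> \<nu>) = \<nu> \<cdot> (Mmu T \<lhd> u))"

definition subequalizing_mor ::
    "('o, 'a, 't) monad_data \<Rightarrow> 'a \<times> 't \<Rightarrow> 'a \<times> 't \<Rightarrow> 't \<Rightarrow> bool" where
  "subequalizing_mor T = (\<lambda>(u, \<nu>) (u', \<nu>') s.
     two_cell K s u u' \<and> s \<cdot> \<nu> = \<nu>' \<cdot> (Mend T \<rhd> s))"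

text \<open>The functor from the category of 1-cells \<open>X \<rightarrow> Eobj E\<close> to the category of subequalizings
  on \<open>X\<close> sends \<open>f\<close> to the restriction of the universal subequalizing along \<open>f\<close>; it is an
  isomorphism of categories iff it is bijective on objects and on each hom-set.  Being induced by
  composition, it is natural in \<open>X\<close>.\<close>

definition em_object :: "('o, 'a, 't) monad_data \<Rightarrow> ('o, 'a, 't) em_data \<Rightarrow> bool" where
  "em_object T E \<longleftrightarrow> (let U = Eu E; \<Phi> = (\<lambda>f. (U \<odot> f, Ebeta E \<lhd> f)) in
     Eobj E \<in> Zero K \<and> subequalizing T (Eobj E) U (Ebeta E) \<and>
     (\<forall>X \<in> Zero K.
        bij_betw \<Phi> {f. one_cell K f X (Eobj E)} {(u, \<nu>). subequalizing T X u \<nu>} \<and>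
        (\<forall>f g. one_cell K f X (Eobj E) \<longrightarrow> one_cell K g X (Eobj E) \<longrightarrow>
           bij_betw (\<lambda>s. U \<rhd> s) {s. two_cell K s f g} {s. subequalizing_mor T (\<Phi> f) (\<Phi> g) s})))"

definition em_free :: "('o, 'a, 't) monad_data \<Rightarrow> ('o, 'a, 't) em_data \<Rightarrow> 'a" where
  "em_free T E = (THE F. one_cell K F (Mobj T) (Eobj E) \<and>
     Eu E \<odot> F = Mend T \<and> Ebeta E \<lhd> F = Mmu T)"

definition em_counit :: "('o, 'a, 't) monad_data \<Rightarrow> ('o, 'a, 't) em_data \<Rightarrow> 't" where
  "em_counit T E = (THE \<epsilon>. two_cell K \<epsilon> (em_free T E \<odot> Eu E) (Id1 K (Eobj E)) \<and>
     Eu E \<rhd> \<epsilon> = Ebeta E)"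

definition reflexive_pair :: "'o \<Rightarrow> 'o \<Rightarrow> 't \<Rightarrow> 't \<Rightarrow> bool" where
  "reflexive_pair X Y s t \<longleftrightarrow> (\<exists>f g r. one_cell K f X Y \<and> one_cell K g X Y \<and>
     two_cell K s f g \<and> two_cell K t f g \<and> two_cell K r g f \<and>
     s \<cdot> r = Id2 K g \<and> t \<cdot> r = Id2 K g)"

definition coequalizer :: "'o \<Rightarrow> 'o \<Rightarrow> 't \<Rightarrow> 't \<Rightarrow> 't \<Rightarrow> bool" where
  "coequalizer X Y s t q \<longleftrightarrow> (\<exists>f g h.
     one_cell K f X Y \<and> one_cell K g X Y \<and> one_cell K h X Y \<and>
     two_cell K s f g \<and> two_cell K t f g \<and> two_cell K q g h \<and> q \<cdot> s = q \<cdot> t \<and>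
     (\<forall>k p. one_cell K k X Y \<and> two_cell K p g k \<and> p \<cdot> s = p \<cdot> t \<longrightarrow>
        (\<exists>!w. two_cell K w h k \<and> w \<cdot> q = p)))"

definition rc_zero_cell :: "'o \<Rightarrow> bool" where
  "rc_zero_cell E \<longleftrightarrow> E \<in> Zero K \<and> (\<forall>X \<in> Zero K.
     (\<forall>s t. reflexive_pair X E s t \<longrightarrow> (\<exists>q. coequalizer X E s t q)) \<and>
     (\<forall>Y F s t q. one_cell K F Y X \<and> reflexive_pair X E s t \<and> coequalizer X E s t q \<longrightarrow>
        coequalizer Y E (s \<lhd> F) (t \<lhd> F) (q \<lhd> F)))"

definition rc_one_cell :: "'a \<Rightarrow> bool" where
  "rc_one_cell G \<longleftrightarrow> G \<in> One K \<and> rc_zero_cell (Src K G) \<and> rc_zero_cell (Trg K G) \<and>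
     (\<forall>X s t q. X \<in> Zero K \<and>
        reflexive_pair X (Src K G) s t \<and> coequalizer X (Src K G) s t q \<longrightarrow>
        coequalizer X (Trg K G) (G \<rhd> s) (G \<rhd> t) (G \<rhd> q))"

end


section \<open>Finite products\<close>

text \<open>Chosen finite products, with the strict 2-dimensional universal property.  Powers are
  bracketed to the right.\<close>

record ('o, 'a, 't) fp_two_cat = "('o, 'a, 't) two_cat" +
  Term :: 'o
  Prod :: "'o \<Rightarrow> 'o \<Rightarrow> 'o"
  Pr1 :: "'o \<Rightarrow> 'o \<Rightarrow> 'a"
  Pr2 :: "'o \<Rightarrow> 'o \<Rightarrow> 'a"

locale fp_two_category = two_category A
  for A :: "('o, 'a, 't) fp_two_cat" (structure) +
  assumes term_zero: "Term A \<in> Zero A"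
    and term_univ1: "X \<in> Zero A \<Longrightarrow> \<exists>!f. one_cell A f X (Term A)"
    and term_univ2: "\<lbrakk>one_cell A f X (Term A); one_cell A g X (Term A)\<rbrakk>
          \<Longrightarrow> \<exists>!s. two_cell A s f g"
    and prod_zero: "\<lbrakk>X \<in> Zero A; Y \<in> Zero A\<rbrakk> \<Longrightarrow> Prod A X Y \<in> Zero A"
    and pr1_cell: "\<lbrakk>X \<in> Zero A; Y \<in> Zero A\<rbrakk> \<Longrightarrow> one_cell A (Pr1 A X Y) (Prod A X Y) X"
    and pr2_cell: "\<lbrakk>X \<in> Zero A; Y \<in> Zero A\<rbrakk> \<Longrightarrow> one_cell A (Pr2 A X Y) (Prod A X Y) Y"
    and prod_univ1: "\<lbrakk>one_cell A f W X; one_cell A g W Y\<rbrakk>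
          \<Longrightarrow> \<exists>!h. one_cell A h W (Prod A X Y) \<and> Pr1 A X Y \<odot> h = f \<and> Pr2 A X Y \<odot> h = g"
    and prod_univ2: "\<lbrakk>X \<in> Zero A; Y \<in> Zero A;
            one_cell A h W (Prod A X Y); one_cell A h' W (Prod A X Y);
            two_cell A s (Pr1 A X Y \<odot> h) (Pr1 A X Y \<odot> h');
            two_cell A t (Pr2 A X Y \<odot> h) (Pr2 A X Y \<odot> h')\<rbrakk>
          \<Longrightarrow> \<exists>!w. two_cell A w h h' \<and> Pr1 A X Y \<rhd> w = s \<and> Pr2 A X Y \<rhd> w = t"


section \<open>Monoidal objects and the 2-category of lax monoidal 1-cells\<close>

record ('o, 'a, 't) mon_obj =
  Und :: 'o
  Ten :: 'a
  Unt :: 'a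
  Asc :: 't
  Lun :: 't
  Run :: 't

text \<open>The source and target monoidal objects (respectively 1-cells) are part of the data, so that
  they are determined by the cell.\<close>

record ('o, 'a, 't) lax_data =
  Lsrc :: "('o, 'a, 't) mon_obj"
  Ltrg :: "('o, 'a, 't) mon_obj"
  Lcell :: 'a
  Lphi :: 't
  Lphi0 :: 't

record ('o, 'a, 't) mon_two_data =
  Mdom :: "('o, 'a, 't) lax_data"
  Mcod :: "('o, 'a, 't) lax_data"
  Mcell :: 't

context
  fixes A :: "('o, 'a, 't) fp_two_cat" (structure)
begin

definition bang :: "'o \<Rightarrow> 'a" where
  "bang X = (THE f. one_cell A f X (Term A))"

definition pair1 :: "'a \<Rightarrow> 'a \<Rightarrow> 'a" where
  "pair1 f g = (let X = Trg A f; Y = Trg A g in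
     THE h. one_cell A h (Src A f) (Prod A X Y) \<and> Pr1 A X Y \<odot> h = f \<and> Pr2 A X Y \<odot> h = g)"

definition pair2 :: "'t \<Rightarrow> 't \<Rightarrow> 't" where
  "pair2 s t = (let X = Trg A (Dom A s); Y = Trg A (Dom A t) in
     THE w. two_cell A w (pair1 (Dom A s) (Dom A t)) (pair1 (Cod A s) (Cod A t)) \<and>
       Pr1 A X Y \<rhd> w = s \<and> Pr2 A X Y \<rhd> w = t)"

definition proj3_1 :: "'o \<Rightarrow> 'a" where
  "proj3_1 C = Pr1 A C (Prod A C C)"
definition proj3_2 :: "'o \<Rightarrow> 'a" where
  "proj3_2 C = Pr1 A C C \<odot> Pr2 A C (Prod A C C)"
definition proj3_3 :: "'o \<Rightarrow> 'a" where
  "proj3_3 C = Pr2 A C C \<odot> Pr2 A C (Prod A C C)"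

definition proj4_1 :: "'o \<Rightarrow> 'a" where
  "proj4_1 C = Pr1 A C (Prod A C (Prod A C C))"
definition proj4_2 :: "'o \<Rightarrow> 'a" where
  "proj4_2 C = proj3_1 C \<odot> Pr2 A C (Prod A C (Prod A C C))"
definition proj4_3 :: "'o \<Rightarrow> 'a" where
  "proj4_3 C = proj3_2 C \<odot> Pr2 A C (Prod A C (Prod A C C))"
definition proj4_4 :: "'o \<Rightarrow> 'a" where
  "proj4_4 C = proj3_3 C \<odot> Pr2 A C (Prod A C (Prod A C C))"

text \<open>The operations used in formulas with variables, the variables being 1-cells into the
  underlying 0-cell: \<open>ten1 M f g\<close> and \<open>ten2 M s t\<close> are the tensors of 1-cells and of 2-cells,
  \<open>unit_at M X\<close> is the unit regarded as a 1-cell with source \<open>X\<close>, and \<open>at2 \<phi> f g\<close>, \<open>at3 \<alpha> f g h\<close>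
  are the components of 2-cells between 1-cells defined on a square or a cube.\<close>

definition ten1 :: "('o, 'a, 't) mon_obj \<Rightarrow> 'a \<Rightarrow> 'a \<Rightarrow> 'a" where
  "ten1 M f g = Ten M \<odot> pair1 f g"

definition ten2 :: "('o, 'a, 't) mon_obj \<Rightarrow> 't \<Rightarrow> 't \<Rightarrow> 't" where
  "ten2 M s t = Ten M \<rhd> pair2 s t"

definition unit_at :: "('o, 'a, 't) mon_obj \<Rightarrow> 'o \<Rightarrow> 'a" where
  "unit_at M X = Unt M \<odot> bang X"

definition at2 :: "'t \<Rightarrow> 'a \<Rightarrow> 'a \<Rightarrow> 't" where
  "at2 \<phi> f g = \<phi> \<lhd> pair1 f g"

definition at3 :: "'t \<Rightarrow> 'a \<Rightarrow> 'a \<Rightarrow> 'a \<Rightarrow> 't" where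
  "at3 \<alpha> f g h = \<alpha> \<lhd> pair1 f (pair1 g h)"

definition monoidal_object :: "('o, 'a, 't) mon_obj \<Rightarrow> bool" where
  "monoidal_object M \<longleftrightarrow> (let C = Und M; \<alpha> = at3 (Asc M) in
     C \<in> Zero A \<and>
     one_cell A (Ten M) (Prod A C C) C \<and>
     one_cell A (Unt M) (Term A) C \<and>
     (let x = proj3_1 C; y = proj3_2 C; z = proj3_3 C in
        two_cell A (Asc M) (ten1 M x (ten1 M y z)) (ten1 M (ten1 M x y) z)) \<and>
     two_cell A (Lun M) (ten1 M (unit_at M C) (Id1 A C)) (Id1 A C) \<and>
     two_cell A (Run M) (ten1 M (Id1 A C) (unit_at M C)) (Id1 A C) \<and>
     invertible A (Asc M) \<and> invertible A (Lun M) \<and> invertible A (Run M) \<and>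
     (let w = proj4_1 C; x = proj4_2 C; y = proj4_3 C; z = proj4_4 C in
        \<alpha> (ten1 M w x) y z \<cdot> \<alpha> w x (ten1 M y z) =
        ten2 M (\<alpha> w x y) (Id2 A z) \<cdot> \<alpha> w (ten1 M x y) z \<cdot> ten2 M (Id2 A w) (\<alpha> x y z)) \<and>
     (let x = Pr1 A C C; y = Pr2 A C C; I = unit_at M (Prod A C C) in
        ten2 M (Run M \<lhd> x) (Id2 A y) \<cdot> \<alpha> x I y = ten2 M (Id2 A x) (Lun M \<lhd> y)))"

definition lax_monoidal :: "('o, 'a, 't) lax_data \<Rightarrow> bool" where
  "lax_monoidal L \<longleftrightarrow> (let M = Lsrc L; N = Ltrg L; F = Lcell L; \<phi> = Lphi L; \<phi>0 = Lphi0 L;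
       C = Und M; D = Und N in
     monoidal_object M \<and> monoidal_object N \<and> one_cell A F C D \<and>
     (let x = Pr1 A C C; y = Pr2 A C C in
        two_cell A \<phi> (ten1 N (F \<odot> x) (F \<odot> y)) (F \<odot> ten1 M x y)) \<and>
     two_cell A \<phi>0 (Unt N) (F \<odot> Unt M) \<and>
     (let x = proj3_1 C; y = proj3_2 C; z = proj3_3 C in
        (F \<rhd> at3 (Asc M) x y z) \<cdot> at2 \<phi> x (ten1 M y z) \<cdot> ten2 N (Id2 A (F \<odot> x)) (at2 \<phi> y z) =
        at2 \<phi> (ten1 M x y) z \<cdot> ten2 N (at2 \<phi> x y) (Id2 A (F \<odot> z)) \<cdot>
          at3 (Asc N) (F \<odot> x) (F \<odot> y) (F \<odot> z)) \<and>
     (F \<rhd> Lun M) \<cdot> at2 \<phi> (unit_at M C) (Id1 A C) \<cdot> ten2 N (\<phi>0 \<lhd> bang C) (Id2 A F) =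
       Lun N \<lhd> F \<and>
     (F \<rhd> Run M) \<cdot> at2 \<phi> (Id1 A C) (unit_at M C) \<cdot> ten2 N (Id2 A F) (\<phi>0 \<lhd> bang C) =
       Run N \<lhd> F)"

definition strong_monoidal :: "('o, 'a, 't) lax_data \<Rightarrow> bool" where
  "strong_monoidal L \<longleftrightarrow> lax_monoidal L \<and> invertible A (Lphi L) \<and> invertible A (Lphi0 L)"

definition monoidal_two_cell :: "('o, 'a, 't) mon_two_data \<Rightarrow> bool" where
  "monoidal_two_cell S \<longleftrightarrow> (let F = Mdom S; G = Mcod S; \<tau> = Mcell S;
       M = Lsrc F; N = Ltrg F; C = Und M in
     lax_monoidal F \<and> lax_monoidal G \<and> Lsrc G = M \<and> Ltrg G = N \<and>
     two_cell A \<tau> (Lcell F) (Lcell G) \<and>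
     (let x = Pr1 A C C; y = Pr2 A C C in
        (\<tau> \<lhd> ten1 M x y) \<cdot> Lphi F = Lphi G \<cdot> ten2 N (\<tau> \<lhd> x) (\<tau> \<lhd> y)) \<and>
     (\<tau> \<lhd> Unt M) \<cdot> Lphi0 F = Lphi0 G)"

definition lax_id :: "('o, 'a, 't) mon_obj \<Rightarrow> ('o, 'a, 't) lax_data" where
  "lax_id M = \<lparr>Lsrc = M, Ltrg = M, Lcell = Id1 A (Und M),
     Lphi = Id2 A (Ten M), Lphi0 = Id2 A (Unt M)\<rparr>"

definition lax_comp ::
    "('o, 'a, 't) lax_data \<Rightarrow> ('o, 'a, 't) lax_data \<Rightarrow> ('o, 'a, 't) lax_data" where
  "lax_comp G F = (let C = Und (Lsrc F) in
     \<lparr>Lsrc = Lsrc F, Ltrg = Ltrg G, Lcell = Lcell G \<odot> Lcell F,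
      Lphi = (Lcell G \<rhd> Lphi F) \<cdot>
        at2 (Lphi G) (Lcell F \<odot> Pr1 A C C) (Lcell F \<odot> Pr2 A C C),
      Lphi0 = (Lcell G \<rhd> Lphi0 F) \<cdot> Lphi0 G\<rparr>)"

definition Mon_l ::
    "(('o, 'a, 't) mon_obj, ('o, 'a, 't) lax_data, ('o, 'a, 't) mon_two_data) two_cat" where
  "Mon_l = \<lparr>
     Zero = {M. monoidal_object M},
     One = {F. lax_monoidal F},
     Two = {S. monoidal_two_cell S},
     Src = Lsrc, Trg = Ltrg, Dom = Mdom, Cod = Mcod,
     Id1 = lax_id,
     Comp1 = lax_comp,
     Id2 = (\<lambda>F. \<lparr>Mdom = F, Mcod = F, Mcell = Id2 A (Lcell F)\<rparr>),
     Vcomp = (\<lambda>T S. \<lparr>Mdom = Mdom S, Mcod = Mcod T, Mcell = Mcell T \<cdot> Mcell S\<rparr>),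
     Hcomp = (\<lambda>T S. \<lparr>Mdom = lax_comp (Mdom T) (Mdom S), Mcod = lax_comp (Mcod T) (Mcod S),
                Mcell = Mcell T \<star> Mcell S\<rparr>)\<rparr>"

definition rc_monoidal_object :: "('o, 'a, 't) mon_obj \<Rightarrow> bool" where
  "rc_monoidal_object M \<longleftrightarrow>
     monoidal_object M \<and> rc_zero_cell A (Und M) \<and> rc_one_cell A (Ten M)"

definition rc_monad :: "('o, 'a, 't) monad_data \<Rightarrow> bool" where
  "rc_monad T \<longleftrightarrow> monad A T \<and> rc_zero_cell A (Mobj T) \<and> rc_one_cell A (Mend T)"

end


section \<open>The standard Eilenberg--Moore object\<close>

type_synonym ('o, 'a, 't) lax_monoidal_monad =
  "(('o, 'a, 't) mon_obj, ('o, 'a, 't) lax_data, ('o, 'a, 't) mon_two_data) monad_data"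

definition underlying_monad ::
    "('o, 'a, 't) lax_monoidal_monad \<Rightarrow> ('o, 'a, 't) monad_data" where
  "underlying_monad T = \<lparr>Mobj = Und (Mobj T), Mend = Lcell (Mend T),
     Meta = Mcell (Meta T), Mmu = Mcell (Mmu T)\<rparr>"

definition rc_lax_monoidal_monad ::
    "('o, 'a, 't) fp_two_cat \<Rightarrow> ('o, 'a, 't) lax_monoidal_monad \<Rightarrow> bool" where
  "rc_lax_monoidal_monad A T \<longleftrightarrow> monad (Mon_l A) T \<and>
     rc_monoidal_object A (Mobj T) \<and> rc_monad A (underlying_monad T)"

context
  fixes A :: "('o, 'a, 't) fp_two_cat" (structure)
    and T :: "('o, 'a, 't) lax_monoidal_monad"
    and E :: "('o, 'a, 't) em_data"
begin

text \<open>Here \<open>T\<close> is a lax monoidal monad and \<open>E\<close> an Eilenberg--Moore object of its underlying monad.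
  The coequalizer \<open>q\<close>, which is only determined up to isomorphism, is a parameter; it determines
  all the rest of the structure uniquely.\<close>

definition standard_coequalizer :: "'t \<Rightarrow> bool" where
  "standard_coequalizer q \<longleftrightarrow> (let M = Mobj T; R = Lcell (Mend T);
       \<phi> = Lphi (Mend T); \<mu> = Mcell (Mmu T); U = Eu E; \<beta> = Ebeta E;
       p\<^sub>1 = Pr1 A (Eobj E) (Eobj E); p\<^sub>2 = Pr2 A (Eobj E) (Eobj E); x = U \<odot> p\<^sub>1; y = U \<odot> p\<^sub>2 in
     coequalizer A (Prod A (Eobj E) (Eobj E)) (Und M)
       ((\<mu> \<lhd> ten1 A M x y) \<cdot> (R \<rhd> at2 A \<phi> x y))
       (R \<rhd> ten2 A M (\<beta> \<lhd> p\<^sub>1) (\<beta> \<lhd> p\<^sub>2))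
       q)"

definition q_left :: "'t \<Rightarrow> ('o, 'a, 't) mon_obj \<Rightarrow> 'a \<Rightarrow> 'a \<Rightarrow> 'a \<Rightarrow> 't" where
  "q_left q N x y z = (let M = Mobj T; R = Lcell (Mend T); \<eta> = Mcell (Meta T); U = Eu E in
     at2 A q x (ten1 A N y z) \<cdot>
     (R \<rhd> ten2 A M (Id2 A (U \<odot> x)) (at2 A q y z)) \<cdot>
     (R \<rhd> ten2 A M (Id2 A (U \<odot> x)) (\<eta> \<lhd> ten1 A M (U \<odot> y) (U \<odot> z))))"

definition q_right :: "'t \<Rightarrow> ('o, 'a, 't) mon_obj \<Rightarrow> 'a \<Rightarrow> 'a \<Rightarrow> 'a \<Rightarrow> 't" where
  "q_right q N x y z = (let M = Mobj T; R = Lcell (Mend T); \<eta> = Mcell (Meta T); U = Eu E in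
     at2 A q (ten1 A N x y) z \<cdot>
     (R \<rhd> ten2 A M (at2 A q x y) (Id2 A (U \<odot> z))) \<cdot>
     (R \<rhd> ten2 A M (\<eta> \<lhd> ten1 A M (U \<odot> x) (U \<odot> y)) (Id2 A (U \<odot> z))))"

text \<open>The 2-cells below are specified after application of \<open>U\<close>, which is injective on 2-cells.\<close>

definition standard_structure :: "'t \<Rightarrow> ('o, 'a, 't) mon_obj \<Rightarrow> bool" where
  "standard_structure q N \<longleftrightarrow> (let M = Mobj T; R = Lcell (Mend T);
       \<phi> = Lphi (Mend T); \<eta> = Mcell (Meta T); \<mu> = Mcell (Mmu T);
       D = Eobj E; U = Eu E; \<beta> = Ebeta E; J = unit_at A N D in
     Und N = D \<and>
     Unt N = em_free A (underlying_monad T) E \<odot> Unt M \<and>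
     one_cell A (Ten N) (Prod A D D) D \<and>
     U \<odot> Ten N = Cod A q \<and>
     unique_two_cell A
       (\<lambda>t. t \<cdot> (R \<rhd> q) = q \<cdot> (\<mu> \<lhd> ten1 A M (U \<odot> Pr1 A D D) (U \<odot> Pr2 A D D)))
       (R \<odot> Cod A q) (Cod A q) (\<beta> \<lhd> Ten N) \<and>
     two_cell A (Lun N) (ten1 A N J (Id1 A D)) (Id1 A D) \<and>
     unique_two_cell A
       (\<lambda>t. t \<cdot> at2 A q J (Id1 A D) =
          \<beta> \<cdot> (\<mu> \<lhd> U) \<cdot> (R \<rhd> R \<rhd> (Lun M \<lhd> U)) \<cdot> (R \<rhd> at2 A \<phi> (unit_at A M D) U) \<cdot>
          (R \<rhd> ten2 A M (Id2 A (R \<odot> unit_at A M D)) (\<eta> \<lhd> U)))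
       (U \<odot> ten1 A N J (Id1 A D)) U (U \<rhd> Lun N) \<and>
     two_cell A (Run N) (ten1 A N (Id1 A D) J) (Id1 A D) \<and>
     unique_two_cell A
       (\<lambda>t. t \<cdot> at2 A q (Id1 A D) J =
          \<beta> \<cdot> (\<mu> \<lhd> U) \<cdot> (R \<rhd> R \<rhd> (Run M \<lhd> U)) \<cdot> (R \<rhd> at2 A \<phi> U (unit_at A M D)) \<cdot>
          (R \<rhd> ten2 A M (\<eta> \<lhd> U) (Id2 A (R \<odot> unit_at A M D))))
       (U \<odot> ten1 A N (Id1 A D) J) U (U \<rhd> Run N) \<and>
     (let x = proj3_1 A D; y = proj3_2 A D; z = proj3_3 A D;
          l = ten1 A N x (ten1 A N y z); r = ten1 A N (ten1 A N x y) z in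
        two_cell A (Asc N) l r \<and>
        unique_two_cell A
          (\<lambda>t. t \<cdot> q_left q N x y z =
             q_right q N x y z \<cdot> (R \<rhd> at3 A (Asc M) (U \<odot> x) (U \<odot> y) (U \<odot> z)))
          (U \<odot> l) (U \<odot> r) (U \<rhd> Asc N)))"

definition standard_U :: "'t \<Rightarrow> ('o, 'a, 't) mon_obj \<Rightarrow> ('o, 'a, 't) lax_data" where
  "standard_U q N = (let M = Mobj T; U = Eu E; D = Eobj E; \<eta> = Mcell (Meta T) in
     \<lparr>Lsrc = N, Ltrg = M, Lcell = U,
      Lphi = q \<cdot> (\<eta> \<lhd> ten1 A M (U \<odot> Pr1 A D D) (U \<odot> Pr2 A D D)),
      Lphi0 = \<eta> \<lhd> Unt M\<rparr>)"

definition standard_em :: "'t \<Rightarrow> ('o, 'a, 't) mon_obj \<Rightarrow>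
    (('o, 'a, 't) mon_obj, ('o, 'a, 't) lax_data, ('o, 'a, 't) mon_two_data) em_data" where
  "standard_em q N = \<lparr>Eobj = N, Eu = standard_U q N,
     Ebeta = \<lparr>Mdom = lax_comp A (Mend T) (standard_U q N), Mcod = standard_U q N,
              Mcell = Ebeta E\<rparr>\<rparr>"

end

text \<open>For an adjunction \<open>F \<stileturn> U\<close> with unit \<open>\<eta>\<close> and counit \<open>\<epsilon>\<close> and a lax monoidal structure \<open>L\<close> on \<open>U\<close>,
  the binary and nullary parts of the induced oplax monoidal structure on \<open>F\<close>.\<close>

context
  fixes A :: "('o, 'a, 't) fp_two_cat" (structure)
begin

definition induced_oplax :: "'a \<Rightarrow> ('o, 'a, 't) lax_data \<Rightarrow> 't \<Rightarrow> 't \<Rightarrow> 't" where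
  "induced_oplax F L \<eta> \<epsilon> = (let N = Lsrc L; M = Ltrg L; C = Und M;
       x = Pr1 A C C; y = Pr2 A C C in
     (\<epsilon> \<lhd> ten1 A N (F \<odot> x) (F \<odot> y)) \<cdot> (F \<rhd> at2 A (Lphi L) (F \<odot> x) (F \<odot> y)) \<cdot>
     (F \<rhd> ten2 A M (\<eta> \<lhd> x) (\<eta> \<lhd> y)))"

definition induced_oplax0 :: "'a \<Rightarrow> ('o, 'a, 't) lax_data \<Rightarrow> 't \<Rightarrow> 't" where
  "induced_oplax0 F L \<epsilon> = (\<epsilon> \<lhd> Unt (Lsrc L)) \<cdot> (F \<rhd> Lphi0 L)"

end

end

theory Submission
  imports Defs
begin

text \<open>The proof takes place in the hom-categories. For every 0-cell \<open>X\<close> the category \<open>A(X, C)\<close> is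
  monoidal, postcomposition with \<open>R\<close> is a lax monoidal monad on it, and postcomposition with \<open>U\<close>
  identifies \<open>A(X, C\<^sup>R)\<close> with the category of algebras of that monad. All this is compatible with
  precomposition, so the structure cells of \<open>C\<^sup>R\<close> can be constructed, and equations between them
  proved, with 1-cells \<open>X \<rightarrow> C\<^sup>R\<close> as generalized elements. What remains is a statement about
  algebras of a lax monoidal monad on an ordinary category.

  There, call \<open>p : A \<otimes> B \<rightarrow> Z\<close> a bimorphism of algebras if
  \<open>z \<bullet> R p \<bullet> \<phi> = p \<bullet> (a \<otimes> b)\<close>. As \<open>q\<close> is a coequalizer of \<open>\<mu> \<bullet> R \<phi>\<close> and \<open>R (a \<otimes> b)\<close>, the cell
  \<open>u = q \<bullet> \<eta>\<close> is a universal bimorphism (lemma \<open>ext2\<close>). Maps \<open>A \<otimes> (B \<otimes> C) \<rightarrow> Z\<close> that are linear in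
  all three variables extend in the same way to the iterated tensor product of algebras (lemma
  \<open>ext3\<close>); this is where it matters that the tensor of the base preserves reflexive coequalizers.
  The cell \<open>u \<bullet> (u \<otimes> 1) \<bullet> \<alpha>\<close> is linear in all three variables, so it induces the associator, and the
  same argument for the reversed tensor product gives its inverse; the unit constraints come from
  \<open>unit_ext\<close>.

  All equations to be proved hold between algebra maps. They are tested on cells \<open>g\<close> that
  generate their domain, in the sense that the algebra map \<open>a \<bullet> R g\<close> extending \<open>g\<close> is an
  epimorphism. For this to be useful, \<open>u \<bullet> (g \<otimes> h)\<close> has to be generating whenever \<open>g\<close> and \<open>h\<close> are. This
  holds if epimorphisms are replaced by those that stay epimorphic under \<open>R\<close> and under tensoring,
  repeated arbitrarily often (lemma \<open>dense_tensor\<close>). Since \<open>\<eta>\<close> and identities are generating, so are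
  all cells built from \<open>u\<close> and \<open>\<eta>\<close>, and an equation about \<open>C\<^sup>R\<close> restricts along them to the
  corresponding equation about \<open>C\<close>. In this way one obtains the pentagon and triangle, and also the
  axioms in the universal property below.

  For the universal property in \<open>Mon_l\<close>, consider a subequalizing \<open>(w, \<nu>)\<close> in \<open>Mon_l\<close>. That \<open>\<nu>\<close> is
  monoidal means that the structure cell of \<open>w\<close> is a bimorphism; so it factors uniquely through \<open>u\<close>,
  and the factor is the structure cell of the induced 1-cell into \<open>C\<^sup>R\<close>. Finally, in any 2-category
  an Eilenberg--Moore object comes with an adjunction (lemma \<open>em_adjunction\<close>). In \<open>Mon_l\<close> this is the
  monoidal adjunction of the theorem. Its left adjoint carries the structure cell induced by the
  bimorphism \<open>\<phi>\<close>, and testing on \<open>\<eta>\<close> and \<open>u \<bullet> (\<eta> \<otimes> \<eta>)\<close> shows that it is inverse to the oplax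
  structure obtained from \<open>u\<close>.\<close>

section \<open>Stable epimorphisms for a lax monoidal monad on a category\<close>

text \<open>Domains and codomains of composites, tensor products and images under \<open>R\<close> are given without
  side conditions, so that only \<open>arr\<close> carries typing information. This suits the later
  application, in which an arrow is a 2-cell together with its intended boundary.\<close>

locale tensor_monad =
  fixes obj :: "'a \<Rightarrow> bool" and arr :: "'m \<Rightarrow> bool"
    and dom cod :: "'m \<Rightarrow> 'a" and one :: "'a \<Rightarrow> 'm"
    and comp :: "'m \<Rightarrow> 'm \<Rightarrow> 'm" (infixr "\<bullet>" 55)
    and tob :: "'a \<Rightarrow> 'a \<Rightarrow> 'a" (infixr "\<boxtimes>" 65)
    and tar :: "'m \<Rightarrow> 'm \<Rightarrow> 'm" (infixr "\<otimes>" 65)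
    and R0 :: "'a \<Rightarrow> 'a" and R :: "'m \<Rightarrow> 'm"
    and \<phi> :: "'a \<Rightarrow> 'a \<Rightarrow> 'm" and \<eta> \<mu> :: "'a \<Rightarrow> 'm"
  assumes dom_one [simp]: "dom (one a) = a" and cod_one [simp]: "cod (one a) = a"
    and dom_comp [simp]: "dom (g \<bullet> f) = dom f" and cod_comp [simp]: "cod (g \<bullet> f) = cod g"
    and dom_tar [simp]: "dom (f \<otimes> g) = dom f \<boxtimes> dom g"
    and cod_tar [simp]: "cod (f \<otimes> g) = cod f \<boxtimes> cod g"
    and dom_R [simp]: "dom (R f) = R0 (dom f)" and cod_R [simp]: "cod (R f) = R0 (cod f)"
    and dom_phi [simp]: "dom (\<phi> a b) = R0 a \<boxtimes> R0 b"
    and cod_phi [simp]: "cod (\<phi> a b) = R0 (a \<boxtimes> b)"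
    and dom_eta [simp]: "dom (\<eta> a) = a" and cod_eta [simp]: "cod (\<eta> a) = R0 a"
    and dom_mu [simp]: "dom (\<mu> a) = R0 (R0 a)" and cod_mu [simp]: "cod (\<mu> a) = R0 a"
    and obj_dom [simp]: "arr f \<Longrightarrow> obj (dom f)" and obj_cod [simp]: "arr f \<Longrightarrow> obj (cod f)"
    and obj_tob [simp]: "obj a \<Longrightarrow> obj b \<Longrightarrow> obj (a \<boxtimes> b)"
    and obj_R [simp]: "obj a \<Longrightarrow> obj (R0 a)"
    and arr_one [simp]: "obj a \<Longrightarrow> arr (one a)"
    and arr_comp [simp]: "arr f \<Longrightarrow> arr g \<Longrightarrow> dom g = cod f \<Longrightarrow> arr (g \<bullet> f)"
    and arr_tar [simp]: "arr f \<Longrightarrow> arr g \<Longrightarrow> arr (f \<otimes> g)"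
    and arr_R [simp]: "arr f \<Longrightarrow> arr (R f)"
    and arr_phi [simp]: "obj a \<Longrightarrow> obj b \<Longrightarrow> arr (\<phi> a b)"
    and arr_eta [simp]: "obj a \<Longrightarrow> arr (\<eta> a)" and arr_mu [simp]: "obj a \<Longrightarrow> arr (\<mu> a)"
    and one_left [simp]: "arr f \<Longrightarrow> cod f = a \<Longrightarrow> one a \<bullet> f = f"
    and one_right [simp]: "arr f \<Longrightarrow> dom f = a \<Longrightarrow> f \<bullet> one a = f"
    and assoc: "arr f \<Longrightarrow> arr g \<Longrightarrow> arr h \<Longrightarrow> dom g = cod f \<Longrightarrow> dom h = cod g
      \<Longrightarrow> (h \<bullet> g) \<bullet> f = h \<bullet> g \<bullet> f"
    and one_tar [simp]: "obj a \<Longrightarrow> obj b \<Longrightarrow> one a \<otimes> one b = one (a \<boxtimes> b)"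
    and tar_comp: "arr f \<Longrightarrow> arr g \<Longrightarrow> arr f' \<Longrightarrow> arr g' \<Longrightarrow> dom g = cod f \<Longrightarrow> dom g' = cod f'
      \<Longrightarrow> (g \<otimes> g') \<bullet> (f \<otimes> f') = (g \<bullet> f) \<otimes> (g' \<bullet> f')"
    and R_one [simp]: "obj a \<Longrightarrow> R (one a) = one (R0 a)"
    and R_comp: "arr f \<Longrightarrow> arr g \<Longrightarrow> dom g = cod f \<Longrightarrow> R (g \<bullet> f) = R g \<bullet> R f"
    and phi_nat: "arr f \<Longrightarrow> arr g \<Longrightarrow>
      \<phi> (cod f) (cod g) \<bullet> (R f \<otimes> R g) = R (f \<otimes> g) \<bullet> \<phi> (dom f) (dom g)"
    and eta_nat: "arr f \<Longrightarrow> \<eta> (cod f) \<bullet> f = R f \<bullet> \<eta> (dom f)"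
    and mu_nat: "arr f \<Longrightarrow> \<mu> (cod f) \<bullet> R (R f) = R f \<bullet> \<mu> (dom f)"
    and mu_R_eta: "obj a \<Longrightarrow> \<mu> a \<bullet> R (\<eta> a) = one (R0 a)"
    and mu_eta_R: "obj a \<Longrightarrow> \<mu> a \<bullet> \<eta> (R0 a) = one (R0 a)"
    and mu_mu: "obj a \<Longrightarrow> \<mu> a \<bullet> R (\<mu> a) = \<mu> a \<bullet> \<mu> (R0 a)"
    and phi_eta: "obj a \<Longrightarrow> obj b \<Longrightarrow> \<phi> a b \<bullet> (\<eta> a \<otimes> \<eta> b) = \<eta> (a \<boxtimes> b)"
    and mu_phi: "obj a \<Longrightarrow> obj b \<Longrightarrow>
      \<mu> (a \<boxtimes> b) \<bullet> R (\<phi> a b) \<bullet> \<phi> (R0 a) (R0 b) = \<phi> a b \<bullet> (\<mu> a \<otimes> \<mu> b)"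
begin

text \<open>Reversing the tensor product is a symmetry of the axioms. It turns left-handed statements
  into right-handed ones.\<close>

lemma flipped: "tensor_monad obj arr dom cod one (\<bullet>) (\<lambda>a b. b \<boxtimes> a) (\<lambda>f g. g \<otimes> f)
    R0 R (\<lambda>a b. \<phi> b a) \<eta> \<mu>"
  by unfold_locales
    (simp_all add: assoc tar_comp R_comp phi_nat eta_nat mu_nat mu_R_eta mu_eta_R mu_mu phi_eta mu_phi)

definition epi :: "'m \<Rightarrow> bool" where
  "epi e \<longleftrightarrow> arr e \<and> (\<forall>f g. arr f \<and> arr g \<and> dom f = cod e \<and> dom g = cod e \<and>
     f \<bullet> e = g \<bullet> e \<longrightarrow> f = g)"

text \<open>Coinduction makes a stable epimorphism one that stays epimorphic under every composite of
  the functors \<open>R\<close>, \<open>a \<otimes> -\<close> and \<open>- \<otimes> a\<close>. Unlike coequalizers, stable epimorphisms are closed under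
  composition and under passing from \<open>e' \<bullet> e\<close> to \<open>e'\<close>, since the epimorphisms are.\<close>

coinductive stable :: "'m \<Rightarrow> bool" where
  stableI: "epi e \<Longrightarrow> stable (R e) \<Longrightarrow> (\<forall>a. obj a \<longrightarrow> stable (one a \<otimes> e))
    \<Longrightarrow> (\<forall>a. obj a \<longrightarrow> stable (e \<otimes> one a)) \<Longrightarrow> stable e"

lemma stableD:
  assumes "stable e"
  shows "epi e" "arr e" "stable (R e)" "obj a \<Longrightarrow> stable (one a \<otimes> e)" "obj a \<Longrightarrow> stable (e \<otimes> one a)"
  using assms by (auto elim: stable.cases simp: epi_def)

lemma epiD: "epi e \<Longrightarrow> f \<bullet> e = g \<bullet> e \<Longrightarrow> arr f \<Longrightarrow> arr g \<Longrightarrow> dom f = cod e \<Longrightarrow> dom g = cod e \<Longrightarrow> f = g"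
  unfolding epi_def by blast

lemma epi_comp:
  assumes "epi e" "epi e'" "dom e' = cod e"
  shows "epi (e' \<bullet> e)"
  unfolding epi_def
proof (intro conjI allI impI)
  show "arr (e' \<bullet> e)" using assms by (simp add: epi_def)
next
  fix f g
  assume *: "arr f \<and> arr g \<and> dom f = cod (e' \<bullet> e) \<and> dom g = cod (e' \<bullet> e) \<and> f \<bullet> e' \<bullet> e = g \<bullet> e' \<bullet> e"
  have "arr e" "arr e'" using assms by (auto simp: epi_def)
  with * assms(3) have "(f \<bullet> e') \<bullet> e = (g \<bullet> e') \<bullet> e" by (simp add: assoc)
  with * assms \<open>arr e\<close> \<open>arr e'\<close> have "f \<bullet> e' = g \<bullet> e'"
    by - (rule epiD[OF assms(1)], simp_all)
  with * assms \<open>arr e'\<close> show "f = g" by - (rule epiD[OF assms(2)], simp_all)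
qed

lemma epi_cancel:
  assumes "epi (e' \<bullet> e)" "arr e" "arr e'" "dom e' = cod e"
  shows "epi e'"
  unfolding epi_def
proof (intro conjI allI impI)
  fix f g
  assume *: "arr f \<and> arr g \<and> dom f = cod e' \<and> dom g = cod e' \<and> f \<bullet> e' = g \<bullet> e'"
  then have f: "arr f" "arr g" "dom f = cod e'" "dom g = cod e'" and fg: "f \<bullet> e' = g \<bullet> e'" by simp_all
  have "f \<bullet> e' \<bullet> e = (f \<bullet> e') \<bullet> e" using f assms(2-4) by (simp add: assoc)
  also have "\<dots> = g \<bullet> e' \<bullet> e" unfolding fg using f assms(2-4) by (simp add: assoc)
  finally have "f \<bullet> e' \<bullet> e = g \<bullet> e' \<bullet> e" .
  with * assms show "f = g" by - (rule epiD[OF assms(1)], simp_all)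
qed (rule assms)

lemma epi_one: "obj a \<Longrightarrow> epi (one a)"
  unfolding epi_def by (metis arr_one cod_one one_right)

lemma stable_one:
  assumes "obj a"
  shows "stable (one a)"
proof (rule stable.coinduct[of "\<lambda>e. \<exists>a. e = one a \<and> obj a"])
  show "\<exists>b. one a = one b \<and> obj b" using assms by blast
  fix e
  assume "\<exists>a. e = one a \<and> obj a"
  then obtain a where e: "e = one a" and a: "obj a" by blast
  have 1: "\<exists>b. R e = one b \<and> obj b" using a by (intro exI[of _ "R0 a"]) (simp add: e)
  have 2: "\<exists>b. one c \<otimes> e = one b \<and> obj b" if "obj c" for c
    using a that by (intro exI[of _ "c \<boxtimes> a"]) (simp add: e)
  have 3: "\<exists>b. e \<otimes> one c = one b \<and> obj b" if "obj c" for c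
    using a that by (intro exI[of _ "a \<boxtimes> c"]) (simp add: e)
  have "epi e" unfolding e using a by (rule epi_one)
  with 1 2 3 show "\<exists>k. e = k \<and> epi k \<and> ((\<exists>b. R k = one b \<and> obj b) \<or> stable (R k)) \<and>
      (\<forall>a. obj a \<longrightarrow> (\<exists>b. one a \<otimes> k = one b \<and> obj b) \<or> stable (one a \<otimes> k)) \<and>
      (\<forall>a. obj a \<longrightarrow> (\<exists>b. k \<otimes> one a = one b \<and> obj b) \<or> stable (k \<otimes> one a))"
    by blast
qed

lemma stable_comp:
  assumes "stable e" "stable e'" "dom e' = cod e"
  shows "stable (e' \<bullet> e)"
proof (rule stable.coinduct[of "\<lambda>k. \<exists>e e'. k = e' \<bullet> e \<and> stable e \<and> stable e' \<and> dom e' = cod e"])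
  show "\<exists>f f'. e' \<bullet> e = f' \<bullet> f \<and> stable f \<and> stable f' \<and> dom f' = cod f" using assms by blast
  fix k
  assume "\<exists>e e'. k = e' \<bullet> e \<and> stable e \<and> stable e' \<and> dom e' = cod e"
  then obtain e e' where k: "k = e' \<bullet> e" and s: "stable e" "stable e'" and d: "dom e' = cod e" by blast
  note a = stableD(2)[OF s(1)] stableD(2)[OF s(2)]
  have "R k = R e' \<bullet> R e" using a d by (simp add: R_comp k)
  then have 1: "\<exists>f f'. R k = f' \<bullet> f \<and> stable f \<and> stable f' \<and> dom f' = cod f"
    using s d stableD(3) by (intro exI[of _ "R e"] exI[of _ "R e'"]) simp
  have 2: "\<exists>f f'. one c \<otimes> k = f' \<bullet> f \<and> stable f \<and> stable f' \<and> dom f' = cod f" if "obj c" for c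
    using s d stableD(4) a that
    by (intro exI[of _ "one c \<otimes> e"] exI[of _ "one c \<otimes> e'"]) (simp add: k tar_comp)
  have 3: "\<exists>f f'. k \<otimes> one c = f' \<bullet> f \<and> stable f \<and> stable f' \<and> dom f' = cod f" if "obj c" for c
    using s d stableD(5) a that
    by (intro exI[of _ "e \<otimes> one c"] exI[of _ "e' \<otimes> one c"]) (simp add: k tar_comp)
  have "epi k" unfolding k using s d stableD(1) epi_comp by blast
  with 1 2 3 show "\<exists>e. k = e \<and> epi e \<and>
      ((\<exists>f f'. R e = f' \<bullet> f \<and> stable f \<and> stable f' \<and> dom f' = cod f) \<or> stable (R e)) \<and>
      (\<forall>a. obj a \<longrightarrow> (\<exists>f f'. one a \<otimes> e = f' \<bullet> f \<and> stable f \<and> stable f' \<and> dom f' = cod f) \<or> stable (one a \<otimes> e)) \<and>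
      (\<forall>a. obj a \<longrightarrow> (\<exists>f f'. e \<otimes> one a = f' \<bullet> f \<and> stable f \<and> stable f' \<and> dom f' = cod f) \<or> stable (e \<otimes> one a))"
    by blast
qed

lemma stable_cancel:
  assumes "stable (e' \<bullet> e)" "arr e" "arr e'" "dom e' = cod e"
  shows "stable e'"
proof (rule stable.coinduct[of "\<lambda>k. \<exists>e. stable (k \<bullet> e) \<and> arr e \<and> arr k \<and> dom k = cod e"])
  show "\<exists>e. stable (e' \<bullet> e) \<and> arr e \<and> arr e' \<and> dom e' = cod e" using assms by blast
  fix k
  assume "\<exists>e. stable (k \<bullet> e) \<and> arr e \<and> arr k \<and> dom k = cod e"
  then obtain e where s: "stable (k \<bullet> e)" and a: "arr e" "arr k" and d: "dom k = cod e" by blast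
  have 1: "\<exists>e. stable (R k \<bullet> e) \<and> arr e \<and> arr (R k) \<and> dom (R k) = cod e"
    using stableD(3)[OF s] a d by (intro exI[of _ "R e"]) (simp add: R_comp)
  have 2: "\<exists>e. stable ((one c \<otimes> k) \<bullet> e) \<and> arr e \<and> arr (one c \<otimes> k) \<and> dom (one c \<otimes> k) = cod e" if "obj c" for c
    using stableD(4)[OF s that] a d that by (intro exI[of _ "one c \<otimes> e"]) (simp add: tar_comp)
  have 3: "\<exists>e. stable ((k \<otimes> one c) \<bullet> e) \<and> arr e \<and> arr (k \<otimes> one c) \<and> dom (k \<otimes> one c) = cod e" if "obj c" for c
    using stableD(5)[OF s that] a d that by (intro exI[of _ "e \<otimes> one c"]) (simp add: tar_comp)
  have "epi k" using stableD(1)[OF s] a d epi_cancel by blast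
  with 1 2 3 show "\<exists>e. k = e \<and> epi e \<and>
      ((\<exists>f. stable (R e \<bullet> f) \<and> arr f \<and> arr (R e) \<and> dom (R e) = cod f) \<or> stable (R e)) \<and>
      (\<forall>a. obj a \<longrightarrow> (\<exists>f. stable ((one a \<otimes> e) \<bullet> f) \<and> arr f \<and> arr (one a \<otimes> e) \<and> dom (one a \<otimes> e) = cod f) \<or> stable (one a \<otimes> e)) \<and>
      (\<forall>a. obj a \<longrightarrow> (\<exists>f. stable ((e \<otimes> one a) \<bullet> f) \<and> arr f \<and> arr (e \<otimes> one a) \<and> dom (e \<otimes> one a) = cod f) \<or> stable (e \<otimes> one a))"
    by blast
qed

lemma stable_tar:
  assumes "stable e" "stable e'"
  shows "stable (e \<otimes> e')"
proof -
  have "e \<otimes> e' = (e \<otimes> one (cod e')) \<bullet> (one (dom e) \<otimes> e')"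
    using assms by (simp add: tar_comp stableD)
  then show ?thesis using assms by (simp add: stable_comp stableD)
qed

text \<open>Associativity makes an equation \<open>f \<bullet> g = h\<close> applicable inside a right-nested composite.\<close>

lemma reduce: "f \<bullet> g = h \<Longrightarrow> arr f \<Longrightarrow> arr g \<Longrightarrow> arr k \<Longrightarrow> dom f = cod g \<Longrightarrow> dom g = cod k
    \<Longrightarrow> f \<bullet> g \<bullet> k = h \<bullet> k"
  by (metis assoc)

end

section \<open>Algebras, bimorphisms and generating maps\<close>

text \<open>A family of algebras \<open>(U x, act x)\<close> that contains the free ones and is closed under the
  tensor product of algebras. The assumption \<open>q_eq\<close> and the three factorization properties say that
  \<open>q\<close> is a coequalizer and remains one after tensoring with an object; uniqueness of the
  factorizations is part of stability.\<close>

locale algebra_tensor = tensor_monad +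
  fixes Alg :: "'d \<Rightarrow> bool" and U and act and Fr and Tn :: "'d \<Rightarrow> 'd \<Rightarrow> 'd" and q
  assumes obj_U [simp]: "Alg x \<Longrightarrow> obj (U x)"
    and arr_act [simp]: "Alg x \<Longrightarrow> arr (act x)"
    and dom_act [simp]: "dom (act x) = R0 (U x)" and cod_act [simp]: "cod (act x) = U x"
    and act_eta: "Alg x \<Longrightarrow> act x \<bullet> \<eta> (U x) = one (U x)"
    and act_act: "Alg x \<Longrightarrow> act x \<bullet> R (act x) = act x \<bullet> \<mu> (U x)"
    and Alg_Fr [simp]: "obj a \<Longrightarrow> Alg (Fr a)"
    and U_Fr [simp]: "obj a \<Longrightarrow> U (Fr a) = R0 a" and act_Fr [simp]: "obj a \<Longrightarrow> act (Fr a) = \<mu> a"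
    and Alg_Tn [simp]: "Alg x \<Longrightarrow> Alg y \<Longrightarrow> Alg (Tn x y)"
    and arr_q [simp]: "Alg x \<Longrightarrow> Alg y \<Longrightarrow> arr (q x y)"
    and dom_q [simp]: "dom (q x y) = R0 (U x \<boxtimes> U y)" and cod_q [simp]: "cod (q x y) = U (Tn x y)"
    and act_Tn: "Alg x \<Longrightarrow> Alg y \<Longrightarrow> act (Tn x y) \<bullet> R (q x y) = q x y \<bullet> \<mu> (U x \<boxtimes> U y)"
    and q_eq: "Alg x \<Longrightarrow> Alg y \<Longrightarrow>
      q x y \<bullet> \<mu> (U x \<boxtimes> U y) \<bullet> R (\<phi> (U x) (U y)) = q x y \<bullet> R (act x \<otimes> act y)"
    and q_stable: "Alg x \<Longrightarrow> Alg y \<Longrightarrow> stable (q x y)"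
    and q_fac: "Alg x \<Longrightarrow> Alg y \<Longrightarrow> arr p \<Longrightarrow> dom p = R0 (U x \<boxtimes> U y) \<Longrightarrow>
      p \<bullet> \<mu> (U x \<boxtimes> U y) \<bullet> R (\<phi> (U x) (U y)) = p \<bullet> R (act x \<otimes> act y) \<Longrightarrow>
      \<exists>w. arr w \<and> dom w = U (Tn x y) \<and> cod w = cod p \<and> w \<bullet> q x y = p"
    and q_fac_left: "obj a \<Longrightarrow> Alg x \<Longrightarrow> Alg y \<Longrightarrow> arr p \<Longrightarrow> dom p = a \<boxtimes> R0 (U x \<boxtimes> U y) \<Longrightarrow>
      p \<bullet> (one a \<otimes> (\<mu> (U x \<boxtimes> U y) \<bullet> R (\<phi> (U x) (U y)))) = p \<bullet> (one a \<otimes> R (act x \<otimes> act y)) \<Longrightarrow>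
      \<exists>w. arr w \<and> dom w = a \<boxtimes> U (Tn x y) \<and> cod w = cod p \<and> w \<bullet> (one a \<otimes> q x y) = p"
    and q_fac_right: "obj a \<Longrightarrow> Alg x \<Longrightarrow> Alg y \<Longrightarrow> arr p \<Longrightarrow> dom p = R0 (U x \<boxtimes> U y) \<boxtimes> a \<Longrightarrow>
      p \<bullet> ((\<mu> (U x \<boxtimes> U y) \<bullet> R (\<phi> (U x) (U y))) \<otimes> one a) = p \<bullet> (R (act x \<otimes> act y) \<otimes> one a) \<Longrightarrow>
      \<exists>w. arr w \<and> dom w = U (Tn x y) \<boxtimes> a \<and> cod w = cod p \<and> w \<bullet> (q x y \<otimes> one a) = p"
begin

lemma flip_stable:
  assumes "stable e"
  shows "tensor_monad.stable obj arr dom cod one (\<bullet>) (\<lambda>f g. g \<otimes> f) R e"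
proof -
  interpret flip: tensor_monad obj arr dom cod one comp "\<lambda>a b. b \<boxtimes> a" "\<lambda>f g. g \<otimes> f" R0 R "\<lambda>a b. \<phi> b a" \<eta> \<mu>
    by (rule flipped)
  have "flip.epi = epi" by (simp add: flip.epi_def[abs_def] epi_def[abs_def])
  with assms show ?thesis
    by (coinduction arbitrary: e rule: flip.stable.coinduct) (auto dest: stableD)
qed

lemma flipped_algebra: "algebra_tensor obj arr dom cod one (\<bullet>) (\<lambda>a b. b \<boxtimes> a) (\<lambda>f g. g \<otimes> f)
    R0 R (\<lambda>a b. \<phi> b a) \<eta> \<mu> Alg U act Fr (\<lambda>x y. Tn y x) (\<lambda>x y. q y x)"
proof -
  interpret flip: tensor_monad obj arr dom cod one comp "\<lambda>a b. b \<boxtimes> a" "\<lambda>f g. g \<otimes> f" R0 R "\<lambda>a b. \<phi> b a" \<eta> \<mu>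
    by (rule flipped)
  show ?thesis
    using q_fac q_fac_left q_fac_right
    by unfold_locales (simp_all add: act_eta act_act act_Tn q_eq q_stable flip_stable)
qed

definition u where
  "u x y = q x y \<bullet> \<eta> (U x \<boxtimes> U y)"

definition amap where
  "amap x y h \<longleftrightarrow> arr h \<and> dom h = U x \<and> cod h = U y \<and> h \<bullet> act x = act y \<bullet> R h"

text \<open>A dense map generates the algebra \<open>x\<close>: its extension to the free algebra on its domain is a
  stable epimorphism.\<close>

definition dense where
  "dense x g \<longleftrightarrow> arr g \<and> cod g = U x \<and> stable (act x \<bullet> R g)"

lemma arr_u [simp]: "Alg x \<Longrightarrow> Alg y \<Longrightarrow> arr (u x y)"
  and dom_u [simp]: "dom (u x y) = U x \<boxtimes> U y"
  and cod_u [simp]: "cod (u x y) = U (Tn x y)"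
  by (simp_all add: u_def)

lemma amapD: "amap x y h \<Longrightarrow> arr h" "amap x y h \<Longrightarrow> dom h = U x" "amap x y h \<Longrightarrow> cod h = U y"
  "amap x y h \<Longrightarrow> h \<bullet> act x = act y \<bullet> R h"
  by (auto simp: amap_def)

lemma amap_one: "Alg x \<Longrightarrow> amap x x (one (U x))"
  by (simp add: amap_def)

lemma amap_comp:
  assumes "Alg x" "Alg y" "Alg z" "amap x y f" "amap y z g"
  shows "amap x z (g \<bullet> f)"
proof -
  note [simp] = amapD(1-3)[OF assms(4)] amapD(1-3)[OF assms(5)]
  have "(g \<bullet> f) \<bullet> act x = g \<bullet> act y \<bullet> R f" using assms by (simp add: assoc amapD(4)[OF assms(4)])
  also have "\<dots> = act z \<bullet> R (g \<bullet> f)" using assms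
    by (simp add: reduce[OF amapD(4)[OF assms(5)]] R_comp assoc)
  finally show ?thesis by (simp add: amap_def)
qed

lemma act_R_u: "Alg x \<Longrightarrow> Alg y \<Longrightarrow> act (Tn x y) \<bullet> R (u x y) = q x y"
  by (simp add: u_def R_comp reduce[OF act_Tn] assoc mu_R_eta)

lemma u_bimor:
  assumes "Alg x" "Alg y"
  shows "act (Tn x y) \<bullet> R (u x y) \<bullet> \<phi> (U x) (U y) = u x y \<bullet> (act x \<otimes> act y)"
proof -
  let ?a = "U x" let ?b = "U y"
  have "u x y \<bullet> (act x \<otimes> act y) = q x y \<bullet> R (act x \<otimes> act y) \<bullet> \<eta> (R0 ?a \<boxtimes> R0 ?b)"
    using assms eta_nat[of "act x \<otimes> act y"] by (simp add: u_def assoc)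
  also have "\<dots> = (q x y \<bullet> \<mu> (?a \<boxtimes> ?b) \<bullet> R (\<phi> ?a ?b)) \<bullet> \<eta> (R0 ?a \<boxtimes> R0 ?b)"
    using assms by (simp add: q_eq assoc)
  also have "\<dots> = q x y \<bullet> \<mu> (?a \<boxtimes> ?b) \<bullet> \<eta> (R0 (?a \<boxtimes> ?b)) \<bullet> \<phi> ?a ?b"
    using assms eta_nat[of "\<phi> ?a ?b"] by (simp add: assoc)
  also have "\<dots> = q x y \<bullet> \<phi> ?a ?b"
    using assms by (simp add: reduce[OF mu_eta_R])
  finally show ?thesis using assms by (simp add: reduce[OF act_R_u])
qed

text \<open>The action is a split epimorphism, with section \<open>\<eta>\<close>, so it is stable.\<close>

lemma dense_one:
  assumes "Alg x"
  shows "dense x (one (U x))"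
proof -
  have "stable (act x \<bullet> \<eta> (U x))" using assms by (simp add: act_eta stable_one)
  then have "stable (act x)" using assms by (intro stable_cancel[of "act x" "\<eta> (U x)"]) auto
  then show ?thesis using assms by (simp add: dense_def)
qed

lemma dense_eta: "obj a \<Longrightarrow> dense (Fr a) (\<eta> a)"
  by (simp add: dense_def mu_R_eta stable_one)

text \<open>The extension of \<open>u x y \<bullet> (g \<otimes> h)\<close> is \<open>q x y \<bullet> R (g \<otimes> h)\<close>. Composed with \<open>\<mu> \<bullet> R \<phi>\<close> it becomes
  \<open>q x y\<close> after the \<open>R\<close>-image of a tensor product of two stable epimorphisms, so it is stable by
  cancellation.\<close>

lemma dense_tensor:
  assumes "Alg x" "Alg y" "dense x g" "dense y h"
  shows "dense (Tn x y) (u x y \<bullet> (g \<otimes> h))"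
proof -
  have g [simp]: "arr g" "cod g = U x" and h [simp]: "arr h" "cod h = U y"
    using assms by (auto simp: dense_def)
  let ?a = "U x" let ?b = "U y" let ?m = "dom g" let ?n = "dom h"
  have 1: "act (Tn x y) \<bullet> R (u x y \<bullet> (g \<otimes> h)) = q x y \<bullet> R (g \<otimes> h)"
    using assms by (simp add: R_comp reduce[OF act_R_u])
  have "q x y \<bullet> R ((act x \<bullet> R g) \<otimes> (act y \<bullet> R h)) = (q x y \<bullet> R (act x \<otimes> act y)) \<bullet> R (R g \<otimes> R h)"
    using assms by (simp add: R_comp assoc tar_comp[symmetric])
  also have "\<dots> = q x y \<bullet> \<mu> (?a \<boxtimes> ?b) \<bullet> R (\<phi> ?a ?b \<bullet> (R g \<otimes> R h))"
    using assms by (simp add: q_eq[symmetric] R_comp assoc)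
  also have "\<dots> = q x y \<bullet> (\<mu> (?a \<boxtimes> ?b) \<bullet> R (R (g \<otimes> h))) \<bullet> R (\<phi> ?m ?n)"
    using assms phi_nat[of g h] by (simp add: R_comp assoc)
  also have "\<dots> = (q x y \<bullet> R (g \<otimes> h)) \<bullet> \<mu> (?m \<boxtimes> ?n) \<bullet> R (\<phi> ?m ?n)"
    using assms mu_nat[of "g \<otimes> h"] by (simp add: assoc)
  finally have 2: "q x y \<bullet> R ((act x \<bullet> R g) \<otimes> (act y \<bullet> R h)) =
    (q x y \<bullet> R (g \<otimes> h)) \<bullet> \<mu> (?m \<boxtimes> ?n) \<bullet> R (\<phi> ?m ?n)" .
  have "stable (q x y \<bullet> R ((act x \<bullet> R g) \<otimes> (act y \<bullet> R h)))"
    using assms by (intro stable_comp[OF stableD(3)[OF stable_tar] q_stable]) (auto simp: dense_def)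
  then have "stable (q x y \<bullet> R (g \<otimes> h))" unfolding 2
    by (rule stable_cancel) (use assms in auto)
  then show ?thesis using assms 1 by (simp add: dense_def)
qed

lemma dense_u: "Alg x \<Longrightarrow> Alg y \<Longrightarrow> dense (Tn x y) (u x y)"
  using dense_tensor[OF _ _ dense_one dense_one, of x y] by simp

text \<open>An algebra map \<open>w\<close> satisfies \<open>w \<bullet> act x \<bullet> R g = act z \<bullet> R (w \<bullet> g)\<close>, so \<open>w \<bullet> g\<close>
  determines it on the epimorphism \<open>act x \<bullet> R g\<close>.\<close>

lemma dense_eq:
  assumes "Alg x" "dense x g" "amap x z w" "amap x z' w'" "Alg z" "z' = z" "w \<bullet> g = w' \<bullet> g"
  shows "w = w'"
proof -
  have g [simp]: "arr g" "cod g = U x" and e: "epi (act x \<bullet> R g)"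
    using assms by (auto simp: dense_def stableD)
  note w [simp] = amapD(1-3)[OF assms(3)] amapD(1-3)[OF assms(4)]
  have "w \<bullet> act x \<bullet> R g = act z \<bullet> R (w \<bullet> g)"
    using assms(1-6) by (simp add: reduce[OF amapD(4)[OF assms(3)]] R_comp assoc)
  also have "\<dots> = act z \<bullet> R (w' \<bullet> g)" using assms(7) by simp
  also have "\<dots> = w' \<bullet> act x \<bullet> R g"
    using assms(1-6) by (simp add: reduce[OF amapD(4)[OF assms(4)]] R_comp assoc)
  finally show ?thesis using epiD[OF e] by simp
qed

lemma amap_free:
  assumes "obj a" "Alg z" "arr t" "dom t = a" "cod t = U z"
  shows "amap (Fr a) z (act z \<bullet> R t)" "(act z \<bullet> R t) \<bullet> \<eta> a = t"
proof -
  have "(act z \<bullet> R t) \<bullet> \<mu> a = act z \<bullet> \<mu> (U z) \<bullet> R (R t)"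
    using assms mu_nat[of t] by (simp add: assoc)
  also have "\<dots> = act z \<bullet> R (act z \<bullet> R t)"
    using assms by (simp add: reduce[OF act_act[symmetric]] R_comp assoc)
  finally show "amap (Fr a) z (act z \<bullet> R t)" using assms by (simp add: amap_def)
  show "(act z \<bullet> R t) \<bullet> \<eta> a = t"
    using assms eta_nat[of t, symmetric] by (simp add: assoc reduce[OF act_eta])
qed

text \<open>The extension \<open>act z \<bullet> R p\<close> of \<open>p\<close> to the free algebra coequalizes the pair that defines \<open>q\<close>,
  because \<open>p\<close> is a bimorphism. The induced map is an algebra map since \<open>R (q x y)\<close> is an epimorphism.\<close>

lemma ext2:
  assumes "Alg x" "Alg y" "Alg z" "arr p" "dom p = U x \<boxtimes> U y" "cod p = U z"
    and bi: "act z \<bullet> R p \<bullet> \<phi> (U x) (U y) = p \<bullet> (act x \<otimes> act y)"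
  obtains w where "amap (Tn x y) z w" "w \<bullet> u x y = p" "w \<bullet> q x y = act z \<bullet> R p"
proof -
  let ?a = "U x" let ?b = "U y"
  let ?p = "act z \<bullet> R p"
  note p [simp] = assms(1-6)
  have "?p \<bullet> \<mu> (?a \<boxtimes> ?b) \<bullet> R (\<phi> ?a ?b) = act z \<bullet> (\<mu> (U z) \<bullet> R (R p)) \<bullet> R (\<phi> ?a ?b)"
    using mu_nat[of p] by (simp add: assoc)
  also have "\<dots> = act z \<bullet> R (act z \<bullet> R p \<bullet> \<phi> ?a ?b)"
    by (simp add: assoc reduce[OF act_act[symmetric]] R_comp)
  also have "\<dots> = ?p \<bullet> R (act x \<otimes> act y)" unfolding bi by (simp add: R_comp assoc)
  finally obtain w where w: "arr w" "dom w = U (Tn x y)" "cod w = U z" "w \<bullet> q x y = ?p"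
    using q_fac[of x y ?p] by auto
  have "(w \<bullet> act (Tn x y)) \<bullet> R (q x y) = ?p \<bullet> \<mu> (?a \<boxtimes> ?b)"
    using w(1-3) by (simp add: assoc act_Tn reduce[OF w(4)])
  also have "\<dots> = act z \<bullet> R ?p" using amap_free(1)[of "?a \<boxtimes> ?b" z p] by (simp add: amap_def)
  also have "\<dots> = (act z \<bullet> R w) \<bullet> R (q x y)" using w(1-3) by (simp add: w(4)[symmetric] R_comp assoc)
  finally have "w \<bullet> act (Tn x y) = act z \<bullet> R w"
    by (rule epiD[OF stableD(1)[OF stableD(3)[OF q_stable[OF assms(1,2)]]]]) (use w in auto)
  then have "amap (Tn x y) z w" using w by (simp add: amap_def)
  moreover have "w \<bullet> u x y = p"
    using w(1-3) amap_free(2)[of "?a \<boxtimes> ?b" z p] by (simp add: u_def reduce[OF w(4)])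
  ultimately show ?thesis using that w(4) by blast
qed

text \<open>The extension of a map \<open>t\<close> on \<open>a \<otimes> b\<close>, along \<open>one a \<otimes> \<eta> b\<close>, to a map that is
  linear in the second variable.\<close>

definition ext where
  "ext k a b t = act k \<bullet> R t \<bullet> \<phi> a b \<bullet> (\<eta> a \<otimes> one (R0 b))"

context
  fixes k a b t
  assumes k [simp]: "Alg k" "obj a" "obj b" "arr t" "dom t = a \<boxtimes> b" "cod t = U k"
begin

lemma arr_ext [simp]: "arr (ext k a b t)" and dom_ext [simp]: "dom (ext k a b t) = a \<boxtimes> R0 b"
  and cod_ext [simp]: "cod (ext k a b t) = U k"
  by (simp_all add: ext_def)

lemma ext_eta: "ext k a b t \<bullet> (one a \<otimes> \<eta> b) = t"
proof -
  have "ext k a b t \<bullet> (one a \<otimes> \<eta> b) = act k \<bullet> R t \<bullet> \<eta> (a \<boxtimes> b)"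
    by (simp add: ext_def assoc tar_comp phi_eta)
  also have "\<dots> = (act k \<bullet> R t) \<bullet> \<eta> (a \<boxtimes> b)" by (simp add: assoc)
  also have "\<dots> = t" by (rule amap_free(2)) auto
  finally show ?thesis .
qed

lemma ext_nat:
  assumes [simp]: "arr s" "cod s = b"
  shows "ext k a b t \<bullet> (one a \<otimes> R s) = ext k a (dom s) (t \<bullet> (one a \<otimes> s))"
proof -
  have "ext k a b t \<bullet> (one a \<otimes> R s) = act k \<bullet> R t \<bullet> (\<phi> a b \<bullet> (one (R0 a) \<otimes> R s)) \<bullet> (\<eta> a \<otimes> one (R0 (dom s)))"
    by (simp add: ext_def assoc tar_comp)
  also have "\<phi> a b \<bullet> (one (R0 a) \<otimes> R s) = R (one a \<otimes> s) \<bullet> \<phi> a (dom s)"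
    using phi_nat[of "one a" s] by simp
  finally show ?thesis by (simp add: ext_def assoc R_comp)
qed

lemma act_R_ext: "act k \<bullet> R (ext k a b t) =
  act k \<bullet> R t \<bullet> \<mu> (a \<boxtimes> b) \<bullet> R (\<phi> a b) \<bullet> R (\<eta> a \<otimes> one (R0 b))"
proof -
  have "act k \<bullet> R (ext k a b t) = act k \<bullet> (\<mu> (U k) \<bullet> R (R t)) \<bullet> R (\<phi> a b) \<bullet> R (\<eta> a \<otimes> one (R0 b))"
    by (simp add: ext_def assoc reduce[OF act_act] R_comp)
  also have "\<mu> (U k) \<bullet> R (R t) = R t \<bullet> \<mu> (a \<boxtimes> b)" using mu_nat[of t] by simp
  finally show ?thesis by (simp add: assoc)
qed

lemma ext_mu:
  assumes "arr g" "arr h" "cod g = a" "cod h = R0 (R0 b)"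
  shows "act k \<bullet> R (ext k a b t) \<bullet> \<phi> a (R0 b) \<bullet> (R g \<otimes> h) = act k \<bullet> R t \<bullet> \<phi> a b \<bullet> (R g \<otimes> (\<mu> b \<bullet> h))"
proof -
  have "act k \<bullet> R (ext k a b t) \<bullet> \<phi> a (R0 b) \<bullet> (R g \<otimes> h) =
      act k \<bullet> R t \<bullet> \<mu> (a \<boxtimes> b) \<bullet> R (\<phi> a b) \<bullet> (R (\<eta> a \<otimes> one (R0 b)) \<bullet> \<phi> a (R0 b)) \<bullet> (R g \<otimes> h)"
    using assms by (simp add: assoc reduce[OF act_R_ext])
  also have "R (\<eta> a \<otimes> one (R0 b)) \<bullet> \<phi> a (R0 b) = \<phi> (R0 a) (R0 b) \<bullet> (R (\<eta> a) \<otimes> one (R0 (R0 b)))"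
    using phi_nat[of "\<eta> a" "one (R0 b)"] by simp
  also have "act k \<bullet> R t \<bullet> \<mu> (a \<boxtimes> b) \<bullet> R (\<phi> a b) \<bullet> (\<phi> (R0 a) (R0 b) \<bullet> (R (\<eta> a) \<otimes> one (R0 (R0 b)))) \<bullet> (R g \<otimes> h)
     = act k \<bullet> R t \<bullet> (\<mu> (a \<boxtimes> b) \<bullet> R (\<phi> a b) \<bullet> \<phi> (R0 a) (R0 b)) \<bullet> ((R (\<eta> a) \<bullet> R g) \<otimes> h)"
    using assms by (simp add: assoc tar_comp)
  also have "\<dots> = act k \<bullet> R t \<bullet> \<phi> a b \<bullet> ((\<mu> a \<bullet> R (\<eta> a) \<bullet> R g) \<otimes> (\<mu> b \<bullet> h))"
    using assms by (simp add: mu_phi assoc tar_comp)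
  also have "\<mu> a \<bullet> R (\<eta> a) \<bullet> R g = R g" using assms by (simp add: reduce[OF mu_R_eta])
  finally show ?thesis .
qed

text \<open>Extending in the second variable and then in the first amounts to extending in both
  variables at once. This is the commutativity of the monad, which comes from \<open>\<mu>\<close> being monoidal.\<close>

lemma ext_swap:
  "act k \<bullet> R (ext k a b t) \<bullet> \<phi> a (R0 b) \<bullet> (one (R0 a) \<otimes> \<eta> (R0 b)) = act k \<bullet> R t \<bullet> \<phi> a b"
  using ext_mu[of "one a" "\<eta> (R0 b)"] by (simp add: mu_eta_R)

lemma R_ext_eta: "act k \<bullet> R (ext k a b t) \<bullet> \<phi> a (R0 b) \<bullet> (\<eta> a \<otimes> one (R0 (R0 b))) = ext k a b t \<bullet> (one a \<otimes> \<mu> b)"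
proof -
  have "act k \<bullet> R (ext k a b t) \<bullet> \<phi> a (R0 b) \<bullet> (\<eta> a \<otimes> one (R0 (R0 b)))
      = (act k \<bullet> R (ext k a b t) \<bullet> \<phi> a (R0 b) \<bullet> (R (one a) \<otimes> one (R0 (R0 b)))) \<bullet> (\<eta> a \<otimes> one (R0 (R0 b)))"
    by (simp add: assoc tar_comp)
  also have "\<dots> = (act k \<bullet> R t \<bullet> \<phi> a b \<bullet> (R (one a) \<otimes> (\<mu> b \<bullet> one (R0 (R0 b))))) \<bullet> (\<eta> a \<otimes> one (R0 (R0 b)))"
    by (subst ext_mu) simp_all
  also have "\<dots> = ext k a b t \<bullet> (one a \<otimes> \<mu> b)"
    by (simp add: ext_def assoc tar_comp)
  finally show ?thesis .
qed

end

lemma ext_ext: "Alg k \<Longrightarrow> obj a \<Longrightarrow> obj b \<Longrightarrow> arr t \<Longrightarrow> dom t = a \<boxtimes> b \<Longrightarrow> cod t = U k \<Longrightarrow>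
    ext k a (R0 b) (ext k a b t) = ext k a b t \<bullet> (one a \<otimes> \<mu> b)"
  using R_ext_eta[of k a b t] by (simp add: ext_def[of k a "R0 b"])

text \<open>Linearity in each variable separately suffices, because by \<open>ext_swap\<close> the extension in both
  variables can be carried out one variable at a time.\<close>

lemma bimorI:
  assumes [simp]: "Alg x" "Alg y" "Alg k" "arr p" "dom p = U x \<boxtimes> U y" "cod p = U k"
    and l1: "act k \<bullet> R p \<bullet> \<phi> (U x) (U y) \<bullet> (one (R0 (U x)) \<otimes> \<eta> (U y)) = p \<bullet> (act x \<otimes> one (U y))"
    and l2: "ext k (U x) (U y) p = p \<bullet> (one (U x) \<otimes> act y)"
  shows "act k \<bullet> R p \<bullet> \<phi> (U x) (U y) = p \<bullet> (act x \<otimes> act y)"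
proof -
  let ?a = "U x" let ?b = "U y"
  have "p \<bullet> (act x \<otimes> act y) = (p \<bullet> (act x \<otimes> one ?b)) \<bullet> (one (R0 ?a) \<otimes> act y)"
    by (simp add: assoc tar_comp)
  also have "\<dots> = act k \<bullet> R p \<bullet> \<phi> ?a ?b \<bullet> (one (R0 ?a) \<otimes> (\<eta> ?b \<bullet> act y))"
    by (simp add: l1[symmetric] assoc tar_comp)
  also have "\<eta> ?b \<bullet> act y = R (act y) \<bullet> \<eta> (R0 ?b)" using eta_nat[of "act y"] by simp
  also have "act k \<bullet> R p \<bullet> \<phi> ?a ?b \<bullet> (one (R0 ?a) \<otimes> (R (act y) \<bullet> \<eta> (R0 ?b)))
    = act k \<bullet> R p \<bullet> (\<phi> ?a ?b \<bullet> (R (one ?a) \<otimes> R (act y))) \<bullet> (one (R0 ?a) \<otimes> \<eta> (R0 ?b))"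
    by (simp add: assoc tar_comp)
  also have "\<phi> ?a ?b \<bullet> (R (one ?a) \<otimes> R (act y)) = R (one ?a \<otimes> act y) \<bullet> \<phi> ?a (R0 ?b)"
    using phi_nat[of "one ?a" "act y"] by simp
  also have "act k \<bullet> R p \<bullet> (R (one ?a \<otimes> act y) \<bullet> \<phi> ?a (R0 ?b)) \<bullet> (one (R0 ?a) \<otimes> \<eta> (R0 ?b))
     = act k \<bullet> R (ext k ?a ?b p) \<bullet> \<phi> ?a (R0 ?b) \<bullet> (one (R0 ?a) \<otimes> \<eta> (R0 ?b))"
    by (simp add: l2 R_comp assoc)
  also have "\<dots> = act k \<bullet> R p \<bullet> \<phi> ?a ?b" by (rule ext_swap) simp_all
  finally show ?thesis by simp
qed

text \<open>The map \<open>t\<close> extends to \<open>U x \<otimes> R (U y \<otimes> U z)\<close>, and the extension factors through the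
  coequalizer \<open>one \<otimes> q y z\<close>. This gives a map \<open>p\<close> on \<open>U x \<otimes> U (Tn y z)\<close> that restricts to \<open>t\<close>. It is
  linear in each variable, as one sees after precomposition with the epimorphisms \<open>one \<otimes> q y z\<close>
  and \<open>one \<otimes> R (q y z)\<close>; so \<open>ext2\<close> applies to \<open>p\<close>.\<close>

lemma ext3:
  assumes [simp]: "Alg x" "Alg y" "Alg z" "Alg k" "arr t" "dom t = U x \<boxtimes> U y \<boxtimes> U z" "cod t = U k"
    and tri: "act k \<bullet> R t \<bullet> \<phi> (U x) (U y \<boxtimes> U z) \<bullet> (one (R0 (U x)) \<otimes> \<phi> (U y) (U z))
      = t \<bullet> (act x \<otimes> act y \<otimes> act z)"
  obtains w where "amap (Tn x (Tn y z)) k w" "w \<bullet> u x (Tn y z) \<bullet> (one (U x) \<otimes> u y z) = t"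
proof -
  let ?a = "U x" let ?b = "U y" let ?c = "U z" let ?e = "ext k (U x) (U y \<boxtimes> U z) t"
  \<comment> \<open>The two consequences of trilinearity: linearity in the last two variables jointly, and in the first.\<close>
  have e1: "?e \<bullet> (one ?a \<otimes> \<phi> ?b ?c) = t \<bullet> (one ?a \<otimes> act y \<otimes> act z)"
  proof -
    have "?e \<bullet> (one ?a \<otimes> \<phi> ?b ?c) = (act k \<bullet> R t \<bullet> \<phi> ?a (?b \<boxtimes> ?c) \<bullet> (one (R0 ?a) \<otimes> \<phi> ?b ?c)) \<bullet> (\<eta> ?a \<otimes> one (R0 ?b \<boxtimes> R0 ?c))"
      by (simp add: ext_def assoc tar_comp)
    also have "\<dots> = t \<bullet> (one ?a \<otimes> act y \<otimes> act z)"
      unfolding tri by (simp add: assoc tar_comp act_eta)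
    finally show ?thesis .
  qed
  have e2: "act k \<bullet> R t \<bullet> \<phi> ?a (?b \<boxtimes> ?c) \<bullet> (one (R0 ?a) \<otimes> \<eta> (?b \<boxtimes> ?c)) = t \<bullet> (act x \<otimes> one (?b \<boxtimes> ?c))"
  proof -
    have "act k \<bullet> R t \<bullet> \<phi> ?a (?b \<boxtimes> ?c) \<bullet> (one (R0 ?a) \<otimes> \<eta> (?b \<boxtimes> ?c)) =
      (act k \<bullet> R t \<bullet> \<phi> ?a (?b \<boxtimes> ?c) \<bullet> (one (R0 ?a) \<otimes> \<phi> ?b ?c)) \<bullet> (one (R0 ?a) \<otimes> \<eta> ?b \<otimes> \<eta> ?c)"
      by (simp add: assoc tar_comp phi_eta)
    also have "\<dots> = t \<bullet> (act x \<otimes> one (?b \<boxtimes> ?c))"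
      unfolding tri by (simp add: assoc tar_comp act_eta)
    finally show ?thesis .
  qed
  have "?e \<bullet> (one ?a \<otimes> (\<mu> (?b \<boxtimes> ?c) \<bullet> R (\<phi> ?b ?c))) = (?e \<bullet> (one ?a \<otimes> \<mu> (?b \<boxtimes> ?c))) \<bullet> (one ?a \<otimes> R (\<phi> ?b ?c))"
    by (simp add: assoc tar_comp)
  also have "\<dots> = ext k ?a (R0 (?b \<boxtimes> ?c)) ?e \<bullet> (one ?a \<otimes> R (\<phi> ?b ?c))"
    by (simp add: ext_ext)
  also have "\<dots> = ext k ?a (R0 ?b \<boxtimes> R0 ?c) (t \<bullet> (one ?a \<otimes> act y \<otimes> act z))"
    by (subst ext_nat) (simp_all add: e1)
  also have "\<dots> = ?e \<bullet> (one ?a \<otimes> R (act y \<otimes> act z))" by (subst ext_nat) simp_all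
  finally obtain p where p [simp]: "arr p" "dom p = ?a \<boxtimes> U (Tn y z)" "cod p = U k"
      and pq: "p \<bullet> (one ?a \<otimes> q y z) = ?e"
    using q_fac_left[of ?a y z ?e] by auto
  have pu: "p \<bullet> (one ?a \<otimes> u y z) = t"
  proof -
    have "p \<bullet> (one ?a \<otimes> u y z) = (p \<bullet> (one ?a \<otimes> q y z)) \<bullet> (one ?a \<otimes> \<eta> (?b \<boxtimes> ?c))"
      by (simp add: u_def assoc tar_comp)
    also have "\<dots> = t" unfolding pq by (rule ext_eta) simp_all
    finally show ?thesis .
  qed
  have l2: "ext k ?a (U (Tn y z)) p = p \<bullet> (one ?a \<otimes> act (Tn y z))"
  proof (rule epiD[of "one ?a \<otimes> R (q y z)"])
    show "epi (one ?a \<otimes> R (q y z))" by (intro stableD(1)[OF stableD(4)] stableD(3) q_stable) simp_all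
    have "ext k ?a (U (Tn y z)) p \<bullet> (one ?a \<otimes> R (q y z)) = ext k ?a (R0 (?b \<boxtimes> ?c)) ?e"
      by (subst ext_nat) (simp_all add: pq)
    also have "\<dots> = ?e \<bullet> (one ?a \<otimes> \<mu> (?b \<boxtimes> ?c))" by (simp add: ext_ext)
    also have "\<dots> = p \<bullet> (one ?a \<otimes> (q y z \<bullet> \<mu> (?b \<boxtimes> ?c)))" unfolding pq[symmetric] by (simp add: assoc tar_comp)
    also have "\<dots> = (p \<bullet> (one ?a \<otimes> act (Tn y z))) \<bullet> (one ?a \<otimes> R (q y z))"
      by (simp add: assoc tar_comp act_Tn)
    finally show "ext k ?a (U (Tn y z)) p \<bullet> (one ?a \<otimes> R (q y z)) = (p \<bullet> (one ?a \<otimes> act (Tn y z))) \<bullet> (one ?a \<otimes> R (q y z))" .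
  qed simp_all
  have l1: "act k \<bullet> R p \<bullet> \<phi> ?a (U (Tn y z)) \<bullet> (one (R0 ?a) \<otimes> \<eta> (U (Tn y z))) = p \<bullet> (act x \<otimes> one (U (Tn y z)))"
  proof (rule epiD[of "one (R0 ?a) \<otimes> q y z"])
    show "epi (one (R0 ?a) \<otimes> q y z)" by (intro stableD(1)[OF stableD(4)] q_stable) simp_all
    have "(act k \<bullet> R p \<bullet> \<phi> ?a (U (Tn y z)) \<bullet> (one (R0 ?a) \<otimes> \<eta> (U (Tn y z)))) \<bullet> (one (R0 ?a) \<otimes> q y z)
       = act k \<bullet> R p \<bullet> \<phi> ?a (U (Tn y z)) \<bullet> (one (R0 ?a) \<otimes> (\<eta> (U (Tn y z)) \<bullet> q y z))"
      by (simp add: assoc tar_comp)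
    also have "\<eta> (U (Tn y z)) \<bullet> q y z = R (q y z) \<bullet> \<eta> (R0 (?b \<boxtimes> ?c))"
      using eta_nat[of "q y z"] by simp
    also have "act k \<bullet> R p \<bullet> \<phi> ?a (U (Tn y z)) \<bullet> (one (R0 ?a) \<otimes> (R (q y z) \<bullet> \<eta> (R0 (?b \<boxtimes> ?c))))
       = act k \<bullet> R p \<bullet> (\<phi> ?a (U (Tn y z)) \<bullet> (R (one ?a) \<otimes> R (q y z))) \<bullet> (one (R0 ?a) \<otimes> \<eta> (R0 (?b \<boxtimes> ?c)))"
      by (simp add: assoc tar_comp)
    also have "\<phi> ?a (U (Tn y z)) \<bullet> (R (one ?a) \<otimes> R (q y z)) = R (one ?a \<otimes> q y z) \<bullet> \<phi> ?a (R0 (?b \<boxtimes> ?c))"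
      using phi_nat[of "one ?a" "q y z"] by simp
    also have "act k \<bullet> R p \<bullet> (R (one ?a \<otimes> q y z) \<bullet> \<phi> ?a (R0 (?b \<boxtimes> ?c))) \<bullet> (one (R0 ?a) \<otimes> \<eta> (R0 (?b \<boxtimes> ?c)))
       = act k \<bullet> R ?e \<bullet> \<phi> ?a (R0 (?b \<boxtimes> ?c)) \<bullet> (one (R0 ?a) \<otimes> \<eta> (R0 (?b \<boxtimes> ?c)))"
      unfolding pq[symmetric] by (simp add: R_comp assoc)
    also have "\<dots> = act k \<bullet> R t \<bullet> \<phi> ?a (?b \<boxtimes> ?c)" by (rule ext_swap) simp_all
    also have "\<dots> = ?e \<bullet> (act x \<otimes> one (R0 (?b \<boxtimes> ?c)))"
    proof -
      have "?e \<bullet> (act x \<otimes> one (R0 (?b \<boxtimes> ?c))) = act k \<bullet> R t \<bullet> \<phi> ?a (?b \<boxtimes> ?c) \<bullet> ((\<eta> ?a \<bullet> act x) \<otimes> one (R0 (?b \<boxtimes> ?c)))"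
        by (simp add: ext_def assoc tar_comp)
      also have "\<eta> ?a \<bullet> act x = R (act x) \<bullet> \<eta> (R0 ?a)" using eta_nat[of "act x"] by simp
      also have "act k \<bullet> R t \<bullet> \<phi> ?a (?b \<boxtimes> ?c) \<bullet> ((R (act x) \<bullet> \<eta> (R0 ?a)) \<otimes> one (R0 (?b \<boxtimes> ?c)))
        = act k \<bullet> R t \<bullet> (\<phi> ?a (?b \<boxtimes> ?c) \<bullet> (R (act x) \<otimes> R (one (?b \<boxtimes> ?c)))) \<bullet> (\<eta> (R0 ?a) \<otimes> one (R0 (?b \<boxtimes> ?c)))"
        by (simp add: assoc tar_comp)
      also have "\<phi> ?a (?b \<boxtimes> ?c) \<bullet> (R (act x) \<otimes> R (one (?b \<boxtimes> ?c))) = R (act x \<otimes> one (?b \<boxtimes> ?c)) \<bullet> \<phi> (R0 ?a) (?b \<boxtimes> ?c)"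
        using phi_nat[of "act x" "one (?b \<boxtimes> ?c)"] by simp
      also have "act k \<bullet> R t \<bullet> (R (act x \<otimes> one (?b \<boxtimes> ?c)) \<bullet> \<phi> (R0 ?a) (?b \<boxtimes> ?c)) \<bullet> (\<eta> (R0 ?a) \<otimes> one (R0 (?b \<boxtimes> ?c)))
        = ext k (R0 ?a) (?b \<boxtimes> ?c) (t \<bullet> (act x \<otimes> one (?b \<boxtimes> ?c)))"
        by (simp add: ext_def R_comp assoc)
      also have "\<dots> = act k \<bullet> R t \<bullet> \<phi> ?a (?b \<boxtimes> ?c)"
      proof -
        let ?d = "?b \<boxtimes> ?c"
        have "act k \<bullet> R (act k \<bullet> R t \<bullet> \<phi> ?a ?d \<bullet> (one (R0 ?a) \<otimes> \<eta> ?d))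
           = act k \<bullet> (\<mu> (U k) \<bullet> R (R t)) \<bullet> R (\<phi> ?a ?d) \<bullet> R (one (R0 ?a) \<otimes> \<eta> ?d)"
          by (simp add: R_comp assoc reduce[OF act_act])
        also have "\<dots> = act k \<bullet> R t \<bullet> \<mu> (?a \<boxtimes> ?d) \<bullet> R (\<phi> ?a ?d) \<bullet> R (one (R0 ?a) \<otimes> \<eta> ?d)"
          using mu_nat[of t] by (simp add: assoc)
        finally have 1: "act k \<bullet> R (t \<bullet> (act x \<otimes> one ?d)) =
            act k \<bullet> R t \<bullet> \<mu> (?a \<boxtimes> ?d) \<bullet> R (\<phi> ?a ?d) \<bullet> R (one (R0 ?a) \<otimes> \<eta> ?d)" unfolding e2 .
        have "ext k (R0 ?a) ?d (t \<bullet> (act x \<otimes> one ?d)) = (act k \<bullet> R (t \<bullet> (act x \<otimes> one ?d))) \<bullet> \<phi> (R0 ?a) ?d \<bullet> (\<eta> (R0 ?a) \<otimes> one (R0 ?d))"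
          by (simp add: ext_def assoc)
        also have "\<dots> = act k \<bullet> R t \<bullet> \<mu> (?a \<boxtimes> ?d) \<bullet> R (\<phi> ?a ?d) \<bullet> (R (one (R0 ?a) \<otimes> \<eta> ?d) \<bullet> \<phi> (R0 ?a) ?d) \<bullet> (\<eta> (R0 ?a) \<otimes> one (R0 ?d))"
          unfolding 1 by (simp add: assoc)
        also have "R (one (R0 ?a) \<otimes> \<eta> ?d) \<bullet> \<phi> (R0 ?a) ?d = \<phi> (R0 ?a) (R0 ?d) \<bullet> (one (R0 (R0 ?a)) \<otimes> R (\<eta> ?d))"
          using phi_nat[of "one (R0 ?a)" "\<eta> ?d"] by simp
        also have "act k \<bullet> R t \<bullet> \<mu> (?a \<boxtimes> ?d) \<bullet> R (\<phi> ?a ?d) \<bullet> (\<phi> (R0 ?a) (R0 ?d) \<bullet> (one (R0 (R0 ?a)) \<otimes> R (\<eta> ?d))) \<bullet> (\<eta> (R0 ?a) \<otimes> one (R0 ?d))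
           = act k \<bullet> R t \<bullet> (\<mu> (?a \<boxtimes> ?d) \<bullet> R (\<phi> ?a ?d) \<bullet> \<phi> (R0 ?a) (R0 ?d)) \<bullet> (\<eta> (R0 ?a) \<otimes> R (\<eta> ?d))"
          by (simp add: assoc tar_comp)
        also have "\<dots> = act k \<bullet> R t \<bullet> \<phi> ?a ?d"
          by (simp add: mu_phi assoc tar_comp mu_eta_R mu_R_eta)
        finally show ?thesis .
      qed
      finally show ?thesis by simp
    qed
    also have "\<dots> = (p \<bullet> (act x \<otimes> one (U (Tn y z)))) \<bullet> (one (R0 ?a) \<otimes> q y z)"
      unfolding pq[symmetric] by (simp add: assoc tar_comp)
    finally show "(act k \<bullet> R p \<bullet> \<phi> ?a (U (Tn y z)) \<bullet> (one (R0 ?a) \<otimes> \<eta> (U (Tn y z)))) \<bullet> (one (R0 ?a) \<otimes> q y z)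
      = (p \<bullet> (act x \<otimes> one (U (Tn y z)))) \<bullet> (one (R0 ?a) \<otimes> q y z)" .
  qed simp_all
  obtain w where w: "amap (Tn x (Tn y z)) k w" "w \<bullet> u x (Tn y z) = p"
    by (rule ext2[of x "Tn y z" k p]) (simp_all add: bimorI l1 l2)
  moreover have "w \<bullet> u x (Tn y z) \<bullet> (one ?a \<otimes> u y z) = t"
    using amapD(1-3)[OF w(1)] pu by (simp add: reduce[OF w(2)])
  ultimately show ?thesis using that by blast
qed

lemma ext3_right:
  assumes a: "Alg x" "Alg y" "Alg z" "Alg k" "arr t" "dom t = (U x \<boxtimes> U y) \<boxtimes> U z" "cod t = U k"
    and tri: "act k \<bullet> R t \<bullet> \<phi> (U x \<boxtimes> U y) (U z) \<bullet> (\<phi> (U x) (U y) \<otimes> one (R0 (U z)))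
      = t \<bullet> ((act x \<otimes> act y) \<otimes> act z)"
  obtains w where "amap (Tn (Tn x y) z) k w" "w \<bullet> u (Tn x y) z \<bullet> (u x y \<otimes> one (U z)) = t"
proof -
  interpret flip: algebra_tensor obj arr dom cod one comp "\<lambda>a b. b \<boxtimes> a" "\<lambda>f g. g \<otimes> f" R0 R "\<lambda>a b. \<phi> b a" \<eta> \<mu>
    Alg U act Fr "\<lambda>x y. Tn y x" "\<lambda>x y. q y x"
    by (rule flipped_algebra)
  show ?thesis
    by (rule flip.ext3[of z y x k t])
      (use a tri that in \<open>auto simp: flip.u_def u_def\<close>)
qed

text \<open>The map \<open>w\<close> is induced by the bimorphism that extends the unit constraint of the base from \<open>I\<close>
  to \<open>R I\<close>. Its inverse is \<open>u \<bullet> (\<eta> I \<otimes> one) \<bullet> lun'\<close>, which is linear because the unit constraint is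
  natural and compatible with \<open>\<phi>\<close>. One composite is an identity by construction, the other one
  because \<open>u \<bullet> (\<eta> I \<otimes> one)\<close> is dense. Only a one-sided unit is involved, so that reversing the
  tensor product covers the other side.\<close>

lemma unit_ext:
  fixes I lun lun'
  assumes I [simp]: "obj I" and x [simp]: "Alg x"
    and lun [simp]: "\<And>a. obj a \<Longrightarrow> arr (lun a)" "\<And>a. dom (lun a) = I \<boxtimes> a" "\<And>a. cod (lun a) = a"
    and lun' [simp]: "\<And>a. obj a \<Longrightarrow> arr (lun' a)" "\<And>a. cod (lun' a) = I \<boxtimes> a" "\<And>a. dom (lun' a) = a"
    and inv1: "\<And>a. obj a \<Longrightarrow> lun a \<bullet> lun' a = one a"
    and inv2: "\<And>a. obj a \<Longrightarrow> lun' a \<bullet> lun a = one (I \<boxtimes> a)"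
    and nat: "\<And>f. arr f \<Longrightarrow> lun (cod f) \<bullet> (one I \<otimes> f) = f \<bullet> lun (dom f)"
    and R_lun: "\<And>a. obj a \<Longrightarrow> R (lun a) \<bullet> \<phi> I a \<bullet> (\<eta> I \<otimes> one (R0 a)) = lun (R0 a)"
  obtains w w' where "amap (Tn (Fr I) x) x w" "amap x (Tn (Fr I) x) w'"
    "w \<bullet> w' = one (U x)" "w' \<bullet> w = one (U (Tn (Fr I) x))"
    "w \<bullet> u (Fr I) x \<bullet> (\<eta> I \<otimes> one (U x)) = lun (U x)"
    "w \<bullet> q (Fr I) x = act x \<bullet> \<mu> (U x) \<bullet> R (R (lun (U x))) \<bullet> R (\<phi> I (U x)) \<bullet> R (one (R0 I) \<otimes> \<eta> (U x))"
proof -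
  let ?a = "U x"
  let ?p = "act x \<bullet> R (lun ?a) \<bullet> \<phi> I ?a \<bullet> (one (R0 I) \<otimes> \<eta> ?a)"
  have actp: "act x \<bullet> R ?p = act x \<bullet> \<mu> ?a \<bullet> R (R (lun ?a)) \<bullet> R (\<phi> I ?a) \<bullet> R (one (R0 I) \<otimes> \<eta> ?a)"
    by (simp add: R_comp assoc reduce[OF act_act])
  have main: "act x \<bullet> \<mu> ?a \<bullet> R (R (lun ?a)) \<bullet> R (\<phi> I ?a) \<bullet> \<phi> (R0 I) (R0 ?a) \<bullet> (f \<otimes> g) =
      act x \<bullet> R (lun ?a) \<bullet> \<phi> I ?a \<bullet> ((\<mu> I \<bullet> f) \<otimes> (\<mu> ?a \<bullet> g))"
    if [simp]: "arr f" "arr g" "cod f = R0 (R0 I)" "cod g = R0 (R0 ?a)" for f g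
  proof -
    have "act x \<bullet> \<mu> ?a \<bullet> R (R (lun ?a)) \<bullet> R (\<phi> I ?a) \<bullet> \<phi> (R0 I) (R0 ?a) \<bullet> (f \<otimes> g) =
      act x \<bullet> (\<mu> ?a \<bullet> R (R (lun ?a))) \<bullet> R (\<phi> I ?a) \<bullet> \<phi> (R0 I) (R0 ?a) \<bullet> (f \<otimes> g)"
      by (simp add: assoc)
    also have "\<mu> ?a \<bullet> R (R (lun ?a)) = R (lun ?a) \<bullet> \<mu> (I \<boxtimes> ?a)" using mu_nat[of "lun ?a"] by simp
    also have "act x \<bullet> (R (lun ?a) \<bullet> \<mu> (I \<boxtimes> ?a)) \<bullet> R (\<phi> I ?a) \<bullet> \<phi> (R0 I) (R0 ?a) \<bullet> (f \<otimes> g)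
      = act x \<bullet> R (lun ?a) \<bullet> (\<mu> (I \<boxtimes> ?a) \<bullet> R (\<phi> I ?a) \<bullet> \<phi> (R0 I) (R0 ?a)) \<bullet> (f \<otimes> g)"
      by (simp add: assoc)
    also have "\<dots> = act x \<bullet> R (lun ?a) \<bullet> \<phi> I ?a \<bullet> ((\<mu> I \<bullet> f) \<otimes> (\<mu> ?a \<bullet> g))"
      by (simp add: mu_phi assoc tar_comp)
    finally show ?thesis .
  qed
  \<comment> \<open>Both sides of the bimorphism condition for \<open>?p\<close> reduce to \<open>act x \<bullet> R (lun ?a) \<bullet> \<phi> I ?a \<bullet> (\<mu> I \<otimes> one)\<close>.\<close>
  have "act x \<bullet> R ?p \<bullet> \<phi> (U (Fr I)) ?a = act x \<bullet> \<mu> ?a \<bullet> R (R (lun ?a)) \<bullet> R (\<phi> I ?a) \<bullet> R (one (R0 I) \<otimes> \<eta> ?a) \<bullet> \<phi> (R0 I) ?a"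
    using reduce[OF actp, of "\<phi> (R0 I) ?a"] by (simp add: assoc)
  also have "R (one (R0 I) \<otimes> \<eta> ?a) \<bullet> \<phi> (R0 I) ?a = \<phi> (R0 I) (R0 ?a) \<bullet> (one (R0 (R0 I)) \<otimes> R (\<eta> ?a))"
    using phi_nat[of "one (R0 I)" "\<eta> ?a"] by simp
  also have "act x \<bullet> \<mu> ?a \<bullet> R (R (lun ?a)) \<bullet> R (\<phi> I ?a) \<bullet> \<phi> (R0 I) (R0 ?a) \<bullet> (one (R0 (R0 I)) \<otimes> R (\<eta> ?a))
     = act x \<bullet> R (lun ?a) \<bullet> \<phi> I ?a \<bullet> (\<mu> I \<otimes> one (R0 ?a))"
    by (subst main) (simp_all add: mu_R_eta)
  also have "\<dots> = ?p \<bullet> (act (Fr I) \<otimes> act x)"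
  proof -
    have "?p \<bullet> (act (Fr I) \<otimes> act x) = act x \<bullet> R (lun ?a) \<bullet> \<phi> I ?a \<bullet> (\<mu> I \<otimes> (\<eta> ?a \<bullet> act x))"
      by (simp add: assoc tar_comp)
    also have "\<eta> ?a \<bullet> act x = R (act x) \<bullet> \<eta> (R0 ?a)" using eta_nat[of "act x"] by simp
    also have "act x \<bullet> R (lun ?a) \<bullet> \<phi> I ?a \<bullet> (\<mu> I \<otimes> (R (act x) \<bullet> \<eta> (R0 ?a)))
      = act x \<bullet> R (lun ?a) \<bullet> (\<phi> I ?a \<bullet> (R (one I) \<otimes> R (act x))) \<bullet> (\<mu> I \<otimes> \<eta> (R0 ?a))"
      by (simp add: assoc tar_comp)
    also have "\<phi> I ?a \<bullet> (R (one I) \<otimes> R (act x)) = R (one I \<otimes> act x) \<bullet> \<phi> I (R0 ?a)"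
      using phi_nat[of "one I" "act x"] by simp
    also have "act x \<bullet> R (lun ?a) \<bullet> (R (one I \<otimes> act x) \<bullet> \<phi> I (R0 ?a)) \<bullet> (\<mu> I \<otimes> \<eta> (R0 ?a))
      = act x \<bullet> R (lun ?a \<bullet> (one I \<otimes> act x)) \<bullet> \<phi> I (R0 ?a) \<bullet> (\<mu> I \<otimes> \<eta> (R0 ?a))"
      by (simp add: assoc R_comp)
    also have "lun ?a \<bullet> (one I \<otimes> act x) = act x \<bullet> lun (R0 ?a)" using nat[of "act x"] by simp
    also have "\<dots> = act x \<bullet> R (lun ?a) \<bullet> \<phi> I ?a \<bullet> (\<eta> I \<otimes> one (R0 ?a))" by (simp add: R_lun)
    also have "act x \<bullet> R (act x \<bullet> R (lun ?a) \<bullet> \<phi> I ?a \<bullet> (\<eta> I \<otimes> one (R0 ?a))) \<bullet> \<phi> I (R0 ?a) \<bullet> (\<mu> I \<otimes> \<eta> (R0 ?a))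
      = act x \<bullet> \<mu> ?a \<bullet> R (R (lun ?a)) \<bullet> R (\<phi> I ?a) \<bullet> (R (\<eta> I \<otimes> one (R0 ?a)) \<bullet> \<phi> I (R0 ?a)) \<bullet> (\<mu> I \<otimes> \<eta> (R0 ?a))"
      by (simp add: assoc R_comp reduce[OF act_act])
    also have "R (\<eta> I \<otimes> one (R0 ?a)) \<bullet> \<phi> I (R0 ?a) = \<phi> (R0 I) (R0 ?a) \<bullet> (R (\<eta> I) \<otimes> one (R0 (R0 ?a)))"
      using phi_nat[of "\<eta> I" "one (R0 ?a)"] by simp
    also have "act x \<bullet> \<mu> ?a \<bullet> R (R (lun ?a)) \<bullet> R (\<phi> I ?a) \<bullet> (\<phi> (R0 I) (R0 ?a) \<bullet> (R (\<eta> I) \<otimes> one (R0 (R0 ?a)))) \<bullet> (\<mu> I \<otimes> \<eta> (R0 ?a))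
      = act x \<bullet> \<mu> ?a \<bullet> R (R (lun ?a)) \<bullet> R (\<phi> I ?a) \<bullet> \<phi> (R0 I) (R0 ?a) \<bullet> ((R (\<eta> I) \<bullet> \<mu> I) \<otimes> \<eta> (R0 ?a))"
      by (simp add: assoc tar_comp)
    also have "\<dots> = act x \<bullet> R (lun ?a) \<bullet> \<phi> I ?a \<bullet> (\<mu> I \<otimes> one (R0 ?a))"
      by (subst main) (simp_all add: mu_eta_R reduce[OF mu_R_eta])
    finally show ?thesis by simp
  qed
  finally obtain w where w: "amap (Tn (Fr I) x) x w" "w \<bullet> u (Fr I) x = ?p" "w \<bullet> q (Fr I) x = act x \<bullet> R ?p"
    using ext2[of "Fr I" x x ?p] by auto
  note [simp] = amapD(1-3)[OF w(1)]
  have wl: "w \<bullet> u (Fr I) x \<bullet> (\<eta> I \<otimes> one ?a) = lun ?a"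
  proof -
    have "w \<bullet> u (Fr I) x \<bullet> (\<eta> I \<otimes> one ?a) = (act x \<bullet> R (lun ?a)) \<bullet> \<eta> (I \<boxtimes> ?a)"
      by (simp add: reduce[OF w(2)] assoc tar_comp phi_eta)
    also have "\<dots> = lun ?a" by (rule amap_free(2)) simp_all
    finally show ?thesis .
  qed
  let ?w = "u (Fr I) x \<bullet> (\<eta> I \<otimes> one ?a) \<bullet> lun' ?a"
  have "w \<bullet> ?w = (w \<bullet> u (Fr I) x \<bullet> (\<eta> I \<otimes> one ?a)) \<bullet> lun' ?a" by (simp add: assoc)
  also have "\<dots> = one ?a" unfolding wl by (simp add: inv1)
  finally have ww: "w \<bullet> ?w = one ?a" .
  have nat': "lun' ?a \<bullet> act x = (one I \<otimes> act x) \<bullet> lun' (R0 ?a)"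
  proof -
    have "lun' ?a \<bullet> act x = lun' ?a \<bullet> (act x \<bullet> lun (R0 ?a)) \<bullet> lun' (R0 ?a)"
      by (simp add: assoc inv1)
    also have "act x \<bullet> lun (R0 ?a) = lun ?a \<bullet> (one I \<otimes> act x)" using nat[of "act x"] by simp
    finally show ?thesis by (simp add: assoc reduce[OF inv2])
  qed
  have R_lun': "\<phi> I ?a \<bullet> (\<eta> I \<otimes> one (R0 ?a)) \<bullet> lun' (R0 ?a) = R (lun' ?a)"
  proof -
    have "R (lun' ?a) = R (lun' ?a) \<bullet> lun (R0 ?a) \<bullet> lun' (R0 ?a)" by (simp add: inv1)
    also have "\<dots> = R (lun' ?a \<bullet> lun ?a) \<bullet> \<phi> I ?a \<bullet> (\<eta> I \<otimes> one (R0 ?a)) \<bullet> lun' (R0 ?a)"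
      by (simp add: R_lun[symmetric] R_comp assoc)
    finally show ?thesis by (simp add: inv2)
  qed
  have "?w \<bullet> act x = u (Fr I) x \<bullet> (\<eta> I \<otimes> act x) \<bullet> lun' (R0 ?a)"
    by (simp add: assoc nat' reduce[OF tar_comp])
  also have "\<dots> = (u (Fr I) x \<bullet> (act (Fr I) \<otimes> act x)) \<bullet> ((R (\<eta> I) \<bullet> \<eta> I) \<otimes> one (R0 ?a)) \<bullet> lun' (R0 ?a)"
    by (simp add: assoc reduce[OF tar_comp] reduce[OF mu_R_eta])
  also have "u (Fr I) x \<bullet> (act (Fr I) \<otimes> act x) = q (Fr I) x \<bullet> \<phi> (R0 I) ?a"
    using u_bimor[of "Fr I" x] by (simp add: reduce[OF act_R_u])
  also have "(q (Fr I) x \<bullet> \<phi> (R0 I) ?a) \<bullet> ((R (\<eta> I) \<bullet> \<eta> I) \<otimes> one (R0 ?a)) \<bullet> lun' (R0 ?a)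
     = q (Fr I) x \<bullet> (\<phi> (R0 I) ?a \<bullet> (R (\<eta> I) \<otimes> R (one ?a))) \<bullet> (\<eta> I \<otimes> one (R0 ?a)) \<bullet> lun' (R0 ?a)"
    by (simp add: assoc reduce[OF tar_comp])
  also have "\<phi> (R0 I) ?a \<bullet> (R (\<eta> I) \<otimes> R (one ?a)) = R (\<eta> I \<otimes> one ?a) \<bullet> \<phi> I ?a"
    using phi_nat[of "\<eta> I" "one ?a"] by simp
  also have "q (Fr I) x \<bullet> (R (\<eta> I \<otimes> one ?a) \<bullet> \<phi> I ?a) \<bullet> (\<eta> I \<otimes> one (R0 ?a)) \<bullet> lun' (R0 ?a)
     = q (Fr I) x \<bullet> R (\<eta> I \<otimes> one ?a) \<bullet> R (lun' ?a)"
    by (simp add: assoc R_lun'[symmetric])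
  also have "\<dots> = act (Tn (Fr I) x) \<bullet> R ?w" by (simp add: R_comp reduce[OF act_R_u])
  finally have w': "amap x (Tn (Fr I) x) ?w" by (simp add: amap_def)
  have "?w \<bullet> w = one (U (Tn (Fr I) x))"
  proof (rule dense_eq)
    show "dense (Tn (Fr I) x) (u (Fr I) x \<bullet> (\<eta> I \<otimes> one ?a))"
      by (intro dense_tensor dense_eta dense_one) simp_all
    show "amap (Tn (Fr I) x) (Tn (Fr I) x) (?w \<bullet> w)"
      by (rule amap_comp[OF _ _ _ w(1) w']) simp_all
    show "amap (Tn (Fr I) x) (Tn (Fr I) x) (one (U (Tn (Fr I) x)))" by (rule amap_one) simp
    show "(?w \<bullet> w) \<bullet> u (Fr I) x \<bullet> (\<eta> I \<otimes> one ?a) = one (U (Tn (Fr I) x)) \<bullet> u (Fr I) x \<bullet> (\<eta> I \<otimes> one ?a)"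
      by (simp add: assoc wl inv2)
  qed simp_all
  with w wl ww w' actp that show ?thesis by auto
qed

end

section \<open>Coherence for the tensor product of algebras\<close>

locale monoidal_algebra_tensor = algebra_tensor +
  fixes I and asc and asc' and lun and lun' and run and run'
  assumes obj_I [simp]: "obj I"
    and arr_asc [simp]: "obj a \<Longrightarrow> obj b \<Longrightarrow> obj c \<Longrightarrow> arr (asc a b c)"
    and dom_asc [simp]: "dom (asc a b c) = a \<boxtimes> b \<boxtimes> c" and cod_asc [simp]: "cod (asc a b c) = (a \<boxtimes> b) \<boxtimes> c"
    and arr_asc' [simp]: "obj a \<Longrightarrow> obj b \<Longrightarrow> obj c \<Longrightarrow> arr (asc' a b c)"
    and cod_asc' [simp]: "cod (asc' a b c) = a \<boxtimes> b \<boxtimes> c" and dom_asc' [simp]: "dom (asc' a b c) = (a \<boxtimes> b) \<boxtimes> c"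
    and asc_asc': "obj a \<Longrightarrow> obj b \<Longrightarrow> obj c \<Longrightarrow> asc a b c \<bullet> asc' a b c = one ((a \<boxtimes> b) \<boxtimes> c)"
    and asc'_asc: "obj a \<Longrightarrow> obj b \<Longrightarrow> obj c \<Longrightarrow> asc' a b c \<bullet> asc a b c = one (a \<boxtimes> b \<boxtimes> c)"
    and asc_nat: "arr f \<Longrightarrow> arr g \<Longrightarrow> arr h \<Longrightarrow>
      asc (cod f) (cod g) (cod h) \<bullet> (f \<otimes> g \<otimes> h) = ((f \<otimes> g) \<otimes> h) \<bullet> asc (dom f) (dom g) (dom h)"
    and pentagon: "obj a \<Longrightarrow> obj b \<Longrightarrow> obj c \<Longrightarrow> obj d \<Longrightarrow>
      asc (a \<boxtimes> b) c d \<bullet> asc a b (c \<boxtimes> d) =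
      (asc a b c \<otimes> one d) \<bullet> asc a (b \<boxtimes> c) d \<bullet> (one a \<otimes> asc b c d)"
    and phi_asc: "obj a \<Longrightarrow> obj b \<Longrightarrow> obj c \<Longrightarrow>
      R (asc a b c) \<bullet> \<phi> a (b \<boxtimes> c) \<bullet> (one (R0 a) \<otimes> \<phi> b c) =
      \<phi> (a \<boxtimes> b) c \<bullet> (\<phi> a b \<otimes> one (R0 c)) \<bullet> asc (R0 a) (R0 b) (R0 c)"
    and arr_lun [simp]: "obj a \<Longrightarrow> arr (lun a)" and dom_lun [simp]: "dom (lun a) = I \<boxtimes> a" and cod_lun [simp]: "cod (lun a) = a"
    and arr_lun' [simp]: "obj a \<Longrightarrow> arr (lun' a)" and cod_lun' [simp]: "cod (lun' a) = I \<boxtimes> a" and dom_lun' [simp]: "dom (lun' a) = a"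
    and lun_lun': "obj a \<Longrightarrow> lun a \<bullet> lun' a = one a" and lun'_lun: "obj a \<Longrightarrow> lun' a \<bullet> lun a = one (I \<boxtimes> a)"
    and lun_nat: "arr f \<Longrightarrow> lun (cod f) \<bullet> (one I \<otimes> f) = f \<bullet> lun (dom f)"
    and R_lun: "obj a \<Longrightarrow> R (lun a) \<bullet> \<phi> I a \<bullet> (\<eta> I \<otimes> one (R0 a)) = lun (R0 a)"
    and arr_run [simp]: "obj a \<Longrightarrow> arr (run a)" and dom_run [simp]: "dom (run a) = a \<boxtimes> I" and cod_run [simp]: "cod (run a) = a"
    and arr_run' [simp]: "obj a \<Longrightarrow> arr (run' a)" and cod_run' [simp]: "cod (run' a) = a \<boxtimes> I" and dom_run' [simp]: "dom (run' a) = a"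
    and run_run': "obj a \<Longrightarrow> run a \<bullet> run' a = one a" and run'_run: "obj a \<Longrightarrow> run' a \<bullet> run a = one (a \<boxtimes> I)"
    and run_nat: "arr f \<Longrightarrow> run (cod f) \<bullet> (f \<otimes> one I) = f \<bullet> run (dom f)"
    and R_run: "obj a \<Longrightarrow> R (run a) \<bullet> \<phi> a I \<bullet> (one (R0 a) \<otimes> \<eta> I) = run (R0 a)"
    and triangle: "obj a \<Longrightarrow> obj b \<Longrightarrow> (run a \<otimes> one b) \<bullet> asc a I b = one a \<otimes> lun b"
begin

lemma left_unit:
  assumes "Alg x"
  obtains w w' where "amap (Tn (Fr I) x) x w" "amap x (Tn (Fr I) x) w'"
    "w \<bullet> w' = one (U x)" "w' \<bullet> w = one (U (Tn (Fr I) x))"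
    "w \<bullet> u (Fr I) x \<bullet> (\<eta> I \<otimes> one (U x)) = lun (U x)"
    "w \<bullet> q (Fr I) x = act x \<bullet> \<mu> (U x) \<bullet> R (R (lun (U x))) \<bullet> R (\<phi> I (U x)) \<bullet> R (one (R0 I) \<otimes> \<eta> (U x))"
  using unit_ext[of I x lun lun'] assms that by (auto simp: lun_lun' lun'_lun lun_nat R_lun)

lemma right_unit:
  assumes "Alg x"
  obtains w w' where "amap (Tn x (Fr I)) x w" "amap x (Tn x (Fr I)) w'"
    "w \<bullet> w' = one (U x)" "w' \<bullet> w = one (U (Tn x (Fr I)))"
    "w \<bullet> u x (Fr I) \<bullet> (one (U x) \<otimes> \<eta> I) = run (U x)"
    "w \<bullet> q x (Fr I) = act x \<bullet> \<mu> (U x) \<bullet> R (R (run (U x))) \<bullet> R (\<phi> (U x) I) \<bullet> R (\<eta> (U x) \<otimes> one (R0 I))"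
proof -
  interpret flip: algebra_tensor obj arr dom cod one comp "\<lambda>a b. b \<boxtimes> a" "\<lambda>f g. g \<otimes> f" R0 R "\<lambda>a b. \<phi> b a" \<eta> \<mu>
    Alg U act Fr "\<lambda>x y. Tn y x" "\<lambda>x y. q y x"
    by (rule flipped_algebra)
  have flip_u: "flip.u = (\<lambda>x y. u y x)"
    by (intro HOL.ext) (simp add: flip.u_def u_def)
  obtain w w' where "amap (Tn x (Fr I)) x w" "amap x (Tn x (Fr I)) w'"
    "w \<bullet> w' = one (U x)" "w' \<bullet> w = one (U (Tn x (Fr I)))"
    "w \<bullet> flip.u (Fr I) x \<bullet> (one (U x) \<otimes> \<eta> I) = run (U x)"
    "w \<bullet> q x (Fr I) = act x \<bullet> \<mu> (U x) \<bullet> R (R (run (U x))) \<bullet> R (\<phi> (U x) I) \<bullet> R (\<eta> (U x) \<otimes> one (R0 I))"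
    by (rule flip.unit_ext[of I x run run', OF obj_I assms arr_run dom_run cod_run arr_run' cod_run' dom_run'
        run_run' run'_run run_nat R_run])
  then show ?thesis unfolding flip_u by (rule that)
qed

definition u_left where "u_left x y z = u x (Tn y z) \<bullet> (one (U x) \<otimes> u y z)"
definition u_right where "u_right x y z = u (Tn x y) z \<bullet> (u x y \<otimes> one (U z))"

context
  fixes x y z
  assumes alg [simp]: "Alg x" "Alg y" "Alg z"
begin

lemma u_left_arr [simp]: "arr (u_left x y z)" "dom (u_left x y z) = U x \<boxtimes> U y \<boxtimes> U z"
    "cod (u_left x y z) = U (Tn x (Tn y z))"
  and u_right_arr [simp]: "arr (u_right x y z)" "dom (u_right x y z) = (U x \<boxtimes> U y) \<boxtimes> U z"
    "cod (u_right x y z) = U (Tn (Tn x y) z)"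
  by (simp_all add: u_left_def u_right_def)

lemma dense_u_left: "dense (Tn x (Tn y z)) (u_left x y z)"
  unfolding u_left_def by (intro dense_tensor dense_one dense_u) simp_all

lemma dense_u_right: "dense (Tn (Tn x y) z) (u_right x y z)"
  unfolding u_right_def by (intro dense_tensor dense_one dense_u) simp_all

lemma u_left_trimor: "act (Tn x (Tn y z)) \<bullet> R (u_left x y z) \<bullet> \<phi> (U x) (U y \<boxtimes> U z) \<bullet> (one (R0 (U x)) \<otimes> \<phi> (U y) (U z))
  = u_left x y z \<bullet> (act x \<otimes> act y \<otimes> act z)"
proof -
  let ?a = "U x" let ?b = "U y" let ?c = "U z" let ?d = "U (Tn y z)"
  have "act (Tn x (Tn y z)) \<bullet> R (u_left x y z) \<bullet> \<phi> ?a (?b \<boxtimes> ?c) \<bullet> (one (R0 ?a) \<otimes> \<phi> ?b ?c)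
    = act (Tn x (Tn y z)) \<bullet> R (u x (Tn y z)) \<bullet> (R (one ?a \<otimes> u y z) \<bullet> \<phi> ?a (?b \<boxtimes> ?c)) \<bullet> (one (R0 ?a) \<otimes> \<phi> ?b ?c)"
    by (simp add: u_left_def R_comp assoc)
  also have "R (one ?a \<otimes> u y z) \<bullet> \<phi> ?a (?b \<boxtimes> ?c) = \<phi> ?a ?d \<bullet> (one (R0 ?a) \<otimes> R (u y z))"
    using phi_nat[of "one ?a" "u y z"] by simp
  also have "act (Tn x (Tn y z)) \<bullet> R (u x (Tn y z)) \<bullet> (\<phi> ?a ?d \<bullet> (one (R0 ?a) \<otimes> R (u y z))) \<bullet> (one (R0 ?a) \<otimes> \<phi> ?b ?c)
    = (act (Tn x (Tn y z)) \<bullet> R (u x (Tn y z)) \<bullet> \<phi> ?a ?d) \<bullet> (one (R0 ?a) \<otimes> (R (u y z) \<bullet> \<phi> ?b ?c))"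
    by (simp add: assoc tar_comp)
  also have "\<dots> = u x (Tn y z) \<bullet> (act x \<otimes> (act (Tn y z) \<bullet> R (u y z) \<bullet> \<phi> ?b ?c))"
    by (subst u_bimor) (simp_all add: assoc tar_comp)
  also have "\<dots> = u_left x y z \<bullet> (act x \<otimes> act y \<otimes> act z)"
    by (simp add: u_bimor u_left_def assoc tar_comp)
  finally show ?thesis .
qed

lemma u_right_trimor: "act (Tn (Tn x y) z) \<bullet> R (u_right x y z) \<bullet> \<phi> (U x \<boxtimes> U y) (U z) \<bullet> (\<phi> (U x) (U y) \<otimes> one (R0 (U z)))
  = u_right x y z \<bullet> ((act x \<otimes> act y) \<otimes> act z)"
proof -
  let ?a = "U x" let ?b = "U y" let ?c = "U z" let ?d = "U (Tn x y)" let ?t = "act (Tn (Tn x y) z)"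
  have "?t \<bullet> R (u_right x y z) \<bullet> \<phi> (?a \<boxtimes> ?b) ?c \<bullet> (\<phi> ?a ?b \<otimes> one (R0 ?c))
    = ?t \<bullet> R (u (Tn x y) z) \<bullet> (R (u x y \<otimes> one ?c) \<bullet> \<phi> (?a \<boxtimes> ?b) ?c) \<bullet> (\<phi> ?a ?b \<otimes> one (R0 ?c))"
    by (simp add: u_right_def R_comp assoc)
  also have "R (u x y \<otimes> one ?c) \<bullet> \<phi> (?a \<boxtimes> ?b) ?c = \<phi> ?d ?c \<bullet> (R (u x y) \<otimes> one (R0 ?c))"
    using phi_nat[of "u x y" "one ?c"] by simp
  also have "?t \<bullet> R (u (Tn x y) z) \<bullet> (\<phi> ?d ?c \<bullet> (R (u x y) \<otimes> one (R0 ?c))) \<bullet> (\<phi> ?a ?b \<otimes> one (R0 ?c))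
    = (?t \<bullet> R (u (Tn x y) z) \<bullet> \<phi> ?d ?c) \<bullet> ((R (u x y) \<bullet> \<phi> ?a ?b) \<otimes> one (R0 ?c))"
    by (simp add: assoc tar_comp)
  also have "\<dots> = u (Tn x y) z \<bullet> ((act (Tn x y) \<bullet> R (u x y) \<bullet> \<phi> ?a ?b) \<otimes> act z)"
    by (subst u_bimor) (simp_all add: assoc tar_comp)
  also have "\<dots> = u_right x y z \<bullet> ((act x \<otimes> act y) \<otimes> act z)"
    by (simp add: u_bimor u_right_def assoc tar_comp)
  finally show ?thesis .
qed

text \<open>The universal trilinear maps for the two bracketings correspond to each other under the
  associator of the base. So each of them, composed with the associator or its inverse, extends
  along the other one. The two extensions are mutually
  inverse because \<open>u_left\<close> and \<open>u_right\<close> are dense.\<close>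

lemma associator:
  obtains w w' where "amap (Tn x (Tn y z)) (Tn (Tn x y) z) w" "amap (Tn (Tn x y) z) (Tn x (Tn y z)) w'"
    "w \<bullet> w' = one (U (Tn (Tn x y) z))" "w' \<bullet> w = one (U (Tn x (Tn y z)))"
    "w \<bullet> u_left x y z = u_right x y z \<bullet> asc (U x) (U y) (U z)"
proof -
  let ?a = "U x" let ?b = "U y" let ?c = "U z"
  let ?l = "Tn x (Tn y z)" let ?r = "Tn (Tn x y) z"
  let ?t = "u_right x y z \<bullet> asc ?a ?b ?c" let ?t' = "u_left x y z \<bullet> asc' ?a ?b ?c"
  have "act ?r \<bullet> R ?t \<bullet> \<phi> ?a (?b \<boxtimes> ?c) \<bullet> (one (R0 ?a) \<otimes> \<phi> ?b ?c)
     = act ?r \<bullet> R (u_right x y z) \<bullet> (R (asc ?a ?b ?c) \<bullet> \<phi> ?a (?b \<boxtimes> ?c) \<bullet> (one (R0 ?a) \<otimes> \<phi> ?b ?c))"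
    by (simp add: R_comp assoc)
  also have "\<dots> = (act ?r \<bullet> R (u_right x y z) \<bullet> \<phi> (?a \<boxtimes> ?b) ?c \<bullet> (\<phi> ?a ?b \<otimes> one (R0 ?c))) \<bullet> asc (R0 ?a) (R0 ?b) (R0 ?c)"
    by (simp add: phi_asc assoc)
  also have "\<dots> = ?t \<bullet> (act x \<otimes> act y \<otimes> act z)"
    unfolding u_right_trimor using asc_nat[of "act x" "act y" "act z"] by (simp add: assoc)
  finally have "act ?r \<bullet> R ?t \<bullet> \<phi> ?a (?b \<boxtimes> ?c) \<bullet> (one (R0 ?a) \<otimes> \<phi> ?b ?c) = ?t \<bullet> (act x \<otimes> act y \<otimes> act z)" .
  then obtain w where w: "amap ?l ?r w" "w \<bullet> u_left x y z = ?t"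
    using ext3[of x y z ?r ?t] unfolding u_left_def by auto
  have phi_asc': "R (asc' ?a ?b ?c) \<bullet> \<phi> (?a \<boxtimes> ?b) ?c \<bullet> (\<phi> ?a ?b \<otimes> one (R0 ?c)) =
     \<phi> ?a (?b \<boxtimes> ?c) \<bullet> (one (R0 ?a) \<otimes> \<phi> ?b ?c) \<bullet> asc' (R0 ?a) (R0 ?b) (R0 ?c)"
  proof -
    have "R (asc' ?a ?b ?c) \<bullet> \<phi> (?a \<boxtimes> ?b) ?c \<bullet> (\<phi> ?a ?b \<otimes> one (R0 ?c)) =
      R (asc' ?a ?b ?c) \<bullet> (\<phi> (?a \<boxtimes> ?b) ?c \<bullet> (\<phi> ?a ?b \<otimes> one (R0 ?c)) \<bullet> asc (R0 ?a) (R0 ?b) (R0 ?c)) \<bullet> asc' (R0 ?a) (R0 ?b) (R0 ?c)"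
      by (simp add: assoc asc_asc')
    also have "\<dots> = R (asc' ?a ?b ?c \<bullet> asc ?a ?b ?c) \<bullet> \<phi> ?a (?b \<boxtimes> ?c) \<bullet> (one (R0 ?a) \<otimes> \<phi> ?b ?c) \<bullet> asc' (R0 ?a) (R0 ?b) (R0 ?c)"
      by (simp add: phi_asc[symmetric] assoc R_comp)
    finally show ?thesis by (simp add: asc'_asc)
  qed
  have asc_nat': "asc' ?a ?b ?c \<bullet> ((act x \<otimes> act y) \<otimes> act z) = (act x \<otimes> act y \<otimes> act z) \<bullet> asc' (R0 ?a) (R0 ?b) (R0 ?c)"
  proof -
    have "asc' ?a ?b ?c \<bullet> ((act x \<otimes> act y) \<otimes> act z) =
       asc' ?a ?b ?c \<bullet> (((act x \<otimes> act y) \<otimes> act z) \<bullet> asc (R0 ?a) (R0 ?b) (R0 ?c)) \<bullet> asc' (R0 ?a) (R0 ?b) (R0 ?c)"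
      by (simp add: assoc asc_asc')
    also have "((act x \<otimes> act y) \<otimes> act z) \<bullet> asc (R0 ?a) (R0 ?b) (R0 ?c) = asc ?a ?b ?c \<bullet> (act x \<otimes> act y \<otimes> act z)"
      using asc_nat[of "act x" "act y" "act z"] by simp
    finally show ?thesis by (simp add: assoc reduce[OF asc'_asc])
  qed
  have "act ?l \<bullet> R ?t' \<bullet> \<phi> (?a \<boxtimes> ?b) ?c \<bullet> (\<phi> ?a ?b \<otimes> one (R0 ?c))
     = (act ?l \<bullet> R (u_left x y z) \<bullet> \<phi> ?a (?b \<boxtimes> ?c) \<bullet> (one (R0 ?a) \<otimes> \<phi> ?b ?c)) \<bullet> asc' (R0 ?a) (R0 ?b) (R0 ?c)"
    by (simp add: R_comp assoc phi_asc')
  also have "\<dots> = ?t' \<bullet> ((act x \<otimes> act y) \<otimes> act z)"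
    unfolding u_left_trimor by (simp add: assoc asc_nat')
  finally have "act ?l \<bullet> R ?t' \<bullet> \<phi> (?a \<boxtimes> ?b) ?c \<bullet> (\<phi> ?a ?b \<otimes> one (R0 ?c)) = ?t' \<bullet> ((act x \<otimes> act y) \<otimes> act z)" .
  then obtain w' where w': "amap ?r ?l w'" "w' \<bullet> u_right x y z = ?t'"
    using ext3_right[of x y z ?l ?t'] unfolding u_right_def by auto
  note [simp] = amapD(1-3)[OF w(1)] amapD(1-3)[OF w'(1)]
  have 1: "w \<bullet> w' = one (U ?r)"
  proof (rule dense_eq[OF _ dense_u_right])
    show "amap ?r ?r (w \<bullet> w')" using amap_comp[OF _ _ _ w'(1) w(1)] by simp
    show "amap ?r ?r (one (U ?r))" by (rule amap_one) simp
    show "(w \<bullet> w') \<bullet> u_right x y z = one (U ?r) \<bullet> u_right x y z"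
      by (simp add: assoc w'(2) reduce[OF w(2)] asc_asc')
  qed simp_all
  have 2: "w' \<bullet> w = one (U ?l)"
  proof (rule dense_eq[OF _ dense_u_left])
    show "amap ?l ?l (w' \<bullet> w)" using amap_comp[OF _ _ _ w(1) w'(1)] by simp
    show "amap ?l ?l (one (U ?l))" by (rule amap_one) simp
    show "(w' \<bullet> w) \<bullet> u_left x y z = one (U ?l) \<bullet> u_left x y z"
      by (simp add: assoc w(2) reduce[OF w'(2)] asc'_asc)
  qed simp_all
  show ?thesis using that[OF w(1) w'(1) 1 2 w(2)] .
qed

end

definition q_left where
  "q_left x y z = q x (Tn y z) \<bullet> R (one (U x) \<otimes> q y z) \<bullet> R (one (U x) \<otimes> \<eta> (U y \<boxtimes> U z))"
definition q_right where
  "q_right x y z = q (Tn x y) z \<bullet> R (q x y \<otimes> one (U z)) \<bullet> R (\<eta> (U x \<boxtimes> U y) \<otimes> one (U z))"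

lemma q_left_eq: "Alg x \<Longrightarrow> Alg y \<Longrightarrow> Alg z \<Longrightarrow> q_left x y z = act (Tn x (Tn y z)) \<bullet> R (u_left x y z)"
  by (simp add: q_left_def u_left_def R_comp reduce[OF act_R_u]) (simp add: u_def R_comp[symmetric] tar_comp)

lemma q_right_eq: "Alg x \<Longrightarrow> Alg y \<Longrightarrow> Alg z \<Longrightarrow> q_right x y z = act (Tn (Tn x y) z) \<bullet> R (u_right x y z)"
  by (simp add: q_right_def u_right_def R_comp reduce[OF act_R_u]) (simp add: u_def R_comp[symmetric] tar_comp)

lemma q_left_arr [simp]: "Alg x \<Longrightarrow> Alg y \<Longrightarrow> Alg z \<Longrightarrow> arr (q_left x y z)"
  "Alg x \<Longrightarrow> Alg y \<Longrightarrow> Alg z \<Longrightarrow> dom (q_left x y z) = R0 (U x \<boxtimes> U y \<boxtimes> U z)"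
  "Alg x \<Longrightarrow> Alg y \<Longrightarrow> Alg z \<Longrightarrow> cod (q_left x y z) = U (Tn x (Tn y z))"
  by (simp_all add: q_left_eq)

lemma epi_q_left: "Alg x \<Longrightarrow> Alg y \<Longrightarrow> Alg z \<Longrightarrow> epi (q_left x y z)"
  using dense_u_left[of x y z] by (simp add: q_left_eq dense_def stableD)

text \<open>The maps \<open>q_left\<close> and \<open>q_right\<close> are the extensions of \<open>u_left\<close> and \<open>u_right\<close> to free algebras, and
  algebra maps on a free algebra are compared on its generators.\<close>

lemma associator_q:
  assumes [simp]: "Alg x" "Alg y" "Alg z"
    and w: "amap (Tn x (Tn y z)) (Tn (Tn x y) z) w"
  shows "w \<bullet> q_left x y z = q_right x y z \<bullet> R (asc (U x) (U y) (U z)) \<longleftrightarrow>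
    w \<bullet> u_left x y z = u_right x y z \<bullet> asc (U x) (U y) (U z)"
proof
  note [simp] = amapD(1-3)[OF w]
  assume *: "w \<bullet> q_left x y z = q_right x y z \<bullet> R (asc (U x) (U y) (U z))"
  have "w \<bullet> u_left x y z = w \<bullet> q_left x y z \<bullet> \<eta> (U x \<boxtimes> U y \<boxtimes> U z)"
    using amap_free(2)[of "U x \<boxtimes> U y \<boxtimes> U z" "Tn x (Tn y z)" "u_left x y z"] by (simp add: q_left_eq)
  also have "\<dots> = (q_right x y z \<bullet> R (asc (U x) (U y) (U z))) \<bullet> \<eta> (U x \<boxtimes> U y \<boxtimes> U z)"
    unfolding *[symmetric] by (simp add: assoc)
  also have "\<dots> = (act (Tn (Tn x y) z) \<bullet> R (u_right x y z \<bullet> asc (U x) (U y) (U z))) \<bullet> \<eta> (U x \<boxtimes> U y \<boxtimes> U z)"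
    by (simp add: q_right_eq R_comp assoc)
  also have "\<dots> = u_right x y z \<bullet> asc (U x) (U y) (U z)" by (rule amap_free(2)) simp_all
  finally show "w \<bullet> u_left x y z = u_right x y z \<bullet> asc (U x) (U y) (U z)" .
next
  note [simp] = amapD(1-3)[OF w]
  assume *: "w \<bullet> u_left x y z = u_right x y z \<bullet> asc (U x) (U y) (U z)"
  have "w \<bullet> q_left x y z = act (Tn (Tn x y) z) \<bullet> R (w \<bullet> u_left x y z)"
    by (simp add: q_left_eq reduce[OF amapD(4)[OF w]] R_comp assoc)
  also have "\<dots> = q_right x y z \<bullet> R (asc (U x) (U y) (U z))"
    unfolding * by (simp add: q_right_eq R_comp assoc)
  finally show "w \<bullet> q_left x y z = q_right x y z \<bullet> R (asc (U x) (U y) (U z))" .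
qed

lemma left_unit_u:
  assumes [simp]: "Alg x" "arr w" "dom w = U (Tn (Fr I) x)" "cod w = U x"
    and w: "w \<bullet> q (Fr I) x = act x \<bullet> \<mu> (U x) \<bullet> R (R (lun (U x))) \<bullet> R (\<phi> I (U x)) \<bullet> R (one (R0 I) \<otimes> \<eta> (U x))"
  shows "w \<bullet> u (Fr I) x \<bullet> (\<eta> I \<otimes> one (U x)) = lun (U x)"
proof -
  obtain v where v: "amap (Tn (Fr I) x) x v" "v \<bullet> u (Fr I) x \<bullet> (\<eta> I \<otimes> one (U x)) = lun (U x)"
    "v \<bullet> q (Fr I) x = w \<bullet> q (Fr I) x"
    using left_unit[of x] by (auto simp: w)
  have "v = w" using v by (intro epiD[OF stableD(1)[OF q_stable] v(3)]) (auto simp: amap_def)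
  with v show ?thesis by simp
qed

lemma right_unit_u:
  assumes [simp]: "Alg x" "arr w" "dom w = U (Tn x (Fr I))" "cod w = U x"
    and w: "w \<bullet> q x (Fr I) = act x \<bullet> \<mu> (U x) \<bullet> R (R (run (U x))) \<bullet> R (\<phi> (U x) I) \<bullet> R (\<eta> (U x) \<otimes> one (R0 I))"
  shows "w \<bullet> u x (Fr I) \<bullet> (one (U x) \<otimes> \<eta> I) = run (U x)"
proof -
  obtain v where v: "amap (Tn x (Fr I)) x v" "v \<bullet> u x (Fr I) \<bullet> (one (U x) \<otimes> \<eta> I) = run (U x)"
    "v \<bullet> q x (Fr I) = w \<bullet> q x (Fr I)"
    using right_unit[of x] by (auto simp: w)
  have "v = w" using v by (intro epiD[OF stableD(1)[OF q_stable] v(3)]) (auto simp: amap_def)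
  with v show ?thesis by simp
qed

lemma amap_comp': "amap x y f \<Longrightarrow> amap y z g \<Longrightarrow> Alg x \<Longrightarrow> Alg y \<Longrightarrow> Alg z \<Longrightarrow> amap x z (g \<bullet> f)"
  by (rule amap_comp)

text \<open>Along the dense map \<open>u \<bullet> (one \<otimes> (u \<bullet> (one \<otimes> u)))\<close> both sides restrict to
  \<open>u \<bullet> ((u \<bullet> (u \<otimes> one)) \<otimes> one)\<close> composed with the two sides of the pentagon of the base.\<close>

lemma pentagon_lift:
  assumes alg [simp]: "Alg w" "Alg x" "Alg y" "Alg z"
    and a1: "amap (Tn (Tn w x) (Tn y z)) (Tn (Tn (Tn w x) y) z) A1"
      "A1 \<bullet> u_left (Tn w x) y z = u_right (Tn w x) y z \<bullet> asc (U (Tn w x)) (U y) (U z)"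
    and a2: "amap (Tn w (Tn x (Tn y z))) (Tn (Tn w x) (Tn y z)) A2"
      "A2 \<bullet> u_left w x (Tn y z) = u_right w x (Tn y z) \<bullet> asc (U w) (U x) (U (Tn y z))"
    and b: "amap (Tn w (Tn x y)) (Tn (Tn w x) y) B"
      "B \<bullet> u_left w x y = u_right w x y \<bullet> asc (U w) (U x) (U y)"
    and a3: "amap (Tn (Tn w (Tn x y)) z) (Tn (Tn (Tn w x) y) z) A3"
      "A3 \<bullet> u (Tn w (Tn x y)) z = u (Tn (Tn w x) y) z \<bullet> (B \<otimes> one (U z))"
    and a4: "amap (Tn w (Tn (Tn x y) z)) (Tn (Tn w (Tn x y)) z) A4"
      "A4 \<bullet> u_left w (Tn x y) z = u_right w (Tn x y) z \<bullet> asc (U w) (U (Tn x y)) (U z)"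
    and c: "amap (Tn x (Tn y z)) (Tn (Tn x y) z) C"
      "C \<bullet> u_left x y z = u_right x y z \<bullet> asc (U x) (U y) (U z)"
    and a5: "amap (Tn w (Tn x (Tn y z))) (Tn w (Tn (Tn x y) z)) A5"
      "A5 \<bullet> u w (Tn x (Tn y z)) = u w (Tn (Tn x y) z) \<bullet> (one (U w) \<otimes> C)"
  shows "A1 \<bullet> A2 = A3 \<bullet> A4 \<bullet> A5"
proof (rule dense_eq)
  let ?w = "U w" let ?x = "U x" let ?y = "U y" let ?z = "U z"
  note [simp] = amapD(1-3)[OF a1(1)] amapD(1-3)[OF a2(1)] amapD(1-3)[OF a3(1)] amapD(1-3)[OF a4(1)]
    amapD(1-3)[OF a5(1)] amapD(1-3)[OF b(1)] amapD(1-3)[OF c(1)]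
  let ?g = "u w (Tn x (Tn y z)) \<bullet> (one ?w \<otimes> u_left x y z)"
  show "dense (Tn w (Tn x (Tn y z))) ?g" by (intro dense_tensor dense_one dense_u_left) simp_all
  show "amap (Tn w (Tn x (Tn y z))) (Tn (Tn (Tn w x) y) z) (A1 \<bullet> A2)"
    using a2(1) a1(1) by (rule amap_comp') simp_all
  show "amap (Tn w (Tn x (Tn y z))) (Tn (Tn (Tn w x) y) z) (A3 \<bullet> A4 \<bullet> A5)"
    by (intro amap_comp'[OF _ a3(1)] amap_comp'[OF _ a4(1)] a5(1)) simp_all
  have n1: "asc ?w ?x (U (Tn y z)) \<bullet> (one ?w \<otimes> one ?x \<otimes> u y z) = (one (?w \<boxtimes> ?x) \<otimes> u y z) \<bullet> asc ?w ?x (?y \<boxtimes> ?z)"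
    using asc_nat[of "one ?w" "one ?x" "u y z"] by simp
  have n2: "asc (U (Tn w x)) ?y ?z \<bullet> (u w x \<otimes> one (?y \<boxtimes> ?z)) = ((u w x \<otimes> one ?y) \<otimes> one ?z) \<bullet> asc (?w \<boxtimes> ?x) ?y ?z"
    using asc_nat[of "u w x" "one ?y" "one ?z"] by simp
  have n3: "asc ?w (U (Tn x y)) ?z \<bullet> (one ?w \<otimes> u x y \<otimes> one ?z) = ((one ?w \<otimes> u x y) \<otimes> one ?z) \<bullet> asc ?w (?x \<boxtimes> ?y) ?z"
    using asc_nat[of "one ?w" "u x y" "one ?z"] by simp
  let ?u = "u (Tn (Tn w x) y) z \<bullet> ((u (Tn w x) y \<bullet> (u w x \<otimes> one ?y)) \<otimes> one ?z)"
  have "(A1 \<bullet> A2) \<bullet> ?g = A1 \<bullet> (A2 \<bullet> u_left w x (Tn y z)) \<bullet> (one ?w \<otimes> one ?x \<otimes> u y z)"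
    by (simp add: u_left_def assoc tar_comp del: one_tar)
  also have "\<dots> = A1 \<bullet> u_right w x (Tn y z) \<bullet> (asc ?w ?x (U (Tn y z)) \<bullet> (one ?w \<otimes> one ?x \<otimes> u y z))"
    unfolding a2 by (simp add: assoc)
  also have "\<dots> = A1 \<bullet> u (Tn w x) (Tn y z) \<bullet> (u w x \<otimes> u y z) \<bullet> asc ?w ?x (?y \<boxtimes> ?z)"
    unfolding n1 by (simp add: u_right_def assoc reduce[OF tar_comp])
  also have "\<dots> = (A1 \<bullet> u_left (Tn w x) y z) \<bullet> (u w x \<otimes> one (?y \<boxtimes> ?z)) \<bullet> asc ?w ?x (?y \<boxtimes> ?z)"
    by (simp add: u_left_def assoc reduce[OF tar_comp])
  also have "\<dots> = u_right (Tn w x) y z \<bullet> (asc (U (Tn w x)) ?y ?z \<bullet> (u w x \<otimes> one (?y \<boxtimes> ?z))) \<bullet> asc ?w ?x (?y \<boxtimes> ?z)"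
    unfolding a1 by (simp add: assoc)
  also have "\<dots> = ?u \<bullet> (asc (?w \<boxtimes> ?x) ?y ?z \<bullet> asc ?w ?x (?y \<boxtimes> ?z))"
    unfolding n2 by (simp add: u_right_def assoc reduce[OF tar_comp])
  also have "\<dots> = ?u \<bullet> (asc ?w ?x ?y \<otimes> one ?z) \<bullet> asc ?w (?x \<boxtimes> ?y) ?z \<bullet> (one ?w \<otimes> asc ?x ?y ?z)"
    by (simp add: pentagon)
  finally have l: "(A1 \<bullet> A2) \<bullet> ?g = \<dots>" .
  have "(A3 \<bullet> A4 \<bullet> A5) \<bullet> ?g = A3 \<bullet> A4 \<bullet> (A5 \<bullet> u w (Tn x (Tn y z))) \<bullet> (one ?w \<otimes> u_left x y z)"
    by (simp add: assoc)
  also have "\<dots> = A3 \<bullet> A4 \<bullet> u w (Tn (Tn x y) z) \<bullet> (one ?w \<otimes> (C \<bullet> u_left x y z))"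
    unfolding a5 by (simp add: assoc tar_comp)
  also have "\<dots> = A3 \<bullet> (A4 \<bullet> u_left w (Tn x y) z) \<bullet> (one ?w \<otimes> u x y \<otimes> one ?z) \<bullet> (one ?w \<otimes> asc ?x ?y ?z)"
    unfolding c by (simp add: u_left_def u_right_def assoc tar_comp)
  also have "\<dots> = A3 \<bullet> u_right w (Tn x y) z \<bullet> (asc ?w (U (Tn x y)) ?z \<bullet> (one ?w \<otimes> u x y \<otimes> one ?z)) \<bullet> (one ?w \<otimes> asc ?x ?y ?z)"
    unfolding a4 by (simp add: assoc)
  also have "\<dots> = (A3 \<bullet> u (Tn w (Tn x y)) z) \<bullet> (u_left w x y \<otimes> one ?z) \<bullet> asc ?w (?x \<boxtimes> ?y) ?z \<bullet> (one ?w \<otimes> asc ?x ?y ?z)"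
    unfolding n3 by (simp add: u_left_def u_right_def assoc reduce[OF tar_comp])
  also have "\<dots> = u (Tn (Tn w x) y) z \<bullet> ((B \<bullet> u_left w x y) \<otimes> one ?z) \<bullet> asc ?w (?x \<boxtimes> ?y) ?z \<bullet> (one ?w \<otimes> asc ?x ?y ?z)"
    unfolding a3 by (simp add: assoc reduce[OF tar_comp])
  also have "\<dots> = ?u \<bullet> (asc ?w ?x ?y \<otimes> one ?z) \<bullet> asc ?w (?x \<boxtimes> ?y) ?z \<bullet> (one ?w \<otimes> asc ?x ?y ?z)"
    unfolding b by (simp add: u_right_def assoc reduce[OF tar_comp])
  finally show "(A1 \<bullet> A2) \<bullet> ?g = (A3 \<bullet> A4 \<bullet> A5) \<bullet> ?g" using l by simp
qed simp_all

text \<open>Tested on \<open>u \<bullet> (one \<otimes> (u \<bullet> (\<eta> I \<otimes> one)))\<close>, which is dense since \<open>\<eta> I\<close> generates the unit algebra.\<close>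

lemma triangle_lift:
  assumes alg [simp]: "Alg x" "Alg y"
    and a: "amap (Tn x (Tn (Fr I) y)) (Tn (Tn x (Fr I)) y) A"
      "A \<bullet> u_left x (Fr I) y = u_right x (Fr I) y \<bullet> asc (U x) (U (Fr I)) (U y)"
    and l: "amap (Tn (Fr I) y) y L" "L \<bullet> u (Fr I) y \<bullet> (\<eta> I \<otimes> one (U y)) = lun (U y)"
    and r: "amap (Tn x (Fr I)) x S" "S \<bullet> u x (Fr I) \<bullet> (one (U x) \<otimes> \<eta> I) = run (U x)"
    and m: "amap (Tn (Tn x (Fr I)) y) (Tn x y) M" "M \<bullet> u (Tn x (Fr I)) y = u x y \<bullet> (S \<otimes> one (U y))"
    and n: "amap (Tn x (Tn (Fr I) y)) (Tn x y) N" "N \<bullet> u x (Tn (Fr I) y) = u x y \<bullet> (one (U x) \<otimes> L)"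
  shows "M \<bullet> A = N"
proof (rule dense_eq)
  note [simp] = amapD(1-3)[OF a(1)] amapD(1-3)[OF l(1)] amapD(1-3)[OF r(1)] amapD(1-3)[OF m(1)] amapD(1-3)[OF n(1)]
  let ?g = "u x (Tn (Fr I) y) \<bullet> (one (U x) \<otimes> (u (Fr I) y \<bullet> (\<eta> I \<otimes> one (U y))))"
  show "dense (Tn x (Tn (Fr I) y)) ?g" by (intro dense_tensor dense_one dense_eta) simp_all
  show "amap (Tn x (Tn (Fr I) y)) (Tn x y) (M \<bullet> A)" using a(1) m(1) by (rule amap_comp') simp_all
  show "amap (Tn x (Tn (Fr I) y)) (Tn x y) N" by (rule n)
  have nat: "asc (U x) (R0 I) (U y) \<bullet> (one (U x) \<otimes> \<eta> I \<otimes> one (U y)) = ((one (U x) \<otimes> \<eta> I) \<otimes> one (U y)) \<bullet> asc (U x) I (U y)"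
    using asc_nat[of "one (U x)" "\<eta> I" "one (U y)"] by simp
  have "(M \<bullet> A) \<bullet> ?g = M \<bullet> (A \<bullet> u_left x (Fr I) y) \<bullet> (one (U x) \<otimes> \<eta> I \<otimes> one (U y))"
    by (simp add: u_left_def assoc tar_comp)
  also have "\<dots> = M \<bullet> u_right x (Fr I) y \<bullet> (asc (U x) (R0 I) (U y) \<bullet> (one (U x) \<otimes> \<eta> I \<otimes> one (U y)))"
    unfolding a by (simp add: assoc)
  also have "\<dots> = (M \<bullet> u (Tn x (Fr I)) y) \<bullet> ((u x (Fr I) \<bullet> (one (U x) \<otimes> \<eta> I)) \<otimes> one (U y)) \<bullet> asc (U x) I (U y)"
    unfolding nat by (simp add: u_right_def assoc reduce[OF tar_comp])
  also have "\<dots> = u x y \<bullet> ((run (U x) \<otimes> one (U y)) \<bullet> asc (U x) I (U y))"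
    unfolding m by (simp add: assoc reduce[OF tar_comp] r)
  also have "\<dots> = u x y \<bullet> (one (U x) \<otimes> (L \<bullet> u (Fr I) y \<bullet> (\<eta> I \<otimes> one (U y))))" by (simp add: triangle l)
  also have "\<dots> = (N \<bullet> u x (Tn (Fr I) y)) \<bullet> (one (U x) \<otimes> (u (Fr I) y \<bullet> (\<eta> I \<otimes> one (U y))))"
    unfolding n by (simp add: assoc tar_comp)
  also have "\<dots> = N \<bullet> ?g" by (simp add: assoc)
  finally show "(M \<bullet> A) \<bullet> ?g = N \<bullet> ?g" .
qed simp_all

text \<open>The associativity axiom for a lax monoidal functor with values in algebras follows from the
  one for its composite with the forgetful functor. Here \<open>g1\<close>, \<open>g2\<close>, \<open>h1\<close> and \<open>h2\<close> are components of
  the structure map, and \<open>s\<close> is the image of an associator; the unit axioms are treated likewise.\<close>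

lemma lax_assoc_lift:
  assumes alg [simp]: "Alg x" "Alg y" "Alg z" "Alg p" "Alg r" "Alg k" "Alg k'"
    and g1: "amap (Tn y z) p g1" and g2: "amap (Tn x p) k g2" and s: "amap k k' s"
    and h1: "amap (Tn x y) r h1" and h2: "amap (Tn r z) k' h2"
    and t1: "amap (Tn x (Tn y z)) (Tn x p) t1" "t1 \<bullet> u x (Tn y z) = u x p \<bullet> (one (U x) \<otimes> g1)"
    and t2: "amap (Tn (Tn x y) z) (Tn r z) t2" "t2 \<bullet> u (Tn x y) z = u r z \<bullet> (h1 \<otimes> one (U z))"
    and a: "amap (Tn x (Tn y z)) (Tn (Tn x y) z) A"
      "A \<bullet> u_left x y z = u_right x y z \<bullet> asc (U x) (U y) (U z)"
    and eq: "s \<bullet> (g2 \<bullet> u x p) \<bullet> (one (U x) \<otimes> (g1 \<bullet> u y z)) =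
      (h2 \<bullet> u r z) \<bullet> ((h1 \<bullet> u x y) \<otimes> one (U z)) \<bullet> asc (U x) (U y) (U z)"
  shows "s \<bullet> g2 \<bullet> t1 = h2 \<bullet> t2 \<bullet> A"
proof (rule dense_eq[OF _ dense_u_left])
  note [simp] = amapD(1-3)[OF a(1)] amapD(1-3)[OF g1] amapD(1-3)[OF g2] amapD(1-3)[OF h1] amapD(1-3)[OF h2]
    amapD(1-3)[OF t1(1)] amapD(1-3)[OF t2(1)] amapD(1-3)[OF s]
  show "amap (Tn x (Tn y z)) k' (s \<bullet> g2 \<bullet> t1)" by (intro amap_comp'[OF _ s] amap_comp'[OF _ g2] t1(1)) simp_all
  show "amap (Tn x (Tn y z)) k' (h2 \<bullet> t2 \<bullet> A)" by (intro amap_comp'[OF _ h2] amap_comp'[OF _ t2(1)] a(1)) simp_all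
  have "(s \<bullet> g2 \<bullet> t1) \<bullet> u_left x y z = s \<bullet> g2 \<bullet> (t1 \<bullet> u x (Tn y z)) \<bullet> (one (U x) \<otimes> u y z)"
    by (simp add: u_left_def assoc)
  also have "\<dots> = s \<bullet> (g2 \<bullet> u x p) \<bullet> (one (U x) \<otimes> (g1 \<bullet> u y z))"
    unfolding t1 by (simp add: assoc tar_comp)
  also have "\<dots> = h2 \<bullet> (u r z \<bullet> (h1 \<otimes> one (U z))) \<bullet> (u x y \<otimes> one (U z)) \<bullet> asc (U x) (U y) (U z)"
    unfolding eq by (simp add: assoc reduce[OF tar_comp])
  also have "\<dots> = h2 \<bullet> t2 \<bullet> (u_right x y z \<bullet> asc (U x) (U y) (U z))"
    unfolding t2(2)[symmetric] by (simp add: u_right_def assoc)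
  also have "\<dots> = (h2 \<bullet> t2 \<bullet> A) \<bullet> u_left x y z"
    unfolding a(2)[symmetric] by (simp add: assoc)
  finally show "(s \<bullet> g2 \<bullet> t1) \<bullet> u_left x y z = (h2 \<bullet> t2 \<bullet> A) \<bullet> u_left x y z" .
qed simp_all

lemma lax_left_unit_lift:
  assumes alg [simp]: "Alg x" "Alg e" "Alg k"
    and g: "amap (Tn e x) k g" and s: "amap k x s"
    and e0: "amap (Fr I) e e0" and t: "amap (Tn (Fr I) x) (Tn e x) t" "t \<bullet> u (Fr I) x = u e x \<bullet> (e0 \<otimes> one (U x))"
    and l: "amap (Tn (Fr I) x) x L" "L \<bullet> u (Fr I) x \<bullet> (\<eta> I \<otimes> one (U x)) = lun (U x)"
    and eq: "s \<bullet> (g \<bullet> u e x) \<bullet> ((e0 \<bullet> \<eta> I) \<otimes> one (U x)) = lun (U x)"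
  shows "s \<bullet> g \<bullet> t = L"
proof (rule dense_eq)
  note [simp] = amapD(1-3)[OF g] amapD(1-3)[OF s] amapD(1-3)[OF e0] amapD(1-3)[OF t(1)] amapD(1-3)[OF l(1)]
  show "dense (Tn (Fr I) x) (u (Fr I) x \<bullet> (\<eta> I \<otimes> one (U x)))" by (intro dense_tensor dense_one dense_eta) simp_all
  show "amap (Tn (Fr I) x) x (s \<bullet> g \<bullet> t)" by (intro amap_comp'[OF _ s] amap_comp'[OF _ g] t(1)) simp_all
  show "amap (Tn (Fr I) x) x L" by (rule l)
  have "(s \<bullet> g \<bullet> t) \<bullet> u (Fr I) x \<bullet> (\<eta> I \<otimes> one (U x)) = s \<bullet> g \<bullet> (t \<bullet> u (Fr I) x) \<bullet> (\<eta> I \<otimes> one (U x))"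
    by (simp add: assoc)
  also have "\<dots> = s \<bullet> (g \<bullet> u e x) \<bullet> ((e0 \<bullet> \<eta> I) \<otimes> one (U x))"
    unfolding t by (simp add: assoc tar_comp)
  finally show "(s \<bullet> g \<bullet> t) \<bullet> u (Fr I) x \<bullet> (\<eta> I \<otimes> one (U x)) = L \<bullet> u (Fr I) x \<bullet> (\<eta> I \<otimes> one (U x))"
    unfolding eq l .
qed simp_all

lemma lax_right_unit_lift:
  assumes alg [simp]: "Alg x" "Alg e" "Alg k"
    and g: "amap (Tn x e) k g" and s: "amap k x s"
    and e0: "amap (Fr I) e e0" and t: "amap (Tn x (Fr I)) (Tn x e) t" "t \<bullet> u x (Fr I) = u x e \<bullet> (one (U x) \<otimes> e0)"
    and l: "amap (Tn x (Fr I)) x L" "L \<bullet> u x (Fr I) \<bullet> (one (U x) \<otimes> \<eta> I) = run (U x)"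
    and eq: "s \<bullet> (g \<bullet> u x e) \<bullet> (one (U x) \<otimes> (e0 \<bullet> \<eta> I)) = run (U x)"
  shows "s \<bullet> g \<bullet> t = L"
proof (rule dense_eq)
  note [simp] = amapD(1-3)[OF g] amapD(1-3)[OF s] amapD(1-3)[OF e0] amapD(1-3)[OF t(1)] amapD(1-3)[OF l(1)]
  show "dense (Tn x (Fr I)) (u x (Fr I) \<bullet> (one (U x) \<otimes> \<eta> I))" by (intro dense_tensor dense_one dense_eta) simp_all
  show "amap (Tn x (Fr I)) x (s \<bullet> g \<bullet> t)" by (intro amap_comp'[OF _ s] amap_comp'[OF _ g] t(1)) simp_all
  show "amap (Tn x (Fr I)) x L" by (rule l)
  have "(s \<bullet> g \<bullet> t) \<bullet> u x (Fr I) \<bullet> (one (U x) \<otimes> \<eta> I) = s \<bullet> g \<bullet> (t \<bullet> u x (Fr I)) \<bullet> (one (U x) \<otimes> \<eta> I)"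
    by (simp add: assoc)
  also have "\<dots> = s \<bullet> (g \<bullet> u x e) \<bullet> (one (U x) \<otimes> (e0 \<bullet> \<eta> I))"
    unfolding t by (simp add: assoc tar_comp)
  finally show "(s \<bullet> g \<bullet> t) \<bullet> u x (Fr I) \<bullet> (one (U x) \<otimes> \<eta> I) = L \<bullet> u x (Fr I) \<bullet> (one (U x) \<otimes> \<eta> I)"
    unfolding eq l .
qed simp_all

end

section \<open>Calculus of cells in a 2-category with finite products\<close>

context two_category
begin

lemmas cell_defs = one_cell_def two_cell_def

lemma Id1_mem [simp]: "X \<in> Zero K \<Longrightarrow> Id1 K X \<in> One K" "X \<in> Zero K \<Longrightarrow> Src K (Id1 K X) = X"
  "X \<in> Zero K \<Longrightarrow> Trg K (Id1 K X) = X"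
  using id1_cell by (auto simp: cell_defs)

lemma boundary_mem [simp]: "f \<in> One K \<Longrightarrow> Src K f \<in> Zero K" "f \<in> One K \<Longrightarrow> Trg K f \<in> Zero K"
  "s \<in> Two K \<Longrightarrow> Dom K s \<in> One K" "s \<in> Two K \<Longrightarrow> Cod K s \<in> One K"
  "s \<in> Two K \<Longrightarrow> Src K (Cod K s) = Src K (Dom K s)" "s \<in> Two K \<Longrightarrow> Trg K (Cod K s) = Trg K (Dom K s)"
  using src_zero trg_zero dom_one cod_one src_cod trg_cod by auto

lemma comp1_mem [simp]:
  assumes "f \<in> One K" "g \<in> One K" "Src K g = Trg K f"
  shows "g \<odot> f \<in> One K" "Src K (g \<odot> f) = Src K f" "Trg K (g \<odot> f) = Trg K g"
  using comp1_cell[of f "Src K f" "Trg K f" g "Trg K g"] assms by (auto simp: cell_defs)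

lemma comp1_Id1 [simp]: "f \<in> One K \<Longrightarrow> Trg K f = Y \<Longrightarrow> Id1 K Y \<odot> f = f"
  "f \<in> One K \<Longrightarrow> Src K f = X \<Longrightarrow> f \<odot> Id1 K X = f"
  using comp1_id_left[of f "Src K f" Y] comp1_id_right[of f X "Trg K f"] by (auto simp: cell_defs)

lemma comp1_assoc' [simp]:
  "f \<in> One K \<Longrightarrow> g \<in> One K \<Longrightarrow> h \<in> One K \<Longrightarrow> Src K g = Trg K f \<Longrightarrow> Src K h = Trg K g
    \<Longrightarrow> (h \<odot> g) \<odot> f = h \<odot> g \<odot> f"
  using comp1_assoc[of f "Src K f" "Trg K f" g "Trg K g" h "Trg K h"] by (auto simp: cell_defs)

lemma Id2_mem [simp]: "f \<in> One K \<Longrightarrow> Id2 K f \<in> Two K" "f \<in> One K \<Longrightarrow> Dom K (Id2 K f) = f"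
  "f \<in> One K \<Longrightarrow> Cod K (Id2 K f) = f"
  using id2_cell by (auto simp: cell_defs)

lemma vcomp_mem [simp]:
  assumes "s \<in> Two K" "t \<in> Two K" "Dom K t = Cod K s"
  shows "t \<cdot> s \<in> Two K" "Dom K (t \<cdot> s) = Dom K s" "Cod K (t \<cdot> s) = Cod K t"
  using vcomp_cell[of s "Dom K s" "Cod K s" t "Cod K t"] assms by (auto simp: cell_defs)

lemma vcomp_Id2 [simp]: "s \<in> Two K \<Longrightarrow> Cod K s = g \<Longrightarrow> Id2 K g \<cdot> s = s"
  "s \<in> Two K \<Longrightarrow> Dom K s = f \<Longrightarrow> s \<cdot> Id2 K f = s"
  using vcomp_id_left[of s "Dom K s" g] vcomp_id_right[of s f "Cod K s"] by (auto simp: cell_defs)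

lemma vcomp_assoc' [simp]:
  "r \<in> Two K \<Longrightarrow> s \<in> Two K \<Longrightarrow> t \<in> Two K \<Longrightarrow> Dom K s = Cod K r \<Longrightarrow> Dom K t = Cod K s
    \<Longrightarrow> (t \<cdot> s) \<cdot> r = t \<cdot> s \<cdot> r"
  using vcomp_assoc[of r "Dom K r" "Cod K r" s "Cod K s" t "Cod K t"] by (auto simp: cell_defs)

lemma hcomp_mem [simp]:
  assumes "s \<in> Two K" "t \<in> Two K" "Src K (Dom K t) = Trg K (Dom K s)"
  shows "t \<star> s \<in> Two K" "Dom K (t \<star> s) = Dom K t \<odot> Dom K s" "Cod K (t \<star> s) = Cod K t \<odot> Cod K s"
  using hcomp_cell[of s "Dom K s" "Cod K s" t "Dom K t" "Cod K t"] assms by (auto simp: cell_defs)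

lemma hcomp_assoc':
  "r \<in> Two K \<Longrightarrow> s \<in> Two K \<Longrightarrow> t \<in> Two K \<Longrightarrow> Src K (Dom K s) = Trg K (Dom K r) \<Longrightarrow>
    Src K (Dom K t) = Trg K (Dom K s) \<Longrightarrow> (t \<star> s) \<star> r = t \<star> s \<star> r"
  using hcomp_assoc[of r "Dom K r" "Cod K r" s "Dom K s" "Cod K s" t "Dom K t" "Cod K t"] by (auto simp: cell_defs)

lemma hcomp_Id2: "f \<in> One K \<Longrightarrow> g \<in> One K \<Longrightarrow> Src K g = Trg K f \<Longrightarrow> Id2 K g \<star> Id2 K f = Id2 K (g \<odot> f)"
  using hcomp_id2[of f "Src K f" "Trg K f" g "Trg K g"] by (auto simp: cell_defs)

lemma interchange':
  "s \<in> Two K \<Longrightarrow> s' \<in> Two K \<Longrightarrow> t \<in> Two K \<Longrightarrow> t' \<in> Two K \<Longrightarrow> Dom K s' = Cod K s \<Longrightarrow> Dom K t' = Cod K t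
    \<Longrightarrow> Src K (Dom K t) = Trg K (Dom K s) \<Longrightarrow> (t' \<cdot> t) \<star> (s' \<cdot> s) = (t' \<star> s') \<cdot> (t \<star> s)"
  using interchange[of s "Dom K s" "Cod K s" s' "Cod K s'" t "Dom K t" "Cod K t" t' "Cod K t'"]
  by (auto simp: cell_defs)

lemma post_mem [simp]:
  assumes "s \<in> Two K" "G \<in> One K" "Src K G = Trg K (Dom K s)"
  shows "G \<rhd> s \<in> Two K" "Dom K (G \<rhd> s) = G \<odot> Dom K s" "Cod K (G \<rhd> s) = G \<odot> Cod K s"
  using assms by (simp_all add: post_whisker_def)

lemma pre_mem [simp]:
  assumes "s \<in> Two K" "F \<in> One K" "Trg K F = Src K (Dom K s)"
  shows "s \<lhd> F \<in> Two K" "Dom K (s \<lhd> F) = Dom K s \<odot> F" "Cod K (s \<lhd> F) = Cod K s \<odot> F"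
  using assms by (simp_all add: pre_whisker_def)

lemma post_vcomp [simp]: "s \<in> Two K \<Longrightarrow> t \<in> Two K \<Longrightarrow> Dom K t = Cod K s \<Longrightarrow> G \<in> One K \<Longrightarrow>
    Src K G = Trg K (Dom K s) \<Longrightarrow> G \<rhd> (t \<cdot> s) = (G \<rhd> t) \<cdot> (G \<rhd> s)"
  using interchange'[of s t "Id2 K G" "Id2 K G"] by (simp add: post_whisker_def)

lemma pre_vcomp [simp]: "s \<in> Two K \<Longrightarrow> t \<in> Two K \<Longrightarrow> Dom K t = Cod K s \<Longrightarrow> F \<in> One K \<Longrightarrow>
    Trg K F = Src K (Dom K s) \<Longrightarrow> (t \<cdot> s) \<lhd> F = (t \<lhd> F) \<cdot> (s \<lhd> F)"
  using interchange'[of "Id2 K F" "Id2 K F" s t] by (simp add: pre_whisker_def)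

lemma post_Id2 [simp]: "f \<in> One K \<Longrightarrow> G \<in> One K \<Longrightarrow> Src K G = Trg K f \<Longrightarrow> G \<rhd> Id2 K f = Id2 K (G \<odot> f)"
  by (simp add: post_whisker_def hcomp_Id2)

lemma pre_Id2 [simp]: "f \<in> One K \<Longrightarrow> g \<in> One K \<Longrightarrow> Src K g = Trg K f \<Longrightarrow> Id2 K g \<lhd> f = Id2 K (g \<odot> f)"
  by (simp add: pre_whisker_def hcomp_Id2)

lemma post_Id1 [simp]: "s \<in> Two K \<Longrightarrow> Trg K (Dom K s) = Y \<Longrightarrow> Id1 K Y \<rhd> s = s"
  using hcomp_id_left[of s "Dom K s" "Cod K s" Y] by (simp add: post_whisker_def cell_defs)

lemma pre_Id1 [simp]: "s \<in> Two K \<Longrightarrow> Src K (Dom K s) = X \<Longrightarrow> s \<lhd> Id1 K X = s"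
  using hcomp_id_right[of s "Dom K s" "Cod K s" X] by (simp add: pre_whisker_def cell_defs)

lemma post_post [simp]: "s \<in> Two K \<Longrightarrow> G \<in> One K \<Longrightarrow> H \<in> One K \<Longrightarrow> Src K G = Trg K (Dom K s) \<Longrightarrow>
    Src K H = Trg K G \<Longrightarrow> (H \<odot> G) \<rhd> s = H \<rhd> G \<rhd> s"
  using hcomp_assoc'[of s "Id2 K G" "Id2 K H"] by (simp add: post_whisker_def hcomp_Id2)

lemma pre_pre [simp]: "s \<in> Two K \<Longrightarrow> F \<in> One K \<Longrightarrow> G \<in> One K \<Longrightarrow> Trg K F = Src K (Dom K s) \<Longrightarrow>
    Trg K G = Src K F \<Longrightarrow> (s \<lhd> F) \<lhd> G = s \<lhd> (F \<odot> G)"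
  using hcomp_assoc'[of "Id2 K G" "Id2 K F" s] by (simp add: pre_whisker_def hcomp_Id2)

lemma post_pre [simp]: "s \<in> Two K \<Longrightarrow> F \<in> One K \<Longrightarrow> G \<in> One K \<Longrightarrow> Trg K F = Src K (Dom K s) \<Longrightarrow>
    Src K G = Trg K (Dom K s) \<Longrightarrow> (G \<rhd> s) \<lhd> F = G \<rhd> (s \<lhd> F)"
  using hcomp_assoc'[of "Id2 K F" s "Id2 K G"] by (simp add: post_whisker_def pre_whisker_def)

lemma hcomp_left: "s \<in> Two K \<Longrightarrow> t \<in> Two K \<Longrightarrow> Src K (Dom K t) = Trg K (Dom K s) \<Longrightarrow>
    t \<star> s = (t \<lhd> Cod K s) \<cdot> (Dom K t \<rhd> s)"
  using interchange'[of s "Id2 K (Cod K s)" "Id2 K (Dom K t)" t] by (simp add: post_whisker_def pre_whisker_def)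

lemma hcomp_right: "s \<in> Two K \<Longrightarrow> t \<in> Two K \<Longrightarrow> Src K (Dom K t) = Trg K (Dom K s) \<Longrightarrow>
    t \<star> s = (Cod K t \<rhd> s) \<cdot> (t \<lhd> Dom K s)"
  using interchange'[of "Id2 K (Dom K s)" s t "Id2 K (Cod K t)"] by (simp add: post_whisker_def pre_whisker_def)

lemma whisker_exchange: "s \<in> Two K \<Longrightarrow> t \<in> Two K \<Longrightarrow> Src K (Dom K t) = Trg K (Dom K s) \<Longrightarrow>
    (t \<lhd> Cod K s) \<cdot> (Dom K t \<rhd> s) = (Cod K t \<rhd> s) \<cdot> (t \<lhd> Dom K s)"
  using hcomp_left hcomp_right by metis

lemma vcomp_reduce: "t \<cdot> s = r \<Longrightarrow> t \<in> Two K \<Longrightarrow> s \<in> Two K \<Longrightarrow> k \<in> Two K \<Longrightarrow> Dom K t = Cod K s \<Longrightarrow> Dom K s = Cod K k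
    \<Longrightarrow> t \<cdot> s \<cdot> k = r \<cdot> k"
  using vcomp_assoc' by metis

end

context fp_two_category
begin

declare term_zero [simp] prod_zero [simp]

lemma Pr_mem [simp]: assumes "X \<in> Zero A" "Y \<in> Zero A"
  shows "Pr1 A X Y \<in> One A" "Src A (Pr1 A X Y) = Prod A X Y" "Trg A (Pr1 A X Y) = X"
   "Pr2 A X Y \<in> One A" "Src A (Pr2 A X Y) = Prod A X Y" "Trg A (Pr2 A X Y) = Y"
  using pr1_cell[OF assms] pr2_cell[OF assms] by (auto simp: cell_defs)

lemma bang_mem [simp]: assumes "X \<in> Zero A"
  shows "bang A X \<in> One A" "Src A (bang A X) = X" "Trg A (bang A X) = Term A"
  using theI'[OF term_univ1[OF assms]] by (auto simp: cell_defs bang_def)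

lemma bang_eq: "f \<in> One A \<Longrightarrow> Trg A f = Term A \<Longrightarrow> f = bang A (Src A f)"
  using term_univ1[of "Src A f"] by (auto simp: cell_defs)

lemma bang_comp [simp]: "f \<in> One A \<Longrightarrow> Trg A f = X \<Longrightarrow> bang A X \<odot> f = bang A (Src A f)"
  using bang_eq[of "bang A X \<odot> f"] by auto

context
  fixes f g assumes fg: "f \<in> One A" "g \<in> One A" "Src A g = Src A f"
begin

lemma pair1_props: "one_cell A (pair1 A f g) (Src A f) (Prod A (Trg A f) (Trg A g)) \<and>
   Pr1 A (Trg A f) (Trg A g) \<odot> pair1 A f g = f \<and> Pr2 A (Trg A f) (Trg A g) \<odot> pair1 A f g = g"
  using theI'[OF prod_univ1[of f "Src A f" "Trg A f" g "Trg A g"]] fg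
  by (auto simp: cell_defs pair1_def Let_def)

lemma pair1_mem [simp]: "pair1 A f g \<in> One A" "Src A (pair1 A f g) = Src A f"
   "Trg A (pair1 A f g) = Prod A (Trg A f) (Trg A g)"
  using pair1_props by (auto simp: cell_defs)

lemma Pr_pair1 [simp]: "Trg A f = X \<Longrightarrow> Trg A g = Y \<Longrightarrow> Pr1 A X Y \<odot> pair1 A f g = f"
   "Trg A f = X \<Longrightarrow> Trg A g = Y \<Longrightarrow> Pr2 A X Y \<odot> pair1 A f g = g"
  using pair1_props by auto

end

lemma pair1_eqI:
  assumes "h \<in> One A" "k \<in> One A" "Src A h = Src A k" "Trg A h = Prod A X Y" "Trg A k = Prod A X Y" "X \<in> Zero A" "Y \<in> Zero A"
   "Pr1 A X Y \<odot> h = Pr1 A X Y \<odot> k" "Pr2 A X Y \<odot> h = Pr2 A X Y \<odot> k"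
  shows "h = k"
  using prod_univ1[of "Pr1 A X Y \<odot> h" "Src A h" X "Pr2 A X Y \<odot> h" Y] assms
  by (auto simp: cell_defs)

lemma pair1_comp [simp]: "f \<in> One A \<Longrightarrow> g \<in> One A \<Longrightarrow> Src A g = Src A f \<Longrightarrow> h \<in> One A \<Longrightarrow> Trg A h = Src A f \<Longrightarrow>
    pair1 A f g \<odot> h = pair1 A (f \<odot> h) (g \<odot> h)"
  by (rule pair1_eqI[where X="Trg A f" and Y="Trg A g"]) (simp_all flip: comp1_assoc')

lemma pair1_Pr [simp]: "X \<in> Zero A \<Longrightarrow> Y \<in> Zero A \<Longrightarrow> pair1 A (Pr1 A X Y) (Pr2 A X Y) = Id1 A (Prod A X Y)"
  by (rule pair1_eqI[where X=X and Y=Y]) simp_all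

lemma pair2_eqI:
  assumes "s \<in> Two A" "t \<in> Two A" "Dom A s = Dom A t" "Cod A s = Cod A t" "Trg A (Dom A s) = Prod A X Y"
   "X \<in> Zero A" "Y \<in> Zero A"
   "Pr1 A X Y \<rhd> s = Pr1 A X Y \<rhd> t" "Pr2 A X Y \<rhd> s = Pr2 A X Y \<rhd> t"
  shows "s = t"
proof -
  have "Trg A (Dom A t) = Prod A X Y" "Trg A (Cod A t) = Prod A X Y" using assms by (metis boundary_mem(6))+
  then show ?thesis
  using prod_univ2[of X Y "Dom A s" "Src A (Dom A s)" "Cod A s" "Pr1 A X Y \<rhd> s" "Pr2 A X Y \<rhd> s"] assms
  by (auto simp: cell_defs)
qed

context
  fixes s t assumes st: "s \<in> Two A" "t \<in> Two A" "Src A (Dom A t) = Src A (Dom A s)"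
begin

lemma pair2_props: "two_cell A (pair2 A s t) (pair1 A (Dom A s) (Dom A t)) (pair1 A (Cod A s) (Cod A t)) \<and>
   Pr1 A (Trg A (Dom A s)) (Trg A (Dom A t)) \<rhd> pair2 A s t = s \<and> Pr2 A (Trg A (Dom A s)) (Trg A (Dom A t)) \<rhd> pair2 A s t = t"
proof -
  let ?X = "Trg A (Dom A s)" let ?Y = "Trg A (Dom A t)"
  have "\<exists>!w. two_cell A w (pair1 A (Dom A s) (Dom A t)) (pair1 A (Cod A s) (Cod A t)) \<and> Pr1 A ?X ?Y \<rhd> w = s \<and> Pr2 A ?X ?Y \<rhd> w = t"
    by (rule prod_univ2[where W = "Src A (Dom A s)"]) (use st in \<open>simp_all add: cell_defs\<close>)
  from theI'[OF this] show ?thesis by (simp add: pair2_def Let_def)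
qed

lemma pair2_mem [simp]: "pair2 A s t \<in> Two A" "Dom A (pair2 A s t) = pair1 A (Dom A s) (Dom A t)"
    "Cod A (pair2 A s t) = pair1 A (Cod A s) (Cod A t)"
  using pair2_props by (auto simp: cell_defs)

lemma Pr_pair2 [simp]: "Trg A (Dom A s) = X \<Longrightarrow> Trg A (Dom A t) = Y \<Longrightarrow> Pr1 A X Y \<rhd> pair2 A s t = s"
  "Trg A (Dom A s) = X \<Longrightarrow> Trg A (Dom A t) = Y \<Longrightarrow> Pr2 A X Y \<rhd> pair2 A s t = t"
  using pair2_props by auto

end

lemma pair2_vcomp [simp]: "s \<in> Two A \<Longrightarrow> t \<in> Two A \<Longrightarrow> Src A (Dom A t) = Src A (Dom A s) \<Longrightarrow>
   s' \<in> Two A \<Longrightarrow> t' \<in> Two A \<Longrightarrow> Dom A s' = Cod A s \<Longrightarrow> Dom A t' = Cod A t \<Longrightarrow>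
   pair2 A s' t' \<cdot> pair2 A s t = pair2 A (s' \<cdot> s) (t' \<cdot> t)"
  by (rule pair2_eqI[where X="Trg A (Dom A s)" and Y = "Trg A (Dom A t)"]) simp_all

lemma pair2_Id2 [simp]: "f \<in> One A \<Longrightarrow> g \<in> One A \<Longrightarrow> Src A g = Src A f \<Longrightarrow>
   pair2 A (Id2 A f) (Id2 A g) = Id2 A (pair1 A f g)"
  by (rule pair2_eqI[where X="Trg A f" and Y = "Trg A g"]) simp_all

lemma pair2_pre [simp]: "s \<in> Two A \<Longrightarrow> t \<in> Two A \<Longrightarrow> Src A (Dom A t) = Src A (Dom A s) \<Longrightarrow>
   h \<in> One A \<Longrightarrow> Trg A h = Src A (Dom A s) \<Longrightarrow> pair2 A s t \<lhd> h = pair2 A (s \<lhd> h) (t \<lhd> h)"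
  by (rule pair2_eqI[where X="Trg A (Dom A s)" and Y = "Trg A (Dom A t)"]) (simp_all flip: post_pre)

lemma pair1_fst_snd [simp]: "h \<in> One A \<Longrightarrow> Trg A h = Prod A X Y \<Longrightarrow> X \<in> Zero A \<Longrightarrow> Y \<in> Zero A \<Longrightarrow>
    pair1 A (Pr1 A X Y \<odot> h) (Pr2 A X Y \<odot> h) = h"
  by (rule pair1_eqI[where X=X and Y=Y]) simp_all

lemma projections [simp]:
  assumes "C \<in> Zero A"
  shows "proj3_1 A C \<in> One A" "Src A (proj3_1 A C) = Prod A C (Prod A C C)" "Trg A (proj3_1 A C) = C"
    "proj3_2 A C \<in> One A" "Src A (proj3_2 A C) = Prod A C (Prod A C C)" "Trg A (proj3_2 A C) = C"
    "proj3_3 A C \<in> One A" "Src A (proj3_3 A C) = Prod A C (Prod A C C)" "Trg A (proj3_3 A C) = C"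
    "proj4_1 A C \<in> One A" "Src A (proj4_1 A C) = Prod A C (Prod A C (Prod A C C))" "Trg A (proj4_1 A C) = C"
    "proj4_2 A C \<in> One A" "Src A (proj4_2 A C) = Prod A C (Prod A C (Prod A C C))" "Trg A (proj4_2 A C) = C"
    "proj4_3 A C \<in> One A" "Src A (proj4_3 A C) = Prod A C (Prod A C (Prod A C C))" "Trg A (proj4_3 A C) = C"
    "proj4_4 A C \<in> One A" "Src A (proj4_4 A C) = Prod A C (Prod A C (Prod A C C))" "Trg A (proj4_4 A C) = C"
  using assms by (simp_all add: proj3_1_def proj3_2_def proj3_3_def proj4_1_def proj4_2_def proj4_3_def proj4_4_def)

lemma projections_pair [simp]:
  assumes "x \<in> One A" "y \<in> One A" "z \<in> One A" "Src A y = Src A x" "Src A z = Src A x"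
    "Trg A x = C" "Trg A y = C" "Trg A z = C"
  shows "proj3_1 A C \<odot> pair1 A x (pair1 A y z) = x" "proj3_2 A C \<odot> pair1 A x (pair1 A y z) = y"
    "proj3_3 A C \<odot> pair1 A x (pair1 A y z) = z"
    "w \<in> One A \<Longrightarrow> Src A w = Src A x \<Longrightarrow> Trg A w = C \<Longrightarrow> proj4_1 A C \<odot> pair1 A w (pair1 A x (pair1 A y z)) = w"
    "w \<in> One A \<Longrightarrow> Src A w = Src A x \<Longrightarrow> Trg A w = C \<Longrightarrow> proj4_2 A C \<odot> pair1 A w (pair1 A x (pair1 A y z)) = x"
    "w \<in> One A \<Longrightarrow> Src A w = Src A x \<Longrightarrow> Trg A w = C \<Longrightarrow> proj4_3 A C \<odot> pair1 A w (pair1 A x (pair1 A y z)) = y"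
    "w \<in> One A \<Longrightarrow> Src A w = Src A x \<Longrightarrow> Trg A w = C \<Longrightarrow> proj4_4 A C \<odot> pair1 A w (pair1 A x (pair1 A y z)) = z"
  using assms boundary_mem(2)[OF assms(1)] by (simp_all add: proj3_1_def proj3_2_def proj3_3_def proj4_1_def proj4_2_def proj4_3_def proj4_4_def)

context
  fixes M :: "('o, 'a, 't) mon_obj" assumes T: "Und M \<in> Zero A" "Ten M \<in> One A" "Src A (Ten M) = Prod A (Und M) (Und M)" "Trg A (Ten M) = Und M"
begin

lemma ten1_mem [simp]: assumes "f \<in> One A" "g \<in> One A" "Src A g = Src A f" "Trg A f = Und M" "Trg A g = Und M"
  shows "ten1 A M f g \<in> One A" "Src A (ten1 A M f g) = Src A f" "Trg A (ten1 A M f g) = Und M"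
  using assms T by (simp_all add: ten1_def)

lemma ten1_comp [simp]: assumes "f \<in> One A" "g \<in> One A" "Src A g = Src A f" "Trg A f = Und M" "Trg A g = Und M"
  "h \<in> One A" "Trg A h = Src A f"
  shows "ten1 A M f g \<odot> h = ten1 A M (f \<odot> h) (g \<odot> h)"
  using assms T by (simp add: ten1_def)

lemma ten2_mem [simp]: assumes "s \<in> Two A" "t \<in> Two A" "Src A (Dom A t) = Src A (Dom A s)" "Trg A (Dom A s) = Und M" "Trg A (Dom A t) = Und M"
  shows "ten2 A M s t \<in> Two A" "Dom A (ten2 A M s t) = ten1 A M (Dom A s) (Dom A t)" "Cod A (ten2 A M s t) = ten1 A M (Cod A s) (Cod A t)"
  using assms T by (simp_all add: ten1_def ten2_def)

lemma ten2_vcomp [simp]: "s \<in> Two A \<Longrightarrow> t \<in> Two A \<Longrightarrow> Src A (Dom A t) = Src A (Dom A s) \<Longrightarrow> Trg A (Dom A s) = Und M \<Longrightarrow> Trg A (Dom A t) = Und M \<Longrightarrow>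
   s' \<in> Two A \<Longrightarrow> t' \<in> Two A \<Longrightarrow> Dom A s' = Cod A s \<Longrightarrow> Dom A t' = Cod A t \<Longrightarrow>
   ten2 A M s' t' \<cdot> ten2 A M s t = ten2 A M (s' \<cdot> s) (t' \<cdot> t)"
  using T by (simp add: ten2_def flip: post_vcomp)

lemma ten2_Id2 [simp]: "f \<in> One A \<Longrightarrow> g \<in> One A \<Longrightarrow> Src A g = Src A f \<Longrightarrow> Trg A f = Und M \<Longrightarrow> Trg A g = Und M \<Longrightarrow>
   ten2 A M (Id2 A f) (Id2 A g) = Id2 A (ten1 A M f g)"
  using T by (simp add: ten2_def ten1_def)

lemma ten2_pre [simp]: assumes "s \<in> Two A" "t \<in> Two A" "Src A (Dom A t) = Src A (Dom A s)" "Trg A (Dom A s) = Und M" "Trg A (Dom A t) = Und M"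
    "h \<in> One A" "Trg A h = Src A (Dom A s)"
  shows "ten2 A M s t \<lhd> h = ten2 A M (s \<lhd> h) (t \<lhd> h)"
  using assms T by (simp add: ten2_def)

lemma Ten_Id2 [simp]: "Ten M \<rhd> pair2 A s t = ten2 A M s t" by (simp add: ten2_def)

lemma Ten_pair [simp]: "Ten M \<odot> pair1 A s t = ten1 A M s t" by (simp add: ten1_def)

lemma ten1_Pr [simp]: "ten1 A M (Pr1 A (Und M) (Und M)) (Pr2 A (Und M) (Und M)) = Ten M"
  using T by (simp add: ten1_def)

end

lemma at2_mem [simp]:
  assumes "\<phi> \<in> Two A" "Src A (Dom A \<phi>) = Prod A X Y" "x \<in> One A" "y \<in> One A" "Src A y = Src A x" "Trg A x = X" "Trg A y = Y"
  shows "at2 A \<phi> x y \<in> Two A" "Dom A (at2 A \<phi> x y) = Dom A \<phi> \<odot> pair1 A x y" "Cod A (at2 A \<phi> x y) = Cod A \<phi> \<odot> pair1 A x y"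
  using assms by (simp_all add: at2_def)

lemma at2_pre [simp]:
  assumes "\<phi> \<in> Two A" "Src A (Dom A \<phi>) = Prod A X Y" "x \<in> One A" "y \<in> One A" "Src A y = Src A x" "Trg A x = X" "Trg A y = Y"
    "h \<in> One A" "Trg A h = Src A x"
  shows "at2 A \<phi> x y \<lhd> h = at2 A \<phi> (x \<odot> h) (y \<odot> h)"
  using assms by (simp add: at2_def)

lemma at3_mem [simp]:
  assumes "\<phi> \<in> Two A" "Src A (Dom A \<phi>) = Prod A X (Prod A Y Z)" "x \<in> One A" "y \<in> One A" "z \<in> One A"
    "Src A y = Src A x" "Src A z = Src A x" "Trg A x = X" "Trg A y = Y" "Trg A z = Z"
  shows "at3 A \<phi> x y z \<in> Two A" "Dom A (at3 A \<phi> x y z) = Dom A \<phi> \<odot> pair1 A x (pair1 A y z)" "Cod A (at3 A \<phi> x y z) = Cod A \<phi> \<odot> pair1 A x (pair1 A y z)"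
  using assms by (simp_all add: at3_def)

lemma at3_pre [simp]:
  assumes "\<phi> \<in> Two A" "Src A (Dom A \<phi>) = Prod A X (Prod A Y Z)" "x \<in> One A" "y \<in> One A" "z \<in> One A"
    "Src A y = Src A x" "Src A z = Src A x" "Trg A x = X" "Trg A y = Y" "Trg A z = Z"
    "h \<in> One A" "Trg A h = Src A x"
  shows "at3 A \<phi> x y z \<lhd> h = at3 A \<phi> (x \<odot> h) (y \<odot> h) (z \<odot> h)"
  using assms by (simp add: at3_def)

end

section \<open>Monoidal objects and generalized elements\<close>

context fp_two_category
begin

lemma post_pair1 [simp]: assumes [simp]: "s \<in> Two A" "f \<in> One A" "g \<in> One A" "Src A f = Trg A (Dom A s)" "Src A g = Trg A (Dom A s)"
  shows "pair1 A f g \<rhd> s = pair2 A (f \<rhd> s) (g \<rhd> s)"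
proof -
  let ?X = "Trg A f" let ?Y = "Trg A g"
  have 1: "Pr1 A ?X ?Y \<rhd> pair1 A f g \<rhd> s = (Pr1 A ?X ?Y \<odot> pair1 A f g) \<rhd> s"
    by (rule post_post[symmetric]; simp)
  have 2: "Pr2 A ?X ?Y \<rhd> pair1 A f g \<rhd> s = (Pr2 A ?X ?Y \<odot> pair1 A f g) \<rhd> s"
    by (rule post_post[symmetric]; simp)
  show ?thesis
  proof (rule pair2_eqI[where X="?X" and Y = "?Y"])
  show "Pr1 A ?X ?Y \<rhd> pair1 A f g \<rhd> s = Pr1 A ?X ?Y \<rhd> pair2 A (f \<rhd> s) (g \<rhd> s)" unfolding 1 by simp
  show "Pr2 A ?X ?Y \<rhd> pair1 A f g \<rhd> s = Pr2 A ?X ?Y \<rhd> pair2 A (f \<rhd> s) (g \<rhd> s)" unfolding 2 by simp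
  show "pair1 A f g \<rhd> s \<in> Two A" by simp
  show "pair2 A (f \<rhd> s) (g \<rhd> s) \<in> Two A" by simp
  show "Dom A (pair1 A f g \<rhd> s) = Dom A (pair2 A (f \<rhd> s) (g \<rhd> s))" by simp
  show "Cod A (pair1 A f g \<rhd> s) = Cod A (pair2 A (f \<rhd> s) (g \<rhd> s))" by simp
  show "Trg A (Dom A (pair1 A f g \<rhd> s)) = Prod A ?X ?Y" by simp
  show "?X \<in> Zero A" by simp
  show "?Y \<in> Zero A" by simp
  qed
qed

lemma post_ten1 [simp]:
  assumes "Und M \<in> Zero A" "Ten M \<in> One A" "Src A (Ten M) = Prod A (Und M) (Und M)" "Trg A (Ten M) = Und M"
   "s \<in> Two A" "f \<in> One A" "g \<in> One A" "Src A f = Trg A (Dom A s)" "Src A g = Trg A (Dom A s)" "Trg A f = Und M" "Trg A g = Und M"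
  shows "ten1 A M f g \<rhd> s = ten2 A M (f \<rhd> s) (g \<rhd> s)"
  using assms by (simp add: ten1_def ten2_def del: Ten_pair Ten_Id2)

lemma term_two_eq:
  assumes "s \<in> Two A" "t \<in> Two A" "Dom A s = Dom A t" "Cod A s = Cod A t" "Trg A (Dom A t) = Term A"
  shows "s = t"
  using term_univ2[of "Dom A t" "Src A (Dom A t)" "Cod A t"] assms boundary_mem(6)[OF assms(2)] boundary_mem(5)[OF assms(2)]
  unfolding cell_defs by (metis boundary_mem(3,4))

lemma post_bang [simp]: "s \<in> Two A \<Longrightarrow> Trg A (Dom A s) = X \<Longrightarrow> bang A X \<rhd> s = Id2 A (bang A (Src A (Dom A s)))"
  using boundary_mem(2)[of "Dom A s"] by (auto intro!: term_two_eq)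

lemma post_proj3 [simp]:
  assumes "s \<in> Two A" "t \<in> Two A" "r \<in> Two A" "Src A (Dom A t) = Src A (Dom A s)" "Src A (Dom A r) = Src A (Dom A s)"
    "Trg A (Dom A s) = C" "Trg A (Dom A t) = C" "Trg A (Dom A r) = C"
  shows "proj3_1 A C \<rhd> pair2 A s (pair2 A t r) = s" "proj3_2 A C \<rhd> pair2 A s (pair2 A t r) = t"
    "proj3_3 A C \<rhd> pair2 A s (pair2 A t r) = r"
  using assms boundary_mem(2)[of "Dom A s"] by (simp_all add: proj3_1_def proj3_2_def proj3_3_def)

definition inv_cell :: "'t \<Rightarrow> 't" where "inv_cell s = (SOME t. inverse_cells A s t)"

lemma inv_cell: "invertible A s \<Longrightarrow> inverse_cells A s (inv_cell s)"
  unfolding invertible_def inv_cell_def by (rule someI_ex)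

lemma inv_cell_props:
  assumes "invertible A s"
  shows "inv_cell s \<in> Two A" "Dom A (inv_cell s) = Cod A s" "Cod A (inv_cell s) = Dom A s"
    "inv_cell s \<cdot> s = Id2 A (Dom A s)" "s \<cdot> inv_cell s = Id2 A (Cod A s)"
  using inv_cell[OF assms] by (auto simp: inverse_cells_def cell_defs)

text \<open>The axioms of a monoidal object are equations at product projections. Precomposition with
  a tuple turns them into equations at arbitrary 1-cells \<open>X \<rightarrow> Und M\<close>.\<close>

context
  fixes M :: "('o, 'a, 't) mon_obj" assumes M: "monoidal_object A M"
begin

lemma mon_mem [simp]: "Und M \<in> Zero A" "Ten M \<in> One A" "Src A (Ten M) = Prod A (Und M) (Und M)" "Trg A (Ten M) = Und M"
   "Unt M \<in> One A" "Src A (Unt M) = Term A" "Trg A (Unt M) = Und M"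
  using M by (auto simp: monoidal_object_def Let_def cell_defs)

lemma unit_at_mem [simp]: "X \<in> Zero A \<Longrightarrow> unit_at A M X \<in> One A" "X \<in> Zero A \<Longrightarrow> Src A (unit_at A M X) = X"
  "X \<in> Zero A \<Longrightarrow> Trg A (unit_at A M X) = Und M"
  by (simp_all add: unit_at_def)

lemma unit_at_comp [simp]: "f \<in> One A \<Longrightarrow> Trg A f = X \<Longrightarrow> unit_at A M X \<odot> f = unit_at A M (Src A f)"
  using boundary_mem(2)[of f] by (auto simp: unit_at_def)

lemma post_unit_at [simp]: "s \<in> Two A \<Longrightarrow> Trg A (Dom A s) = X \<Longrightarrow> unit_at A M X \<rhd> s = Id2 A (unit_at A M (Src A (Dom A s)))"
  using boundary_mem(2)[of "Dom A s"] by (auto simp: unit_at_def)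

lemma Asc_mem: "Asc M \<in> Two A" "Dom A (Asc M) = ten1 A M (proj3_1 A (Und M)) (ten1 A M (proj3_2 A (Und M)) (proj3_3 A (Und M)))"
   "Cod A (Asc M) = ten1 A M (ten1 A M (proj3_1 A (Und M)) (proj3_2 A (Und M))) (proj3_3 A (Und M))" "invertible A (Asc M)"
  using M by (auto simp: monoidal_object_def Let_def cell_defs)

lemma Lun_mem: "Lun M \<in> Two A" "Dom A (Lun M) = ten1 A M (unit_at A M (Und M)) (Id1 A (Und M))" "Cod A (Lun M) = Id1 A (Und M)" "invertible A (Lun M)"
  and Run_mem: "Run M \<in> Two A" "Dom A (Run M) = ten1 A M (Id1 A (Und M)) (unit_at A M (Und M))" "Cod A (Run M) = Id1 A (Und M)" "invertible A (Run M)"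
  using M by (auto simp: monoidal_object_def Let_def cell_defs)

context
  fixes x X assumes x [simp]: "x \<in> One A" "Src A x = X" "Trg A x = Und M"
begin

lemma lun_mem [simp]: "Lun M \<lhd> x \<in> Two A" "Dom A (Lun M \<lhd> x) = ten1 A M (unit_at A M X) x" "Cod A (Lun M \<lhd> x) = x"
  and run_mem [simp]: "Run M \<lhd> x \<in> Two A" "Dom A (Run M \<lhd> x) = ten1 A M x (unit_at A M X)" "Cod A (Run M \<lhd> x) = x"
  using Lun_mem Run_mem by simp_all

lemma lun_inv: "inv_cell (Lun M) \<lhd> x \<in> Two A" "Cod A (inv_cell (Lun M) \<lhd> x) = ten1 A M (unit_at A M X) x" "Dom A (inv_cell (Lun M) \<lhd> x) = x"
    "(Lun M \<lhd> x) \<cdot> (inv_cell (Lun M) \<lhd> x) = Id2 A x" "(inv_cell (Lun M) \<lhd> x) \<cdot> (Lun M \<lhd> x) = Id2 A (ten1 A M (unit_at A M X) x)"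
  using Lun_mem inv_cell_props[OF Lun_mem(4)] by (simp_all flip: pre_vcomp)

lemma run_inv: "inv_cell (Run M) \<lhd> x \<in> Two A" "Cod A (inv_cell (Run M) \<lhd> x) = ten1 A M x (unit_at A M X)" "Dom A (inv_cell (Run M) \<lhd> x) = x"
    "(Run M \<lhd> x) \<cdot> (inv_cell (Run M) \<lhd> x) = Id2 A x" "(inv_cell (Run M) \<lhd> x) \<cdot> (Run M \<lhd> x) = Id2 A (ten1 A M x (unit_at A M X))"
  using Run_mem inv_cell_props[OF Run_mem(4)] by (simp_all flip: pre_vcomp)

end

context
  fixes x y z X assumes x [simp]: "x \<in> One A" "Src A x = X" "Trg A x = Und M"
   and y [simp]: "y \<in> One A" "Src A y = X" "Trg A y = Und M"
   and z [simp]: "z \<in> One A" "Src A z = X" "Trg A z = Und M"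
begin

lemma asc_mem [simp]: "at3 A (Asc M) x y z \<in> Two A" "Dom A (at3 A (Asc M) x y z) = ten1 A M x (ten1 A M y z)"
   "Cod A (at3 A (Asc M) x y z) = ten1 A M (ten1 A M x y) z"
  using Asc_mem by (simp_all add: at3_def)

lemma asc_pre [simp]: "h \<in> One A \<Longrightarrow> Trg A h = X \<Longrightarrow> at3 A (Asc M) x y z \<lhd> h = at3 A (Asc M) (x \<odot> h) (y \<odot> h) (z \<odot> h)"
  using Asc_mem by (simp add: at3_def)

lemma asc_inv: "at3 A (inv_cell (Asc M)) x y z \<in> Two A" "Cod A (at3 A (inv_cell (Asc M)) x y z) = ten1 A M x (ten1 A M y z)"
   "Dom A (at3 A (inv_cell (Asc M)) x y z) = ten1 A M (ten1 A M x y) z"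
   "at3 A (Asc M) x y z \<cdot> at3 A (inv_cell (Asc M)) x y z = Id2 A (ten1 A M (ten1 A M x y) z)"
   "at3 A (inv_cell (Asc M)) x y z \<cdot> at3 A (Asc M) x y z = Id2 A (ten1 A M x (ten1 A M y z))"
  using Asc_mem inv_cell_props[OF Asc_mem(4)]
  by (simp_all add: at3_def flip: pre_vcomp)

lemma pentagon_el:
  assumes [simp]: "w \<in> One A" "Src A w = X" "Trg A w = Und M"
  shows "at3 A (Asc M) (ten1 A M w x) y z \<cdot> at3 A (Asc M) w x (ten1 A M y z) =
        ten2 A M (at3 A (Asc M) w x y) (Id2 A z) \<cdot> at3 A (Asc M) w (ten1 A M x y) z \<cdot> ten2 A M (Id2 A w) (at3 A (Asc M) x y z)"
proof -
  let ?C = "Und M" let ?w = "proj4_1 A ?C" let ?x = "proj4_2 A ?C" let ?y = "proj4_3 A ?C" let ?z = "proj4_4 A ?C"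
  let ?a = "at3 A (Asc M)"
  have [simp]: "X \<in> Zero A" using boundary_mem(1)[OF x(1)] by simp
  have "?a (ten1 A M ?w ?x) ?y ?z \<cdot> ?a ?w ?x (ten1 A M ?y ?z) =
        ten2 A M (?a ?w ?x ?y) (Id2 A ?z) \<cdot> ?a ?w (ten1 A M ?x ?y) ?z \<cdot> ten2 A M (Id2 A ?w) (?a ?x ?y ?z)"
    using M by (simp add: monoidal_object_def Let_def)
  from arg_cong[OF this, of "\<lambda>s. s \<lhd> pair1 A w (pair1 A x (pair1 A y z))"] show ?thesis
    using Asc_mem by simp
qed

end

lemma triangle_el:
  assumes x [simp]: "x \<in> One A" "Src A x = X" "Trg A x = Und M"
   and y [simp]: "y \<in> One A" "Src A y = X" "Trg A y = Und M"
  shows "ten2 A M (Run M \<lhd> x) (Id2 A y) \<cdot> at3 A (Asc M) x (unit_at A M X) y = ten2 A M (Id2 A x) (Lun M \<lhd> y)"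
proof -
  let ?C = "Und M"
  have [simp]: "X \<in> Zero A" using boundary_mem(1)[OF x(1)] by simp
  have "ten2 A M (Run M \<lhd> Pr1 A ?C ?C) (Id2 A (Pr2 A ?C ?C)) \<cdot> at3 A (Asc M) (Pr1 A ?C ?C) (unit_at A M (Prod A ?C ?C)) (Pr2 A ?C ?C)
    = ten2 A M (Id2 A (Pr1 A ?C ?C)) (Lun M \<lhd> Pr2 A ?C ?C)"
    using M by (simp add: monoidal_object_def Let_def)
  from arg_cong[OF this, of "\<lambda>s. s \<lhd> pair1 A x y"] show ?thesis
    using Lun_mem Run_mem Asc_mem by simp
qed

lemma asc_nat_el:
  assumes "s \<in> Two A" "t \<in> Two A" "r \<in> Two A" "Src A (Dom A t) = Src A (Dom A s)" "Src A (Dom A r) = Src A (Dom A s)"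
    "Trg A (Dom A s) = Und M" "Trg A (Dom A t) = Und M" "Trg A (Dom A r) = Und M"
  shows "at3 A (Asc M) (Cod A s) (Cod A t) (Cod A r) \<cdot> ten2 A M s (ten2 A M t r) =
    ten2 A M (ten2 A M s t) r \<cdot> at3 A (Asc M) (Dom A s) (Dom A t) (Dom A r)"
  using whisker_exchange[of "pair2 A s (pair2 A t r)" "Asc M"] assms Asc_mem by (simp add: at3_def)

lemma lun_nat_el: "s \<in> Two A \<Longrightarrow> Trg A (Dom A s) = Und M \<Longrightarrow>
   (Lun M \<lhd> Cod A s) \<cdot> ten2 A M (Id2 A (unit_at A M (Src A (Dom A s)))) s = s \<cdot> (Lun M \<lhd> Dom A s)"
  using whisker_exchange[of s "Lun M"] Lun_mem by simp

lemma run_nat_el: "s \<in> Two A \<Longrightarrow> Trg A (Dom A s) = Und M \<Longrightarrow>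
   (Run M \<lhd> Cod A s) \<cdot> ten2 A M s (Id2 A (unit_at A M (Src A (Dom A s)))) = s \<cdot> (Run M \<lhd> Dom A s)"
  using whisker_exchange[of s "Run M"] Run_mem by simp

end

end

section \<open>Lax monoidal 1-cells and their composition\<close>

context two_category
begin

text \<open>The associativity axiom for a composite of lax monoidal 1-cells: \<open>n1\<close> and \<open>n2\<close> are naturality of
  the structure cell of the outer 1-cell, \<open>A\<close> is the image of the axiom for the inner 1-cell, and \<open>B\<close>
  is the axiom for the outer one.\<close>

lemma paste_assoc:
  assumes c: "two_cell K t2 e0 e1" "two_cell K t1 e1 e2" "two_cell K g1 e2 e3" "two_cell K gf1 e3 e4" "two_cell K ga e4 e9"
   "two_cell K g2 e1 d1" "two_cell K gt d1 e3" "two_cell K gb d1 d2" "two_cell K gs d2 d3" "two_cell K gf2 d3 e9"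
   "two_cell K a e0 c1" "two_cell K s2 c1 c2" "two_cell K g3 c2 d2" "two_cell K s1 c2 c3" "two_cell K g4 c3 d3"
   and n1: "g1 \<cdot> t1 = gt \<cdot> g2" and A: "ga \<cdot> gf1 \<cdot> gt = gf2 \<cdot> gs \<cdot> gb"
   and B: "gb \<cdot> g2 \<cdot> t2 = g3 \<cdot> s2 \<cdot> a" and n2: "gs \<cdot> g3 = g4 \<cdot> s1"
 shows "ga \<cdot> (gf1 \<cdot> g1) \<cdot> (t1 \<cdot> t2) = (gf2 \<cdot> g4) \<cdot> (s1 \<cdot> s2) \<cdot> a"
proof -
  note [simp] = c[unfolded cell_defs]
  have "ga \<cdot> (gf1 \<cdot> g1) \<cdot> (t1 \<cdot> t2) = ga \<cdot> gf1 \<cdot> (g1 \<cdot> t1) \<cdot> t2" by simp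
  also have "\<dots> = (ga \<cdot> gf1 \<cdot> gt) \<cdot> g2 \<cdot> t2" unfolding n1 by simp
  also have "\<dots> = gf2 \<cdot> gs \<cdot> (gb \<cdot> g2 \<cdot> t2)" unfolding A by simp
  also have "\<dots> = gf2 \<cdot> (gs \<cdot> g3) \<cdot> s2 \<cdot> a" unfolding B by simp
  also have "\<dots> = (gf2 \<cdot> g4) \<cdot> (s1 \<cdot> s2) \<cdot> a" unfolding n2 by simp
  finally show ?thesis .
qed

lemma paste_unit:
  assumes c: "two_cell K t2 e0 e1" "two_cell K t1 e1 e2" "two_cell K g1 e2 e3" "two_cell K gf1 e3 e4" "two_cell K ga e4 e9"
   "two_cell K g2 e1 d1" "two_cell K gt d1 e3" "two_cell K b d1 e9"
   and n1: "g1 \<cdot> t1 = gt \<cdot> g2" and A: "ga \<cdot> gf1 \<cdot> gt = b" and B: "b \<cdot> g2 \<cdot> t2 = r"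
 shows "ga \<cdot> (gf1 \<cdot> g1) \<cdot> (t1 \<cdot> t2) = r"
proof -
  note [simp] = c[unfolded cell_defs]
  have "ga \<cdot> (gf1 \<cdot> g1) \<cdot> (t1 \<cdot> t2) = ga \<cdot> gf1 \<cdot> (g1 \<cdot> t1) \<cdot> t2" by simp
  also have "\<dots> = (ga \<cdot> gf1 \<cdot> gt) \<cdot> g2 \<cdot> t2" unfolding n1 by simp
  finally show ?thesis unfolding A B .
qed

end

context fp_two_category
begin

lemma Unt_bang [simp]: "Unt M \<odot> bang A X = unit_at A M X"
  by (simp add: unit_at_def)

context
  fixes L :: "('o, 'a, 't) lax_data" assumes L: "lax_monoidal A L"
begin

lemma lax_mem [simp]: "monoidal_object A (Lsrc L)" "monoidal_object A (Ltrg L)"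
  "Lcell L \<in> One A" "Src A (Lcell L) = Und (Lsrc L)" "Trg A (Lcell L) = Und (Ltrg L)"
  using L by (auto simp: lax_monoidal_def Let_def cell_defs)

lemma Lphi_mem [simp]: "Lphi L \<in> Two A"
   "Dom A (Lphi L) = ten1 A (Ltrg L) (Lcell L \<odot> Pr1 A (Und (Lsrc L)) (Und (Lsrc L))) (Lcell L \<odot> Pr2 A (Und (Lsrc L)) (Und (Lsrc L)))"
   "Cod A (Lphi L) = Lcell L \<odot> Ten (Lsrc L)"
   "Lphi0 L \<in> Two A" "Dom A (Lphi0 L) = Unt (Ltrg L)" "Cod A (Lphi0 L) = Lcell L \<odot> Unt (Lsrc L)"
  using L by (auto simp: lax_monoidal_def Let_def cell_defs)

context
  fixes x y X assumes x [simp]: "x \<in> One A" "Src A x = X" "Trg A x = Und (Lsrc L)"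
   and y [simp]: "y \<in> One A" "Src A y = X" "Trg A y = Und (Lsrc L)"
begin

lemma phi_mem [simp]: "at2 A (Lphi L) x y \<in> Two A" "Dom A (at2 A (Lphi L) x y) = ten1 A (Ltrg L) (Lcell L \<odot> x) (Lcell L \<odot> y)"
   "Cod A (at2 A (Lphi L) x y) = Lcell L \<odot> ten1 A (Lsrc L) x y"
  by (simp_all add: at2_def)

lemma phi_pre [simp]: "h \<in> One A \<Longrightarrow> Trg A h = X \<Longrightarrow> at2 A (Lphi L) x y \<lhd> h = at2 A (Lphi L) (x \<odot> h) (y \<odot> h)"
  by (simp add: at2_def)

end

lemma phi_assoc_el:
  assumes x [simp]: "x \<in> One A" "Src A x = X" "Trg A x = Und (Lsrc L)"
   and y [simp]: "y \<in> One A" "Src A y = X" "Trg A y = Und (Lsrc L)"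
   and z [simp]: "z \<in> One A" "Src A z = X" "Trg A z = Und (Lsrc L)"
  shows "(Lcell L \<rhd> at3 A (Asc (Lsrc L)) x y z) \<cdot> at2 A (Lphi L) x (ten1 A (Lsrc L) y z) \<cdot> ten2 A (Ltrg L) (Id2 A (Lcell L \<odot> x)) (at2 A (Lphi L) y z) =
   at2 A (Lphi L) (ten1 A (Lsrc L) x y) z \<cdot> ten2 A (Ltrg L) (at2 A (Lphi L) x y) (Id2 A (Lcell L \<odot> z)) \<cdot>
          at3 A (Asc (Ltrg L)) (Lcell L \<odot> x) (Lcell L \<odot> y) (Lcell L \<odot> z)"
proof -
  let ?C = "Und (Lsrc L)" let ?x = "proj3_1 A ?C" let ?y = "proj3_2 A ?C" let ?z = "proj3_3 A ?C"
  have "(Lcell L \<rhd> at3 A (Asc (Lsrc L)) ?x ?y ?z) \<cdot> at2 A (Lphi L) ?x (ten1 A (Lsrc L) ?y ?z) \<cdot> ten2 A (Ltrg L) (Id2 A (Lcell L \<odot> ?x)) (at2 A (Lphi L) ?y ?z) =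
   at2 A (Lphi L) (ten1 A (Lsrc L) ?x ?y) ?z \<cdot> ten2 A (Ltrg L) (at2 A (Lphi L) ?x ?y) (Id2 A (Lcell L \<odot> ?z)) \<cdot>
          at3 A (Asc (Ltrg L)) (Lcell L \<odot> ?x) (Lcell L \<odot> ?y) (Lcell L \<odot> ?z)"
    using L by (simp only: lax_monoidal_def Let_def)
  from arg_cong[OF this, of "\<lambda>s. s \<lhd> pair1 A x (pair1 A y z)"] show ?thesis by simp
qed

context
  fixes x X assumes x [simp]: "x \<in> One A" "Src A x = X" "Trg A x = Und (Lsrc L)"
begin

lemma phi_lun_el:
  "(Lcell L \<rhd> (Lun (Lsrc L) \<lhd> x)) \<cdot> at2 A (Lphi L) (unit_at A (Lsrc L) X) x \<cdot> ten2 A (Ltrg L) (Lphi0 L \<lhd> bang A X) (Id2 A (Lcell L \<odot> x))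
    = Lun (Ltrg L) \<lhd> (Lcell L \<odot> x)"
proof -
  let ?C = "Und (Lsrc L)"
  have [simp]: "X \<in> Zero A" using boundary_mem(1)[OF x(1)] by simp
  have "(Lcell L \<rhd> Lun (Lsrc L)) \<cdot> at2 A (Lphi L) (unit_at A (Lsrc L) ?C) (Id1 A ?C) \<cdot> ten2 A (Ltrg L) (Lphi0 L \<lhd> bang A ?C) (Id2 A (Lcell L))
    = Lun (Ltrg L) \<lhd> Lcell L"
    using L by (simp only: lax_monoidal_def Let_def)
  from arg_cong[OF this, of "\<lambda>s. s \<lhd> x"] show ?thesis by (simp add: Lun_mem)
qed

lemma phi_run_el:
  "(Lcell L \<rhd> (Run (Lsrc L) \<lhd> x)) \<cdot> at2 A (Lphi L) x (unit_at A (Lsrc L) X) \<cdot> ten2 A (Ltrg L) (Id2 A (Lcell L \<odot> x)) (Lphi0 L \<lhd> bang A X)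
    = Run (Ltrg L) \<lhd> (Lcell L \<odot> x)"
proof -
  let ?C = "Und (Lsrc L)"
  have [simp]: "X \<in> Zero A" using boundary_mem(1)[OF x(1)] by simp
  have "(Lcell L \<rhd> Run (Lsrc L)) \<cdot> at2 A (Lphi L) (Id1 A ?C) (unit_at A (Lsrc L) ?C) \<cdot> ten2 A (Ltrg L) (Id2 A (Lcell L)) (Lphi0 L \<lhd> bang A ?C)
    = Run (Ltrg L) \<lhd> Lcell L"
    using L by (simp only: lax_monoidal_def Let_def)
  from arg_cong[OF this, of "\<lambda>s. s \<lhd> x"] show ?thesis by (simp add: Run_mem)
qed

end

lemma Lphi_at2 [simp]: "at2 A (Lphi L) (Pr1 A (Und (Lsrc L)) (Und (Lsrc L))) (Pr2 A (Und (Lsrc L)) (Und (Lsrc L))) = Lphi L"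
  by (simp add: at2_def)

lemma phi_nat_el:
  assumes "s \<in> Two A" "t \<in> Two A" "Src A (Dom A t) = Src A (Dom A s)" "Trg A (Dom A s) = Und (Lsrc L)" "Trg A (Dom A t) = Und (Lsrc L)"
  shows "at2 A (Lphi L) (Cod A s) (Cod A t) \<cdot> ten2 A (Ltrg L) (Lcell L \<rhd> s) (Lcell L \<rhd> t) =
    (Lcell L \<rhd> ten2 A (Lsrc L) s t) \<cdot> at2 A (Lphi L) (Dom A s) (Dom A t)"
  using whisker_exchange[of "pair2 A s t" "Lphi L"] assms by (simp add: at2_def)

end

lemma lax_id_lax: assumes [simp]: "monoidal_object A M" shows "lax_monoidal A (lax_id A M)"
  by (simp add: lax_monoidal_def lax_id_def Let_def cell_defs at2_def Lun_mem Run_mem)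

lemma lax_comp_simps [simp]: "Lsrc (lax_comp A G F) = Lsrc F" "Ltrg (lax_comp A G F) = Ltrg G"
  "Lcell (lax_comp A G F) = Lcell G \<odot> Lcell F"
  by (simp_all add: lax_comp_def Let_def)

lemma lax_comp_phi0: "Lphi0 (lax_comp A G F) = (Lcell G \<rhd> Lphi0 F) \<cdot> Lphi0 G"
  by (simp add: lax_comp_def Let_def)

context
  fixes G F assumes F [simp]: "lax_monoidal A F" and G [simp]: "lax_monoidal A G" and FG [simp]: "Lsrc G = Ltrg F"
begin

lemma lax_comp_phi_mem [simp]: "Lphi (lax_comp A G F) \<in> Two A"
  "Dom A (Lphi (lax_comp A G F)) = ten1 A (Ltrg G) (Lcell G \<odot> Lcell F \<odot> Pr1 A (Und (Lsrc F)) (Und (Lsrc F))) (Lcell G \<odot> Lcell F \<odot> Pr2 A (Und (Lsrc F)) (Und (Lsrc F)))"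
  "Cod A (Lphi (lax_comp A G F)) = Lcell G \<odot> Lcell F \<odot> Ten (Lsrc F)"
  by (simp_all add: lax_comp_def Let_def)

lemma lax_comp_phi_at: 
  assumes [simp]: "x \<in> One A" "y \<in> One A" "Src A y = Src A x" "Trg A x = Und (Lsrc F)" "Trg A y = Und (Lsrc F)"
  shows "at2 A (Lphi (lax_comp A G F)) x y = (Lcell G \<rhd> at2 A (Lphi F) x y) \<cdot> at2 A (Lphi G) (Lcell F \<odot> x) (Lcell F \<odot> y)"
  by (simp add: at2_def[of _ _ x y] lax_comp_def Let_def)

lemma lax_comp_assoc:
  assumes x [simp]: "x \<in> One A" "Src A x = X" "Trg A x = Und (Lsrc F)"
   and y [simp]: "y \<in> One A" "Src A y = X" "Trg A y = Und (Lsrc F)"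
   and z [simp]: "z \<in> One A" "Src A z = X" "Trg A z = Und (Lsrc F)"
  shows "((Lcell G \<odot> Lcell F) \<rhd> at3 A (Asc (Lsrc F)) x y z) \<cdot> at2 A (Lphi (lax_comp A G F)) x (ten1 A (Lsrc F) y z) \<cdot> ten2 A (Ltrg G) (Id2 A ((Lcell G \<odot> Lcell F) \<odot> x)) (at2 A (Lphi (lax_comp A G F)) y z) =
   at2 A (Lphi (lax_comp A G F)) (ten1 A (Lsrc F) x y) z \<cdot> ten2 A (Ltrg G) (at2 A (Lphi (lax_comp A G F)) x y) (Id2 A ((Lcell G \<odot> Lcell F) \<odot> z)) \<cdot>
          at3 A (Asc (Ltrg G)) ((Lcell G \<odot> Lcell F) \<odot> x) ((Lcell G \<odot> Lcell F) \<odot> y) ((Lcell G \<odot> Lcell F) \<odot> z)"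
    (is "?L = ?R")
proof -
  let ?F = "Lcell F" let ?G = "Lcell G" let ?f = "at2 A (Lphi F)" let ?g = "at2 A (Lphi G)"
  let ?tM = "ten1 A (Lsrc F)" let ?tN = "ten1 A (Ltrg F)" let ?TN = "ten2 A (Ltrg F)" let ?TP = "ten2 A (Ltrg G)"
  have n1: "?g (?F \<odot> x) (?F \<odot> ?tM y z) \<cdot> ?TP (Id2 A (?G \<odot> ?F \<odot> x)) (?G \<rhd> ?f y z) = (?G \<rhd> ?TN (Id2 A (?F \<odot> x)) (?f y z)) \<cdot> ?g (?F \<odot> x) (?tN (?F \<odot> y) (?F \<odot> z))"
    using phi_nat_el[OF G, of "Id2 A (?F \<odot> x)" "?f y z"] by simp
  have n2: "?g (?F \<odot> ?tM x y) (?F \<odot> z) \<cdot> ?TP (?G \<rhd> ?f x y) (Id2 A (?G \<odot> ?F \<odot> z)) = (?G \<rhd> ?TN (?f x y) (Id2 A (?F \<odot> z))) \<cdot> ?g (?tN (?F \<odot> x) (?F \<odot> y)) (?F \<odot> z)"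
    using phi_nat_el[OF G, of "?f x y" "Id2 A (?F \<odot> z)"] by simp
  have t: "?TP (Id2 A (?G \<odot> ?F \<odot> x)) ((?G \<rhd> ?f y z) \<cdot> ?g (?F \<odot> y) (?F \<odot> z)) =
      ?TP (Id2 A (?G \<odot> ?F \<odot> x)) (?G \<rhd> ?f y z) \<cdot> ?TP (Id2 A (?G \<odot> ?F \<odot> x)) (?g (?F \<odot> y) (?F \<odot> z))"
    "?TP ((?G \<rhd> ?f x y) \<cdot> ?g (?F \<odot> x) (?F \<odot> y)) (Id2 A (?G \<odot> ?F \<odot> z)) =
      ?TP (?G \<rhd> ?f x y) (Id2 A (?G \<odot> ?F \<odot> z)) \<cdot> ?TP (?g (?F \<odot> x) (?F \<odot> y)) (Id2 A (?G \<odot> ?F \<odot> z))"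
    by simp_all
  have A: "(?G \<rhd> ?F \<rhd> at3 A (Asc (Lsrc F)) x y z) \<cdot> (?G \<rhd> ?f x (?tM y z)) \<cdot> (?G \<rhd> ?TN (Id2 A (?F \<odot> x)) (?f y z)) =
     (?G \<rhd> (?f (?tM x y) z)) \<cdot> (?G \<rhd> ?TN (?f x y) (Id2 A (?F \<odot> z))) \<cdot> (?G \<rhd> at3 A (Asc (Ltrg F)) (?F \<odot> x) (?F \<odot> y) (?F \<odot> z))"
    using arg_cong[OF phi_assoc_el[OF F x y z], of "\<lambda>s. ?G \<rhd> s"] by simp
  have p: "(?G \<odot> ?F) \<rhd> at3 A (Asc (Lsrc F)) x y z = ?G \<rhd> ?F \<rhd> at3 A (Asc (Lsrc F)) x y z"
    "(?G \<odot> ?F) \<odot> x = ?G \<odot> ?F \<odot> x" "(?G \<odot> ?F) \<odot> y = ?G \<odot> ?F \<odot> y" "(?G \<odot> ?F) \<odot> z = ?G \<odot> ?F \<odot> z"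
    "at2 A (Lphi (lax_comp A G F)) x y = (?G \<rhd> ?f x y) \<cdot> ?g (?F \<odot> x) (?F \<odot> y)"
    "at2 A (Lphi (lax_comp A G F)) y z = (?G \<rhd> ?f y z) \<cdot> ?g (?F \<odot> y) (?F \<odot> z)"
    "at2 A (Lphi (lax_comp A G F)) x (?tM y z) = (?G \<rhd> ?f x (?tM y z)) \<cdot> ?g (?F \<odot> x) (?F \<odot> ?tM y z)"
    "at2 A (Lphi (lax_comp A G F)) (?tM x y) z = (?G \<rhd> ?f (?tM x y) z) \<cdot> ?g (?F \<odot> ?tM x y) (?F \<odot> z)"
    by (simp_all add: lax_comp_phi_at)
  show ?thesis unfolding p t
    by (rule paste_assoc[OF _ _ _ _ _ _ _ _ _ _ _ _ _ _ _ n1 A _ n2[symmetric]])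
      (simp_all only: cell_defs, use phi_assoc_el[OF G, of "?F \<odot> x" X "?F \<odot> y" "?F \<odot> z"] in simp_all)
qed

lemma lax_comp_lun:
  "((Lcell G \<odot> Lcell F) \<rhd> Lun (Lsrc F)) \<cdot> at2 A (Lphi (lax_comp A G F)) (unit_at A (Lsrc F) (Und (Lsrc F))) (Id1 A (Und (Lsrc F))) \<cdot>
     ten2 A (Ltrg G) (Lphi0 (lax_comp A G F) \<lhd> bang A (Und (Lsrc F))) (Id2 A (Lcell G \<odot> Lcell F)) = Lun (Ltrg G) \<lhd> (Lcell G \<odot> Lcell F)"
    (is "?L = ?R")
proof -
  let ?F = "Lcell F" let ?G = "Lcell G" let ?f = "at2 A (Lphi F)" let ?g = "at2 A (Lphi G)" let ?C = "Und (Lsrc F)"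
  let ?I = "unit_at A (Lsrc F) ?C" let ?TN = "ten2 A (Ltrg F)" let ?TP = "ten2 A (Ltrg G)" let ?b = "bang A ?C"
  note [simp] = Lun_mem
  have n: "?g (?F \<odot> ?I) ?F \<cdot> ?TP (?G \<rhd> (Lphi0 F \<lhd> ?b)) (Id2 A (?G \<odot> ?F)) = (?G \<rhd> ?TN (Lphi0 F \<lhd> ?b) (Id2 A ?F)) \<cdot> ?g (unit_at A (Ltrg F) ?C) ?F"
    using phi_nat_el[OF G, of "Lphi0 F \<lhd> ?b" "Id2 A ?F"] by simp
  have t: "?TP ((?G \<rhd> (Lphi0 F \<lhd> ?b)) \<cdot> (Lphi0 G \<lhd> ?b)) (Id2 A (?G \<odot> ?F)) = ?TP (?G \<rhd> (Lphi0 F \<lhd> ?b)) (Id2 A (?G \<odot> ?F)) \<cdot> ?TP (Lphi0 G \<lhd> ?b) (Id2 A (?G \<odot> ?F))"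
    by simp
  have A: "(?G \<rhd> ?F \<rhd> Lun (Lsrc F)) \<cdot> (?G \<rhd> ?f ?I (Id1 A ?C)) \<cdot> (?G \<rhd> ?TN (Lphi0 F \<lhd> ?b) (Id2 A ?F)) = ?G \<rhd> (Lun (Ltrg F) \<lhd> ?F)"
    using arg_cong[OF phi_lun_el[OF F, of "Id1 A ?C" ?C], of "\<lambda>s. ?G \<rhd> s"] by simp
  have p: "(?G \<odot> ?F) \<rhd> Lun (Lsrc F) = ?G \<rhd> ?F \<rhd> Lun (Lsrc F)"
    "at2 A (Lphi (lax_comp A G F)) ?I (Id1 A ?C) = (?G \<rhd> ?f ?I (Id1 A ?C)) \<cdot> ?g (?F \<odot> ?I) ?F"
    "Lphi0 (lax_comp A G F) \<lhd> ?b = (?G \<rhd> (Lphi0 F \<lhd> ?b)) \<cdot> (Lphi0 G \<lhd> ?b)"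
    by (simp_all add: lax_comp_phi_at lax_comp_phi0)
  show ?thesis unfolding p t
    by (rule paste_unit[OF _ _ _ _ _ _ _ _ n A])
      (simp_all only: cell_defs, use phi_lun_el[OF G, of ?F ?C] in simp_all)
qed

lemma lax_comp_run:
  "((Lcell G \<odot> Lcell F) \<rhd> Run (Lsrc F)) \<cdot> at2 A (Lphi (lax_comp A G F)) (Id1 A (Und (Lsrc F))) (unit_at A (Lsrc F) (Und (Lsrc F))) \<cdot>
     ten2 A (Ltrg G) (Id2 A (Lcell G \<odot> Lcell F)) (Lphi0 (lax_comp A G F) \<lhd> bang A (Und (Lsrc F))) = Run (Ltrg G) \<lhd> (Lcell G \<odot> Lcell F)"
    (is "?L = ?R")
proof -
  let ?F = "Lcell F" let ?G = "Lcell G" let ?f = "at2 A (Lphi F)" let ?g = "at2 A (Lphi G)" let ?C = "Und (Lsrc F)"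
  let ?I = "unit_at A (Lsrc F) ?C" let ?TN = "ten2 A (Ltrg F)" let ?TP = "ten2 A (Ltrg G)" let ?b = "bang A ?C"
  note [simp] = Run_mem
  have n: "?g ?F (?F \<odot> ?I) \<cdot> ?TP (Id2 A (?G \<odot> ?F)) (?G \<rhd> (Lphi0 F \<lhd> ?b)) = (?G \<rhd> ?TN (Id2 A ?F) (Lphi0 F \<lhd> ?b)) \<cdot> ?g ?F (unit_at A (Ltrg F) ?C)"
    using phi_nat_el[OF G, of "Id2 A ?F" "Lphi0 F \<lhd> ?b"] by simp
  have t: "?TP (Id2 A (?G \<odot> ?F)) ((?G \<rhd> (Lphi0 F \<lhd> ?b)) \<cdot> (Lphi0 G \<lhd> ?b)) = ?TP (Id2 A (?G \<odot> ?F)) (?G \<rhd> (Lphi0 F \<lhd> ?b)) \<cdot> ?TP (Id2 A (?G \<odot> ?F)) (Lphi0 G \<lhd> ?b)"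
    by simp
  have A: "(?G \<rhd> ?F \<rhd> Run (Lsrc F)) \<cdot> (?G \<rhd> ?f (Id1 A ?C) ?I) \<cdot> (?G \<rhd> ?TN (Id2 A ?F) (Lphi0 F \<lhd> ?b)) = ?G \<rhd> (Run (Ltrg F) \<lhd> ?F)"
    using arg_cong[OF phi_run_el[OF F, of "Id1 A ?C" ?C], of "\<lambda>s. ?G \<rhd> s"] by simp
  have p: "(?G \<odot> ?F) \<rhd> Run (Lsrc F) = ?G \<rhd> ?F \<rhd> Run (Lsrc F)"
    "at2 A (Lphi (lax_comp A G F)) (Id1 A ?C) ?I = (?G \<rhd> ?f (Id1 A ?C) ?I) \<cdot> ?g ?F (?F \<odot> ?I)"
    "Lphi0 (lax_comp A G F) \<lhd> ?b = (?G \<rhd> (Lphi0 F \<lhd> ?b)) \<cdot> (Lphi0 G \<lhd> ?b)"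
    by (simp_all add: lax_comp_phi_at lax_comp_phi0)
  show ?thesis unfolding p t
    by (rule paste_unit[OF _ _ _ _ _ _ _ _ n A])
      (simp_all only: cell_defs, use phi_run_el[OF G, of ?F ?C] in simp_all)
qed

lemma lax_comp_lax: "lax_monoidal A (lax_comp A G F)"
proof -
  let ?C = "Und (Lsrc F)"
  note lax_comp_assoc[of "proj3_1 A ?C" "Prod A ?C (Prod A ?C ?C)" "proj3_2 A ?C" "proj3_3 A ?C"]
  moreover have "Lphi0 (lax_comp A G F) \<in> Two A" "Dom A (Lphi0 (lax_comp A G F)) = Unt (Ltrg G)"
    "Cod A (Lphi0 (lax_comp A G F)) = (Lcell G \<odot> Lcell F) \<odot> Unt (Lsrc F)" by (simp_all add: lax_comp_phi0)
  ultimately show ?thesis using lax_comp_lun lax_comp_run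
    unfolding lax_monoidal_def Let_def cell_defs lax_comp_simps by simp
qed

end

end

section \<open>The 2-category of monoidal objects\<close>

context fp_two_category
begin

context
  fixes S :: "('o, 'a, 't) mon_two_data" assumes S: "monoidal_two_cell A S"
begin

lemma mon2_mem [simp]: "lax_monoidal A (Mdom S)" "lax_monoidal A (Mcod S)"
  "Lsrc (Mcod S) = Lsrc (Mdom S)" "Ltrg (Mcod S) = Ltrg (Mdom S)"
  "Mcell S \<in> Two A" "Dom A (Mcell S) = Lcell (Mdom S)" "Cod A (Mcell S) = Lcell (Mcod S)"
  using S by (auto simp: monoidal_two_cell_def Let_def cell_defs)

lemma mon2_unit: "(Mcell S \<lhd> Unt (Lsrc (Mdom S))) \<cdot> Lphi0 (Mdom S) = Lphi0 (Mcod S)"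
  using S by (simp add: monoidal_two_cell_def Let_def)

lemma mon2_tensor:
  assumes [simp]: "x \<in> One A" "y \<in> One A" "Src A y = Src A x" "Trg A x = Und (Lsrc (Mdom S))" "Trg A y = Und (Lsrc (Mdom S))"
  shows "(Mcell S \<lhd> ten1 A (Lsrc (Mdom S)) x y) \<cdot> at2 A (Lphi (Mdom S)) x y =
    at2 A (Lphi (Mcod S)) x y \<cdot> ten2 A (Ltrg (Mdom S)) (Mcell S \<lhd> x) (Mcell S \<lhd> y)"
proof -
  let ?C = "Und (Lsrc (Mdom S))"
  have "(Mcell S \<lhd> ten1 A (Lsrc (Mdom S)) (Pr1 A ?C ?C) (Pr2 A ?C ?C)) \<cdot> Lphi (Mdom S) =
    Lphi (Mcod S) \<cdot> ten2 A (Ltrg (Mdom S)) (Mcell S \<lhd> Pr1 A ?C ?C) (Mcell S \<lhd> Pr2 A ?C ?C)"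
    using S by (simp only: monoidal_two_cell_def Let_def)
  from arg_cong[OF this, of "\<lambda>s. s \<lhd> pair1 A x y"] show ?thesis by (simp add: at2_def)
qed

end

lemma monoidal_two_cellI:
  assumes "lax_monoidal A F" "lax_monoidal A G" "Lsrc G = Lsrc F" "Ltrg G = Ltrg F"
    "t \<in> Two A" "Dom A t = Lcell F" "Cod A t = Lcell G"
    "(t \<lhd> Ten (Lsrc F)) \<cdot> Lphi F = Lphi G \<cdot> ten2 A (Ltrg F) (t \<lhd> Pr1 A (Und (Lsrc F)) (Und (Lsrc F))) (t \<lhd> Pr2 A (Und (Lsrc F)) (Und (Lsrc F)))"
    "(t \<lhd> Unt (Lsrc F)) \<cdot> Lphi0 F = Lphi0 G"
  shows "monoidal_two_cell A \<lparr>Mdom = F, Mcod = G, Mcell = t\<rparr>"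
  using assms by (simp add: monoidal_two_cell_def Let_def cell_defs)

lemma mon2_Id2: "lax_monoidal A F \<Longrightarrow> monoidal_two_cell A \<lparr>Mdom = F, Mcod = F, Mcell = Id2 A (Lcell F)\<rparr>"
  by (rule monoidal_two_cellI) simp_all

lemma mon2_tensor_Pr:
  assumes "monoidal_two_cell A S"
  shows "(Mcell S \<lhd> Ten (Lsrc (Mdom S))) \<cdot> Lphi (Mdom S) = Lphi (Mcod S) \<cdot> ten2 A (Ltrg (Mdom S))
     (Mcell S \<lhd> Pr1 A (Und (Lsrc (Mdom S))) (Und (Lsrc (Mdom S)))) (Mcell S \<lhd> Pr2 A (Und (Lsrc (Mdom S))) (Und (Lsrc (Mdom S))))"
proof -
  note [simp] = assms
  have "Lphi (Mcod S) = at2 A (Lphi (Mcod S)) (Pr1 A (Und (Lsrc (Mdom S))) (Und (Lsrc (Mdom S)))) (Pr2 A (Und (Lsrc (Mdom S))) (Und (Lsrc (Mdom S))))"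
    using Lphi_at2[of "Mcod S"] by simp
  then show ?thesis
    using mon2_tensor[OF assms, of "Pr1 A (Und (Lsrc (Mdom S))) (Und (Lsrc (Mdom S)))" "Pr2 A (Und (Lsrc (Mdom S))) (Und (Lsrc (Mdom S)))"] by simp
qed

lemma mon2_vcomp:
  assumes S: "monoidal_two_cell A S" and T: "monoidal_two_cell A T" and ST: "Mdom T = Mcod S"
  shows "monoidal_two_cell A \<lparr>Mdom = Mdom S, Mcod = Mcod T, Mcell = Mcell T \<cdot> Mcell S\<rparr>"
proof (rule monoidal_two_cellI)
  note [simp] = S T ST mon2_mem(2-7)[OF T, unfolded ST]
  let ?M = "Lsrc (Mdom S)" let ?C = "Und ?M" let ?x = "Pr1 A ?C ?C" let ?y = "Pr2 A ?C ?C" let ?t = "ten2 A (Ltrg (Mdom S))"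
  have 1: "(Mcell T \<lhd> Ten ?M) \<cdot> Lphi (Mcod S) = Lphi (Mcod T) \<cdot> ?t (Mcell T \<lhd> ?x) (Mcell T \<lhd> ?y)"
    using mon2_tensor_Pr[OF T] by simp
  have "((Mcell T \<cdot> Mcell S) \<lhd> Ten ?M) \<cdot> Lphi (Mdom S) = (Mcell T \<lhd> Ten ?M) \<cdot> ((Mcell S \<lhd> Ten ?M) \<cdot> Lphi (Mdom S))"
    by simp
  also have "\<dots> = ((Mcell T \<lhd> Ten ?M) \<cdot> Lphi (Mcod S)) \<cdot> ?t (Mcell S \<lhd> ?x) (Mcell S \<lhd> ?y)"
    unfolding mon2_tensor_Pr[OF S] by simp
  also have "\<dots> = Lphi (Mcod T) \<cdot> ?t ((Mcell T \<cdot> Mcell S) \<lhd> ?x) ((Mcell T \<cdot> Mcell S) \<lhd> ?y)"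
    unfolding 1 by simp
  finally show "((Mcell T \<cdot> Mcell S) \<lhd> Ten ?M) \<cdot> Lphi (Mdom S) = \<dots>" .
  have "((Mcell T \<cdot> Mcell S) \<lhd> Unt ?M) \<cdot> Lphi0 (Mdom S) = (Mcell T \<lhd> Unt ?M) \<cdot> ((Mcell S \<lhd> Unt ?M) \<cdot> Lphi0 (Mdom S))"
    by simp
  then show "((Mcell T \<cdot> Mcell S) \<lhd> Unt ?M) \<cdot> Lphi0 (Mdom S) = Lphi0 (Mcod T)"
    using mon2_unit[OF T] by (simp add: mon2_unit[OF S])
  show "lax_monoidal A (Mcod T)" by (simp only: mon2_mem T)
qed (use mon2_mem[OF S] mon2_mem[OF T] ST in \<open>simp_all\<close>)

lemma mon2_post:
  assumes S [simp]: "monoidal_two_cell A S" and G [simp]: "lax_monoidal A G" "Lsrc G = Ltrg (Mdom S)"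
  shows "monoidal_two_cell A \<lparr>Mdom = lax_comp A G (Mdom S), Mcod = lax_comp A G (Mcod S), Mcell = Lcell G \<rhd> Mcell S\<rparr>"
proof (rule monoidal_two_cellI)
  let ?F = "Mdom S" let ?H = "Mcod S" let ?s = "Mcell S"
  let ?M = "Lsrc ?F" let ?C = "Und ?M" let ?x = "Pr1 A ?C ?C" let ?y = "Pr2 A ?C ?C" let ?t = "ten2 A (Ltrg ?F)"
  let ?G = "Lcell G" let ?g = "at2 A (Lphi G)" let ?T = "ten2 A (Ltrg G)"
  show "lax_monoidal A (lax_comp A G ?F)" by (rule lax_comp_lax) simp_all
  show "lax_monoidal A (lax_comp A G ?H)" by (rule lax_comp_lax) simp_all
  have 1: "?g (Lcell ?H \<odot> ?x) (Lcell ?H \<odot> ?y) \<cdot> ?T (?G \<rhd> (?s \<lhd> ?x)) (?G \<rhd> (?s \<lhd> ?y)) = (?G \<rhd> ?t (?s \<lhd> ?x) (?s \<lhd> ?y)) \<cdot> ?g (Lcell ?F \<odot> ?x) (Lcell ?F \<odot> ?y)"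
    using phi_nat_el[OF G(1), of "?s \<lhd> ?x" "?s \<lhd> ?y"] by simp
  have "((?G \<rhd> ?s) \<lhd> Ten ?M) \<cdot> Lphi (lax_comp A G ?F) = (?G \<rhd> ((?s \<lhd> Ten ?M) \<cdot> Lphi ?F)) \<cdot> ?g (Lcell ?F \<odot> ?x) (Lcell ?F \<odot> ?y)"
    by (simp add: lax_comp_def Let_def)
  also have "\<dots> = (?G \<rhd> Lphi ?H) \<cdot> ?g (Lcell ?H \<odot> ?x) (Lcell ?H \<odot> ?y) \<cdot> ?T (?G \<rhd> (?s \<lhd> ?x)) (?G \<rhd> (?s \<lhd> ?y))"
    unfolding mon2_tensor_Pr[OF S] 1 by simp
  also have "\<dots> = Lphi (lax_comp A G ?H) \<cdot> ?T ((?G \<rhd> ?s) \<lhd> ?x) ((?G \<rhd> ?s) \<lhd> ?y)"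
    by (simp add: lax_comp_def Let_def)
  finally show "((?G \<rhd> ?s) \<lhd> Ten (Lsrc (lax_comp A G ?F))) \<cdot> Lphi (lax_comp A G ?F) = Lphi (lax_comp A G ?H) \<cdot>
     ten2 A (Ltrg (lax_comp A G ?F)) ((?G \<rhd> ?s) \<lhd> Pr1 A (Und (Lsrc (lax_comp A G ?F))) (Und (Lsrc (lax_comp A G ?F)))) ((?G \<rhd> ?s) \<lhd> Pr2 A (Und (Lsrc (lax_comp A G ?F))) (Und (Lsrc (lax_comp A G ?F))))"
    by simp
  have "((?G \<rhd> ?s) \<lhd> Unt ?M) \<cdot> Lphi0 (lax_comp A G ?F) = (?G \<rhd> ((?s \<lhd> Unt ?M) \<cdot> Lphi0 ?F)) \<cdot> Lphi0 G"
    by (simp add: lax_comp_phi0)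
  then show "((?G \<rhd> ?s) \<lhd> Unt (Lsrc (lax_comp A G ?F))) \<cdot> Lphi0 (lax_comp A G ?F) = Lphi0 (lax_comp A G ?H)"
    unfolding mon2_unit[OF S] by (simp add: lax_comp_phi0)
qed simp_all

lemma mon2_pre:
  assumes S [simp]: "monoidal_two_cell A S" and F [simp]: "lax_monoidal A F" "Ltrg F = Lsrc (Mdom S)"
  shows "monoidal_two_cell A \<lparr>Mdom = lax_comp A (Mdom S) F, Mcod = lax_comp A (Mcod S) F, Mcell = Mcell S \<lhd> Lcell F\<rparr>"
proof (rule monoidal_two_cellI)
  let ?G = "Mdom S" let ?H = "Mcod S" let ?s = "Mcell S" let ?F = "Lcell F"
  let ?M = "Lsrc F" let ?C = "Und ?M" let ?x = "Pr1 A ?C ?C" let ?y = "Pr2 A ?C ?C" let ?t = "ten1 A (Ltrg F)"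
  let ?g = "at2 A (Lphi ?G)" let ?h = "at2 A (Lphi ?H)" let ?T = "ten2 A (Ltrg ?G)"
  have sh: "Lsrc ?H = Ltrg F" by simp
  show "lax_monoidal A (lax_comp A ?G F)" by (rule lax_comp_lax) simp_all
  show "lax_monoidal A (lax_comp A ?H F)" by (rule lax_comp_lax) simp_all
  have h [simp]: "?h (?F \<odot> ?x) (?F \<odot> ?y) \<in> Two A" "Dom A (?h (?F \<odot> ?x) (?F \<odot> ?y)) = ten1 A (Ltrg ?G) (Lcell ?H \<odot> ?F \<odot> ?x) (Lcell ?H \<odot> ?F \<odot> ?y)"
    "Cod A (?h (?F \<odot> ?x) (?F \<odot> ?y)) = Lcell ?H \<odot> ten1 A (Lsrc ?G) (?F \<odot> ?x) (?F \<odot> ?y)"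
    using phi_mem[of ?H "?F \<odot> ?x" "Prod A ?C ?C" "?F \<odot> ?y"] by simp_all
  have 1: "(?s \<lhd> (?F \<odot> Ten ?M)) \<cdot> (Lcell ?G \<rhd> Lphi F) = (Lcell ?H \<rhd> Lphi F) \<cdot> (?s \<lhd> ten1 A (Lsrc ?G) (?F \<odot> ?x) (?F \<odot> ?y))"
    using whisker_exchange[of "Lphi F" ?s] by simp
  have 2: "(?s \<lhd> ten1 A (Lsrc ?G) (?F \<odot> ?x) (?F \<odot> ?y)) \<cdot> ?g (?F \<odot> ?x) (?F \<odot> ?y) =
     ?h (?F \<odot> ?x) (?F \<odot> ?y) \<cdot> ?T (?s \<lhd> (?F \<odot> ?x)) (?s \<lhd> (?F \<odot> ?y))"
    using mon2_tensor[OF S, of "?F \<odot> ?x" "?F \<odot> ?y"] by simp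
  have "((?s \<lhd> ?F) \<lhd> Ten ?M) \<cdot> Lphi (lax_comp A ?G F) = ((?s \<lhd> (?F \<odot> Ten ?M)) \<cdot> (Lcell ?G \<rhd> Lphi F)) \<cdot> ?g (?F \<odot> ?x) (?F \<odot> ?y)"
    by (simp add: lax_comp_def Let_def)
  also have "\<dots> = (Lcell ?H \<rhd> Lphi F) \<cdot> ((?s \<lhd> ten1 A (Lsrc ?G) (?F \<odot> ?x) (?F \<odot> ?y)) \<cdot> ?g (?F \<odot> ?x) (?F \<odot> ?y))"
    unfolding 1 by simp
  also have "\<dots> = Lphi (lax_comp A ?H F) \<cdot> ?T ((?s \<lhd> ?F) \<lhd> ?x) ((?s \<lhd> ?F) \<lhd> ?y)"
    unfolding 2 by (simp add: lax_comp_def Let_def)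
  finally show "((?s \<lhd> ?F) \<lhd> Ten (Lsrc (lax_comp A ?G F))) \<cdot> Lphi (lax_comp A ?G F) = Lphi (lax_comp A ?H F) \<cdot>
     ten2 A (Ltrg (lax_comp A ?G F)) ((?s \<lhd> ?F) \<lhd> Pr1 A (Und (Lsrc (lax_comp A ?G F))) (Und (Lsrc (lax_comp A ?G F)))) ((?s \<lhd> ?F) \<lhd> Pr2 A (Und (Lsrc (lax_comp A ?G F))) (Und (Lsrc (lax_comp A ?G F))))"
    by simp
  have 3: "(?s \<lhd> (?F \<odot> Unt ?M)) \<cdot> (Lcell ?G \<rhd> Lphi0 F) = (Lcell ?H \<rhd> Lphi0 F) \<cdot> (?s \<lhd> Unt (Lsrc ?G))"
    using whisker_exchange[of "Lphi0 F" ?s] by simp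
  have h0 [simp]: "Lphi0 ?H \<in> Two A" "Dom A (Lphi0 ?H) = Unt (Ltrg ?G)" "Cod A (Lphi0 ?H) = Lcell ?H \<odot> Unt (Lsrc ?G)"
    using Lphi_mem[of ?H] by simp_all
  have "((?s \<lhd> ?F) \<lhd> Unt ?M) \<cdot> Lphi0 (lax_comp A ?G F) = ((?s \<lhd> (?F \<odot> Unt ?M)) \<cdot> (Lcell ?G \<rhd> Lphi0 F)) \<cdot> Lphi0 ?G"
    by (simp add: lax_comp_phi0)
  also have "\<dots> = (Lcell ?H \<rhd> Lphi0 F) \<cdot> ((?s \<lhd> Unt (Lsrc ?G)) \<cdot> Lphi0 ?G)" unfolding 3 by simp
  finally show "((?s \<lhd> ?F) \<lhd> Unt (Lsrc (lax_comp A ?G F))) \<cdot> Lphi0 (lax_comp A ?G F) = Lphi0 (lax_comp A ?H F)"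
    unfolding mon2_unit[OF S] by (simp add: lax_comp_phi0)
qed simp_all

lemma mon2_hcomp:
  assumes S [simp]: "monoidal_two_cell A S" and T [simp]: "monoidal_two_cell A T" and ST [simp]: "Lsrc (Mdom T) = Ltrg (Mdom S)"
  shows "monoidal_two_cell A \<lparr>Mdom = lax_comp A (Mdom T) (Mdom S), Mcod = lax_comp A (Mcod T) (Mcod S), Mcell = Mcell T \<star> Mcell S\<rparr>"
  using mon2_vcomp[OF mon2_post[OF S, of "Mdom T"] mon2_pre[OF T, of "Mcod S"]] by (simp add: hcomp_left)

lemma lax_comp_id: "lax_monoidal A F \<Longrightarrow> lax_comp A (lax_id A (Ltrg F)) F = F" "lax_monoidal A F \<Longrightarrow> lax_comp A F (lax_id A (Lsrc F)) = F"
  by (simp_all add: lax_comp_def lax_id_def Let_def at2_def)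

lemma lax_comp_assoc3:
  assumes [simp]: "lax_monoidal A F" "lax_monoidal A G" "lax_monoidal A H" "Lsrc G = Ltrg F" "Lsrc H = Ltrg G"
  shows "lax_comp A (lax_comp A H G) F = lax_comp A H (lax_comp A G F)"
proof -
  let ?C = "Und (Lsrc F)"
  have [simp]: "at2 A (Lphi (lax_comp A H G)) (Lcell F \<odot> Pr1 A ?C ?C) (Lcell F \<odot> Pr2 A ?C ?C) =
     (Lcell H \<rhd> at2 A (Lphi G) (Lcell F \<odot> Pr1 A ?C ?C) (Lcell F \<odot> Pr2 A ?C ?C)) \<cdot> at2 A (Lphi H) (Lcell G \<odot> Lcell F \<odot> Pr1 A ?C ?C) (Lcell G \<odot> Lcell F \<odot> Pr2 A ?C ?C)"
    by (rule lax_comp_phi_at) simp_all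
  show ?thesis
  proof (rule lax_data.equality)
    show "Lphi (lax_comp A (lax_comp A H G) F) = Lphi (lax_comp A H (lax_comp A G F))"
      unfolding lax_comp_def[of A "lax_comp A H G" F] lax_comp_def[of A H "lax_comp A G F"] Let_def lax_data.simps lax_comp_simps
      by (simp add: lax_comp_def[of A G F] Let_def)
    show "Lphi0 (lax_comp A (lax_comp A H G) F) = Lphi0 (lax_comp A H (lax_comp A G F))"
      by (simp add: lax_comp_phi0)
  qed simp_all
qed

lemma Mon_l_simps [simp]: "Zero (Mon_l A) = {M. monoidal_object A M}" "One (Mon_l A) = {F. lax_monoidal A F}"
  "Two (Mon_l A) = {S. monoidal_two_cell A S}" "Src (Mon_l A) = Lsrc" "Trg (Mon_l A) = Ltrg" "Dom (Mon_l A) = Mdom" "Cod (Mon_l A) = Mcod"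
  "Id1 (Mon_l A) = lax_id A" "Comp1 (Mon_l A) = lax_comp A"
  "Id2 (Mon_l A) F = \<lparr>Mdom = F, Mcod = F, Mcell = Id2 A (Lcell F)\<rparr>"
  "Vcomp (Mon_l A) T S = \<lparr>Mdom = Mdom S, Mcod = Mcod T, Mcell = Mcell T \<cdot> Mcell S\<rparr>"
  "Hcomp (Mon_l A) T S = \<lparr>Mdom = lax_comp A (Mdom T) (Mdom S), Mcod = lax_comp A (Mcod T) (Mcod S), Mcell = Mcell T \<star> Mcell S\<rparr>"
  by (simp_all add: Mon_l_def)

lemma lax_id_simps [simp]: "Lsrc (lax_id A M) = M" "Ltrg (lax_id A M) = M" "Lcell (lax_id A M) = Id1 A (Und M)"
  by (simp_all add: lax_id_def)

lemma two_category_Mon_l: "two_category (Mon_l A)"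
proof (unfold_locales, goal_cases)
  case 7 then show ?case by (auto simp: one_cell_def lax_id_lax)
next
  case 8 then show ?case by (auto simp: one_cell_def lax_comp_lax)
next
  case 9 then show ?case by (auto simp: one_cell_def lax_comp_id)
next
  case 10 then show ?case by (auto simp: one_cell_def lax_comp_id)
next
  case 11 then show ?case by (auto simp: one_cell_def lax_comp_assoc3)
next
  case 12 then show ?case by (auto simp: two_cell_def mon2_Id2)
next
  case 13 then show ?case by (auto simp: two_cell_def mon2_vcomp)
next
  case 14 then show ?case by (auto simp: two_cell_def)
next
  case 15 then show ?case by (auto simp: two_cell_def)
next
  case 16 then show ?case by (auto simp: two_cell_def intro!: vcomp_assoc')
next
  case 17 then show ?case by (auto simp: two_cell_def mon2_hcomp)
next
  case (18 s f g Y)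
  then have s: "monoidal_two_cell A s" "Mdom s = f" "Mcod s = g" "Ltrg f = Y" by (auto simp: two_cell_def)
  show ?case using s hcomp_id_left[of "Mcell s" "Lcell f" "Lcell g" "Und (Ltrg f)"] lax_comp_id(1)[of f] lax_comp_id(1)[of g]
    by (auto simp: two_cell_def intro!: mon_two_data.equality)
next
  case (19 s f g X)
  then have s: "monoidal_two_cell A s" "Mdom s = f" "Mcod s = g" "Lsrc f = X" by (auto simp: two_cell_def)
  show ?case using s hcomp_id_right[of "Mcell s" "Lcell f" "Lcell g" "Und (Lsrc f)"] lax_comp_id(2)[of f] lax_comp_id(2)[of g]
    by (auto simp: two_cell_def intro!: mon_two_data.equality)
next
  case (20 r f f' s g g' t h h')
  then have c: "monoidal_two_cell A r" "monoidal_two_cell A s" "monoidal_two_cell A t" "Mdom r = f" "Mcod r = f'"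
    "Mdom s = g" "Mcod s = g'" "Mdom t = h" "Mcod t = h'" "Ltrg f = Lsrc g" "Ltrg g = Lsrc h" by (auto simp: two_cell_def)
  note m = mon2_mem[OF c(1)] mon2_mem[OF c(2)] mon2_mem[OF c(3)]
  show ?case
    using c m by (auto intro!: hcomp_assoc' lax_comp_assoc3)
next
  case 21 then show ?case by (auto simp: one_cell_def hcomp_Id2)
next
  case (22 s f f' s' f'' t g g' t' g'')
  then have c: "monoidal_two_cell A s" "monoidal_two_cell A s'" "monoidal_two_cell A t" "monoidal_two_cell A t'"
     "Mdom s = f" "Mcod s = f'" "Mdom s' = f'" "Mcod s' = f''" "Mdom t = g" "Mcod t = g'" "Mdom t' = g'" "Mcod t' = g''"
     "Ltrg f = Lsrc g" by (auto simp: two_cell_def)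
  note m = mon2_mem[OF c(1)] mon2_mem[OF c(2)] mon2_mem[OF c(3)] mon2_mem[OF c(4)]
  show ?case using c m by (auto intro!: interchange')
qed (auto simp: two_cell_def)

end

section \<open>The adjunction of an Eilenberg--Moore object\<close>

context two_category
begin

context
  fixes T and E
  assumes T: "monad K T" and E: "em_object K T E"
begin

lemma em_lift1:
  assumes "subequalizing K T X w \<nu>" "X \<in> Zero K"
  shows "\<exists>!f. one_cell K f X (Eobj E) \<and> Eu E \<odot> f = w \<and> Ebeta E \<lhd> f = \<nu>"
proof -
  let ?P = "\<lambda>f. (Eu E \<odot> f, Ebeta E \<lhd> f)"
  have b: "bij_betw ?P {f. one_cell K f X (Eobj E)} {(w, \<nu>). subequalizing K T X w \<nu>}"
    using E assms(2) by (auto simp: em_object_def Let_def)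
  then have "(w, \<nu>) \<in> ?P ` {f. one_cell K f X (Eobj E)}" using assms(1) by (simp add: bij_betw_def)
  then obtain f where "one_cell K f X (Eobj E)" "?P f = (w, \<nu>)" by auto
  then show ?thesis using b unfolding bij_betw_def inj_on_def by (intro ex1I[of _ f]) auto
qed

lemma em_lift2:
  assumes "one_cell K f X (Eobj E)" "one_cell K g X (Eobj E)" "two_cell K s (Eu E \<odot> f) (Eu E \<odot> g)"
    "s \<cdot> (Ebeta E \<lhd> f) = (Ebeta E \<lhd> g) \<cdot> (Mend T \<rhd> s)"
  shows "\<exists>!t. two_cell K t f g \<and> Eu E \<rhd> t = s"
proof -
  have X: "X \<in> Zero K" using assms(1) by (auto simp: cell_defs)
  have b: "bij_betw (\<lambda>s. Eu E \<rhd> s) {s. two_cell K s f g} {s. subequalizing_mor K T (Eu E \<odot> f, Ebeta E \<lhd> f) (Eu E \<odot> g, Ebeta E \<lhd> g) s}"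
    using E X assms(1,2) unfolding em_object_def Let_def by blast
  moreover have "s \<in> {s. subequalizing_mor K T (Eu E \<odot> f, Ebeta E \<lhd> f) (Eu E \<odot> g, Ebeta E \<lhd> g) s}"
    using assms by (simp add: subequalizing_mor_def)
  ultimately have "s \<in> (\<lambda>s. Eu E \<rhd> s) ` {s. two_cell K s f g}" by (simp add: bij_betw_def)
  then obtain t where "two_cell K t f g" "Eu E \<rhd> t = s" by auto
  then show ?thesis using b unfolding bij_betw_def inj_on_def by (intro ex1I[of _ t]) auto
qed

lemma em_faithful:
  assumes "s \<in> Two K" "t \<in> Two K" "Dom K t = Dom K s" "Cod K t = Cod K s" "Trg K (Dom K s) = Eobj E" "Eu E \<rhd> s = Eu E \<rhd> t"
  shows "s = t"
proof -
  let ?X = "Src K (Dom K s)"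
  have X: "?X \<in> Zero K" using assms(1) by simp
  have o: "one_cell K (Dom K s) ?X (Eobj E)" "one_cell K (Cod K s) ?X (Eobj E)" using assms by (auto simp: cell_defs)
  have "bij_betw (\<lambda>s. Eu E \<rhd> s) {t. two_cell K t (Dom K s) (Cod K s)} {t. subequalizing_mor K T (Eu E \<odot> Dom K s, Ebeta E \<lhd> Dom K s) (Eu E \<odot> Cod K s, Ebeta E \<lhd> Cod K s) t}"
    using E X o unfolding em_object_def Let_def by blast
  then show ?thesis using assms unfolding bij_betw_def inj_on_def two_cell_def by auto
qed

lemma monad_mem [simp]: "Mobj T \<in> Zero K" "Mend T \<in> One K" "Src K (Mend T) = Mobj T" "Trg K (Mend T) = Mobj T"
   "Meta T \<in> Two K" "Dom K (Meta T) = Id1 K (Mobj T)" "Cod K (Meta T) = Mend T"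
   "Mmu T \<in> Two K" "Dom K (Mmu T) = Mend T \<odot> Mend T" "Cod K (Mmu T) = Mend T"
  using T by (auto simp: monad_def Let_def cell_defs)

lemma monad_eqs: "Mmu T \<cdot> (Mend T \<rhd> Meta T) = Id2 K (Mend T)" "Mmu T \<cdot> (Meta T \<lhd> Mend T) = Id2 K (Mend T)"
   "Mmu T \<cdot> (Mend T \<rhd> Mmu T) = Mmu T \<cdot> (Mmu T \<lhd> Mend T)"
  using T by (auto simp: monad_def Let_def)

lemma em_mem [simp]: "Eobj E \<in> Zero K" "Eu E \<in> One K" "Src K (Eu E) = Eobj E" "Trg K (Eu E) = Mobj T"
   "Ebeta E \<in> Two K" "Dom K (Ebeta E) = Mend T \<odot> Eu E" "Cod K (Ebeta E) = Eu E"
  using E by (auto simp: em_object_def subequalizing_def Let_def cell_defs)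

lemma em_eqs: "Ebeta E \<cdot> (Meta T \<lhd> Eu E) = Id2 K (Eu E)" "Ebeta E \<cdot> (Mend T \<rhd> Ebeta E) = Ebeta E \<cdot> (Mmu T \<lhd> Eu E)"
  using E by (auto simp: em_object_def subequalizing_def Let_def)

lemma em_free_props: "one_cell K (em_free K T E) (Mobj T) (Eobj E) \<and> Eu E \<odot> em_free K T E = Mend T \<and> Ebeta E \<lhd> em_free K T E = Mmu T"
  unfolding em_free_def
  by (rule theI'[OF em_lift1]) (simp_all add: subequalizing_def Let_def cell_defs monad_eqs)

lemma em_free_mem [simp]: "em_free K T E \<in> One K" "Src K (em_free K T E) = Mobj T" "Trg K (em_free K T E) = Eobj E"
  "Eu E \<odot> em_free K T E = Mend T" "Ebeta E \<lhd> em_free K T E = Mmu T"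
  using em_free_props by (auto simp: cell_defs)

lemma em_free_comp: "x \<in> One K \<Longrightarrow> Trg K x = Mobj T \<Longrightarrow> Eu E \<odot> em_free K T E \<odot> x = Mend T \<odot> x"
   "x \<in> One K \<Longrightarrow> Trg K x = Mobj T \<Longrightarrow> Ebeta E \<lhd> (em_free K T E \<odot> x) = Mmu T \<lhd> x"
proof -
  assume x: "x \<in> One K" "Trg K x = Mobj T"
  have "(Eu E \<odot> em_free K T E) \<odot> x = Eu E \<odot> em_free K T E \<odot> x" using x by (intro comp1_assoc') simp_all
  then show "Eu E \<odot> em_free K T E \<odot> x = Mend T \<odot> x" by simp
  have "(Ebeta E \<lhd> em_free K T E) \<lhd> x = Ebeta E \<lhd> (em_free K T E \<odot> x)" using x by (intro pre_pre) simp_all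
  then show "Ebeta E \<lhd> (em_free K T E \<odot> x) = Mmu T \<lhd> x" by simp
qed

lemma em_counit_props: "two_cell K (em_counit K T E) (em_free K T E \<odot> Eu E) (Id1 K (Eobj E)) \<and> Eu E \<rhd> em_counit K T E = Ebeta E"
  unfolding em_counit_def
proof (rule theI'[OF em_lift2])
  show "Ebeta E \<cdot> (Ebeta E \<lhd> (em_free K T E \<odot> Eu E)) = (Ebeta E \<lhd> Id1 K (Eobj E)) \<cdot> (Mend T \<rhd> Ebeta E)"
    using em_eqs(2) by (simp add: em_free_comp)
qed (simp_all add: cell_defs em_free_comp)

lemma em_counit_mem [simp]: "em_counit K T E \<in> Two K" "Dom K (em_counit K T E) = em_free K T E \<odot> Eu E"
   "Cod K (em_counit K T E) = Id1 K (Eobj E)" "Eu E \<rhd> em_counit K T E = Ebeta E"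
  using em_counit_props by (auto simp: cell_defs)

text \<open>The first triangle identity is tested after \<open>U\<close>, which is faithful on 2-cells; there it is a
  unit law of the monad. The second one is the unit law of \<open>\<beta>\<close>.\<close>

lemma em_adjunction: "adjunction K (em_free K T E) (Eu E) (Meta T) (em_counit K T E)"
proof -
  let ?F = "em_free K T E" let ?e = "em_counit K T E"
  have "(?e \<lhd> ?F) \<cdot> (?F \<rhd> Meta T) = Id2 K ?F"
  proof (rule em_faithful)
    have "Eu E \<rhd> ((?e \<lhd> ?F) \<cdot> (?F \<rhd> Meta T)) = (Eu E \<rhd> (?e \<lhd> ?F)) \<cdot> (Eu E \<rhd> ?F \<rhd> Meta T)"
      by (rule post_vcomp) simp_all
    also have "Eu E \<rhd> (?e \<lhd> ?F) = (Eu E \<rhd> ?e) \<lhd> ?F" by (rule post_pre[symmetric]) simp_all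
    also have "Eu E \<rhd> ?F \<rhd> Meta T = (Eu E \<odot> ?F) \<rhd> Meta T" by (rule post_post[symmetric]) simp_all
    also have "((Eu E \<rhd> ?e) \<lhd> ?F) \<cdot> ((Eu E \<odot> ?F) \<rhd> Meta T) = Id2 K (Mend T)" by (simp add: monad_eqs)
    finally show "Eu E \<rhd> ((?e \<lhd> ?F) \<cdot> (?F \<rhd> Meta T)) = Eu E \<rhd> Id2 K ?F" by simp
  qed simp_all
  then show ?thesis unfolding adjunction_def
    by (intro exI[of _ "Mobj T"] exI[of _ "Eobj E"]) (simp add: cell_defs em_eqs)
qed

end

end

section \<open>Reflexive coequalizers of 2-cells\<close>

context two_category
begin

lemma coequalizerD:
  assumes "coequalizer K X Y s t q"
  shows "s \<in> Two K" "t \<in> Two K" "q \<in> Two K" "Dom K t = Dom K s" "Cod K t = Cod K s" "Dom K q = Cod K s"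
    "Src K (Dom K s) = X" "Trg K (Dom K s) = Y" "q \<cdot> s = q \<cdot> t"
  using assms unfolding coequalizer_def cell_defs by auto

lemma coequalizer_univ:
  assumes "coequalizer K X Y s t q" "one_cell K k X Y" "two_cell K p (Cod K s) k" "p \<cdot> s = p \<cdot> t"
  shows "\<exists>!w. two_cell K w (Cod K q) k \<and> w \<cdot> q = p"
proof -
  obtain f g h where s: "two_cell K s f g" and q: "two_cell K q g h"
    and u: "\<forall>k p. one_cell K k X Y \<and> two_cell K p g k \<and> p \<cdot> s = p \<cdot> t \<longrightarrow> (\<exists>!w. two_cell K w h k \<and> w \<cdot> q = p)"
    using assms(1) unfolding coequalizer_def by (elim exE conjE)
  have "g = Cod K s" "h = Cod K q" using s q by (simp_all add: two_cell_def)
  with u[rule_format, of k p] assms(2-4) show ?thesis by simp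
qed

lemma coequalizer_factor:
  assumes "coequalizer K X Y s t q" "p \<in> Two K" "Dom K p = Cod K s" "p \<cdot> s = p \<cdot> t"
  shows "\<exists>w. w \<in> Two K \<and> Dom K w = Cod K q \<and> Cod K w = Cod K p \<and> w \<cdot> q = p"
proof -
  note c = coequalizerD[OF assms(1)]
  have 1: "one_cell K (Cod K p) X Y"  "two_cell K p (Cod K s) (Cod K p)"
    using assms(2,3) c by (simp_all add: cell_defs)
  from coequalizer_univ[OF assms(1) 1 assms(4)] show ?thesis by (auto simp: two_cell_def)
qed

lemma coequalizer_epi:
  assumes "coequalizer K X Y s t q" "v \<in> Two K" "w \<in> Two K" "Dom K v = Cod K q" "Dom K w = Cod K q" "v \<cdot> q = w \<cdot> q"
  shows "v = w"
proof -
  note c = coequalizerD[OF assms(1)]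
  have "Cod K (v \<cdot> q) = Cod K v" "Cod K (w \<cdot> q) = Cod K w" using assms(2-5) c by simp_all
  then have cod: "Cod K w = Cod K v" using assms(6) by metis
  have 1: "(v \<cdot> q) \<cdot> s = (v \<cdot> q) \<cdot> t" using c assms(2,4) by simp
  have 2: "one_cell K (Cod K v) X Y" "two_cell K (v \<cdot> q) (Cod K s) (Cod K v)"
    using assms(2,4) c boundary_mem(5,6)[OF assms(2)] by (simp_all add: cell_defs)
  have "two_cell K v (Cod K q) (Cod K v)" "two_cell K w (Cod K q) (Cod K v)" using assms cod by (simp_all add: cell_defs)
  with coequalizer_univ[OF assms(1) 2 1] assms(6) show ?thesis by metis
qed

lemma coequalizerI:
  assumes "s \<in> Two K" "t \<in> Two K" "q \<in> Two K" "Dom K t = Dom K s" "Cod K t = Cod K s" "Dom K q = Cod K s"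
    "Src K (Dom K s) = X" "Trg K (Dom K s) = Y" "q \<cdot> s = q \<cdot> t"
    and "\<And>p. p \<in> Two K \<Longrightarrow> Dom K p = Cod K s \<Longrightarrow> p \<cdot> s = p \<cdot> t \<Longrightarrow> \<exists>w. w \<in> Two K \<and> Dom K w = Cod K q \<and> Cod K w = Cod K p \<and> w \<cdot> q = p"
    and "\<And>v w. v \<in> Two K \<Longrightarrow> w \<in> Two K \<Longrightarrow> Dom K v = Cod K q \<Longrightarrow> Dom K w = Cod K q \<Longrightarrow> v \<cdot> q = w \<cdot> q \<Longrightarrow> v = w"
  shows "coequalizer K X Y s t q"
  unfolding coequalizer_def
proof (rule exI[of _ "Dom K s"], rule exI[of _ "Cod K s"], rule exI[of _ "Cod K q"], intro conjI allI impI)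
  fix k p assume "one_cell K k X Y \<and> two_cell K p (Cod K s) k \<and> p \<cdot> s = p \<cdot> t"
  then have p: "p \<in> Two K" "Dom K p = Cod K s" "Cod K p = k" "p \<cdot> s = p \<cdot> t" by (auto simp: cell_defs)
  obtain w where "w \<in> Two K" "Dom K w = Cod K q" "Cod K w = Cod K p" "w \<cdot> q = p" using assms(10)[OF p(1,2,4)] by blast
  with p assms(11) show "\<exists>!w. two_cell K w (Cod K q) k \<and> w \<cdot> q = p" by (intro ex1I[of _ w]) (auto simp: cell_defs)
qed (use assms boundary_mem(5,6)[OF assms(1)] boundary_mem(5,6)[OF assms(3)] in \<open>simp_all add: cell_defs\<close>)

lemma coequalizer_Id2: "f \<in> One K \<Longrightarrow> coequalizer K (Src K f) (Trg K f) (Id2 K f) (Id2 K f) (Id2 K f)"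
  by (rule coequalizerI) auto

lemma reflexive_pairI: "s \<in> Two K \<Longrightarrow> t \<in> Two K \<Longrightarrow> r \<in> Two K \<Longrightarrow> Dom K t = Dom K s \<Longrightarrow> Cod K t = Cod K s \<Longrightarrow> Dom K r = Cod K s \<Longrightarrow>
   Cod K r = Dom K s \<Longrightarrow> s \<cdot> r = Id2 K (Cod K s) \<Longrightarrow> t \<cdot> r = Id2 K (Cod K s) \<Longrightarrow> Src K (Dom K s) = X \<Longrightarrow> Trg K (Dom K s) = Y \<Longrightarrow> reflexive_pair K X Y s t"
  unfolding reflexive_pair_def cell_defs
  by (rule exI[of _ "Dom K s"], rule exI[of _ "Cod K s"], rule exI[of _ r]) simp

lemma reflexive_pairE:
  assumes "reflexive_pair K X Y s t"
  obtains r where "s \<in> Two K" "t \<in> Two K" "r \<in> Two K" "Dom K t = Dom K s" "Cod K t = Cod K s" "Dom K r = Cod K s"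
   "Cod K r = Dom K s" "s \<cdot> r = Id2 K (Cod K s)" "t \<cdot> r = Id2 K (Cod K s)" "Src K (Dom K s) = X" "Trg K (Dom K s) = Y"
  using assms unfolding reflexive_pair_def cell_defs by auto

lemma reflexive_pair_post:
  assumes "reflexive_pair K X Y s t" "G \<in> One K" "Src K G = Y"
  shows "reflexive_pair K X (Trg K G) (G \<rhd> s) (G \<rhd> t)"
  using assms(1)
proof (rule reflexive_pairE)
  fix r assume [simp]: "s \<in> Two K" "t \<in> Two K" "r \<in> Two K" "Dom K t = Dom K s" "Cod K t = Cod K s" "Dom K r = Cod K s"
   "Cod K r = Dom K s" and sr: "s \<cdot> r = Id2 K (Cod K s)" "t \<cdot> r = Id2 K (Cod K s)" and [simp]: "Src K (Dom K s) = X" "Trg K (Dom K s) = Y"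
  note [simp] = assms(2,3)
  have "(G \<rhd> s) \<cdot> (G \<rhd> r) = G \<rhd> (s \<cdot> r)" "(G \<rhd> t) \<cdot> (G \<rhd> r) = G \<rhd> (t \<cdot> r)" by simp_all
  then show ?thesis by (intro reflexive_pairI[where r = "G \<rhd> r"]) (simp_all add: sr)
qed

lemma reflexive_pair_pre:
  assumes "reflexive_pair K X Y s t" "F \<in> One K" "Trg K F = X"
  shows "reflexive_pair K (Src K F) Y (s \<lhd> F) (t \<lhd> F)"
  using assms(1)
proof (rule reflexive_pairE)
  fix r assume [simp]: "s \<in> Two K" "t \<in> Two K" "r \<in> Two K" "Dom K t = Dom K s" "Cod K t = Cod K s" "Dom K r = Cod K s"
   "Cod K r = Dom K s" and sr: "s \<cdot> r = Id2 K (Cod K s)" "t \<cdot> r = Id2 K (Cod K s)" and [simp]: "Src K (Dom K s) = X" "Trg K (Dom K s) = Y"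
  note [simp] = assms(2,3)
  have "(s \<lhd> F) \<cdot> (r \<lhd> F) = (s \<cdot> r) \<lhd> F" "(t \<lhd> F) \<cdot> (r \<lhd> F) = (t \<cdot> r) \<lhd> F" by simp_all
  then show ?thesis by (intro reflexive_pairI[where r = "r \<lhd> F"]) (simp_all add: sr)
qed

end

context fp_two_category
begin

lemma pair2_fst_snd:
  assumes "w \<in> Two A" "Trg A (Dom A w) = Prod A X Y" "X \<in> Zero A" "Y \<in> Zero A"
  shows "pair2 A (Pr1 A X Y \<rhd> w) (Pr2 A X Y \<rhd> w) = w"
  by (rule pair2_eqI[where X=X and Y=Y]) (use assms boundary_mem(6)[OF assms(1)] in simp_all)

text \<open>Hom-categories into a product are products of hom-categories, and in a product of categories
  coequalizers are computed componentwise.\<close>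

lemma pair2_coequalizer:
  assumes c: "coequalizer A X C s t e" and d: "coequalizer A X D s' t' e'"
  shows "coequalizer A X (Prod A C D) (pair2 A s s') (pair2 A t t') (pair2 A e e')"
proof (rule coequalizerI)
  note [simp] = coequalizerD(1-8)[OF c] coequalizerD(1-8)[OF d]
  have [simp]: "C \<in> Zero A" "D \<in> Zero A"
    using boundary_mem(2)[of "Dom A s"] boundary_mem(2)[of "Dom A s'"] by simp_all
  show "pair2 A e e' \<cdot> pair2 A s s' = pair2 A e e' \<cdot> pair2 A t t'"
    using coequalizerD(9)[OF c] coequalizerD(9)[OF d] by simp
  {
    fix p assume p [simp]: "p \<in> Two A" "Dom A p = Cod A (pair2 A s s')" and eq: "p \<cdot> pair2 A s s' = p \<cdot> pair2 A t t'"
    let ?p = "Pr1 A C D \<rhd> p" let ?p' = "Pr2 A C D \<rhd> p"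
    have [simp]: "Trg A (Cod A p) = Prod A C D" using boundary_mem(6)[OF p(1)] by simp
    have "?p \<cdot> s = ?p \<cdot> t" using arg_cong[OF eq, of "\<lambda>s. Pr1 A C D \<rhd> s"] by simp
    then obtain w where w [simp]: "w \<in> Two A" "Dom A w = Cod A e" "Cod A w = Pr1 A C D \<odot> Cod A p" and we: "w \<cdot> e = ?p"
      using coequalizer_factor[OF c, of ?p] by auto
    have "?p' \<cdot> s' = ?p' \<cdot> t'" using arg_cong[OF eq, of "\<lambda>s. Pr2 A C D \<rhd> s"] by simp
    then obtain w' where w' [simp]: "w' \<in> Two A" "Dom A w' = Cod A e'" "Cod A w' = Pr2 A C D \<odot> Cod A p" and we': "w' \<cdot> e' = ?p'"
      using coequalizer_factor[OF d, of ?p'] by auto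
    have "pair2 A w w' \<cdot> pair2 A e e' = p" using pair2_fst_snd[of p C D] by (simp add: we we')
    then show "\<exists>w. w \<in> Two A \<and> Dom A w = Cod A (pair2 A e e') \<and> Cod A w = Cod A p \<and> w \<cdot> pair2 A e e' = p"
      by (intro exI[of _ "pair2 A w w'"]) simp
  }
  {
    fix v w assume [simp]: "v \<in> Two A" "w \<in> Two A" "Dom A v = Cod A (pair2 A e e')" "Dom A w = Cod A (pair2 A e e')"
      and eq: "v \<cdot> pair2 A e e' = w \<cdot> pair2 A e e'"
    have "Cod A v = Cod A (v \<cdot> pair2 A e e')" by simp
    also have "\<dots> = Cod A w" unfolding eq by simp
    finally have cod: "Cod A v = Cod A w" .
    have "(Pr1 A C D \<rhd> v) \<cdot> e = (Pr1 A C D \<rhd> w) \<cdot> e" using arg_cong[OF eq, of "\<lambda>s. Pr1 A C D \<rhd> s"] by simp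
    then have 1: "Pr1 A C D \<rhd> v = Pr1 A C D \<rhd> w" by (rule coequalizer_epi[OF c, rotated 4]) simp_all
    have "(Pr2 A C D \<rhd> v) \<cdot> e' = (Pr2 A C D \<rhd> w) \<cdot> e'" using arg_cong[OF eq, of "\<lambda>s. Pr2 A C D \<rhd> s"] by simp
    then have 2: "Pr2 A C D \<rhd> v = Pr2 A C D \<rhd> w" by (rule coequalizer_epi[OF d, rotated 4]) simp_all
    show "v = w" by (rule pair2_eqI[where X=C and Y=D, OF _ _ _ cod _ _ _ 1 2]) simp_all
  }
qed (use coequalizerD(1-8)[OF c] coequalizerD(1-8)[OF d] in simp_all)

lemma pair2_reflexive:
  assumes "reflexive_pair A X C s t" "reflexive_pair A X D s' t'"
  shows "reflexive_pair A X (Prod A C D) (pair2 A s s') (pair2 A t t')"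
  using assms(1)
proof (rule reflexive_pairE)
  fix r assume r: "s \<in> Two A" "t \<in> Two A" "r \<in> Two A" "Dom A t = Dom A s" "Cod A t = Cod A s" "Dom A r = Cod A s"
   "Cod A r = Dom A s" "s \<cdot> r = Id2 A (Cod A s)" "t \<cdot> r = Id2 A (Cod A s)" "Src A (Dom A s) = X" "Trg A (Dom A s) = C"
  from assms(2) show ?thesis
  proof (rule reflexive_pairE)
    fix r' assume r': "s' \<in> Two A" "t' \<in> Two A" "r' \<in> Two A" "Dom A t' = Dom A s'" "Cod A t' = Cod A s'" "Dom A r' = Cod A s'"
     "Cod A r' = Dom A s'" "s' \<cdot> r' = Id2 A (Cod A s')" "t' \<cdot> r' = Id2 A (Cod A s')" "Src A (Dom A s') = X" "Trg A (Dom A s') = D"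
    show ?thesis by (rule reflexive_pairI[where r = "pair2 A r r'"]) (use r r' in simp_all)
  qed
qed

lemma reflexive_Id2: "f \<in> One A \<Longrightarrow> reflexive_pair A (Src A f) (Trg A f) (Id2 A f) (Id2 A f)"
  by (rule reflexive_pairI[where r = "Id2 A f"]) simp_all

definition reflexive_coequalizer :: "'o \<Rightarrow> 'o \<Rightarrow> 't \<Rightarrow> 't \<Rightarrow> 't \<Rightarrow> bool" where
  "reflexive_coequalizer X Y s t e \<longleftrightarrow> reflexive_pair A X Y s t \<and> coequalizer A X Y s t e"

lemma rc_post:
  assumes "rc_one_cell A G" "reflexive_coequalizer X (Src A G) s t e"
  shows "reflexive_coequalizer X (Trg A G) (G \<rhd> s) (G \<rhd> t) (G \<rhd> e)"
proof -
  have c: "coequalizer A X (Src A G) s t e" and r: "reflexive_pair A X (Src A G) s t" using assms(2) by (auto simp: reflexive_coequalizer_def)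
  have X: "X \<in> Zero A" using coequalizerD(1,7)[OF c] by auto
  have G: "G \<in> One A" using assms(1) by (auto simp: rc_one_cell_def)
  show ?thesis using assms(1) c r X reflexive_pair_post[OF r G] unfolding rc_one_cell_def reflexive_coequalizer_def by blast
qed

lemma rc_pre:
  assumes "rc_zero_cell A C" "reflexive_coequalizer X C s t e" "F \<in> One A" "Trg A F = X"
  shows "reflexive_coequalizer (Src A F) C (s \<lhd> F) (t \<lhd> F) (e \<lhd> F)"
proof -
  have c: "coequalizer A X C s t e" and r: "reflexive_pair A X C s t" using assms(2) by (auto simp: reflexive_coequalizer_def)
  have X: "X \<in> Zero A" using coequalizerD(1,7)[OF c] by auto
  have "one_cell A F (Src A F) X" using assms by (simp add: cell_defs)
  then show ?thesis using assms(1) c r X reflexive_pair_pre[OF r assms(3,4)] unfolding rc_zero_cell_def reflexive_coequalizer_def by blast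
qed

text \<open>With \<open>Id2 A f\<close> as one of the two coequalizers, this says that tensoring with a fixed 1-cell
  preserves reflexive coequalizers.\<close>

lemma rc_ten2:
  assumes M: "rc_monoidal_object A M" and e: "reflexive_coequalizer X (Und M) s t e" and e': "reflexive_coequalizer X (Und M) s' t' e'"
  shows "reflexive_coequalizer X (Und M) (ten2 A M s s') (ten2 A M t t') (ten2 A M e e')"
proof -
  have [simp]: "monoidal_object A M" and T: "rc_one_cell A (Ten M)" using M by (auto simp: rc_monoidal_object_def)
  have "reflexive_coequalizer X (Src A (Ten M)) (pair2 A s s') (pair2 A t t') (pair2 A e e')"
    using e e' pair2_coequalizer pair2_reflexive by (auto simp: reflexive_coequalizer_def)
  from rc_post[OF T this] show ?thesis by simp
qed

lemma reflexive_coequalizer_Id2: "f \<in> One A \<Longrightarrow> Src A f = X \<Longrightarrow> Trg A f = C \<Longrightarrow> reflexive_coequalizer X C (Id2 A f) (Id2 A f) (Id2 A f)"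
  using reflexive_Id2[of f] coequalizer_Id2[of f] by (auto simp: reflexive_coequalizer_def)

end

section \<open>The monad and its algebras at generalized elements\<close>

locale em_setup = fp_two_category A for A :: "('o, 'a, 't) fp_two_cat" (structure) +
  fixes T :: "('o, 'a, 't) lax_monoidal_monad" and E :: "('o, 'a, 't) em_data"
  assumes T: "rc_lax_monoidal_monad A T" and E: "em_object A (underlying_monad T) E"
begin

abbreviation "M \<equiv> Mobj T"
abbreviation "C \<equiv> Und (Mobj T)"
abbreviation "L \<equiv> Mend T"
abbreviation "R \<equiv> Lcell (Mend T)"
abbreviation "\<phi> \<equiv> Lphi (Mend T)"
abbreviation "\<eta> \<equiv> Mcell (Meta T)"
abbreviation "\<mu> \<equiv> Mcell (Mmu T)"
abbreviation "D \<equiv> Eobj E"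
abbreviation "U \<equiv> Eu E"
abbreviation "\<beta> \<equiv> Ebeta E"
abbreviation "F \<equiv> em_free A (underlying_monad T) E"
abbreviation "\<epsilon> \<equiv> em_counit A (underlying_monad T) E"

lemma rc [simp]: "rc_monoidal_object A M" "monoidal_object A M" "rc_zero_cell A C" "rc_one_cell A R"
  using T by (auto simp: rc_lax_monoidal_monad_def rc_monoidal_object_def rc_monad_def underlying_monad_def)

lemma monad_T: "monad (Mon_l A) T" "monad A (underlying_monad T)"
  using T by (auto simp: rc_lax_monoidal_monad_def rc_monad_def)

lemma L [simp]: "lax_monoidal A L" "Lsrc L = M" "Ltrg L = M"
  using monad_T(1) by (auto simp: monad_def Let_def one_cell_def)

lemma etamu [simp]: "monoidal_two_cell A (Meta T)" "Mdom (Meta T) = lax_id A M" "Mcod (Meta T) = L"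
  "monoidal_two_cell A (Mmu T)" "Mdom (Mmu T) = lax_comp A L L" "Mcod (Mmu T) = L"
  using monad_T(1) by (auto simp: monad_def Let_def two_cell_def)

lemma R_mem [simp]: "R \<in> One A" "Src A R = C" "Trg A R = C"
  using lax_mem[OF L(1)] by simp_all

lemma eta_mem [simp]: "\<eta> \<in> Two A" "Dom A \<eta> = Id1 A C" "Cod A \<eta> = R"
  and mu_mem [simp]: "\<mu> \<in> Two A" "Dom A \<mu> = R \<odot> R" "Cod A \<mu> = R"
  using mon2_mem[OF etamu(1)] mon2_mem[OF etamu(4)] by simp_all

lemma monad_laws: "\<mu> \<cdot> (R \<rhd> \<eta>) = Id2 A R" "\<mu> \<cdot> (\<eta> \<lhd> R) = Id2 A R" "\<mu> \<cdot> (R \<rhd> \<mu>) = \<mu> \<cdot> (\<mu> \<lhd> R)"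
  using monad_eqs[OF monad_T(2) E] by (simp_all add: underlying_monad_def)

lemma U_mem [simp]: "D \<in> Zero A" "U \<in> One A" "Src A U = D" "Trg A U = C" "\<beta> \<in> Two A" "Dom A \<beta> = R \<odot> U" "Cod A \<beta> = U"
  using em_mem[OF monad_T(2) E] by (simp_all add: underlying_monad_def)

lemma F_mem [simp]: "F \<in> One A" "Src A F = C" "Trg A F = D" "U \<odot> F = R" "\<beta> \<lhd> F = \<mu>"
  using em_free_mem[OF monad_T(2) E] by (simp_all add: underlying_monad_def)

lemma F_comp [simp]: "x \<in> One A \<Longrightarrow> Trg A x = C \<Longrightarrow> U \<odot> F \<odot> x = R \<odot> x" "x \<in> One A \<Longrightarrow> Trg A x = C \<Longrightarrow> \<beta> \<lhd> (F \<odot> x) = \<mu> \<lhd> x"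
  using em_free_comp[OF monad_T(2) E, of x] by (simp_all add: underlying_monad_def)

lemma beta_laws: "\<beta> \<cdot> (\<eta> \<lhd> U) = Id2 A U" "\<beta> \<cdot> (R \<rhd> \<beta>) = \<beta> \<cdot> (\<mu> \<lhd> U)"
  using em_eqs[OF monad_T(2) E] by (simp_all add: underlying_monad_def)

lemma phi_at_mem [simp]: assumes "x \<in> One A" "y \<in> One A" "Src A y = Src A x" "Trg A x = C" "Trg A y = C"
  shows "at2 A \<phi> x y \<in> Two A" "Dom A (at2 A \<phi> x y) = ten1 A M (R \<odot> x) (R \<odot> y)" "Cod A (at2 A \<phi> x y) = R \<odot> ten1 A M x y"
   "h \<in> One A \<Longrightarrow> Trg A h = Src A x \<Longrightarrow> at2 A \<phi> x y \<lhd> h = at2 A \<phi> (x \<odot> h) (y \<odot> h)"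
  using phi_mem[OF L(1), of x "Src A x" y] phi_pre[OF L(1), of x "Src A x" y h] assms by simp_all

lemma phi0_eq: "Lphi0 L = \<eta> \<lhd> Unt M"
  using mon2_unit[OF etamu(1)] by (simp add: lax_id_def)

lemma eta_ten: assumes [simp]: "x \<in> One A" "y \<in> One A" "Src A y = Src A x" "Trg A x = C" "Trg A y = C"
  shows "at2 A \<phi> x y \<cdot> ten2 A M (\<eta> \<lhd> x) (\<eta> \<lhd> y) = \<eta> \<lhd> ten1 A M x y"
proof -
  have "at2 A (Lphi (lax_id A M)) x y = Id2 A (ten1 A M x y)" by (simp add: lax_id_def at2_def)
  then show ?thesis using mon2_tensor[OF etamu(1), of x y] by simp
qed

lemma mu_ten: assumes [simp]: "x \<in> One A" "y \<in> One A" "Src A y = Src A x" "Trg A x = C" "Trg A y = C"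
  shows "(\<mu> \<lhd> ten1 A M x y) \<cdot> (R \<rhd> at2 A \<phi> x y) \<cdot> at2 A \<phi> (R \<odot> x) (R \<odot> y) = at2 A \<phi> x y \<cdot> ten2 A M (\<mu> \<lhd> x) (\<mu> \<lhd> y)"
  using mon2_tensor[OF etamu(4), of x y] by (simp add: lax_comp_phi_at)

lemma mu_R_eta_el: assumes [simp]: "x \<in> One A" "Trg A x = C"
  shows "(\<mu> \<lhd> x) \<cdot> (R \<rhd> (\<eta> \<lhd> x)) = Id2 A (R \<odot> x)" "(\<mu> \<lhd> x) \<cdot> (\<eta> \<lhd> (R \<odot> x)) = Id2 A (R \<odot> x)"
    "(\<mu> \<lhd> x) \<cdot> (R \<rhd> (\<mu> \<lhd> x)) = (\<mu> \<lhd> x) \<cdot> (\<mu> \<lhd> (R \<odot> x))"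
  using arg_cong[OF monad_laws(1), of "\<lambda>s. s \<lhd> x"] arg_cong[OF monad_laws(2), of "\<lambda>s. s \<lhd> x"] arg_cong[OF monad_laws(3), of "\<lambda>s. s \<lhd> x"]
  by simp_all

lemma beta_el: assumes [simp]: "x \<in> One A" "Trg A x = D"
  shows "(\<beta> \<lhd> x) \<cdot> (\<eta> \<lhd> (U \<odot> x)) = Id2 A (U \<odot> x)" "(\<beta> \<lhd> x) \<cdot> (R \<rhd> (\<beta> \<lhd> x)) = (\<beta> \<lhd> x) \<cdot> (\<mu> \<lhd> (U \<odot> x))"
  using arg_cong[OF beta_laws(1), of "\<lambda>s. s \<lhd> x"] arg_cong[OF beta_laws(2), of "\<lambda>s. s \<lhd> x"]
  by simp_all

text \<open>The common section \<open>R (\<eta> \<otimes> \<eta>)\<close> is due to the unit laws of \<open>\<beta>\<close> and to \<open>\<eta>\<close> being monoidal.\<close>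

lemma coeq_pair_reflexive:
  assumes [simp]: "x \<in> One A" "y \<in> One A" "Src A x = X" "Src A y = X" "Trg A x = D" "Trg A y = D"
  shows "reflexive_pair A X C ((\<mu> \<lhd> ten1 A M (U \<odot> x) (U \<odot> y)) \<cdot> (R \<rhd> at2 A \<phi> (U \<odot> x) (U \<odot> y))) (R \<rhd> ten2 A M (\<beta> \<lhd> x) (\<beta> \<lhd> y))"
proof (rule reflexive_pairI[where r = "R \<rhd> ten2 A M (\<eta> \<lhd> (U \<odot> x)) (\<eta> \<lhd> (U \<odot> y))"])
  let ?t = "ten1 A M (U \<odot> x) (U \<odot> y)"
  have "(R \<rhd> at2 A \<phi> (U \<odot> x) (U \<odot> y)) \<cdot> (R \<rhd> ten2 A M (\<eta> \<lhd> (U \<odot> x)) (\<eta> \<lhd> (U \<odot> y))) = R \<rhd> (\<eta> \<lhd> ?t)"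
    by (simp flip: eta_ten)
  then have "((\<mu> \<lhd> ?t) \<cdot> (R \<rhd> at2 A \<phi> (U \<odot> x) (U \<odot> y))) \<cdot> (R \<rhd> ten2 A M (\<eta> \<lhd> (U \<odot> x)) (\<eta> \<lhd> (U \<odot> y))) = Id2 A (R \<odot> ?t)"
    by (simp add: mu_R_eta_el)
  then show "((\<mu> \<lhd> ?t) \<cdot> (R \<rhd> at2 A \<phi> (U \<odot> x) (U \<odot> y))) \<cdot> (R \<rhd> ten2 A M (\<eta> \<lhd> (U \<odot> x)) (\<eta> \<lhd> (U \<odot> y))) =
    Id2 A (Cod A ((\<mu> \<lhd> ?t) \<cdot> (R \<rhd> at2 A \<phi> (U \<odot> x) (U \<odot> y))))" by simp
  have "(R \<rhd> ten2 A M (\<beta> \<lhd> x) (\<beta> \<lhd> y)) \<cdot> (R \<rhd> ten2 A M (\<eta> \<lhd> (U \<odot> x)) (\<eta> \<lhd> (U \<odot> y))) = Id2 A (R \<odot> ?t)"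
    by (simp add: beta_el flip: post_vcomp)
  then show "(R \<rhd> ten2 A M (\<beta> \<lhd> x) (\<beta> \<lhd> y)) \<cdot> (R \<rhd> ten2 A M (\<eta> \<lhd> (U \<odot> x)) (\<eta> \<lhd> (U \<odot> y))) =
    Id2 A (Cod A ((\<mu> \<lhd> ?t) \<cdot> (R \<rhd> at2 A \<phi> (U \<odot> x) (U \<odot> y))))" by simp
qed simp_all

lemma standard_coequalizer_exists: "\<exists>q. standard_coequalizer A T E q"
  using rc(3) coeq_pair_reflexive[of "Pr1 A D D" "Pr2 A D D" "Prod A D D"]
  unfolding standard_coequalizer_def Let_def rc_zero_cell_def by simp

end

section \<open>Hom-categories as monoidal categories with a monad\<close>

text \<open>A 2-cell with its boundary recorded separately, so that the boundary of a composite can be read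
  off without knowing that the composite is defined.\<close>

datatype ('a, 't) hcell = HCell (hdom: 'a) (cell: 't) (hcod: 'a)

context em_setup
begin

definition hob where "hob X a \<longleftrightarrow> a \<in> One A \<and> Src A a = X \<and> Trg A a = C"
definition har where "har X f \<longleftrightarrow> cell f \<in> Two A \<and> Dom A (cell f) = hdom f \<and> Cod A (cell f) = hcod f \<and>
  Src A (hdom f) = X \<and> Trg A (hdom f) = C"
definition hone where "hone a = HCell a (Id2 A a) a"
definition hcomp where "hcomp g f = HCell (hdom f) (cell g \<cdot> cell f) (hcod g)"
definition htar where "htar f g = HCell (ten1 A M (hdom f) (hdom g)) (ten2 A M (cell f) (cell g)) (ten1 A M (hcod f) (hcod g))"
definition hR where "hR f = HCell (R \<odot> hdom f) (R \<rhd> cell f) (R \<odot> hcod f)"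
definition hphi where "hphi a b = HCell (ten1 A M (R \<odot> a) (R \<odot> b)) (at2 A \<phi> a b) (R \<odot> ten1 A M a b)"
definition heta where "heta a = HCell a (\<eta> \<lhd> a) (R \<odot> a)"
definition hmu where "hmu a = HCell (R \<odot> R \<odot> a) (\<mu> \<lhd> a) (R \<odot> a)"

lemmas hdefs = hone_def hcomp_def htar_def hR_def hphi_def heta_def hmu_def

lemma hobD: assumes "hob X a" shows "a \<in> One A" "Src A a = X" "Trg A a = C"
  using assms by (auto simp: hob_def)

lemma harD: assumes "har X f"
  shows "cell f \<in> Two A" "Dom A (cell f) = hdom f" "Cod A (cell f) = hcod f" "hdom f \<in> One A" "hcod f \<in> One A"
    "Src A (hdom f) = X" "Trg A (hdom f) = C" "Src A (hcod f) = X" "Trg A (hcod f) = C"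
proof -
  show 1: "cell f \<in> Two A" "Dom A (cell f) = hdom f" "Cod A (cell f) = hcod f" "Src A (hdom f) = X" "Trg A (hdom f) = C"
    using assms by (auto simp: har_def)
  show "hdom f \<in> One A" "hcod f \<in> One A" "Src A (hcod f) = X" "Trg A (hcod f) = C"
    using boundary_mem(3-6)[OF 1(1)] 1 by auto
qed

lemma har_HCell: "har X (HCell a s b) \<longleftrightarrow> s \<in> Two A \<and> Dom A s = a \<and> Cod A s = b \<and> Src A a = X \<and> Trg A a = C"
  by (simp add: har_def)

lemma h_phi_nat: "har X f \<Longrightarrow> har X g \<Longrightarrow> hcomp (hphi (hcod f) (hcod g)) (htar (hR f) (hR g)) = hcomp (hR (htar f g)) (hphi (hdom f) (hdom g))"
  using phi_nat_el[OF L(1), of "cell f" "cell g"] harD[of X f] harD[of X g] by (simp add: hdefs)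

lemma h_eta_nat: "har X f \<Longrightarrow> hcomp (heta (hcod f)) f = hcomp (hR f) (heta (hdom f))"
  using whisker_exchange[of "cell f" \<eta>] harD[of X f] by (simp add: hdefs)

lemma h_mu_nat: "har X f \<Longrightarrow> hcomp (hmu (hcod f)) (hR (hR f)) = hcomp (hR f) (hmu (hdom f))"
  using whisker_exchange[of "cell f" \<mu>] harD[of X f] by (simp add: hdefs)

lemma hom_monad:
  "tensor_monad (hob X) (har X) hdom hcod hone hcomp (ten1 A M) htar (Comp1 A R) hR hphi heta hmu"
proof
  fix f g h :: "('a, 't) hcell"
  assume a: "har X f" "har X g" "har X h" "hdom g = hcod f" "hdom h = hcod g"
  then show "hcomp (hcomp h g) f = hcomp h (hcomp g f)"
    using harD[OF a(1)] harD[OF a(2)] harD[OF a(3)] by (simp add: hdefs)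
next
  fix f g f' g' :: "('a, 't) hcell"
  assume a: "har X f" "har X g" "har X f'" "har X g'" "hdom g = hcod f" "hdom g' = hcod f'"
  then show "hcomp (htar g g') (htar f f') = htar (hcomp g f) (hcomp g' f')"
    using harD[OF a(1)] harD[OF a(2)] harD[OF a(3)] harD[OF a(4)] by (simp add: hdefs)
next
  fix f g :: "('a, 't) hcell"
  assume a: "har X f" "har X g" "hdom g = hcod f"
  then show "har X (hcomp g f)" "hR (hcomp g f) = hcomp (hR g) (hR f)"
    using harD[OF a(1)] harD[OF a(2)] by (simp_all add: hdefs har_HCell)
next
  fix f g :: "('a, 't) hcell"
  assume a: "har X f" "har X g"
  show "har X (htar f g)" using harD[OF a(1)] harD[OF a(2)] by (simp add: hdefs har_HCell)
  show "hcomp (hphi (hcod f) (hcod g)) (htar (hR f) (hR g)) = hcomp (hR (htar f g)) (hphi (hdom f) (hdom g))"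
    by (rule h_phi_nat[OF a])
next
  fix f :: "('a, 't) hcell" and a
  assume f: "har X f"
  show "hob X (hdom f)" "hob X (hcod f)" "har X (hR f)" using harD[OF f] by (simp_all add: hdefs har_HCell hob_def)
  show "hcomp (heta (hcod f)) f = hcomp (hR f) (heta (hdom f))" "hcomp (hmu (hcod f)) (hR (hR f)) = hcomp (hR f) (hmu (hdom f))"
    using h_eta_nat[OF f] h_mu_nat[OF f] by auto
  show "hcod f = a \<Longrightarrow> hcomp (hone a) f = f" "hdom f = a \<Longrightarrow> hcomp f (hone a) = f"
    using harD[OF f] by (auto simp: hdefs hcell.expand)
next
  fix a b assume a: "hob X a" "hob X b"
  note [simp] = hobD[OF a(1)] hobD[OF a(2)]
  show "hob X (ten1 A M a b)" "har X (hphi a b)" "htar (hone a) (hone b) = hone (ten1 A M a b)"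
    by (simp_all add: hdefs har_HCell hob_def)
  show "hcomp (hphi a b) (htar (heta a) (heta b)) = heta (ten1 A M a b)"
    by (simp add: hdefs eta_ten)
  show "hcomp (hmu (ten1 A M a b)) (hcomp (hR (hphi a b)) (hphi (R \<odot> a) (R \<odot> b))) = hcomp (hphi a b) (htar (hmu a) (hmu b))"
    by (simp add: hdefs mu_ten)
next
  fix a assume a: "hob X a"
  note [simp] = hobD[OF a]
  show "hob X (R \<odot> a)" "har X (hone a)" "har X (heta a)" "har X (hmu a)" "hR (hone a) = hone (R \<odot> a)"
    by (simp_all add: hdefs har_HCell hob_def)
  show "hcomp (hmu a) (hR (heta a)) = hone (R \<odot> a)" "hcomp (hmu a) (heta (R \<odot> a)) = hone (R \<odot> a)"
    "hcomp (hmu a) (hR (hmu a)) = hcomp (hmu a) (hmu (R \<odot> a))"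
    by (simp_all add: hdefs mu_R_eta_el)
qed (simp_all add: hdefs)

text \<open>By the hypotheses on \<open>R\<close> and on the tensor product, reflexive coequalizers form a class of
  epimorphisms that is closed under the functors in the definition of stability.\<close>

lemma coequalizer_stable:
  assumes "reflexive_coequalizer X C s t e"
  shows "tensor_monad.stable (hob X) (har X) hdom hcod hone hcomp htar hR (HCell (Dom A e) e (Cod A e))"
proof -
  interpret tensor_monad "hob X" "har X" hdom hcod hone hcomp "ten1 A M" htar "Comp1 A R" hR hphi heta hmu
    by (rule hom_monad)
  let ?S = "\<lambda>k. \<exists>s t. reflexive_coequalizer X C s t (cell k) \<and> k = HCell (Dom A (cell k)) (cell k) (Cod A (cell k))"
  show ?thesis
  proof (rule stable.coinduct[of ?S])
    show "?S (HCell (Dom A e) e (Cod A e))" using assms by auto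
    fix k assume "?S k"
    then obtain s t e where c: "reflexive_coequalizer X C s t e" and k: "k = HCell (Dom A e) e (Cod A e)"
      by (metis hcell.sel(2))
    then have ce: "coequalizer A X C s t e" by (simp add: reflexive_coequalizer_def)
    note e [simp] = coequalizerD(1-8)[OF ce]
    have e' [simp]: "Src A (Cod A s) = X" "Trg A (Cod A s) = C" "Cod A s \<in> One A"
      using boundary_mem(3-6)[OF e(3)] boundary_mem(4-6)[OF e(1)] by simp_all
    have "epi k" unfolding epi_def
    proof (intro conjI allI impI)
      show "har X k" by (simp add: k har_HCell)
      fix f g assume fg: "har X f \<and> har X g \<and> hdom f = hcod k \<and> hdom g = hcod k \<and> hcomp f k = hcomp g k"
      have "cell f = cell g"
      proof (rule coequalizer_epi[OF ce])
        show "cell f \<cdot> e = cell g \<cdot> e" using fg by (simp add: hcomp_def k)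
      qed (use fg harD[of X f] harD[of X g] in \<open>simp_all add: k\<close>)
      with fg show "f = g" by (simp add: hcomp_def hcell.expand)
    qed
    moreover have "?S (hR k)"
      using rc_post[OF rc(4), of X s t e] c by (intro exI[of _ "R \<rhd> s"] exI[of _ "R \<rhd> t"]) (simp add: hR_def k)
    moreover have "?S (htar (hone a) k)" "?S (htar k (hone a))" if "hob X a" for a
    proof -
      note a = hobD[OF that]
      note a' = reflexive_coequalizer_Id2[OF a]
      show "?S (htar (hone a) k)" using rc_ten2[OF rc(1) a' c] a
        by (intro exI[of _ "ten2 A M (Id2 A a) s"] exI[of _ "ten2 A M (Id2 A a) t"]) (simp add: htar_def hone_def k)
      show "?S (htar k (hone a))" using rc_ten2[OF rc(1) c a'] a
        by (intro exI[of _ "ten2 A M s (Id2 A a)"] exI[of _ "ten2 A M t (Id2 A a)"]) (simp add: htar_def hone_def k)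
    qed
    ultimately show "\<exists>e. k = e \<and> epi e \<and> (?S (hR e) \<or> stable (hR e)) \<and>
       (\<forall>a. hob X a \<longrightarrow> ?S (htar (hone a) e) \<or> stable (htar (hone a) e)) \<and>
       (\<forall>a. hob X a \<longrightarrow> ?S (htar e (hone a)) \<or> stable (htar e (hone a)))" by blast
  qed
qed

definition hact where "hact x = HCell (R \<odot> U \<odot> x) (\<beta> \<lhd> x) (U \<odot> x)"
definition halg where "halg X x \<longleftrightarrow> x \<in> One A \<and> Src A x = X \<and> Trg A x = D"

lemma halgD: assumes "halg X x" shows "x \<in> One A" "Src A x = X" "Trg A x = D"
  using assms by (auto simp: halg_def)

end

text \<open>The assumptions on \<open>N\<close> concern its underlying 0-cell, unit and tensor product. The coherence
  cells are arbitrary, so that the results can be used to construct them.\<close>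

locale em_std = em_setup A T E for A :: "('o, 'a, 't) fp_two_cat" (structure)
    and T :: "('o, 'a, 't) lax_monoidal_monad" and E :: "('o, 'a, 't) em_data" +
  fixes q :: 't and N :: "('o, 'a, 't) mon_obj"
  assumes q: "standard_coequalizer A T E q"
    and N [simp]: "Und N = D" "Unt N = F \<odot> Unt M" "Ten N \<in> One A" "Src A (Ten N) = Prod A D D" "Trg A (Ten N) = D"
      "Cod A q = U \<odot> Ten N"
    and act_q: "(\<beta> \<lhd> Ten N) \<cdot> (R \<rhd> q) = q \<cdot> (\<mu> \<lhd> ten1 A M (U \<odot> Pr1 A D D) (U \<odot> Pr2 A D D))"
begin

lemma q_coeq: "reflexive_coequalizer (Prod A D D) C
   ((\<mu> \<lhd> ten1 A M (U \<odot> Pr1 A D D) (U \<odot> Pr2 A D D)) \<cdot> (R \<rhd> at2 A \<phi> (U \<odot> Pr1 A D D) (U \<odot> Pr2 A D D)))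
   (R \<rhd> ten2 A M (\<beta> \<lhd> Pr1 A D D) (\<beta> \<lhd> Pr2 A D D)) q"
  using q coeq_pair_reflexive[of "Pr1 A D D" "Pr2 A D D" "Prod A D D"]
  unfolding standard_coequalizer_def Let_def reflexive_coequalizer_def by simp

lemma q_mem [simp]: "q \<in> Two A" "Dom A q = R \<odot> ten1 A M (U \<odot> Pr1 A D D) (U \<odot> Pr2 A D D)"
  using coequalizerD(3,6)[OF conjunct2[OF q_coeq[unfolded reflexive_coequalizer_def]]] by simp_all

context
  fixes x y X assumes x [simp]: "x \<in> One A" "Src A x = X" "Trg A x = D" and y [simp]: "y \<in> One A" "Src A y = X" "Trg A y = D"
begin

lemma q_at_mem [simp]: "at2 A q x y \<in> Two A" "Dom A (at2 A q x y) = R \<odot> ten1 A M (U \<odot> x) (U \<odot> y)" "Cod A (at2 A q x y) = U \<odot> ten1 A N x y"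
   "h \<in> One A \<Longrightarrow> Trg A h = X \<Longrightarrow> at2 A q x y \<lhd> h = at2 A q (x \<odot> h) (y \<odot> h)"
  by (simp_all add: at2_def)

lemma q_at_coeq: "reflexive_coequalizer X C
   ((\<mu> \<lhd> ten1 A M (U \<odot> x) (U \<odot> y)) \<cdot> (R \<rhd> at2 A \<phi> (U \<odot> x) (U \<odot> y))) (R \<rhd> ten2 A M (\<beta> \<lhd> x) (\<beta> \<lhd> y)) (at2 A q x y)"
  using rc_pre[OF rc(3) q_coeq, of "pair1 A x y"] by (simp add: at2_def[of _ q])

lemma act_q_at: "(\<beta> \<lhd> ten1 A N x y) \<cdot> (R \<rhd> at2 A q x y) = at2 A q x y \<cdot> (\<mu> \<lhd> ten1 A M (U \<odot> x) (U \<odot> y))"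
  using arg_cong[OF act_q, of "\<lambda>s. s \<lhd> pair1 A x y"] by (simp add: at2_def)

end

definition hq where "hq x y = HCell (R \<odot> ten1 A M (U \<odot> x) (U \<odot> y)) (at2 A q x y) (U \<odot> ten1 A N x y)"

lemma hom_algebra:
  "algebra_tensor (hob X) (har X) hdom hcod hone hcomp (ten1 A M) htar (Comp1 A R) hR hphi heta hmu
    (halg X) (Comp1 A U) hact (Comp1 A F) (ten1 A N) hq"
proof -
  interpret tensor_monad "hob X" "har X" hdom hcod hone hcomp "ten1 A M" htar "Comp1 A R" hR hphi heta hmu
    by (rule hom_monad)
  show ?thesis
  proof
    fix x assume x: "halg X x"
    note [simp] = halgD[OF x]
    show "hob X (U \<odot> x)" "har X (hact x)" by (simp_all add: hob_def hact_def har_HCell)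
    show "hcomp (hact x) (heta (U \<odot> x)) = hone (U \<odot> x)" "hcomp (hact x) (hR (hact x)) = hcomp (hact x) (hmu (U \<odot> x))"
      by (simp_all add: hdefs hact_def beta_el)
  next
    fix a assume a: "hob X a"
    note [simp] = hobD[OF a]
    show "halg X (F \<odot> a)" "U \<odot> F \<odot> a = R \<odot> a" "hact (F \<odot> a) = hmu a" by (simp_all add: halg_def hact_def hmu_def)
  next
    fix x y assume xy: "halg X x" "halg X y"
    note [simp] = halgD[OF xy(1)] halgD[OF xy(2)]
    let ?s = "(\<mu> \<lhd> ten1 A M (U \<odot> x) (U \<odot> y)) \<cdot> (R \<rhd> at2 A \<phi> (U \<odot> x) (U \<odot> y))" let ?t = "R \<rhd> ten2 A M (\<beta> \<lhd> x) (\<beta> \<lhd> y)"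
    have s: "hcomp (hmu (ten1 A M (U \<odot> x) (U \<odot> y))) (hR (hphi (U \<odot> x) (U \<odot> y))) = HCell (R \<odot> ten1 A M (R \<odot> U \<odot> x) (R \<odot> U \<odot> y)) ?s (R \<odot> ten1 A M (U \<odot> x) (U \<odot> y))"
      and t: "hR (htar (hact x) (hact y)) = HCell (R \<odot> ten1 A M (R \<odot> U \<odot> x) (R \<odot> U \<odot> y)) ?t (R \<odot> ten1 A M (U \<odot> x) (U \<odot> y))"
      by (simp_all add: hdefs hact_def)
    have c: "reflexive_coequalizer X C ?s ?t (at2 A q x y)" by (rule q_at_coeq) simp_all
    then have ce: "coequalizer A X C ?s ?t (at2 A q x y)" by (simp add: reflexive_coequalizer_def)
    show "halg X (ten1 A N x y)" by (simp add: halg_def)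
    show "har X (hq x y)" by (simp add: hq_def har_HCell)
    show "hcomp (hact (ten1 A N x y)) (hR (hq x y)) = hcomp (hq x y) (hmu (ten1 A M (U \<odot> x) (U \<odot> y)))"
      using act_q_at[of x X y] by (simp add: hdefs hact_def hq_def)
    show "hcomp (hq x y) (hcomp (hmu (ten1 A M (U \<odot> x) (U \<odot> y))) (hR (hphi (U \<odot> x) (U \<odot> y)))) = hcomp (hq x y) (hR (htar (hact x) (hact y)))"
      unfolding s t using coequalizerD(9)[OF ce] by (simp add: hcomp_def hq_def)
    show "stable (hq x y)" using coequalizer_stable[OF c] by (simp add: hq_def)
    have fac: "\<exists>w. har X w \<and> hdom w = Cod A e \<and> hcod w = hcod p \<and> hcomp w (HCell (Dom A e) e (Cod A e)) = p"
      if c: "reflexive_coequalizer X C s t e" and hp: "har X p" and dp: "hdom p = Cod A s" and eq: "cell p \<cdot> s = cell p \<cdot> t" for s t e p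
    proof -
      have ce: "coequalizer A X C s t e" using c by (simp add: reflexive_coequalizer_def)
      note p = harD[OF hp]
      obtain w where w: "w \<in> Two A" "Dom A w = Cod A e" "Cod A w = Cod A (cell p)" "w \<cdot> e = cell p"
        using coequalizer_factor[OF ce p(1) _ eq] p(2) dp by auto
      have "Src A (Cod A e) = X" "Trg A (Cod A e) = C"
        using boundary_mem(5,6)[of e] coequalizerD[OF ce] boundary_mem(5,6)[of s] by simp_all
      with w p dp coequalizerD(6)[OF ce] show ?thesis
        by (intro exI[of _ "HCell (Cod A e) w (hcod p)"]) (simp add: har_HCell hcomp_def hcell.expand)
    qed
    fix p assume p: "har X p"
    show "\<exists>w. har X w \<and> hdom w = U \<odot> ten1 A N x y \<and> hcod w = hcod p \<and> hcomp w (hq x y) = p"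
      if "hdom p = R \<odot> ten1 A M (U \<odot> x) (U \<odot> y)" "hcomp p (hcomp (hmu (ten1 A M (U \<odot> x) (U \<odot> y))) (hR (hphi (U \<odot> x) (U \<odot> y)))) = hcomp p (hR (htar (hact x) (hact y)))"
      using fac[OF c p] that unfolding s t by (simp add: hcomp_def hq_def)
    fix a assume a: "hob X a"
    note [simp] = hobD[OF a]
    note a' = reflexive_coequalizer_Id2[of a X C]
    show "\<exists>w. har X w \<and> hdom w = ten1 A M a (U \<odot> ten1 A N x y) \<and> hcod w = hcod p \<and> hcomp w (htar (hone a) (hq x y)) = p"
      if "hdom p = ten1 A M a (R \<odot> ten1 A M (U \<odot> x) (U \<odot> y))"
        "hcomp p (htar (hone a) (hcomp (hmu (ten1 A M (U \<odot> x) (U \<odot> y))) (hR (hphi (U \<odot> x) (U \<odot> y))))) = hcomp p (htar (hone a) (hR (htar (hact x) (hact y))))"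
      using fac[OF rc_ten2[OF rc(1) a' c] p] that unfolding s t by (simp add: hcomp_def hq_def htar_def hone_def)
    show "\<exists>w. har X w \<and> hdom w = ten1 A M (U \<odot> ten1 A N x y) a \<and> hcod w = hcod p \<and> hcomp w (htar (hq x y) (hone a)) = p"
      if "hdom p = ten1 A M (R \<odot> ten1 A M (U \<odot> x) (U \<odot> y)) a"
        "hcomp p (htar (hcomp (hmu (ten1 A M (U \<odot> x) (U \<odot> y))) (hR (hphi (U \<odot> x) (U \<odot> y)))) (hone a)) = hcomp p (htar (hR (htar (hact x) (hact y))) (hone a))"
      using fac[OF rc_ten2[OF rc(1) c a'] p] that unfolding s t by (simp add: hcomp_def hq_def htar_def hone_def)
  qed (simp_all add: hact_def hq_def)
qed

definition hasc where "hasc a b c = HCell (ten1 A M a (ten1 A M b c)) (at3 A (Asc M) a b c) (ten1 A M (ten1 A M a b) c)"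
definition hasc' where "hasc' a b c = HCell (ten1 A M (ten1 A M a b) c) (at3 A (inv_cell (Asc M)) a b c) (ten1 A M a (ten1 A M b c))"
definition hlun where "hlun X a = HCell (ten1 A M (unit_at A M X) a) (Lun M \<lhd> a) a"
definition hlun' where "hlun' X a = HCell a (inv_cell (Lun M) \<lhd> a) (ten1 A M (unit_at A M X) a)"
definition hrun where "hrun X a = HCell (ten1 A M a (unit_at A M X)) (Run M \<lhd> a) a"
definition hrun' where "hrun' X a = HCell a (inv_cell (Run M) \<lhd> a) (ten1 A M a (unit_at A M X))"

lemmas mdefs = hasc_def hasc'_def hlun_def hlun'_def hrun_def hrun'_def

lemma phi0_at: "X \<in> Zero A \<Longrightarrow> Lphi0 L \<lhd> bang A X = \<eta> \<lhd> unit_at A M X"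
  by (simp add: phi0_eq)

lemma hom_monoidal:
  assumes X [simp]: "X \<in> Zero A"
  shows "monoidal_algebra_tensor (hob X) (har X) hdom hcod hone hcomp (ten1 A M) htar (Comp1 A R) hR hphi heta hmu
    (halg X) (Comp1 A U) hact (Comp1 A F) (ten1 A N) hq (unit_at A M X) hasc hasc' (hlun X) (hlun' X) (hrun X) (hrun' X)"
proof -
  interpret algebra_tensor "hob X" "har X" hdom hcod hone hcomp "ten1 A M" htar "Comp1 A R" hR hphi heta hmu
    "halg X" "Comp1 A U" hact "Comp1 A F" "ten1 A N" hq
    by (rule hom_algebra)
  show ?thesis
  proof
    show "hob X (unit_at A M X)" by (simp add: hob_def)
  next
    fix a b c d assume o: "hob X a" "hob X b" "hob X c" "hob X d"
    note [simp] = hobD[OF o(1)] hobD[OF o(2)] hobD[OF o(3)] hobD[OF o(4)]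
    show "hcomp (hasc (ten1 A M a b) c d) (hasc a b (ten1 A M c d)) =
      hcomp (htar (hasc a b c) (hone d)) (hcomp (hasc a (ten1 A M b c) d) (htar (hone a) (hasc b c d)))"
      using pentagon_el[OF rc(2), of b X c d a] by (simp add: mdefs hdefs)
  next
    fix a b c assume o: "hob X a" "hob X b" "hob X c"
    note [simp] = hobD[OF o(1)] hobD[OF o(2)] hobD[OF o(3)]
    show "har X (hasc a b c)" "har X (hasc' a b c)"
      using asc_inv[OF rc(2), of a X b c] by (simp_all add: mdefs har_HCell)
    show "hcomp (hasc a b c) (hasc' a b c) = hone (ten1 A M (ten1 A M a b) c)"
     "hcomp (hasc' a b c) (hasc a b c) = hone (ten1 A M a (ten1 A M b c))"
      using asc_inv[OF rc(2), of a X b c] by (simp_all add: mdefs hdefs)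
    show "hcomp (hR (hasc a b c)) (hcomp (hphi a (ten1 A M b c)) (htar (hone (R \<odot> a)) (hphi b c))) =
       hcomp (hphi (ten1 A M a b) c) (hcomp (htar (hphi a b) (hone (R \<odot> c))) (hasc (R \<odot> a) (R \<odot> b) (R \<odot> c)))"
      using phi_assoc_el[OF L(1), of a X b c] by (simp add: mdefs hdefs)
  next
    fix f g h :: "('a, 't) hcell" assume o: "har X f" "har X g" "har X h"
    note [simp] = harD[OF o(1)] harD[OF o(2)] harD[OF o(3)]
    show "hcomp (hasc (hcod f) (hcod g) (hcod h)) (htar f (htar g h)) = hcomp (htar (htar f g) h) (hasc (hdom f) (hdom g) (hdom h))"
      using asc_nat_el[OF rc(2), of "cell f" "cell g" "cell h"] by (simp add: mdefs hdefs)
  next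
    fix f :: "('a, 't) hcell" assume o: "har X f"
    note [simp] = harD[OF o]
    show "hcomp (hlun X (hcod f)) (htar (hone (unit_at A M X)) f) = hcomp f (hlun X (hdom f))"
      "hcomp (hrun X (hcod f)) (htar f (hone (unit_at A M X))) = hcomp f (hrun X (hdom f))"
      using lun_nat_el[OF rc(2), of "cell f"] run_nat_el[OF rc(2), of "cell f"] by (simp_all add: mdefs hdefs)
  next
    fix a b assume o: "hob X a" "hob X b"
    note [simp] = hobD[OF o(1)] hobD[OF o(2)]
    show "hcomp (htar (hrun X a) (hone b)) (hasc a (unit_at A M X) b) = htar (hone a) (hlun X b)"
      using triangle_el[OF rc(2), of a X b] by (simp add: mdefs hdefs)
  next
    fix a assume o: "hob X a"
    note [simp] = hobD[OF o]
    show "har X (hlun X a)" "har X (hlun' X a)" "har X (hrun X a)" "har X (hrun' X a)"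
      "hcomp (hlun X a) (hlun' X a) = hone a" "hcomp (hlun' X a) (hlun X a) = hone (ten1 A M (unit_at A M X) a)"
      "hcomp (hrun X a) (hrun' X a) = hone a" "hcomp (hrun' X a) (hrun X a) = hone (ten1 A M a (unit_at A M X))"
      using lun_inv[OF rc(2), of a X] run_inv[OF rc(2), of a X] lun_mem[OF rc(2), of a X] run_mem[OF rc(2), of a X]
      by (simp_all add: mdefs hdefs har_HCell)
    show "hcomp (hR (hlun X a)) (hcomp (hphi (unit_at A M X) a) (htar (heta (unit_at A M X)) (hone (R \<odot> a)))) = hlun X (R \<odot> a)"
      "hcomp (hR (hrun X a)) (hcomp (hphi a (unit_at A M X)) (htar (hone (R \<odot> a)) (heta (unit_at A M X)))) = hrun X (R \<odot> a)"
      using phi_lun_el[OF L(1), of a X] phi_run_el[OF L(1), of a X] by (simp_all add: mdefs hdefs phi0_at)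
  qed (simp_all add: mdefs)
qed

end

section \<open>Existence and uniqueness of the standard structure\<close>

context em_setup
begin

lemma em_lift1':
  assumes "w \<in> One A" "Src A w = X" "Trg A w = C" "\<nu> \<in> Two A" "Dom A \<nu> = R \<odot> w" "Cod A \<nu> = w"
    "\<nu> \<cdot> (\<eta> \<lhd> w) = Id2 A w" "\<nu> \<cdot> (R \<rhd> \<nu>) = \<nu> \<cdot> (\<mu> \<lhd> w)"
  shows "\<exists>f. f \<in> One A \<and> Src A f = X \<and> Trg A f = D \<and> U \<odot> f = w \<and> \<beta> \<lhd> f = \<nu>"
proof -
  have "subequalizing A (underlying_monad T) X w \<nu>" "X \<in> Zero A"
    using assms boundary_mem(1)[of w] by (auto simp: subequalizing_def underlying_monad_def cell_defs)
  from em_lift1[OF monad_T(2) E this] show ?thesis by (auto simp: cell_defs)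
qed

lemma em_inj1:
  assumes "f \<in> One A" "g \<in> One A" "Src A f = Src A g" "Trg A f = D" "Trg A g = D" "U \<odot> f = U \<odot> g" "\<beta> \<lhd> f = \<beta> \<lhd> g"
  shows "f = g"
proof -
  let ?X = "Src A g"
  have "subequalizing A (underlying_monad T) ?X (U \<odot> g) (\<beta> \<lhd> g)" "?X \<in> Zero A"
    using assms beta_el[of g] by (auto simp: subequalizing_def underlying_monad_def cell_defs)
  from em_lift1[OF monad_T(2) E this] show ?thesis using assms by (auto simp: cell_defs)
qed

lemma em_lift2':
  assumes "f \<in> One A" "g \<in> One A" "Src A f = Src A g" "Trg A f = D" "Trg A g = D" "s \<in> Two A" "Dom A s = U \<odot> f" "Cod A s = U \<odot> g"
    "s \<cdot> (\<beta> \<lhd> f) = (\<beta> \<lhd> g) \<cdot> (R \<rhd> s)"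
  shows "\<exists>t. t \<in> Two A \<and> Dom A t = f \<and> Cod A t = g \<and> U \<rhd> t = s"
  using em_lift2[OF monad_T(2) E, of f "Src A g" g s] assms by (auto simp: cell_defs underlying_monad_def)

lemmas em_inj2 = em_faithful[OF monad_T(2) E]

lemma U_algebra_map: "s \<in> Two A \<Longrightarrow> Trg A (Dom A s) = D \<Longrightarrow> (U \<rhd> s) \<cdot> (\<beta> \<lhd> Dom A s) = (\<beta> \<lhd> Cod A s) \<cdot> (R \<rhd> U \<rhd> s)"
  using whisker_exchange[of s \<beta>] by simp

text \<open>The cell \<open>q \<cdot> \<mu>\<close> coequalizes the \<open>R\<close>-image of the pair that defines \<open>q\<close>, so it factors through the
  coequalizer \<open>R \<rhd> q\<close>. The factor is an action on the target of \<open>q\<close>: its laws hold after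
  precomposition with \<open>q\<close> and with \<open>R \<rhd> R \<rhd> q\<close>.\<close>

lemma tensor_exists:
  assumes "standard_coequalizer A T E q"
  shows "\<exists>t. t \<in> One A \<and> Src A t = Prod A D D \<and> Trg A t = D \<and> U \<odot> t = Cod A q \<and>
    (\<beta> \<lhd> t) \<cdot> (R \<rhd> q) = q \<cdot> (\<mu> \<lhd> ten1 A M (U \<odot> Pr1 A D D) (U \<odot> Pr2 A D D))"
proof -
  let ?X = "Prod A D D" let ?x = "U \<odot> Pr1 A D D" let ?y = "U \<odot> Pr2 A D D" let ?t = "ten1 A M ?x ?y" let ?h = "Cod A q"
  let ?b = "ten2 A M (\<beta> \<lhd> Pr1 A D D) (\<beta> \<lhd> Pr2 A D D)" let ?p = "at2 A \<phi> ?x ?y"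
  have c: "reflexive_coequalizer ?X C ((\<mu> \<lhd> ?t) \<cdot> (R \<rhd> ?p)) (R \<rhd> ?b) q"
    using assms coeq_pair_reflexive[of "Pr1 A D D" "Pr2 A D D" ?X]
    unfolding standard_coequalizer_def Let_def reflexive_coequalizer_def by simp
  note c1 = rc_post[OF rc(4), of ?X, simplified, OF c]
  note c2 = rc_post[OF rc(4), of ?X, simplified, OF c1]
  note d = conjunct2[OF c[unfolded reflexive_coequalizer_def]]
  note d1 = conjunct2[OF c1[unfolded reflexive_coequalizer_def]]
  note d2 = conjunct2[OF c2[unfolded reflexive_coequalizer_def]]
  have q [simp]: "q \<in> Two A" "Dom A q = R \<odot> ?t" using coequalizerD(3,6)[OF d] by simp_all
  have h [simp]: "?h \<in> One A" "Src A ?h = ?X" "Trg A ?h = C" using boundary_mem(4-6)[OF q(1)] by simp_all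
  have qs: "q \<cdot> (\<mu> \<lhd> ?t) \<cdot> (R \<rhd> ?p) = q \<cdot> (R \<rhd> ?b)" using coequalizerD(9)[OF d] by simp
  have n1: "(\<mu> \<lhd> (R \<odot> ?t)) \<cdot> (R \<rhd> R \<rhd> ?p) = (R \<rhd> ?p) \<cdot> (\<mu> \<lhd> ten1 A M (R \<odot> ?x) (R \<odot> ?y))"
    using whisker_exchange[of ?p \<mu>] by simp
  have n2: "(\<mu> \<lhd> ?t) \<cdot> (R \<rhd> R \<rhd> ?b) = (R \<rhd> ?b) \<cdot> (\<mu> \<lhd> ten1 A M (R \<odot> ?x) (R \<odot> ?y))"
    using whisker_exchange[of ?b \<mu>] by simp
  have "(q \<cdot> (\<mu> \<lhd> ?t)) \<cdot> (R \<rhd> (\<mu> \<lhd> ?t)) \<cdot> (R \<rhd> R \<rhd> ?p) = q \<cdot> ((\<mu> \<lhd> ?t) \<cdot> (R \<rhd> (\<mu> \<lhd> ?t))) \<cdot> (R \<rhd> R \<rhd> ?p)"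
    by simp
  also have "\<dots> = q \<cdot> (\<mu> \<lhd> ?t) \<cdot> ((\<mu> \<lhd> (R \<odot> ?t)) \<cdot> (R \<rhd> R \<rhd> ?p))"
    by (subst mu_R_eta_el(3)) simp_all
  also have "\<dots> = (q \<cdot> (\<mu> \<lhd> ?t) \<cdot> (R \<rhd> ?p)) \<cdot> (\<mu> \<lhd> ten1 A M (R \<odot> ?x) (R \<odot> ?y))"
    unfolding n1 by simp
  also have "\<dots> = q \<cdot> ((R \<rhd> ?b) \<cdot> (\<mu> \<lhd> ten1 A M (R \<odot> ?x) (R \<odot> ?y)))" unfolding qs by simp
  also have "\<dots> = (q \<cdot> (\<mu> \<lhd> ?t)) \<cdot> (R \<rhd> R \<rhd> ?b)" unfolding n2[symmetric] by simp
  finally have "(q \<cdot> (\<mu> \<lhd> ?t)) \<cdot> (R \<rhd> (\<mu> \<lhd> ?t)) \<cdot> (R \<rhd> R \<rhd> ?p) = (q \<cdot> (\<mu> \<lhd> ?t)) \<cdot> (R \<rhd> R \<rhd> ?b)" .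
  then obtain a where a [simp]: "a \<in> Two A" "Dom A a = R \<odot> ?h" "Cod A a = ?h" and aq: "a \<cdot> (R \<rhd> q) = q \<cdot> (\<mu> \<lhd> ?t)"
    using coequalizer_factor[OF d1, of "q \<cdot> (\<mu> \<lhd> ?t)"] by auto
  have unit: "a \<cdot> (\<eta> \<lhd> ?h) = Id2 A ?h"
  proof (rule coequalizer_epi[OF d])
    have "(\<eta> \<lhd> ?h) \<cdot> q = (R \<rhd> q) \<cdot> (\<eta> \<lhd> (R \<odot> ?t))" using whisker_exchange[of q \<eta>] by simp
    then have "(a \<cdot> (\<eta> \<lhd> ?h)) \<cdot> q = (a \<cdot> (R \<rhd> q)) \<cdot> (\<eta> \<lhd> (R \<odot> ?t))" by simp
    also have "\<dots> = q" unfolding aq by (simp add: mu_R_eta_el)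
    finally show "(a \<cdot> (\<eta> \<lhd> ?h)) \<cdot> q = Id2 A ?h \<cdot> q" by simp
  qed simp_all
  have assoc: "a \<cdot> (R \<rhd> a) = a \<cdot> (\<mu> \<lhd> ?h)"
  proof (rule coequalizer_epi[OF d2])
    have "(a \<cdot> (R \<rhd> a)) \<cdot> (R \<rhd> R \<rhd> q) = a \<cdot> (R \<rhd> (a \<cdot> (R \<rhd> q)))" by simp
    also have "\<dots> = a \<cdot> (R \<rhd> (q \<cdot> (\<mu> \<lhd> ?t)))" unfolding aq ..
    also have "\<dots> = (a \<cdot> (R \<rhd> q)) \<cdot> (R \<rhd> (\<mu> \<lhd> ?t))" by simp
    also have "\<dots> = q \<cdot> (\<mu> \<lhd> ?t) \<cdot> (\<mu> \<lhd> (R \<odot> ?t))" unfolding aq by (simp add: mu_R_eta_el)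
    also have "\<dots> = (a \<cdot> (R \<rhd> q)) \<cdot> (\<mu> \<lhd> (R \<odot> ?t))" unfolding aq by simp
    also have "\<dots> = (a \<cdot> (\<mu> \<lhd> ?h)) \<cdot> (R \<rhd> R \<rhd> q)" using whisker_exchange[of q \<mu>] by simp
    finally show "(a \<cdot> (R \<rhd> a)) \<cdot> (R \<rhd> R \<rhd> q) = (a \<cdot> (\<mu> \<lhd> ?h)) \<cdot> (R \<rhd> R \<rhd> q)" .
  qed simp_all
  obtain t where "t \<in> One A" "Src A t = ?X" "Trg A t = D" "U \<odot> t = ?h" "\<beta> \<lhd> t = a"
    using em_lift1'[of ?h ?X a] unit assoc by auto
  with aq show ?thesis by auto
qed

end

context em_std
begin

lemma unit_at_N [simp]: "X \<in> Zero A \<Longrightarrow> unit_at A N X = F \<odot> unit_at A M X"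
  by (simp add: unit_at_def[of A N])

text \<open>The coherence cell of the forgetful 1-cell at generalized elements \<open>x\<close> and \<open>y\<close>, which is the
  universal bimorphism of the hom-category.\<close>

definition uu where "uu x y = at2 A q x y \<cdot> (\<eta> \<lhd> ten1 A M (U \<odot> x) (U \<odot> y))"

context
  fixes X assumes X [simp]: "X \<in> Zero A"
begin

interpretation H: monoidal_algebra_tensor "hob X" "har X" hdom hcod hone hcomp "ten1 A M" htar "Comp1 A R" hR hphi heta hmu
    "halg X" "Comp1 A U" hact "Comp1 A F" "ten1 A N" hq "unit_at A M X" hasc hasc' "hlun X" "hlun' X" "hrun X" "hrun' X"
  by (rule hom_monoidal) simp

lemma hom_u_eq: "H.u x y = HCell (ten1 A M (U \<odot> x) (U \<odot> y)) (uu x y) (U \<odot> ten1 A N x y)"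
  by (simp add: H.u_def hcomp_def hq_def heta_def uu_def)

lemma amap_cell:
  assumes "halg X x" "halg X y" "s \<in> Two A" "Dom A s = x" "Cod A s = y"
  shows "H.amap x y (HCell (U \<odot> x) (U \<rhd> s) (U \<odot> y))"
  using halgD[OF assms(1)] halgD[OF assms(2)] assms U_algebra_map[of s]
  by (simp add: H.amap_def har_HCell hcomp_def hact_def hR_def)

lemma cell_amap:
  assumes w: "H.amap x y w" and xy: "halg X x" "halg X y"
  obtains s where "s \<in> Two A" "Dom A s = x" "Cod A s = y" "w = HCell (U \<odot> x) (U \<rhd> s) (U \<odot> y)"
proof -
  note [simp] = halgD[OF xy(1)] halgD[OF xy(2)]
  have a: "har X w" "hdom w = U \<odot> x" "hcod w = U \<odot> y" "cell w \<cdot> (\<beta> \<lhd> x) = (\<beta> \<lhd> y) \<cdot> (R \<rhd> cell w)"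
    using H.amapD[OF w] by (simp_all add: hcomp_def hact_def hR_def)
  obtain s where "s \<in> Two A" "Dom A s = x" "Cod A s = y" "U \<rhd> s = cell w"
    using em_lift2'[of x y "cell w"] a harD[OF a(1)] by auto
  then show ?thesis using that[of s] a by (metis hcell.collapse)
qed

lemma q_el_epi:
  assumes "halg X x" "halg X y" "v \<in> Two A" "w \<in> Two A" "Dom A v = U \<odot> ten1 A N x y" "Dom A w = U \<odot> ten1 A N x y" "v \<cdot> at2 A q x y = w \<cdot> at2 A q x y"
  shows "v = w"
proof -
  note [simp] = halgD[OF assms(1)] halgD[OF assms(2)]
  have "coequalizer A X C ((\<mu> \<lhd> ten1 A M (U \<odot> x) (U \<odot> y)) \<cdot> (R \<rhd> at2 A \<phi> (U \<odot> x) (U \<odot> y))) (R \<rhd> ten2 A M (\<beta> \<lhd> x) (\<beta> \<lhd> y)) (at2 A q x y)"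
    using q_at_coeq[of x X y] by (simp add: reflexive_coequalizer_def)
  then show ?thesis by (rule coequalizer_epi) (use assms in simp_all)
qed

abbreviation "lun_formula x \<equiv> (\<beta> \<lhd> x) \<cdot> (\<mu> \<lhd> (U \<odot> x)) \<cdot> (R \<rhd> R \<rhd> (Lun M \<lhd> (U \<odot> x))) \<cdot> (R \<rhd> at2 A \<phi> (unit_at A M X) (U \<odot> x)) \<cdot>
          (R \<rhd> ten2 A M (Id2 A (R \<odot> unit_at A M X)) (\<eta> \<lhd> (U \<odot> x)))"
abbreviation "run_formula x \<equiv> (\<beta> \<lhd> x) \<cdot> (\<mu> \<lhd> (U \<odot> x)) \<cdot> (R \<rhd> R \<rhd> (Run M \<lhd> (U \<odot> x))) \<cdot> (R \<rhd> at2 A \<phi> (U \<odot> x) (unit_at A M X)) \<cdot>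
          (R \<rhd> ten2 A M (\<eta> \<lhd> (U \<odot> x)) (Id2 A (R \<odot> unit_at A M X)))"

lemma left_unit_cell:
  assumes x: "halg X x"
  shows "\<exists>l l'. inverse_cells A l l' \<and> l \<in> Two A \<and> Dom A l = ten1 A N (unit_at A N X) x \<and> Cod A l = x \<and>
    (U \<rhd> l) \<cdot> at2 A q (unit_at A N X) x = lun_formula x"
proof -
  note [simp] = halgD[OF x]
  let ?I = "unit_at A M X" let ?J = "F \<odot> ?I" let ?t = "ten1 A N ?J x"
  have J: "halg X ?J" "halg X ?t" by (simp_all add: halg_def)
  obtain w w' where w: "H.amap ?t x w" "H.amap x ?t w'" "hcomp w w' = hone (U \<odot> x)" "hcomp w' w = hone (U \<odot> ?t)"
    "hcomp w (hq ?J x) = hcomp (hact x) (hcomp (hmu (U \<odot> x)) (hcomp (hR (hR (hlun X (U \<odot> x)))) (hcomp (hR (hphi ?I (U \<odot> x))) (hR (htar (hone (R \<odot> ?I)) (heta (U \<odot> x)))))))"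
    by (rule H.left_unit[OF x])
  obtain l where l: "l \<in> Two A" "Dom A l = ?t" "Cod A l = x" "w = HCell (U \<odot> ?t) (U \<rhd> l) (U \<odot> x)"
    by (rule cell_amap[OF w(1) J(2) x])
  obtain l' where l': "l' \<in> Two A" "Dom A l' = x" "Cod A l' = ?t" "w' = HCell (U \<odot> x) (U \<rhd> l') (U \<odot> ?t)"
    by (rule cell_amap[OF w(2) x J(2)])
  have "l \<cdot> l' = Id2 A x" by (rule em_inj2) (use w(3) l l' in \<open>simp_all add: hcomp_def hone_def\<close>)
  moreover have "l' \<cdot> l = Id2 A ?t" by (rule em_inj2) (use w(4) l l' in \<open>simp_all add: hcomp_def hone_def\<close>)
  ultimately have "inverse_cells A l l'" using l l' by (auto simp: inverse_cells_def cell_defs)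
  moreover have "(U \<rhd> l) \<cdot> at2 A q ?J x = lun_formula x"
    using w(5) l by (simp add: hdefs hact_def hq_def hlun_def)
  ultimately show ?thesis using l by auto
qed

lemma right_unit_cell:
  assumes x: "halg X x"
  shows "\<exists>l l'. inverse_cells A l l' \<and> l \<in> Two A \<and> Dom A l = ten1 A N x (unit_at A N X) \<and> Cod A l = x \<and>
    (U \<rhd> l) \<cdot> at2 A q x (unit_at A N X) = run_formula x"
proof -
  note [simp] = halgD[OF x]
  let ?I = "unit_at A M X" let ?J = "F \<odot> ?I" let ?t = "ten1 A N x ?J"
  have J: "halg X ?J" "halg X ?t" by (simp_all add: halg_def)
  obtain w w' where w: "H.amap ?t x w" "H.amap x ?t w'" "hcomp w w' = hone (U \<odot> x)" "hcomp w' w = hone (U \<odot> ?t)"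
    "hcomp w (hq x ?J) = hcomp (hact x) (hcomp (hmu (U \<odot> x)) (hcomp (hR (hR (hrun X (U \<odot> x)))) (hcomp (hR (hphi (U \<odot> x) ?I)) (hR (htar (heta (U \<odot> x)) (hone (R \<odot> ?I)))))))"
    by (rule H.right_unit[OF x])
  obtain l where l: "l \<in> Two A" "Dom A l = ?t" "Cod A l = x" "w = HCell (U \<odot> ?t) (U \<rhd> l) (U \<odot> x)"
    by (rule cell_amap[OF w(1) J(2) x])
  obtain l' where l': "l' \<in> Two A" "Dom A l' = x" "Cod A l' = ?t" "w' = HCell (U \<odot> x) (U \<rhd> l') (U \<odot> ?t)"
    by (rule cell_amap[OF w(2) x J(2)])
  have "l \<cdot> l' = Id2 A x" by (rule em_inj2) (use w(3) l l' in \<open>simp_all add: hcomp_def hone_def\<close>)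
  moreover have "l' \<cdot> l = Id2 A ?t" by (rule em_inj2) (use w(4) l l' in \<open>simp_all add: hcomp_def hone_def\<close>)
  ultimately have "inverse_cells A l l'" using l l' by (auto simp: inverse_cells_def cell_defs)
  moreover have "(U \<rhd> l) \<cdot> at2 A q x ?J = run_formula x"
    using w(5) l by (simp add: hdefs hact_def hq_def hrun_def)
  ultimately show ?thesis using l by auto
qed

context
  fixes x y z assumes alg: "halg X x" "halg X y" "halg X z"
begin

lemma hom_q_left: "H.q_left x y z = HCell (R \<odot> ten1 A M (U \<odot> x) (ten1 A M (U \<odot> y) (U \<odot> z))) (q_left A T E q N x y z) (U \<odot> ten1 A N x (ten1 A N y z))"
  by (simp add: H.q_left_def q_left_def Let_def hdefs hq_def)

lemma hom_q_right: "H.q_right x y z = HCell (R \<odot> ten1 A M (ten1 A M (U \<odot> x) (U \<odot> y)) (U \<odot> z)) (q_right A T E q N x y z) (U \<odot> ten1 A N (ten1 A N x y) z)"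
  by (simp add: H.q_right_def q_right_def Let_def hdefs hq_def)

lemma q_left_epi:
  assumes "v \<in> Two A" "w \<in> Two A" "Dom A v = U \<odot> ten1 A N x (ten1 A N y z)" "Dom A w = U \<odot> ten1 A N x (ten1 A N y z)"
    "v \<cdot> q_left A T E q N x y z = w \<cdot> q_left A T E q N x y z" "Cod A v = Cod A w"
  shows "v = w"
proof -
  note [simp] = halgD[OF alg(1)] halgD[OF alg(2)] halgD[OF alg(3)]
  let ?v = "HCell (Dom A v) v (Cod A v)" let ?w = "HCell (Dom A w) w (Cod A w)"
  have "?v = ?w"
  proof (rule H.epiD[OF H.epi_q_left[OF alg]])
    show "hcomp ?v (H.q_left x y z) = hcomp ?w (H.q_left x y z)" using assms by (simp add: hcomp_def hom_q_left)
  qed (use assms in \<open>simp_all add: har_HCell hom_q_left\<close>)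
  then show ?thesis by simp
qed

lemma associator_cell:
  shows "\<exists>l l'. inverse_cells A l l' \<and> l \<in> Two A \<and> Dom A l = ten1 A N x (ten1 A N y z) \<and> Cod A l = ten1 A N (ten1 A N x y) z \<and>
    (U \<rhd> l) \<cdot> q_left A T E q N x y z = q_right A T E q N x y z \<cdot> (R \<rhd> at3 A (Asc M) (U \<odot> x) (U \<odot> y) (U \<odot> z))"
proof -
  note [simp] = halgD[OF alg(1)] halgD[OF alg(2)] halgD[OF alg(3)]
  let ?l = "ten1 A N x (ten1 A N y z)" let ?r = "ten1 A N (ten1 A N x y) z"
  have J: "halg X ?l" "halg X ?r" by (simp_all add: halg_def)
  obtain w w' where w: "H.amap ?l ?r w" "H.amap ?r ?l w'" "hcomp w w' = hone (U \<odot> ?r)" "hcomp w' w = hone (U \<odot> ?l)"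
    "hcomp w (H.u_left x y z) = hcomp (H.u_right x y z) (hasc (U \<odot> x) (U \<odot> y) (U \<odot> z))"
    by (rule H.associator[OF alg])
  obtain l where l: "l \<in> Two A" "Dom A l = ?l" "Cod A l = ?r" "w = HCell (U \<odot> ?l) (U \<rhd> l) (U \<odot> ?r)"
    by (rule cell_amap[OF w(1) J])
  obtain l' where l': "l' \<in> Two A" "Dom A l' = ?r" "Cod A l' = ?l" "w' = HCell (U \<odot> ?r) (U \<rhd> l') (U \<odot> ?l)"
    by (rule cell_amap[OF w(2) J(2,1)])
  have "l \<cdot> l' = Id2 A ?r" by (rule em_inj2) (use w(3) l l' in \<open>simp_all add: hcomp_def hone_def\<close>)
  moreover have "l' \<cdot> l = Id2 A ?l" by (rule em_inj2) (use w(4) l l' in \<open>simp_all add: hcomp_def hone_def\<close>)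
  ultimately have "inverse_cells A l l'" using l l' by (auto simp: inverse_cells_def cell_defs)
  moreover have "hcomp w (H.q_left x y z) = hcomp (H.q_right x y z) (hR (hasc (U \<odot> x) (U \<odot> y) (U \<odot> z)))"
    using H.associator_q[OF alg w(1)] w(5) by blast
  then have "(U \<rhd> l) \<cdot> q_left A T E q N x y z = q_right A T E q N x y z \<cdot> (R \<rhd> at3 A (Asc M) (U \<odot> x) (U \<odot> y) (U \<odot> z))"
    unfolding hom_q_left hom_q_right l(4) by (simp add: hcomp_def hR_def hasc_def)
  ultimately show ?thesis using l by auto
qed

end

end

end

context em_setup
begin

lemma standard_structureD:
  assumes "standard_coequalizer A T E q" "standard_structure A T E q N"
  shows "em_std A T E q N"
proof -
  have "(\<beta> \<lhd> Ten N) \<cdot> (R \<rhd> q) = q \<cdot> (\<mu> \<lhd> ten1 A M (U \<odot> Pr1 A D D) (U \<odot> Pr2 A D D))"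
    "Und N = D" "Unt N = F \<odot> Unt M" "one_cell A (Ten N) (Prod A D D) D" "U \<odot> Ten N = Cod A q"
    using assms(2) unfolding standard_structure_def Let_def unique_two_cell_def by blast+
  then show ?thesis using assms(1) by unfold_locales (auto simp: cell_defs)
qed

lemma ten1_cong: "Ten N' = Ten N \<Longrightarrow> ten1 A N' = ten1 A N"
  by (intro ext) (simp only: ten1_def)

lemma unit_at_cong: "Unt N' = Unt N \<Longrightarrow> unit_at A N' = unit_at A N"
  by (intro ext) (simp only: unit_at_def)

lemma q_left_cong: "Ten N' = Ten N \<Longrightarrow> q_left A T E q N' = q_left A T E q N" "Ten N' = Ten N \<Longrightarrow> q_right A T E q N' = q_right A T E q N"
  using ten1_cong[of N' N] by (simp_all add: q_left_def q_right_def fun_eq_iff Let_def)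

lemma standard_structure_unique:
  assumes q: "standard_coequalizer A T E q" and N: "standard_structure A T E q N" and N': "standard_structure A T E q N'"
  shows "N = N'"
proof -
  interpret s: em_std A T E q N by (rule standard_structureD[OF q N])
  interpret s': em_std A T E q N' by (rule standard_structureD[OF q N'])
  note d = N[unfolded standard_structure_def Let_def] and d' = N'[unfolded standard_structure_def Let_def]
  have uniq: "unique_two_cell A P f g x \<Longrightarrow> unique_two_cell A P f g y \<Longrightarrow> x = y" for P f g x y
    unfolding unique_two_cell_def by blast
  have act: "\<beta> \<lhd> Ten N' = \<beta> \<lhd> Ten N" using d d' by (blast intro: uniq)
  have ten: "Ten N' = Ten N"
  proof (rule em_inj1[OF _ _ _ _ _ _ act])
    show "U \<odot> Ten N' = U \<odot> Ten N" using s.N(6) s'.N(6) by metis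
  qed simp_all
  have unt: "Unt N' = Unt N" by simp
  note e = ten1_cong[OF ten] unit_at_cong[OF unt] q_left_cong[OF ten]
  note d'' = d'[unfolded e]
  let ?x = "proj3_1 A D" let ?y = "proj3_2 A D" let ?z = "proj3_3 A D"
  have lun: "U \<rhd> Lun N = U \<rhd> Lun N'" using d d'' by (blast intro: uniq)
  have run: "U \<rhd> Run N = U \<rhd> Run N'" using d d'' by (blast intro: uniq)
  have asc: "U \<rhd> Asc N = U \<rhd> Asc N'" using d d'' by (blast intro: uniq)
  have t: "two_cell A (Lun N) (ten1 A N (unit_at A N D) (Id1 A D)) (Id1 A D)" "two_cell A (Lun N') (ten1 A N (unit_at A N D) (Id1 A D)) (Id1 A D)"
    "two_cell A (Run N) (ten1 A N (Id1 A D) (unit_at A N D)) (Id1 A D)" "two_cell A (Run N') (ten1 A N (Id1 A D) (unit_at A N D)) (Id1 A D)"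
    "two_cell A (Asc N) (ten1 A N ?x (ten1 A N ?y ?z)) (ten1 A N (ten1 A N ?x ?y) ?z)"
    "two_cell A (Asc N') (ten1 A N ?x (ten1 A N ?y ?z)) (ten1 A N (ten1 A N ?x ?y) ?z)"
    using d d'' by blast+
  have "Lun N = Lun N'" by (rule em_inj2[OF _ _ _ _ _ lun]) (use t in \<open>simp_all add: cell_defs\<close>)
  moreover have "Run N = Run N'" by (rule em_inj2[OF _ _ _ _ _ run]) (use t in \<open>simp_all add: cell_defs\<close>)
  moreover have "Asc N = Asc N'" by (rule em_inj2[OF _ _ _ _ _ asc]) (use t in \<open>simp_all add: cell_defs\<close>)
  ultimately show ?thesis by (intro mon_obj.equality) (simp_all add: ten)
qed

text \<open>The coherence cells are obtained at the universal elements, namely at the identity and at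
  product projections, from a structure \<open>N0\<close> in which only the tensor product and the unit are
  meaningful.\<close>

lemma standard_structure_exists:
  assumes q: "standard_coequalizer A T E q"
  shows "\<exists>N. standard_structure A T E q N"
proof -
  obtain t where t: "t \<in> One A" "Src A t = Prod A D D" "Trg A t = D" "U \<odot> t = Cod A q"
    "(\<beta> \<lhd> t) \<cdot> (R \<rhd> q) = q \<cdot> (\<mu> \<lhd> ten1 A M (U \<odot> Pr1 A D D) (U \<odot> Pr2 A D D))"
    using tensor_exists[OF q] by blast
  define N0 :: "('o, 'a, 't) mon_obj" where "N0 = \<lparr>Und = D, Ten = t, Unt = F \<odot> Unt M, Asc = undefined, Lun = undefined, Run = undefined\<rparr>"
  interpret n: em_std A T E q N0
    using q t by unfold_locales (simp_all add: N0_def)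
  have TN0: "Ten N0 = t" by (simp add: N0_def)
  let ?x = "proj3_1 A D" let ?y = "proj3_2 A D" let ?z = "proj3_3 A D" let ?D3 = "Prod A D (Prod A D D)"
  have alg: "halg D (Id1 A D)" "halg ?D3 ?x" "halg ?D3 ?y" "halg ?D3 ?z" by (simp_all add: halg_def)
  obtain l where l: "l \<in> Two A" "Dom A l = ten1 A N0 (unit_at A N0 D) (Id1 A D)" "Cod A l = Id1 A D"
    "(U \<rhd> l) \<cdot> at2 A q (unit_at A N0 D) (Id1 A D) = n.lun_formula D (Id1 A D)"
    using n.left_unit_cell[OF _ alg(1)] by auto
  obtain r where r: "r \<in> Two A" "Dom A r = ten1 A N0 (Id1 A D) (unit_at A N0 D)" "Cod A r = Id1 A D"
    "(U \<rhd> r) \<cdot> at2 A q (Id1 A D) (unit_at A N0 D) = n.run_formula D (Id1 A D)"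
    using n.right_unit_cell[OF _ alg(1)] by auto
  obtain a where a: "a \<in> Two A" "Dom A a = ten1 A N0 ?x (ten1 A N0 ?y ?z)" "Cod A a = ten1 A N0 (ten1 A N0 ?x ?y) ?z"
    "(U \<rhd> a) \<cdot> q_left A T E q N0 ?x ?y ?z = q_right A T E q N0 ?x ?y ?z \<cdot> (R \<rhd> at3 A (Asc M) (U \<odot> ?x) (U \<odot> ?y) (U \<odot> ?z))"
    using n.associator_cell[OF _ alg(2-4)] by auto
  define N where "N = N0\<lparr>Asc := a, Lun := l, Run := r\<rparr>"
  have N: "Und N = D" "Unt N = F \<odot> Unt M" "Ten N = t" "Asc N = a" "Lun N = l" "Run N = r" by (simp_all add: N_def N0_def)
  have ten: "Ten N = Ten N0" "Unt N = Unt N0" by (simp_all add: N_def N0_def)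
  note e = ten1_cong[OF ten(1)] unit_at_cong[OF ten(2)] q_left_cong[OF ten(1)]
  have Rq: "coequalizer A (Prod A D D) C (R \<rhd> ((\<mu> \<lhd> ten1 A M (U \<odot> Pr1 A D D) (U \<odot> Pr2 A D D)) \<cdot> (R \<rhd> at2 A \<phi> (U \<odot> Pr1 A D D) (U \<odot> Pr2 A D D))))
     (R \<rhd> R \<rhd> ten2 A M (\<beta> \<lhd> Pr1 A D D) (\<beta> \<lhd> Pr2 A D D)) (R \<rhd> q)"
    using rc_post[OF rc(4)] n.q_coeq unfolding R_mem reflexive_coequalizer_def by blast
  have J: "halg D (unit_at A N0 D)" by (simp add: halg_def)
  have u0: "unique_two_cell A (\<lambda>t. t \<cdot> (R \<rhd> q) = q \<cdot> (\<mu> \<lhd> ten1 A M (U \<odot> Pr1 A D D) (U \<odot> Pr2 A D D))) (R \<odot> Cod A q) (Cod A q) (\<beta> \<lhd> t)"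
    unfolding unique_two_cell_def
  proof (intro conjI allI impI)
    show "two_cell A (\<beta> \<lhd> t) (R \<odot> Cod A q) (Cod A q)" using t unfolding t(4)[symmetric] by (simp add: cell_defs)
    fix y assume y: "two_cell A y (R \<odot> Cod A q) (Cod A q) \<and> y \<cdot> (R \<rhd> q) = q \<cdot> (\<mu> \<lhd> ten1 A M (U \<odot> Pr1 A D D) (U \<odot> Pr2 A D D))"
    show "y = \<beta> \<lhd> t"
      by (rule coequalizer_epi[OF Rq]) (use y t(1-3,5) TN0 in \<open>simp_all add: cell_defs\<close>)
  qed (rule t)
  have u1: "unique_two_cell A (\<lambda>t. t \<cdot> at2 A q (unit_at A N0 D) (Id1 A D) = n.lun_formula D (Id1 A D)) (U \<odot> ten1 A N0 (unit_at A N0 D) (Id1 A D)) U (U \<rhd> l)"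
    unfolding unique_two_cell_def
  proof (intro conjI allI impI)
    fix y assume y: "two_cell A y (U \<odot> ten1 A N0 (unit_at A N0 D) (Id1 A D)) U \<and> y \<cdot> at2 A q (unit_at A N0 D) (Id1 A D) = n.lun_formula D (Id1 A D)"
    show "y = U \<rhd> l"
      by (rule n.q_el_epi[OF _ J alg(1)]) (use y l in \<open>simp_all add: cell_defs\<close>)
  qed (use l in \<open>simp_all add: cell_defs\<close>)
  have u2: "unique_two_cell A (\<lambda>t. t \<cdot> at2 A q (Id1 A D) (unit_at A N0 D) = n.run_formula D (Id1 A D)) (U \<odot> ten1 A N0 (Id1 A D) (unit_at A N0 D)) U (U \<rhd> r)"
    unfolding unique_two_cell_def
  proof (intro conjI allI impI)
    fix y assume y: "two_cell A y (U \<odot> ten1 A N0 (Id1 A D) (unit_at A N0 D)) U \<and> y \<cdot> at2 A q (Id1 A D) (unit_at A N0 D) = n.run_formula D (Id1 A D)"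
    show "y = U \<rhd> r"
      by (rule n.q_el_epi[OF _ alg(1) J]) (use y r in \<open>simp_all add: cell_defs\<close>)
  qed (use r in \<open>simp_all add: cell_defs\<close>)
  have u3: "unique_two_cell A (\<lambda>t. t \<cdot> q_left A T E q N0 ?x ?y ?z = q_right A T E q N0 ?x ?y ?z \<cdot> (R \<rhd> at3 A (Asc M) (U \<odot> ?x) (U \<odot> ?y) (U \<odot> ?z)))
     (U \<odot> ten1 A N0 ?x (ten1 A N0 ?y ?z)) (U \<odot> ten1 A N0 (ten1 A N0 ?x ?y) ?z) (U \<rhd> a)"
    unfolding unique_two_cell_def
  proof (intro conjI allI impI)
    fix y assume y: "two_cell A y (U \<odot> ten1 A N0 ?x (ten1 A N0 ?y ?z)) (U \<odot> ten1 A N0 (ten1 A N0 ?x ?y) ?z) \<and>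
       y \<cdot> q_left A T E q N0 ?x ?y ?z = q_right A T E q N0 ?x ?y ?z \<cdot> (R \<rhd> at3 A (Asc M) (U \<odot> ?x) (U \<odot> ?y) (U \<odot> ?z))"
    show "y = U \<rhd> a"
      by (rule n.q_left_epi[OF _ alg(2-4)]) (use y a in \<open>simp_all add: cell_defs\<close>)
  qed (use a in \<open>simp_all add: cell_defs\<close>)
  have tc: "two_cell A l (ten1 A N0 (unit_at A N0 D) (Id1 A D)) (Id1 A D)" "two_cell A r (ten1 A N0 (Id1 A D) (unit_at A N0 D)) (Id1 A D)"
    "two_cell A a (ten1 A N0 ?x (ten1 A N0 ?y ?z)) (ten1 A N0 (ten1 A N0 ?x ?y) ?z)" "one_cell A t (Prod A D D) D"
    using l r a t by (simp_all add: cell_defs)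
  have Id: "\<beta> \<lhd> Id1 A D = \<beta>" "U \<odot> Id1 A D = U" by simp_all
  have "standard_structure A T E q N"
    unfolding standard_structure_def Let_def N e
    by (intro conjI refl tc u0 u3 t(4) u1[unfolded Id] u2[unfolded Id])
  then show ?thesis by blast
qed

end

section \<open>The monoidal structure of the Eilenberg--Moore object\<close>

locale em_standard = em_setup A T E for A :: "('o, 'a, 't) fp_two_cat" (structure)
    and T :: "('o, 'a, 't) lax_monoidal_monad" and E :: "('o, 'a, 't) em_data" +
  fixes q :: 't and N :: "('o, 'a, 't) mon_obj"
  assumes q_std: "standard_coequalizer A T E q" and N_std: "standard_structure A T E q N"

sublocale em_standard \<subseteq> em_std
  using q_std N_std by (rule standard_structureD)

context em_standard
begin

lemma N_cells [simp]: "Lun N \<in> Two A" "Dom A (Lun N) = ten1 A N (F \<odot> unit_at A M D) (Id1 A D)" "Cod A (Lun N) = Id1 A D"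
  "Run N \<in> Two A" "Dom A (Run N) = ten1 A N (Id1 A D) (F \<odot> unit_at A M D)" "Cod A (Run N) = Id1 A D"
  "Asc N \<in> Two A" "Dom A (Asc N) = ten1 A N (proj3_1 A D) (ten1 A N (proj3_2 A D) (proj3_3 A D))"
  "Cod A (Asc N) = ten1 A N (ten1 A N (proj3_1 A D) (proj3_2 A D)) (proj3_3 A D)"
  using N_std by (auto simp: standard_structure_def Let_def cell_defs)

lemma N_eqs:
  "(U \<rhd> Lun N) \<cdot> at2 A q (F \<odot> unit_at A M D) (Id1 A D) = lun_formula D (Id1 A D)"
  "(U \<rhd> Run N) \<cdot> at2 A q (Id1 A D) (F \<odot> unit_at A M D) = run_formula D (Id1 A D)"
  "(U \<rhd> Asc N) \<cdot> q_left A T E q N (proj3_1 A D) (proj3_2 A D) (proj3_3 A D) =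
     q_right A T E q N (proj3_1 A D) (proj3_2 A D) (proj3_3 A D) \<cdot>
     (R \<rhd> at3 A (Asc M) (U \<odot> proj3_1 A D) (U \<odot> proj3_2 A D) (U \<odot> proj3_3 A D))"
  using N_std unfolding standard_structure_def Let_def unique_two_cell_def by simp_all

lemma uu_mem [simp]:
  assumes "x \<in> One A" "y \<in> One A" "Src A y = Src A x" "Trg A x = D" "Trg A y = D"
  shows "uu x y \<in> Two A" "Dom A (uu x y) = ten1 A M (U \<odot> x) (U \<odot> y)" "Cod A (uu x y) = U \<odot> ten1 A N x y"
    "h \<in> One A \<Longrightarrow> Trg A h = Src A x \<Longrightarrow> uu x y \<lhd> h = uu (x \<odot> h) (y \<odot> h)"
  using assms q_at_mem[of x "Src A x" y] by (simp_all add: uu_def)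

abbreviation "UL \<equiv> standard_U A T E q N"

lemma UL_simps [simp]: "Lsrc UL = N" "Ltrg UL = M" "Lcell UL = U" "Lphi0 UL = \<eta> \<lhd> Unt M"
  by (simp_all add: standard_U_def Let_def)

lemma Lphi_UL: "Lphi UL = uu (Pr1 A D D) (Pr2 A D D)"
  by (simp add: standard_U_def Let_def uu_def at2_def)

lemma UL_at [simp]:
  assumes "x \<in> One A" "y \<in> One A" "Src A y = Src A x" "Trg A x = D" "Trg A y = D"
  shows "at2 A (Lphi UL) x y = uu x y"
  unfolding Lphi_UL at2_def using assms by simp

lemma uu_nat:
  assumes "s \<in> Two A" "t \<in> Two A" "Src A (Dom A t) = Src A (Dom A s)" "Trg A (Dom A s) = D" "Trg A (Dom A t) = D"
  shows "(U \<rhd> ten2 A N s t) \<cdot> uu (Dom A s) (Dom A t) = uu (Cod A s) (Cod A t) \<cdot> ten2 A M (U \<rhd> s) (U \<rhd> t)"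
proof -
  have "uu (Pr1 A D D) (Pr2 A D D) \<lhd> pair1 A (Cod A s) (Cod A t) = uu (Cod A s) (Cod A t)"
    "uu (Pr1 A D D) (Pr2 A D D) \<lhd> pair1 A (Dom A s) (Dom A t) = uu (Dom A s) (Dom A t)" using assms by simp_all
  then show ?thesis using whisker_exchange[of "pair2 A s t" "uu (Pr1 A D D) (Pr2 A D D)"] assms by simp
qed

context
  fixes X assumes X [simp]: "X \<in> Zero A"
begin

interpretation H: monoidal_algebra_tensor "hob X" "har X" hdom hcod hone hcomp "ten1 A M" htar "Comp1 A R" hR hphi heta hmu
    "halg X" "Comp1 A U" hact "Comp1 A F" "ten1 A N" hq "unit_at A M X" hasc hasc' "hlun X" "hlun' X" "hrun X" "hrun' X"
  by (rule hom_monoidal) simp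

lemma hom_u [simp]: "H.u x y = HCell (ten1 A M (U \<odot> x) (U \<odot> y)) (uu x y) (U \<odot> ten1 A N x y)"
  by (rule hom_u_eq[OF X])

lemma hom_amap_cell:
  assumes "s \<in> Two A" "Src A (Dom A s) = X" "Trg A (Dom A s) = D" "Dom A s = x" "Cod A s = y"
  shows "H.amap x y (HCell (U \<odot> x) (U \<rhd> s) (U \<odot> y))"
  by (rule amap_cell[OF X]) (use assms boundary_mem(5,6)[OF assms(1)] in \<open>auto simp: halg_def\<close>)

context
  fixes x assumes x: "halg X x"
begin

lemma lun_N_mem [simp]: "Lun N \<lhd> x \<in> Two A" "Dom A (Lun N \<lhd> x) = ten1 A N (F \<odot> unit_at A M X) x" "Cod A (Lun N \<lhd> x) = x"
  and run_N_mem [simp]: "Run N \<lhd> x \<in> Two A" "Dom A (Run N \<lhd> x) = ten1 A N x (F \<odot> unit_at A M X)" "Cod A (Run N \<lhd> x) = x"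
  using halgD[OF x] by simp_all

lemma lun_N_q: "(U \<rhd> (Lun N \<lhd> x)) \<cdot> at2 A q (F \<odot> unit_at A M X) x = lun_formula X x"
proof -
  note [simp] = halgD[OF x]
  show ?thesis using arg_cong[OF N_eqs(1), of "\<lambda>s. s \<lhd> x"] Lun_mem[OF rc(2)] by simp
qed

lemma run_N_q: "(U \<rhd> (Run N \<lhd> x)) \<cdot> at2 A q x (F \<odot> unit_at A M X) = run_formula X x"
proof -
  note [simp] = halgD[OF x]
  show ?thesis using arg_cong[OF N_eqs(2), of "\<lambda>s. s \<lhd> x"] Run_mem[OF rc(2)] by simp
qed

lemma hom_lun_N: "hcomp (HCell (U \<odot> ten1 A N (F \<odot> unit_at A M X) x) (U \<rhd> (Lun N \<lhd> x)) (U \<odot> x))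
   (hcomp (H.u (F \<odot> unit_at A M X) x) (htar (heta (unit_at A M X)) (hone (U \<odot> x)))) = hlun X (U \<odot> x)"
proof (rule H.left_unit_u[OF x])
  note [simp] = halgD[OF x]
  show "har X (HCell (U \<odot> ten1 A N (F \<odot> unit_at A M X) x) (U \<rhd> (Lun N \<lhd> x)) (U \<odot> x))" by (simp add: har_HCell)
  show "hcomp (HCell (U \<odot> ten1 A N (F \<odot> unit_at A M X) x) (U \<rhd> (Lun N \<lhd> x)) (U \<odot> x)) (hq (F \<odot> unit_at A M X) x) =
    hcomp (hact x) (hcomp (hmu (U \<odot> x)) (hcomp (hR (hR (hlun X (U \<odot> x)))) (hcomp (hR (hphi (unit_at A M X) (U \<odot> x))) (hR (htar (hone (R \<odot> unit_at A M X)) (heta (U \<odot> x)))))))"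
    using lun_N_q by (simp add: hdefs hact_def hq_def hlun_def)
qed simp_all

lemma hom_run_N: "hcomp (HCell (U \<odot> ten1 A N x (F \<odot> unit_at A M X)) (U \<rhd> (Run N \<lhd> x)) (U \<odot> x))
   (hcomp (H.u x (F \<odot> unit_at A M X)) (htar (hone (U \<odot> x)) (heta (unit_at A M X)))) = hrun X (U \<odot> x)"
proof (rule H.right_unit_u[OF x])
  note [simp] = halgD[OF x]
  show "har X (HCell (U \<odot> ten1 A N x (F \<odot> unit_at A M X)) (U \<rhd> (Run N \<lhd> x)) (U \<odot> x))" by (simp add: har_HCell)
  show "hcomp (HCell (U \<odot> ten1 A N x (F \<odot> unit_at A M X)) (U \<rhd> (Run N \<lhd> x)) (U \<odot> x)) (hq x (F \<odot> unit_at A M X)) =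
    hcomp (hact x) (hcomp (hmu (U \<odot> x)) (hcomp (hR (hR (hrun X (U \<odot> x)))) (hcomp (hR (hphi (U \<odot> x) (unit_at A M X))) (hR (htar (heta (U \<odot> x)) (hone (R \<odot> unit_at A M X)))))))"
    using run_N_q by (simp add: hdefs hact_def hq_def hrun_def)
qed simp_all

lemma lun_N_u: "(U \<rhd> (Lun N \<lhd> x)) \<cdot> uu (F \<odot> unit_at A M X) x \<cdot> ten2 A M (\<eta> \<lhd> unit_at A M X) (Id2 A (U \<odot> x)) = Lun M \<lhd> (U \<odot> x)"
  using hom_lun_N by (simp add: hdefs hlun_def)

lemma run_N_u: "(U \<rhd> (Run N \<lhd> x)) \<cdot> uu x (F \<odot> unit_at A M X) \<cdot> ten2 A M (Id2 A (U \<odot> x)) (\<eta> \<lhd> unit_at A M X) = Run M \<lhd> (U \<odot> x)"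
  using hom_run_N by (simp add: hdefs hrun_def)

end

context
  fixes x y z assumes alg: "halg X x" "halg X y" "halg X z"
begin

lemma asc_N_mem [simp]: "at3 A (Asc N) x y z \<in> Two A" "Dom A (at3 A (Asc N) x y z) = ten1 A N x (ten1 A N y z)"
   "Cod A (at3 A (Asc N) x y z) = ten1 A N (ten1 A N x y) z"
  using halgD[OF alg(1)] halgD[OF alg(2)] halgD[OF alg(3)] by (simp_all add: at3_def)

lemma asc_N_q: "(U \<rhd> at3 A (Asc N) x y z) \<cdot> q_left A T E q N x y z = q_right A T E q N x y z \<cdot> (R \<rhd> at3 A (Asc M) (U \<odot> x) (U \<odot> y) (U \<odot> z))"
proof -
  note [simp] = halgD[OF alg(1)] halgD[OF alg(2)] halgD[OF alg(3)]
  let ?x = "proj3_1 A D" let ?y = "proj3_2 A D" let ?z = "proj3_3 A D" let ?p = "pair1 A x (pair1 A y z)"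
  have l: "q_left A T E q N ?x ?y ?z \<in> Two A" "Cod A (q_left A T E q N ?x ?y ?z) = U \<odot> ten1 A N ?x (ten1 A N ?y ?z)"
     "Dom A (q_left A T E q N ?x ?y ?z) = R \<odot> ten1 A M (U \<odot> ?x) (ten1 A M (U \<odot> ?y) (U \<odot> ?z))"
     "q_left A T E q N ?x ?y ?z \<lhd> ?p = q_left A T E q N x y z"
    by (simp_all add: q_left_def Let_def)
  have r: "q_right A T E q N ?x ?y ?z \<in> Two A" "Cod A (q_right A T E q N ?x ?y ?z) = U \<odot> ten1 A N (ten1 A N ?x ?y) ?z"
     "Dom A (q_right A T E q N ?x ?y ?z) = R \<odot> ten1 A M (ten1 A M (U \<odot> ?x) (U \<odot> ?y)) (U \<odot> ?z)"
     "q_right A T E q N ?x ?y ?z \<lhd> ?p = q_right A T E q N x y z"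
    by (simp_all add: q_right_def Let_def)
  have "((U \<rhd> Asc N) \<cdot> q_left A T E q N ?x ?y ?z) \<lhd> ?p = (U \<rhd> at3 A (Asc N) x y z) \<cdot> q_left A T E q N x y z"
    using l by (simp add: at3_def)
  moreover have "(q_right A T E q N ?x ?y ?z \<cdot> (R \<rhd> at3 A (Asc M) (U \<odot> ?x) (U \<odot> ?y) (U \<odot> ?z))) \<lhd> ?p =
     q_right A T E q N x y z \<cdot> (R \<rhd> at3 A (Asc M) (U \<odot> x) (U \<odot> y) (U \<odot> z))"
    using r by simp
  ultimately show ?thesis using N_eqs(3) by simp
qed

lemma hom_asc_N:
  shows "H.amap (ten1 A N x (ten1 A N y z)) (ten1 A N (ten1 A N x y) z) (HCell (U \<odot> ten1 A N x (ten1 A N y z)) (U \<rhd> at3 A (Asc N) x y z) (U \<odot> ten1 A N (ten1 A N x y) z))"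
    "hcomp (HCell (U \<odot> ten1 A N x (ten1 A N y z)) (U \<rhd> at3 A (Asc N) x y z) (U \<odot> ten1 A N (ten1 A N x y) z)) (H.u_left x y z) =
      hcomp (H.u_right x y z) (hasc (U \<odot> x) (U \<odot> y) (U \<odot> z))"
proof -
  note [simp] = halgD[OF alg(1)] halgD[OF alg(2)] halgD[OF alg(3)]
  show 1: "H.amap (ten1 A N x (ten1 A N y z)) (ten1 A N (ten1 A N x y) z) (HCell (U \<odot> ten1 A N x (ten1 A N y z)) (U \<rhd> at3 A (Asc N) x y z) (U \<odot> ten1 A N (ten1 A N x y) z))"
    by (rule hom_amap_cell) simp_all
  show "hcomp (HCell (U \<odot> ten1 A N x (ten1 A N y z)) (U \<rhd> at3 A (Asc N) x y z) (U \<odot> ten1 A N (ten1 A N x y) z)) (H.u_left x y z) =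
      hcomp (H.u_right x y z) (hasc (U \<odot> x) (U \<odot> y) (U \<odot> z))"
    unfolding H.associator_q[OF alg 1, symmetric] hom_q_left[OF X alg] hom_q_right[OF X alg]
    using asc_N_q by (simp add: hcomp_def hR_def hasc_def)
qed

lemma asc_N_u: "(U \<rhd> at3 A (Asc N) x y z) \<cdot> uu x (ten1 A N y z) \<cdot> ten2 A M (Id2 A (U \<odot> x)) (uu y z) =
   uu (ten1 A N x y) z \<cdot> ten2 A M (uu x y) (Id2 A (U \<odot> z)) \<cdot> at3 A (Asc M) (U \<odot> x) (U \<odot> y) (U \<odot> z)"
proof -
  note [simp] = halgD[OF alg(1)] halgD[OF alg(2)] halgD[OF alg(3)]
  show ?thesis using hom_asc_N(2) by (simp add: H.u_left_def H.u_right_def hdefs hasc_def)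
qed

end

lemma hom_ten_N:
  assumes "s \<in> Two A" "t \<in> Two A" "Src A (Dom A s) = X" "Src A (Dom A t) = X" "Trg A (Dom A s) = D" "Trg A (Dom A t) = D"
    "Dom A s = x" "Dom A t = y" "Cod A s = x'" "Cod A t = y'"
  shows "H.amap (ten1 A N x y) (ten1 A N x' y') (HCell (U \<odot> ten1 A N x y) (U \<rhd> ten2 A N s t) (U \<odot> ten1 A N x' y'))"
    "hcomp (HCell (U \<odot> ten1 A N x y) (U \<rhd> ten2 A N s t) (U \<odot> ten1 A N x' y')) (H.u x y) =
     hcomp (H.u x' y') (htar (HCell (U \<odot> x) (U \<rhd> s) (U \<odot> x')) (HCell (U \<odot> y) (U \<rhd> t) (U \<odot> y')))"
proof -
  show "H.amap (ten1 A N x y) (ten1 A N x' y') (HCell (U \<odot> ten1 A N x y) (U \<rhd> ten2 A N s t) (U \<odot> ten1 A N x' y'))"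
    by (rule hom_amap_cell) (use assms in auto)
  show "hcomp (HCell (U \<odot> ten1 A N x y) (U \<rhd> ten2 A N s t) (U \<odot> ten1 A N x' y')) (H.u x y) =
     hcomp (H.u x' y') (htar (HCell (U \<odot> x) (U \<rhd> s) (U \<odot> x')) (HCell (U \<odot> y) (U \<rhd> t) (U \<odot> y')))"
    using uu_nat[of s t] assms by (simp add: hcomp_def htar_def)
qed

lemma pentagon_N:
  assumes alg: "halg X w" "halg X x" "halg X y" "halg X z"
  shows "at3 A (Asc N) (ten1 A N w x) y z \<cdot> at3 A (Asc N) w x (ten1 A N y z) =
        ten2 A N (at3 A (Asc N) w x y) (Id2 A z) \<cdot> at3 A (Asc N) w (ten1 A N x y) z \<cdot> ten2 A N (Id2 A w) (at3 A (Asc N) x y z)"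
proof (rule em_inj2)
  note [simp] = halgD[OF alg(1)] halgD[OF alg(2)] halgD[OF alg(3)] halgD[OF alg(4)]
  have alg': "halg X (ten1 A N w x)" "halg X (ten1 A N x y)" "halg X (ten1 A N y z)" by (simp_all add: halg_def)
  note m [simp] = asc_N_mem[OF alg'(1) alg(3,4)] asc_N_mem[OF alg(1,2) alg'(3)] asc_N_mem[OF alg(1,2,3)] asc_N_mem[OF alg(1) alg'(2) alg(4)] asc_N_mem[OF alg(2,3,4)]
  have Id: "HCell (U \<odot> v) (U \<rhd> Id2 A v) (U \<odot> v) = hone (U \<odot> v)" if "halg X v" for v
    using halgD[OF that] by (simp add: hone_def)
  show "U \<rhd> (at3 A (Asc N) (ten1 A N w x) y z \<cdot> at3 A (Asc N) w x (ten1 A N y z)) =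
        U \<rhd> (ten2 A N (at3 A (Asc N) w x y) (Id2 A z) \<cdot> at3 A (Asc N) w (ten1 A N x y) z \<cdot> ten2 A N (Id2 A w) (at3 A (Asc N) x y z))"
    using H.pentagon_lift[OF alg hom_asc_N[OF alg'(1) alg(3,4)] hom_asc_N[OF alg(1,2) alg'(3)] hom_asc_N[OF alg(1,2,3)]
      hom_ten_N[of "at3 A (Asc N) w x y" "Id2 A z" "ten1 A N w (ten1 A N x y)" z "ten1 A N (ten1 A N w x) y" z, unfolded Id[OF alg(4)]]
      hom_asc_N[OF alg(1) alg'(2) alg(4)] hom_asc_N[OF alg(2,3,4)]
      hom_ten_N[of "Id2 A w" "at3 A (Asc N) x y z" w "ten1 A N x (ten1 A N y z)" w "ten1 A N (ten1 A N x y) z", unfolded Id[OF alg(1)]]]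
    by (simp add: hcomp_def)
qed (use halgD[OF alg(1)] halgD[OF alg(2)] halgD[OF alg(3)] halgD[OF alg(4)] in \<open>simp_all add: at3_def\<close>)

lemma triangle_N:
  assumes alg: "halg X x" "halg X y"
  shows "ten2 A N (Run N \<lhd> x) (Id2 A y) \<cdot> at3 A (Asc N) x (F \<odot> unit_at A M X) y = ten2 A N (Id2 A x) (Lun N \<lhd> y)"
proof (rule em_inj2)
  note [simp] = halgD[OF alg(1)] halgD[OF alg(2)]
  let ?J = "F \<odot> unit_at A M X"
  have J: "halg X ?J" by (simp add: halg_def)
  note m [simp] = asc_N_mem[OF alg(1) J alg(2)]
  have Id: "HCell (U \<odot> v) (U \<rhd> Id2 A v) (U \<odot> v) = hone (U \<odot> v)" if "halg X v" for v
    using halgD[OF that] by (simp add: hone_def)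
  have l: "H.amap (ten1 A N ?J y) y (HCell (U \<odot> ten1 A N ?J y) (U \<rhd> (Lun N \<lhd> y)) (U \<odot> y))"
    by (rule hom_amap_cell) simp_all
  have r: "H.amap (ten1 A N x ?J) x (HCell (U \<odot> ten1 A N x ?J) (U \<rhd> (Run N \<lhd> x)) (U \<odot> x))"
    by (rule hom_amap_cell) simp_all
  show "U \<rhd> (ten2 A N (Run N \<lhd> x) (Id2 A y) \<cdot> at3 A (Asc N) x ?J y) = U \<rhd> ten2 A N (Id2 A x) (Lun N \<lhd> y)"
    using H.triangle_lift[OF alg hom_asc_N[OF alg(1) J alg(2)] l hom_lun_N[OF alg(2)] r hom_run_N[OF alg(1)]
       hom_ten_N[of "Run N \<lhd> x" "Id2 A y" "ten1 A N x ?J" y x y, unfolded Id[OF alg(2)]]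
       hom_ten_N[of "Id2 A x" "Lun N \<lhd> y" x "ten1 A N ?J y" x y, unfolded Id[OF alg(1)]]]
    by (simp add: hcomp_def)
qed (use halgD[OF alg(1)] halgD[OF alg(2)] in \<open>simp_all add: at3_def\<close>)

end

lemma Asc_N_invertible: "invertible A (Asc N)"
proof -
  let ?x = "proj3_1 A D" let ?y = "proj3_2 A D" let ?z = "proj3_3 A D" let ?X = "Prod A D (Prod A D D)"
  have alg: "halg ?X ?x" "halg ?X ?y" "halg ?X ?z" by (simp_all add: halg_def)
  obtain l l' where l: "inverse_cells A l l'" "l \<in> Two A" "Dom A l = ten1 A N ?x (ten1 A N ?y ?z)" "Cod A l = ten1 A N (ten1 A N ?x ?y) ?z"
    "(U \<rhd> l) \<cdot> q_left A T E q N ?x ?y ?z = q_right A T E q N ?x ?y ?z \<cdot> (R \<rhd> at3 A (Asc M) (U \<odot> ?x) (U \<odot> ?y) (U \<odot> ?z))"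
    using associator_cell[OF _ alg] by auto
  have "U \<rhd> l = U \<rhd> Asc N"
    by (rule q_left_epi[OF _ alg]) (use l N_eqs(3) in simp_all)
  then have "l = Asc N" by (rule em_inj2[rotated 5]) (use l in simp_all)
  with l(1) show ?thesis by (auto simp: invertible_def)
qed

lemma Lun_N_invertible: "invertible A (Lun N)"
proof -
  let ?J = "F \<odot> unit_at A M D"
  have alg: "halg D (Id1 A D)" "halg D ?J" by (simp_all add: halg_def)
  obtain l l' where l: "inverse_cells A l l'" "l \<in> Two A" "Dom A l = ten1 A N ?J (Id1 A D)" "Cod A l = Id1 A D"
    "(U \<rhd> l) \<cdot> at2 A q ?J (Id1 A D) = lun_formula D (Id1 A D)"
    using left_unit_cell[OF _ alg(1)] by auto
  have "U \<rhd> l = U \<rhd> Lun N"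
    by (rule q_el_epi[OF _ alg(2,1)]) (use l N_eqs(1) in simp_all)
  then have "l = Lun N" by (rule em_inj2[rotated 5]) (use l in simp_all)
  with l(1) show ?thesis by (auto simp: invertible_def)
qed

lemma Run_N_invertible: "invertible A (Run N)"
proof -
  let ?J = "F \<odot> unit_at A M D"
  have alg: "halg D (Id1 A D)" "halg D ?J" by (simp_all add: halg_def)
  obtain l l' where l: "inverse_cells A l l'" "l \<in> Two A" "Dom A l = ten1 A N (Id1 A D) ?J" "Cod A l = Id1 A D"
    "(U \<rhd> l) \<cdot> at2 A q (Id1 A D) ?J = run_formula D (Id1 A D)"
    using right_unit_cell[OF _ alg(1)] by auto
  have "U \<rhd> l = U \<rhd> Run N"
    by (rule q_el_epi[OF _ alg(1,2)]) (use l N_eqs(2) in simp_all)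
  then have "l = Run N" by (rule em_inj2[rotated 5]) (use l in simp_all)
  with l(1) show ?thesis by (auto simp: invertible_def)
qed

lemma monoidal_N [simp]: "monoidal_object A N"
proof -
  have "halg (Prod A D (Prod A D (Prod A D D))) (proj4_1 A D)" "halg (Prod A D (Prod A D (Prod A D D))) (proj4_2 A D)"
    "halg (Prod A D (Prod A D (Prod A D D))) (proj4_3 A D)" "halg (Prod A D (Prod A D (Prod A D D))) (proj4_4 A D)"
    "halg (Prod A D D) (Pr1 A D D)" "halg (Prod A D D) (Pr2 A D D)" by (simp_all add: halg_def)
  then show ?thesis
    unfolding monoidal_object_def Let_def cell_defs
    using Asc_N_invertible Lun_N_invertible Run_N_invertible
      pentagon_N[of "Prod A D (Prod A D (Prod A D D))" "proj4_1 A D" "proj4_2 A D" "proj4_3 A D" "proj4_4 A D"]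
      triangle_N[of "Prod A D D" "Pr1 A D D" "Pr2 A D D"]
    by simp
qed

text \<open>The axioms are the defining equations of the coherence cells of \<open>N\<close>, restricted along \<open>\<eta>\<close>.\<close>

lemma UL_lax [simp]: "lax_monoidal A UL"
proof -
  have "halg (Prod A D (Prod A D D)) (proj3_1 A D)" "halg (Prod A D (Prod A D D)) (proj3_2 A D)"
    "halg (Prod A D (Prod A D D)) (proj3_3 A D)" "halg D (Id1 A D)" by (simp_all add: halg_def)
  then show ?thesis
    unfolding lax_monoidal_def Let_def cell_defs
    using asc_N_u[of "Prod A D (Prod A D D)" "proj3_1 A D" "proj3_2 A D" "proj3_3 A D"]
      lun_N_u[of D "Id1 A D"] run_N_u[of D "Id1 A D"]
    by (simp add: Lphi_UL[symmetric]) (simp add: Lphi_UL)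
qed

end

section \<open>The universal property in the 2-category of monoidal objects\<close>

context two_category
begin

text \<open>Restricting a subequalizing along a 1-cell, or postcomposing a 2-cell with \<open>U\<close>, gives a
  subequalizing or a morphism of such in any case; bijectivity is what has to be verified.\<close>

lemma em_objectI:
  assumes [simp]: "Mend T \<in> One K" "Src K (Mend T) = Mobj T" "Trg K (Mend T) = Mobj T" "Meta T \<in> Two K" "Dom K (Meta T) = Id1 K (Mobj T)"
      "Cod K (Meta T) = Mend T" "Mmu T \<in> Two K" "Dom K (Mmu T) = Mend T \<odot> Mend T" "Cod K (Mmu T) = Mend T"
    and E0 [simp]: "Eobj E \<in> Zero K" and s: "subequalizing K T (Eobj E) (Eu E) (Ebeta E)"
    and inj1: "\<And>f g X. one_cell K f X (Eobj E) \<Longrightarrow> one_cell K g X (Eobj E) \<Longrightarrow> Eu E \<odot> f = Eu E \<odot> g \<Longrightarrow> Ebeta E \<lhd> f = Ebeta E \<lhd> g \<Longrightarrow> f = g"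
    and ex1: "\<And>w \<nu> X. X \<in> Zero K \<Longrightarrow> subequalizing K T X w \<nu> \<Longrightarrow> \<exists>f. one_cell K f X (Eobj E) \<and> Eu E \<odot> f = w \<and> Ebeta E \<lhd> f = \<nu>"
    and inj2: "\<And>f g s t X. one_cell K f X (Eobj E) \<Longrightarrow> one_cell K g X (Eobj E) \<Longrightarrow> two_cell K s f g \<Longrightarrow> two_cell K t f g \<Longrightarrow> Eu E \<rhd> s = Eu E \<rhd> t \<Longrightarrow> s = t"
    and ex2: "\<And>f g s X. one_cell K f X (Eobj E) \<Longrightarrow> one_cell K g X (Eobj E) \<Longrightarrow> two_cell K s (Eu E \<odot> f) (Eu E \<odot> g) \<Longrightarrow>
       s \<cdot> (Ebeta E \<lhd> f) = (Ebeta E \<lhd> g) \<cdot> (Mend T \<rhd> s) \<Longrightarrow> \<exists>t. two_cell K t f g \<and> Eu E \<rhd> t = s"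
  shows "em_object K T E"
  unfolding em_object_def Let_def
proof (intro conjI ballI allI impI)
  have [simp]: "Mobj T \<in> Zero K" using boundary_mem(1)[OF assms(1)] by simp
  have e [simp]: "Eu E \<in> One K" "Src K (Eu E) = Eobj E" "Trg K (Eu E) = Mobj T"
   "Ebeta E \<in> Two K" "Dom K (Ebeta E) = Mend T \<odot> Eu E" "Cod K (Ebeta E) = Eu E"
    and eq: "Ebeta E \<cdot> (Meta T \<lhd> Eu E) = Id2 K (Eu E)" "Ebeta E \<cdot> (Mend T \<rhd> Ebeta E) = Ebeta E \<cdot> (Mmu T \<lhd> Eu E)"
    using s by (auto simp: subequalizing_def Let_def cell_defs)
  {
    fix X assume X: "X \<in> Zero K"
    have "subequalizing K T X (Eu E \<odot> f) (Ebeta E \<lhd> f)" if f: "one_cell K f X (Eobj E)" for f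
    proof -
      have [simp]: "f \<in> One K" "Src K f = X" "Trg K f = Eobj E" using f by (auto simp: cell_defs)
      show ?thesis using arg_cong[OF eq(1), of "\<lambda>s. s \<lhd> f"] arg_cong[OF eq(2), of "\<lambda>s. s \<lhd> f"]
        by (simp add: subequalizing_def Let_def cell_defs)
    qed
    then show "bij_betw (\<lambda>f. (Eu E \<odot> f, Ebeta E \<lhd> f)) {f. one_cell K f X (Eobj E)} {(u, \<nu>). subequalizing K T X u \<nu>}"
      unfolding bij_betw_def inj_on_def using ex1[OF X] inj1[of _ X] by (auto simp: image_iff) metis
  }
  {
    fix X f g assume f: "one_cell K f X (Eobj E)" and g: "one_cell K g X (Eobj E)"
    have "subequalizing_mor K T (Eu E \<odot> f, Ebeta E \<lhd> f) (Eu E \<odot> g, Ebeta E \<lhd> g) (Eu E \<rhd> s)" if s: "two_cell K s f g" for s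
    proof -
      have fg: "f \<in> One K" "Src K f = X" "Trg K f = Eobj E" "g \<in> One K" "Src K g = X" "Trg K g = Eobj E" using f g by (auto simp: cell_defs)
      have [simp]: "s \<in> Two K" "Dom K s = f" "Cod K s = g" using s by (auto simp: cell_defs)
      show ?thesis using whisker_exchange[of s "Ebeta E"] fg by (simp add: subequalizing_mor_def cell_defs)
    qed
    then show "bij_betw ((\<rhd>\<^bsub>K\<^esub>) (Eu E)) {s. two_cell K s f g} {s. subequalizing_mor K T (Eu E \<odot> f, Ebeta E \<lhd> f) (Eu E \<odot> g, Ebeta E \<lhd> g) s}"
      unfolding bij_betw_def inj_on_def using ex2[OF f g] inj2[OF f g]
      by (auto simp: subequalizing_mor_def image_iff)
  }
qed (rule E0 s)+

end

context em_standard
begin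

context
  fixes X assumes X [simp]: "X \<in> Zero A"
begin

interpretation H: monoidal_algebra_tensor "hob X" "har X" hdom hcod hone hcomp "ten1 A M" htar "Comp1 A R" hR hphi heta hmu
    "halg X" "Comp1 A U" hact "Comp1 A F" "ten1 A N" hq "unit_at A M X" hasc hasc' "hlun X" "hlun' X" "hrun X" "hrun' X"
  by (rule hom_monoidal) simp

lemma hom_u' [simp]: "H.u x y = HCell (ten1 A M (U \<odot> x) (U \<odot> y)) (uu x y) (U \<odot> ten1 A N x y)"
  by (rule hom_u_eq[OF X])

text \<open>A cell between 1-cells into the Eilenberg--Moore object is determined by the restriction of
  its image under \<open>U\<close> to a dense cell. The three lemmas that follow take \<open>u\<close>, \<open>\<eta>\<close> and
  \<open>u \<cdot> (\<eta> \<otimes> \<eta>)\<close> as dense cells.\<close>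

lemma dense_cancel:
  assumes d: "H.dense x (HCell a g (U \<odot> x))" and x: "halg X x"
    and s: "s \<in> Two A" "Dom A s = x" and t: "t \<in> Two A" "Dom A t = x" "Cod A t = Cod A s"
    and eq: "(U \<rhd> s) \<cdot> g = (U \<rhd> t) \<cdot> g"
  shows "s = t"
proof -
  note [simp] = halgD[OF x]
  have z: "halg X (Cod A s)" using s boundary_mem(5,6)[OF s(1)] by (simp add: halg_def)
  have "HCell (U \<odot> x) (U \<rhd> s) (U \<odot> Cod A s) = HCell (U \<odot> x) (U \<rhd> t) (U \<odot> Cod A s)"
  proof (rule H.dense_eq[OF x d _ _ z refl])
    show "H.amap x (Cod A s) (HCell (U \<odot> x) (U \<rhd> s) (U \<odot> Cod A s))" by (rule hom_amap_cell[OF X]) (use s in simp_all)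
    show "H.amap x (Cod A s) (HCell (U \<odot> x) (U \<rhd> t) (U \<odot> Cod A s))" by (rule hom_amap_cell[OF X]) (use t in simp_all)
    show "hcomp (HCell (U \<odot> x) (U \<rhd> s) (U \<odot> Cod A s)) (HCell a g (U \<odot> x)) = hcomp (HCell (U \<odot> x) (U \<rhd> t) (U \<odot> Cod A s)) (HCell a g (U \<odot> x))"
      using eq by (simp add: hcomp_def)
  qed
  then show ?thesis by (intro em_inj2[of s t]) (use s t in simp_all)
qed

lemma uu_cancel:
  assumes xy: "halg X x" "halg X y" and s: "s \<in> Two A" "Dom A s = ten1 A N x y" and t: "t \<in> Two A" "Dom A t = ten1 A N x y" "Cod A t = Cod A s"
    and eq: "(U \<rhd> s) \<cdot> uu x y = (U \<rhd> t) \<cdot> uu x y"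
  shows "s = t"
proof (rule dense_cancel[OF _ _ s t eq])
  note [simp] = halgD[OF xy(1)] halgD[OF xy(2)]
  show "H.dense (ten1 A N x y) (HCell (ten1 A M (U \<odot> x) (U \<odot> y)) (uu x y) (U \<odot> ten1 A N x y))"
    using H.dense_u[OF xy] by simp
  show "halg X (ten1 A N x y)" by (simp add: halg_def)
qed

lemma eta_cancel:
  assumes a: "hob X a" and s: "s \<in> Two A" "Dom A s = F \<odot> a" and t: "t \<in> Two A" "Dom A t = F \<odot> a" "Cod A t = Cod A s"
    and eq: "(U \<rhd> s) \<cdot> (\<eta> \<lhd> a) = (U \<rhd> t) \<cdot> (\<eta> \<lhd> a)"
  shows "s = t"
proof (rule dense_cancel[OF _ _ s t eq])
  note [simp] = hobD[OF a]
  show "H.dense (F \<odot> a) (HCell a (\<eta> \<lhd> a) (U \<odot> F \<odot> a))"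
    using H.dense_eta[OF a] by (simp add: heta_def)
  show "halg X (F \<odot> a)" by (simp add: halg_def)
qed

lemma uu_eta_cancel:
  assumes ab: "hob X a" "hob X b" and s: "s \<in> Two A" "Dom A s = ten1 A N (F \<odot> a) (F \<odot> b)" and t: "t \<in> Two A" "Dom A t = ten1 A N (F \<odot> a) (F \<odot> b)" "Cod A t = Cod A s"
    and eq: "(U \<rhd> s) \<cdot> uu (F \<odot> a) (F \<odot> b) \<cdot> ten2 A M (\<eta> \<lhd> a) (\<eta> \<lhd> b) = (U \<rhd> t) \<cdot> uu (F \<odot> a) (F \<odot> b) \<cdot> ten2 A M (\<eta> \<lhd> a) (\<eta> \<lhd> b)"
  shows "s = t"
proof (rule dense_cancel[OF _ _ s t eq])
  note [simp] = hobD[OF ab(1)] hobD[OF ab(2)]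
  have f: "halg X (F \<odot> a)" "halg X (F \<odot> b)" by (simp_all add: halg_def)
  show "H.dense (ten1 A N (F \<odot> a) (F \<odot> b)) (HCell (ten1 A M a b) (uu (F \<odot> a) (F \<odot> b) \<cdot> ten2 A M (\<eta> \<lhd> a) (\<eta> \<lhd> b)) (U \<odot> ten1 A N (F \<odot> a) (F \<odot> b)))"
    using H.dense_tensor[OF f H.dense_eta[OF ab(1)] H.dense_eta[OF ab(2)]] by (simp add: hcomp_def htar_def heta_def)
  show "halg X (ten1 A N (F \<odot> a) (F \<odot> b))" by (simp add: halg_def)
qed

lemma ext2_cell:
  assumes xyz: "halg X x" "halg X y" "halg X z" and p: "p \<in> Two A" "Dom A p = ten1 A M (U \<odot> x) (U \<odot> y)" "Cod A p = U \<odot> z"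
    and bi: "(\<beta> \<lhd> z) \<cdot> (R \<rhd> p) \<cdot> at2 A \<phi> (U \<odot> x) (U \<odot> y) = p \<cdot> ten2 A M (\<beta> \<lhd> x) (\<beta> \<lhd> y)"
  shows "\<exists>s. s \<in> Two A \<and> Dom A s = ten1 A N x y \<and> Cod A s = z \<and> (U \<rhd> s) \<cdot> uu x y = p"
proof -
  note [simp] = halgD[OF xyz(1)] halgD[OF xyz(2)] halgD[OF xyz(3)]
  let ?p = "HCell (ten1 A M (U \<odot> x) (U \<odot> y)) p (U \<odot> z)"
  have pa: "har X ?p" using p by (simp add: har_HCell)
  have pb: "hcomp (hact z) (hcomp (hR ?p) (hphi (U \<odot> x) (U \<odot> y))) = hcomp ?p (htar (hact x) (hact y))"
    using bi by (simp add: hcomp_def hact_def hR_def hphi_def htar_def)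
  obtain w where w: "H.amap (ten1 A N x y) z w" "hcomp w (H.u x y) = ?p"
    by (rule H.ext2[OF xyz pa _ _ pb]) simp_all
  have t: "halg X (ten1 A N x y)" by (simp add: halg_def)
  obtain s where "s \<in> Two A" "Dom A s = ten1 A N x y" "Cod A s = z" "w = HCell (U \<odot> ten1 A N x y) (U \<rhd> s) (U \<odot> z)"
    by (rule cell_amap[OF X w(1) t xyz(3)])
  with w(2) show ?thesis by (auto simp: hcomp_def)
qed

lemma ext_free_cell:
  assumes a: "hob X a" and z: "halg X z" and p: "p \<in> Two A" "Dom A p = a" "Cod A p = U \<odot> z"
  shows "\<exists>s. s \<in> Two A \<and> Dom A s = F \<odot> a \<and> Cod A s = z \<and> (U \<rhd> s) \<cdot> (\<eta> \<lhd> a) = p"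
proof -
  note [simp] = hobD[OF a] halgD[OF z]
  let ?p = "HCell a p (U \<odot> z)"
  have pa: "har X ?p" using p by (simp add: har_HCell)
  have w: "H.amap (F \<odot> a) z (hcomp (hact z) (hR ?p))" "hcomp (hcomp (hact z) (hR ?p)) (heta a) = ?p"
    by (rule H.amap_free[OF a z pa]; simp)+
  have t: "halg X (F \<odot> a)" by (simp add: halg_def)
  obtain s where "s \<in> Two A" "Dom A s = F \<odot> a" "Cod A s = z" "hcomp (hact z) (hR ?p) = HCell (U \<odot> F \<odot> a) (U \<rhd> s) (U \<odot> z)"
    by (rule cell_amap[OF X w(1) t z])
  with w(2) show ?thesis by (auto simp: hcomp_def heta_def)
qed

lemma uu_bimor:
  assumes xy: "halg X x" "halg X y"
  shows "(\<beta> \<lhd> ten1 A N x y) \<cdot> (R \<rhd> uu x y) \<cdot> at2 A \<phi> (U \<odot> x) (U \<odot> y) = uu x y \<cdot> ten2 A M (\<beta> \<lhd> x) (\<beta> \<lhd> y)"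
proof -
  note [simp] = halgD[OF xy(1)] halgD[OF xy(2)]
  show ?thesis using H.u_bimor[OF xy] by (simp add: hcomp_def hact_def hR_def hphi_def htar_def)
qed

lemma hom_amap: 
  assumes "s \<in> Two A" "Dom A s = x" "Cod A s = y" "halg X x"
  shows "H.amap x y (HCell (U \<odot> x) (U \<rhd> s) (U \<odot> y))"
  by (rule hom_amap_cell[OF X]) (use assms halgD[OF assms(4)] in simp_all)

lemma hom_one: "halg X v \<Longrightarrow> HCell (U \<odot> v) (U \<rhd> Id2 A v) (U \<odot> v) = hone (U \<odot> v)"
  using halgD[of X v] by (simp add: hone_def)

lemma lax_assoc_cells:
  assumes alg: "halg X x" "halg X y" "halg X z" "halg X p" "halg X r" "halg X k" "halg X k'"
    and g1: "g1 \<in> Two A" "Dom A g1 = ten1 A N y z" "Cod A g1 = p"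
    and g2: "g2 \<in> Two A" "Dom A g2 = ten1 A N x p" "Cod A g2 = k"
    and s: "s \<in> Two A" "Dom A s = k" "Cod A s = k'"
    and h1: "h1 \<in> Two A" "Dom A h1 = ten1 A N x y" "Cod A h1 = r"
    and h2: "h2 \<in> Two A" "Dom A h2 = ten1 A N r z" "Cod A h2 = k'"
    and eq: "(U \<rhd> s) \<cdot> ((U \<rhd> g2) \<cdot> uu x p) \<cdot> ten2 A M (Id2 A (U \<odot> x)) ((U \<rhd> g1) \<cdot> uu y z) =
      ((U \<rhd> h2) \<cdot> uu r z) \<cdot> ten2 A M ((U \<rhd> h1) \<cdot> uu x y) (Id2 A (U \<odot> z)) \<cdot> at3 A (Asc M) (U \<odot> x) (U \<odot> y) (U \<odot> z)"
  shows "s \<cdot> g2 \<cdot> ten2 A N (Id2 A x) g1 = h2 \<cdot> ten2 A N h1 (Id2 A z) \<cdot> at3 A (Asc N) x y z"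
proof (rule em_inj2)
  note [simp] = halgD[OF alg(1)] halgD[OF alg(2)] halgD[OF alg(3)] halgD[OF alg(4)] halgD[OF alg(5)] halgD[OF alg(6)] halgD[OF alg(7)]
    g1 g2 s h1 h2 asc_N_mem[OF X alg(1-3)]
  have t: "halg X (ten1 A N y z)" "halg X (ten1 A N x p)" "halg X (ten1 A N x y)" "halg X (ten1 A N r z)" by (simp_all add: halg_def)
  have "hcomp (HCell (U \<odot> k) (U \<rhd> s) (U \<odot> k')) (hcomp (HCell (U \<odot> ten1 A N x p) (U \<rhd> g2) (U \<odot> k)) (HCell (U \<odot> ten1 A N x (ten1 A N y z)) (U \<rhd> ten2 A N (Id2 A x) g1) (U \<odot> ten1 A N x p))) =
    hcomp (HCell (U \<odot> ten1 A N r z) (U \<rhd> h2) (U \<odot> k')) (hcomp (HCell (U \<odot> ten1 A N (ten1 A N x y) z) (U \<rhd> ten2 A N h1 (Id2 A z)) (U \<odot> ten1 A N r z)) (HCell (U \<odot> ten1 A N x (ten1 A N y z)) (U \<rhd> at3 A (Asc N) x y z) (U \<odot> ten1 A N (ten1 A N x y) z)))"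
  proof (rule H.lax_assoc_lift[OF alg hom_amap[OF g1 t(1)] hom_amap[OF g2 t(2)] hom_amap[OF s alg(6)] hom_amap[OF h1 t(3)] hom_amap[OF h2 t(4)] _ _ _ _ hom_asc_N[OF X alg(1-3)]])
    show "H.amap (ten1 A N x (ten1 A N y z)) (ten1 A N x p) (HCell (U \<odot> ten1 A N x (ten1 A N y z)) (U \<rhd> ten2 A N (Id2 A x) g1) (U \<odot> ten1 A N x p))"
      "hcomp (HCell (U \<odot> ten1 A N x (ten1 A N y z)) (U \<rhd> ten2 A N (Id2 A x) g1) (U \<odot> ten1 A N x p)) (H.u x (ten1 A N y z)) =
       hcomp (H.u x p) (htar (hone (U \<odot> x)) (HCell (U \<odot> ten1 A N y z) (U \<rhd> g1) (U \<odot> p)))"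
      by (rule hom_ten_N[OF X, of "Id2 A x" g1 x "ten1 A N y z" x p, unfolded hom_one[OF alg(1)]]; simp)+
    show "H.amap (ten1 A N (ten1 A N x y) z) (ten1 A N r z) (HCell (U \<odot> ten1 A N (ten1 A N x y) z) (U \<rhd> ten2 A N h1 (Id2 A z)) (U \<odot> ten1 A N r z))"
      "hcomp (HCell (U \<odot> ten1 A N (ten1 A N x y) z) (U \<rhd> ten2 A N h1 (Id2 A z)) (U \<odot> ten1 A N r z)) (H.u (ten1 A N x y) z) =
       hcomp (H.u r z) (htar (HCell (U \<odot> ten1 A N x y) (U \<rhd> h1) (U \<odot> r)) (hone (U \<odot> z)))"
      by (rule hom_ten_N[OF X, of h1 "Id2 A z" "ten1 A N x y" z r z, unfolded hom_one[OF alg(3)]]; simp)+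
    show "hcomp (HCell (U \<odot> k) (U \<rhd> s) (U \<odot> k')) (hcomp (hcomp (HCell (U \<odot> ten1 A N x p) (U \<rhd> g2) (U \<odot> k)) (H.u x p)) (htar (hone (U \<odot> x)) (hcomp (HCell (U \<odot> ten1 A N y z) (U \<rhd> g1) (U \<odot> p)) (H.u y z)))) =
      hcomp (hcomp (HCell (U \<odot> ten1 A N r z) (U \<rhd> h2) (U \<odot> k')) (H.u r z)) (hcomp (htar (hcomp (HCell (U \<odot> ten1 A N x y) (U \<rhd> h1) (U \<odot> r)) (H.u x y)) (hone (U \<odot> z))) (hasc (U \<odot> x) (U \<odot> y) (U \<odot> z)))"
      using eq by (simp add: hcomp_def hone_def htar_def hasc_def del: vcomp_assoc')
  qed
  then show "U \<rhd> (s \<cdot> g2 \<cdot> ten2 A N (Id2 A x) g1) = U \<rhd> (h2 \<cdot> ten2 A N h1 (Id2 A z) \<cdot> at3 A (Asc N) x y z)"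
    by (simp add: hcomp_def)
  show "s \<cdot> g2 \<cdot> ten2 A N (Id2 A x) g1 \<in> Two A" "h2 \<cdot> ten2 A N h1 (Id2 A z) \<cdot> at3 A (Asc N) x y z \<in> Two A"
    "Dom A (h2 \<cdot> ten2 A N h1 (Id2 A z) \<cdot> at3 A (Asc N) x y z) = Dom A (s \<cdot> g2 \<cdot> ten2 A N (Id2 A x) g1)"
    "Cod A (h2 \<cdot> ten2 A N h1 (Id2 A z) \<cdot> at3 A (Asc N) x y z) = Cod A (s \<cdot> g2 \<cdot> ten2 A N (Id2 A x) g1)"
    "Trg A (Dom A (s \<cdot> g2 \<cdot> ten2 A N (Id2 A x) g1)) = Eobj E" by simp_all
qed

lemma lax_left_unit_cells:
  assumes alg: "halg X x" "halg X e" "halg X k"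
    and g: "g \<in> Two A" "Dom A g = ten1 A N e x" "Cod A g = k"
    and s: "s \<in> Two A" "Dom A s = k" "Cod A s = x"
    and e0: "e0 \<in> Two A" "Dom A e0 = F \<odot> unit_at A M X" "Cod A e0 = e"
    and eq: "(U \<rhd> s) \<cdot> ((U \<rhd> g) \<cdot> uu e x) \<cdot> ten2 A M ((U \<rhd> e0) \<cdot> (\<eta> \<lhd> unit_at A M X)) (Id2 A (U \<odot> x)) = Lun M \<lhd> (U \<odot> x)"
  shows "s \<cdot> g \<cdot> ten2 A N e0 (Id2 A x) = Lun N \<lhd> x"
proof (rule em_inj2)
  note [simp] = halgD[OF alg(1)] halgD[OF alg(2)] halgD[OF alg(3)] g s e0
  let ?J = "F \<odot> unit_at A M X"
  have t: "halg X (ten1 A N e x)" "halg X ?J" "halg X (ten1 A N ?J x)" by (simp_all add: halg_def)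
  have l: "H.amap (ten1 A N ?J x) x (HCell (U \<odot> ten1 A N ?J x) (U \<rhd> (Lun N \<lhd> x)) (U \<odot> x))"
    by (rule hom_amap[OF _ _ _ t(3)]) simp_all
  have "hcomp (HCell (U \<odot> k) (U \<rhd> s) (U \<odot> x)) (hcomp (HCell (U \<odot> ten1 A N e x) (U \<rhd> g) (U \<odot> k)) (HCell (U \<odot> ten1 A N ?J x) (U \<rhd> ten2 A N e0 (Id2 A x)) (U \<odot> ten1 A N e x)))
    = HCell (U \<odot> ten1 A N ?J x) (U \<rhd> (Lun N \<lhd> x)) (U \<odot> x)"
  proof (rule H.lax_left_unit_lift[OF alg hom_amap[OF g t(1)] hom_amap[OF s alg(3)] hom_amap[OF e0 t(2)] _ _ l hom_lun_N[OF X alg(1)]])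
    show "H.amap (ten1 A N ?J x) (ten1 A N e x) (HCell (U \<odot> ten1 A N ?J x) (U \<rhd> ten2 A N e0 (Id2 A x)) (U \<odot> ten1 A N e x))"
      "hcomp (HCell (U \<odot> ten1 A N ?J x) (U \<rhd> ten2 A N e0 (Id2 A x)) (U \<odot> ten1 A N e x)) (H.u ?J x) =
       hcomp (H.u e x) (htar (HCell (U \<odot> ?J) (U \<rhd> e0) (U \<odot> e)) (hone (U \<odot> x)))"
      by (rule hom_ten_N[OF X, of e0 "Id2 A x" ?J x e x, unfolded hom_one[OF alg(1)]]; simp)+
    show "hcomp (HCell (U \<odot> k) (U \<rhd> s) (U \<odot> x)) (hcomp (hcomp (HCell (U \<odot> ten1 A N e x) (U \<rhd> g) (U \<odot> k)) (H.u e x)) (htar (hcomp (HCell (U \<odot> ?J) (U \<rhd> e0) (U \<odot> e)) (heta (unit_at A M X))) (hone (U \<odot> x)))) = hlun X (U \<odot> x)"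
      using eq by (simp add: hcomp_def hone_def htar_def heta_def hlun_def del: vcomp_assoc')
  qed
  then show "U \<rhd> (s \<cdot> g \<cdot> ten2 A N e0 (Id2 A x)) = U \<rhd> (Lun N \<lhd> x)" by (simp add: hcomp_def)
qed (use halgD[OF alg(1)] halgD[OF alg(2)] halgD[OF alg(3)] g s e0 in simp_all)

lemma lax_right_unit_cells:
  assumes alg: "halg X x" "halg X e" "halg X k"
    and g: "g \<in> Two A" "Dom A g = ten1 A N x e" "Cod A g = k"
    and s: "s \<in> Two A" "Dom A s = k" "Cod A s = x"
    and e0: "e0 \<in> Two A" "Dom A e0 = F \<odot> unit_at A M X" "Cod A e0 = e"
    and eq: "(U \<rhd> s) \<cdot> ((U \<rhd> g) \<cdot> uu x e) \<cdot> ten2 A M (Id2 A (U \<odot> x)) ((U \<rhd> e0) \<cdot> (\<eta> \<lhd> unit_at A M X)) = Run M \<lhd> (U \<odot> x)"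
  shows "s \<cdot> g \<cdot> ten2 A N (Id2 A x) e0 = Run N \<lhd> x"
proof (rule em_inj2)
  note [simp] = halgD[OF alg(1)] halgD[OF alg(2)] halgD[OF alg(3)] g s e0
  let ?J = "F \<odot> unit_at A M X"
  have t: "halg X (ten1 A N x e)" "halg X ?J" "halg X (ten1 A N x ?J)" by (simp_all add: halg_def)
  have l: "H.amap (ten1 A N x ?J) x (HCell (U \<odot> ten1 A N x ?J) (U \<rhd> (Run N \<lhd> x)) (U \<odot> x))"
    by (rule hom_amap[OF _ _ _ t(3)]) simp_all
  have "hcomp (HCell (U \<odot> k) (U \<rhd> s) (U \<odot> x)) (hcomp (HCell (U \<odot> ten1 A N x e) (U \<rhd> g) (U \<odot> k)) (HCell (U \<odot> ten1 A N x ?J) (U \<rhd> ten2 A N (Id2 A x) e0) (U \<odot> ten1 A N x e)))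
    = HCell (U \<odot> ten1 A N x ?J) (U \<rhd> (Run N \<lhd> x)) (U \<odot> x)"
  proof (rule H.lax_right_unit_lift[OF alg hom_amap[OF g t(1)] hom_amap[OF s alg(3)] hom_amap[OF e0 t(2)] _ _ l hom_run_N[OF X alg(1)]])
    show "H.amap (ten1 A N x ?J) (ten1 A N x e) (HCell (U \<odot> ten1 A N x ?J) (U \<rhd> ten2 A N (Id2 A x) e0) (U \<odot> ten1 A N x e))"
      "hcomp (HCell (U \<odot> ten1 A N x ?J) (U \<rhd> ten2 A N (Id2 A x) e0) (U \<odot> ten1 A N x e)) (H.u x ?J) =
       hcomp (H.u x e) (htar (hone (U \<odot> x)) (HCell (U \<odot> ?J) (U \<rhd> e0) (U \<odot> e)))"
      by (rule hom_ten_N[OF X, of "Id2 A x" e0 x ?J x e, unfolded hom_one[OF alg(1)]]; simp)+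
    show "hcomp (HCell (U \<odot> k) (U \<rhd> s) (U \<odot> x)) (hcomp (hcomp (HCell (U \<odot> ten1 A N x e) (U \<rhd> g) (U \<odot> k)) (H.u x e)) (htar (hone (U \<odot> x)) (hcomp (HCell (U \<odot> ?J) (U \<rhd> e0) (U \<odot> e)) (heta (unit_at A M X))))) = hrun X (U \<odot> x)"
      using eq by (simp add: hcomp_def hone_def htar_def heta_def hrun_def del: vcomp_assoc')
  qed
  then show "U \<rhd> (s \<cdot> g \<cdot> ten2 A N (Id2 A x) e0) = U \<rhd> (Run N \<lhd> x)" by (simp add: hcomp_def)
qed (use halgD[OF alg(1)] halgD[OF alg(2)] halgD[OF alg(3)] g s e0 in simp_all)

end

end

context em_standard
begin

abbreviation "EM \<equiv> standard_em A T E q N"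
abbreviation "\<beta>L \<equiv> \<lparr>Mdom = lax_comp A L UL, Mcod = UL, Mcell = \<beta>\<rparr>"

lemma EM_simps [simp]: "Eobj EM = N" "Eu EM = UL" "Ebeta EM = \<beta>L"
  by (simp_all add: standard_em_def)

interpretation Ml: two_category "Mon_l A" by (rule two_category_Mon_l)

lemma Mon_l_pre: "S \<lhd>\<^bsub>Mon_l A\<^esub> f = \<lparr>Mdom = lax_comp A (Mdom S) f, Mcod = lax_comp A (Mcod S) f, Mcell = Mcell S \<lhd> Lcell f\<rparr>"
  and Mon_l_post: "f \<rhd>\<^bsub>Mon_l A\<^esub> S = \<lparr>Mdom = lax_comp A f (Mdom S), Mcod = lax_comp A f (Mcod S), Mcell = Lcell f \<rhd> Mcell S\<rparr>"
  by (simp_all add: pre_whisker_def post_whisker_def)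

lemma Mon_l_cells: "one_cell (Mon_l A) f P Q \<longleftrightarrow> lax_monoidal A f \<and> Lsrc f = P \<and> Ltrg f = Q"
  "two_cell (Mon_l A) S f g \<longleftrightarrow> monoidal_two_cell A S \<and> Mdom S = f \<and> Mcod S = g"
  by (simp_all add: one_cell_def two_cell_def)

lemma ten1_N_Pr [simp]: "ten1 A N (Pr1 A D D) (Pr2 A D D) = Ten N"
  using ten1_Pr[of N] by simp

text \<open>Compatibility of \<open>\<beta>\<close> with the tensor product says that \<open>u\<close> is a bimorphism, and compatibility
  with the unit is a unit law of the monad.\<close>

lemma beta_monoidal: "monoidal_two_cell A \<beta>L"
proof (rule monoidal_two_cellI)
  have alg: "halg (Prod A D D) (Pr1 A D D)" "halg (Prod A D D) (Pr2 A D D)" by (simp_all add: halg_def)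
  show "lax_monoidal A (lax_comp A L UL)" by (rule lax_comp_lax) simp_all
  show "(\<beta> \<lhd> Ten (Lsrc (lax_comp A L UL))) \<cdot> Lphi (lax_comp A L UL) = Lphi UL \<cdot>
    ten2 A (Ltrg (lax_comp A L UL)) (\<beta> \<lhd> Pr1 A (Und (Lsrc (lax_comp A L UL))) (Und (Lsrc (lax_comp A L UL)))) (\<beta> \<lhd> Pr2 A (Und (Lsrc (lax_comp A L UL))) (Und (Lsrc (lax_comp A L UL))))"
    using uu_bimor[OF _ alg] by (simp add: lax_comp_def Let_def Lphi_UL)
  have "(\<beta> \<lhd> (F \<odot> Unt M)) \<cdot> (R \<rhd> (\<eta> \<lhd> Unt M)) \<cdot> (\<eta> \<lhd> Unt M) = \<eta> \<lhd> Unt M"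
    using vcomp_reduce[OF mu_R_eta_el(1)[of "Unt M"], of "\<eta> \<lhd> Unt M"] by simp
  then show "(\<beta> \<lhd> Unt (Lsrc (lax_comp A L UL))) \<cdot> Lphi0 (lax_comp A L UL) = Lphi0 UL"
    by (simp add: lax_comp_phi0 phi0_eq)
qed simp_all

lemma subequalizing_EM: "subequalizing (Mon_l A) T N UL \<beta>L"
  unfolding subequalizing_def Let_def Mon_l_cells Mon_l_pre Mon_l_post
  using beta_monoidal beta_laws lax_comp_assoc3[of UL L L] lax_comp_id(1)[of UL]
  by simp

text \<open>The structure cells of a lax monoidal 1-cell into \<open>N\<close> can be recovered from those of its
  composite with \<open>UL\<close>, because \<open>u\<close> and \<open>\<eta>\<close> are dense.\<close>

lemma EM_inj1:
  assumes f: "lax_monoidal A f" "Ltrg f = N" and g: "lax_monoidal A g" "Ltrg g = N" "Lsrc f = Lsrc g"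
    and c: "lax_comp A UL f = lax_comp A UL g" and b: "\<beta> \<lhd> Lcell f = \<beta> \<lhd> Lcell g"
  shows "f = g"
proof -
  let ?P = "Und (Lsrc g)" let ?X = "Prod A ?P ?P" let ?x = "Pr1 A ?P ?P" let ?y = "Pr2 A ?P ?P"
  note [simp] = f g
  note fm = lax_mem[OF f(1)] lax_mem[OF g(1)] Lphi_mem[OF f(1)] Lphi_mem[OF g(1)]
  note [simp] = fm[unfolded f g N(1)]
  have "U \<odot> Lcell f = U \<odot> Lcell g" using arg_cong[OF c, of Lcell] by simp
  then have cell: "Lcell f = Lcell g" by (rule em_inj1[rotated 5]) (simp_all add: b)
  have alg: "halg ?X (Lcell g \<odot> ?x)" "halg ?X (Lcell g \<odot> ?y)" by (simp_all add: halg_def)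
  have "(U \<rhd> Lphi f) \<cdot> uu (Lcell g \<odot> ?x) (Lcell g \<odot> ?y) = (U \<rhd> Lphi g) \<cdot> uu (Lcell g \<odot> ?x) (Lcell g \<odot> ?y)"
    using arg_cong[OF c, of Lphi] cell by (simp add: lax_comp_def Let_def)
  then have "Lphi f = Lphi g"
    by (rule uu_cancel[OF _ alg, rotated -1]) (simp_all add: cell)
  moreover have "(U \<rhd> Lphi0 f) \<cdot> (\<eta> \<lhd> Unt M) = (U \<rhd> Lphi0 g) \<cdot> (\<eta> \<lhd> Unt M)"
    using arg_cong[OF c, of Lphi0] by (simp add: lax_comp_phi0)
  then have "Lphi0 f = Lphi0 g"
    by (rule eta_cancel[of "Term A", rotated -1]) (simp_all add: cell hob_def)
  ultimately show ?thesis using cell f g by (intro lax_data.equality) simp_all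
qed

text \<open>Since \<open>\<nu>\<close> is monoidal, the structure cell of \<open>w\<close> is a bimorphism and extends along \<open>u\<close>. The
  nullary structure cell extends along \<open>\<eta>\<close>, the unit of \<open>N\<close> being the free algebra on that of \<open>M\<close>.
  The axioms hold by testing on dense cells.\<close>

lemma EM_ex1:
  assumes s: "subequalizing (Mon_l A) T P w \<nu>" and P: "monoidal_object A P"
  shows "\<exists>f. lax_monoidal A f \<and> Lsrc f = P \<and> Ltrg f = N \<and> lax_comp A UL f = w \<and> \<beta>L \<lhd>\<^bsub>Mon_l A\<^esub> f = \<nu>"
proof -
  let ?W = "Lcell w" let ?n = "Mcell \<nu>" let ?C = "Und P" let ?\<psi> = "at2 A (Lphi w)"
  have w [simp]: "lax_monoidal A w" "Lsrc w = P" "Ltrg w = M" and n [simp]: "monoidal_two_cell A \<nu>" "Mdom \<nu> = lax_comp A L w" "Mcod \<nu> = w"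
    and eqs: "?n \<cdot> (\<eta> \<lhd> ?W) = Id2 A ?W" "?n \<cdot> (R \<rhd> ?n) = ?n \<cdot> (\<mu> \<lhd> ?W)"
    using s unfolding subequalizing_def Let_def Mon_l_cells Mon_l_pre Mon_l_post by auto
  note [simp] = P lax_mem[OF w(1), unfolded w] Lphi_mem[OF w(1), unfolded w]
  have nc [simp]: "?n \<in> Two A" "Dom A ?n = R \<odot> ?W" "Cod A ?n = ?W" using mon2_mem[OF n(1)] by simp_all
  obtain f0 where f0 [simp]: "f0 \<in> One A" "Src A f0 = ?C" "Trg A f0 = D" and Uf: "U \<odot> f0 = ?W" and bf: "\<beta> \<lhd> f0 = ?n"
    using em_lift1'[of ?W ?C ?n] eqs by auto
  have Uf' [simp]: "U \<odot> f0 \<odot> h = ?W \<odot> h" if "h \<in> One A" "Trg A h = ?C" for h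
  proof -
    have "(U \<odot> f0) \<odot> h = U \<odot> f0 \<odot> h" using that by (intro comp1_assoc') simp_all
    then show ?thesis by (simp add: Uf)
  qed
  have bf' [simp]: "\<beta> \<lhd> (f0 \<odot> h) = ?n \<lhd> h" if "h \<in> One A" "Trg A h = ?C" for h
  proof -
    have "(\<beta> \<lhd> f0) \<lhd> h = \<beta> \<lhd> (f0 \<odot> h)" using that by (intro pre_pre) simp_all
    then show ?thesis by (simp add: bf)
  qed
  have psi_mem [simp]: "?\<psi> x y \<in> Two A" "Dom A (?\<psi> x y) = ten1 A M (?W \<odot> x) (?W \<odot> y)" "Cod A (?\<psi> x y) = ?W \<odot> ten1 A P x y"
    if "x \<in> One A" "y \<in> One A" "Src A y = Src A x" "Trg A x = ?C" "Trg A y = ?C" for x y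
    using phi_mem[OF w(1), of x "Src A x" y] that by simp_all
  let ?X = "Prod A ?C ?C" let ?x = "Pr1 A ?C ?C" let ?y = "Pr2 A ?C ?C"
  have alg: "halg ?X (f0 \<odot> ?x)" "halg ?X (f0 \<odot> ?y)" "halg ?X (f0 \<odot> Ten P)" by (simp_all add: halg_def)
  have "(?n \<lhd> Ten P) \<cdot> Lphi (lax_comp A L w) = Lphi w \<cdot> ten2 A M (?n \<lhd> ?x) (?n \<lhd> ?y)"
    using mon2_tensor_Pr[OF n(1)] by simp
  then have bi: "(?n \<lhd> Ten P) \<cdot> (R \<rhd> Lphi w) \<cdot> at2 A \<phi> (?W \<odot> ?x) (?W \<odot> ?y) = Lphi w \<cdot> ten2 A M (?n \<lhd> ?x) (?n \<lhd> ?y)"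
    by (simp add: lax_comp_def Let_def)
  obtain \<gamma> where \<gamma> [simp]: "\<gamma> \<in> Two A" "Dom A \<gamma> = ten1 A N (f0 \<odot> ?x) (f0 \<odot> ?y)" "Cod A \<gamma> = f0 \<odot> Ten P"
    and \<gamma>u: "(U \<rhd> \<gamma>) \<cdot> uu (f0 \<odot> ?x) (f0 \<odot> ?y) = Lphi w"
    using ext2_cell[OF _ alg, of "Lphi w"] bi by auto
  obtain \<gamma>0 where \<gamma>0 [simp]: "\<gamma>0 \<in> Two A" "Dom A \<gamma>0 = F \<odot> Unt M" "Cod A \<gamma>0 = f0 \<odot> Unt P"
    and \<gamma>0u: "(U \<rhd> \<gamma>0) \<cdot> (\<eta> \<lhd> Unt M) = Lphi0 w"
    using ext_free_cell[of "Term A" "Unt M" "f0 \<odot> Unt P" "Lphi0 w"] by (auto simp: hob_def halg_def)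
  let ?g = "at2 A \<gamma>"
  have g_mem [simp]: "?g x y \<in> Two A" "Dom A (?g x y) = ten1 A N (f0 \<odot> x) (f0 \<odot> y)" "Cod A (?g x y) = f0 \<odot> ten1 A P x y"
     "(U \<rhd> ?g x y) \<cdot> uu (f0 \<odot> x) (f0 \<odot> y) = ?\<psi> x y"
    if [simp]: "x \<in> One A" "y \<in> One A" "Src A y = Src A x" "Trg A x = ?C" "Trg A y = ?C" for x y
    using arg_cong[OF \<gamma>u, of "\<lambda>s. s \<lhd> pair1 A x y"] by (simp_all add: at2_def)
  let ?f = "\<lparr>Lsrc = P, Ltrg = N, Lcell = f0, Lphi = \<gamma>, Lphi0 = \<gamma>0\<rparr>"
  \<comment> \<open>The axioms for the structure cells \<open>\<gamma>\<close> and \<open>\<gamma>0\<close> reduce to those of \<open>w\<close>.\<close>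
  have assoc: "(f0 \<rhd> at3 A (Asc P) x y z) \<cdot> ?g x (ten1 A P y z) \<cdot> ten2 A N (Id2 A (f0 \<odot> x)) (?g y z) =
     ?g (ten1 A P x y) z \<cdot> ten2 A N (?g x y) (Id2 A (f0 \<odot> z)) \<cdot> at3 A (Asc N) (f0 \<odot> x) (f0 \<odot> y) (f0 \<odot> z)"
    if [simp]: "x \<in> One A" "y \<in> One A" "z \<in> One A" "Src A x = X" "Src A y = X" "Src A z = X" "Trg A x = ?C" "Trg A y = ?C" "Trg A z = ?C" for x y z X
  proof -
    have X: "X \<in> Zero A" using boundary_mem(1)[of x] by simp
    have Ua: "U \<rhd> f0 \<rhd> at3 A (Asc P) x y z = ?W \<rhd> at3 A (Asc P) x y z"
      unfolding Uf[symmetric] by (rule post_post[symmetric]) simp_all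
    show ?thesis
    proof (rule lax_assoc_cells[OF X])
      show "(U \<rhd> f0 \<rhd> at3 A (Asc P) x y z) \<cdot> ((U \<rhd> ?g x (ten1 A P y z)) \<cdot> uu (f0 \<odot> x) (f0 \<odot> ten1 A P y z)) \<cdot>
         ten2 A M (Id2 A (U \<odot> f0 \<odot> x)) ((U \<rhd> ?g y z) \<cdot> uu (f0 \<odot> y) (f0 \<odot> z)) =
         ((U \<rhd> ?g (ten1 A P x y) z) \<cdot> uu (f0 \<odot> ten1 A P x y) (f0 \<odot> z)) \<cdot> ten2 A M ((U \<rhd> ?g x y) \<cdot> uu (f0 \<odot> x) (f0 \<odot> y)) (Id2 A (U \<odot> f0 \<odot> z)) \<cdot>
         at3 A (Asc M) (U \<odot> f0 \<odot> x) (U \<odot> f0 \<odot> y) (U \<odot> f0 \<odot> z)"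
        unfolding Ua using phi_assoc_el[OF w(1), of x X y z] by simp
    qed (simp_all add: halg_def)
  qed
  have J: "unit_at A N ?C = F \<odot> unit_at A M ?C" by simp
  have \<gamma>0b: "(U \<rhd> (\<gamma>0 \<lhd> bang A ?C)) \<cdot> (\<eta> \<lhd> unit_at A M ?C) = Lphi0 w \<lhd> bang A ?C"
    using arg_cong[OF \<gamma>0u, of "\<lambda>s. s \<lhd> bang A ?C"] by simp
  have \<gamma>0m [simp]: "Cod A (\<gamma>0 \<lhd> bang A ?C) = f0 \<odot> unit_at A P ?C" "Dom A (\<gamma>0 \<lhd> bang A ?C) = F \<odot> unit_at A M ?C" by simp_all
  have lun: "(f0 \<rhd> Lun P) \<cdot> ?g (unit_at A P ?C) (Id1 A ?C) \<cdot> ten2 A N (\<gamma>0 \<lhd> bang A ?C) (Id2 A f0) = Lun N \<lhd> f0"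
  proof -
    note [simp] = Lun_mem[OF P]
    have Ua: "U \<rhd> f0 \<rhd> Lun P = ?W \<rhd> Lun P"
      unfolding Uf[symmetric] by (rule post_post[symmetric]) simp_all
    show ?thesis
    proof (rule lax_left_unit_cells[where e = "f0 \<odot> unit_at A P ?C" and X = ?C])
      show "(U \<rhd> f0 \<rhd> Lun P) \<cdot> ((U \<rhd> ?g (unit_at A P ?C) (Id1 A ?C)) \<cdot> uu (f0 \<odot> unit_at A P ?C) f0) \<cdot>
         ten2 A M ((U \<rhd> (\<gamma>0 \<lhd> bang A ?C)) \<cdot> (\<eta> \<lhd> unit_at A M ?C)) (Id2 A (U \<odot> f0)) = Lun M \<lhd> (U \<odot> f0)"
        unfolding \<gamma>0b Ua Uf using phi_lun_el[OF w(1), of "Id1 A ?C" ?C] g_mem(4)[of "unit_at A P ?C" "Id1 A ?C"] by simp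
    qed (simp_all add: halg_def)
  qed
  have run: "(f0 \<rhd> Run P) \<cdot> ?g (Id1 A ?C) (unit_at A P ?C) \<cdot> ten2 A N (Id2 A f0) (\<gamma>0 \<lhd> bang A ?C) = Run N \<lhd> f0"
  proof -
    note [simp] = Run_mem[OF P]
    have Ua: "U \<rhd> f0 \<rhd> Run P = ?W \<rhd> Run P"
      unfolding Uf[symmetric] by (rule post_post[symmetric]) simp_all
    show ?thesis
    proof (rule lax_right_unit_cells[where e = "f0 \<odot> unit_at A P ?C" and X = ?C])
      show "(U \<rhd> f0 \<rhd> Run P) \<cdot> ((U \<rhd> ?g (Id1 A ?C) (unit_at A P ?C)) \<cdot> uu f0 (f0 \<odot> unit_at A P ?C)) \<cdot>
         ten2 A M (Id2 A (U \<odot> f0)) ((U \<rhd> (\<gamma>0 \<lhd> bang A ?C)) \<cdot> (\<eta> \<lhd> unit_at A M ?C)) = Run M \<lhd> (U \<odot> f0)"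
        unfolding \<gamma>0b Ua Uf using phi_run_el[OF w(1), of "Id1 A ?C" ?C] g_mem(4)[of "Id1 A ?C" "unit_at A P ?C"] by simp
    qed (simp_all add: halg_def)
  qed
  have f: "lax_monoidal A ?f"
    unfolding lax_monoidal_def Let_def cell_defs lax_data.simps
    using lun run assoc[of "proj3_1 A ?C" "proj3_2 A ?C" "proj3_3 A ?C" "Prod A ?C (Prod A ?C ?C)"] by simp
  have c: "lax_comp A UL ?f = w"
    by (rule lax_data.equality) (simp_all add: lax_comp_def Let_def Uf \<gamma>u \<gamma>0u)
  have a: "lax_comp A (lax_comp A L UL) ?f = lax_comp A L w"
    using lax_comp_assoc3[OF f UL_lax L(1)] c by simp
  have "\<beta>L \<lhd>\<^bsub>Mon_l A\<^esub> ?f = \<nu>"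
    unfolding Mon_l_pre by (rule mon_two_data.equality) (simp_all add: a c bf)
  with f c show ?thesis by (intro exI[of _ ?f]) simp
qed

text \<open>The underlying cell lifts by the universal property in \<open>A\<close>; that the lift is monoidal is
  tested on the dense cells \<open>u\<close> and \<open>\<eta>\<close>.\<close>

lemma EM_ex2:
  assumes f [simp]: "lax_monoidal A f" "Ltrg f = N" and g [simp]: "lax_monoidal A g" "Ltrg g = N" and fg [simp]: "Lsrc g = Lsrc f"
    and s: "monoidal_two_cell A s" "Mdom s = lax_comp A UL f" "Mcod s = lax_comp A UL g"
    and eq: "Mcell s \<cdot> (\<beta> \<lhd> Lcell f) = (\<beta> \<lhd> Lcell g) \<cdot> (R \<rhd> Mcell s)"
  shows "\<exists>t. monoidal_two_cell A t \<and> Mdom t = f \<and> Mcod t = g \<and> UL \<rhd>\<^bsub>Mon_l A\<^esub> t = s"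
proof -
  let ?P = "Lsrc f" let ?C = "Und ?P" let ?X = "Prod A ?C ?C" let ?x = "Pr1 A ?C ?C" let ?y = "Pr2 A ?C ?C"
  note [simp] = lax_mem[OF f(1), unfolded f N(1)] lax_mem[OF g(1), unfolded fg g N(1)] Lphi_mem[OF f(1), unfolded f] Lphi_mem[OF g(1), unfolded fg g]
  have sc [simp]: "Mcell s \<in> Two A" "Dom A (Mcell s) = U \<odot> Lcell f" "Cod A (Mcell s) = U \<odot> Lcell g"
    using mon2_mem[OF s(1)] s(2,3) by simp_all
  obtain t where t [simp]: "t \<in> Two A" "Dom A t = Lcell f" "Cod A t = Lcell g" and Ut: "U \<rhd> t = Mcell s"
    using em_lift2'[of "Lcell f" "Lcell g" "Mcell s"] eq by auto
  have Ut': "U \<rhd> (t \<lhd> h) = Mcell s \<lhd> h" if "h \<in> One A" "Trg A h = ?C" for h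
    unfolding Ut[symmetric] by (rule post_pre[symmetric]) (use that in simp_all)
  have alg: "halg ?X (Lcell f \<odot> ?x)" "halg ?X (Lcell f \<odot> ?y)" by (simp_all add: halg_def)
  have "(t \<lhd> Ten ?P) \<cdot> Lphi f = Lphi g \<cdot> ten2 A N (t \<lhd> ?x) (t \<lhd> ?y)"
  proof (rule uu_cancel[OF _ alg])
    have 1: "(Mcell s \<lhd> Ten ?P) \<cdot> Lphi (lax_comp A UL f) = Lphi (lax_comp A UL g) \<cdot> ten2 A M (Mcell s \<lhd> ?x) (Mcell s \<lhd> ?y)"
      using mon2_tensor_Pr[OF s(1)] s(2,3) by simp
    have 2: "(U \<rhd> ten2 A N (t \<lhd> ?x) (t \<lhd> ?y)) \<cdot> uu (Lcell f \<odot> ?x) (Lcell f \<odot> ?y) =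
       uu (Lcell g \<odot> ?x) (Lcell g \<odot> ?y) \<cdot> ten2 A M (Mcell s \<lhd> ?x) (Mcell s \<lhd> ?y)"
      using uu_nat[of "t \<lhd> ?x" "t \<lhd> ?y"] by (simp add: Ut')
    have "(U \<rhd> ((t \<lhd> Ten ?P) \<cdot> Lphi f)) \<cdot> uu (Lcell f \<odot> ?x) (Lcell f \<odot> ?y) = (Mcell s \<lhd> Ten ?P) \<cdot> Lphi (lax_comp A UL f)"
      by (simp add: Ut' lax_comp_def Let_def)
    also have "\<dots> = (U \<rhd> Lphi g) \<cdot> ((U \<rhd> ten2 A N (t \<lhd> ?x) (t \<lhd> ?y)) \<cdot> uu (Lcell f \<odot> ?x) (Lcell f \<odot> ?y))"
      unfolding 1 2 by (simp add: lax_comp_def Let_def)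
    also have "\<dots> = (U \<rhd> (Lphi g \<cdot> ten2 A N (t \<lhd> ?x) (t \<lhd> ?y))) \<cdot> uu (Lcell f \<odot> ?x) (Lcell f \<odot> ?y)"
      by simp
    finally show "(U \<rhd> ((t \<lhd> Ten ?P) \<cdot> Lphi f)) \<cdot> uu (Lcell f \<odot> ?x) (Lcell f \<odot> ?y) =
       (U \<rhd> (Lphi g \<cdot> ten2 A N (t \<lhd> ?x) (t \<lhd> ?y))) \<cdot> uu (Lcell f \<odot> ?x) (Lcell f \<odot> ?y)" .
  qed simp_all
  moreover have "(t \<lhd> Unt ?P) \<cdot> Lphi0 f = Lphi0 g"
  proof (rule eta_cancel[of "Term A" "Unt M"])
    have "(U \<rhd> ((t \<lhd> Unt ?P) \<cdot> Lphi0 f)) \<cdot> (\<eta> \<lhd> Unt M) = (Mcell s \<lhd> Unt ?P) \<cdot> Lphi0 (lax_comp A UL f)"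
      by (simp add: Ut' lax_comp_phi0)
    also have "\<dots> = Lphi0 (lax_comp A UL g)" using mon2_unit[OF s(1)] s(2,3) by simp
    finally show "(U \<rhd> ((t \<lhd> Unt ?P) \<cdot> Lphi0 f)) \<cdot> (\<eta> \<lhd> Unt M) = (U \<rhd> Lphi0 g) \<cdot> (\<eta> \<lhd> Unt M)" by (simp add: lax_comp_phi0)
  qed (simp_all add: hob_def)
  ultimately have "monoidal_two_cell A \<lparr>Mdom = f, Mcod = g, Mcell = t\<rparr>"
    by (intro monoidal_two_cellI) simp_all
  then show ?thesis using s(2,3) Ut
    by (intro exI[of _ "\<lparr>Mdom = f, Mcod = g, Mcell = t\<rparr>"]) (simp add: Mon_l_post)
qed

lemma em_object_Mon_l: "em_object (Mon_l A) T EM"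
proof (rule Ml.em_objectI, unfold EM_simps Mon_l_cells)
  show "subequalizing (Mon_l A) T N UL \<beta>L" by (rule subequalizing_EM)
next
  fix f g X
  assume f: "lax_monoidal A f \<and> Lsrc f = X \<and> Ltrg f = N" and g: "lax_monoidal A g \<and> Lsrc g = X \<and> Ltrg g = N"
    and "Comp1 (Mon_l A) UL f = Comp1 (Mon_l A) UL g" "\<beta>L \<lhd>\<^bsub>Mon_l A\<^esub> f = \<beta>L \<lhd>\<^bsub>Mon_l A\<^esub> g"
  with f g show "f = g" by - (rule EM_inj1, simp_all add: Mon_l_pre)
next
  fix w \<nu> X
  assume "X \<in> Zero (Mon_l A)" "subequalizing (Mon_l A) T X w \<nu>"
  then show "\<exists>f. (lax_monoidal A f \<and> Lsrc f = X \<and> Ltrg f = N) \<and> Comp1 (Mon_l A) UL f = w \<and> \<beta>L \<lhd>\<^bsub>Mon_l A\<^esub> f = \<nu>"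
    using EM_ex1[of X w \<nu>] by auto
next
  fix f g s t X
  assume f: "lax_monoidal A f \<and> Lsrc f = X \<and> Ltrg f = N" and g: "lax_monoidal A g \<and> Lsrc g = X \<and> Ltrg g = N"
   and s: "monoidal_two_cell A s \<and> Mdom s = f \<and> Mcod s = g" and t: "monoidal_two_cell A t \<and> Mdom t = f \<and> Mcod t = g"
   and eq: "UL \<rhd>\<^bsub>Mon_l A\<^esub> s = UL \<rhd>\<^bsub>Mon_l A\<^esub> t"
  have "U \<rhd> Mcell s = U \<rhd> Mcell t" using arg_cong[OF eq, of Mcell] by (simp add: Mon_l_post)
  then have "Mcell s = Mcell t"
    by (rule em_inj2[rotated 5]) (use f s t mon2_mem[of s] mon2_mem[of t] lax_mem[of f] in auto)
  with s t show "s = t" by (intro mon_two_data.equality) auto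
next
  fix f g s X
  assume f: "lax_monoidal A f \<and> Lsrc f = X \<and> Ltrg f = N" and g: "lax_monoidal A g \<and> Lsrc g = X \<and> Ltrg g = N"
   and s: "monoidal_two_cell A s \<and> Mdom s = Comp1 (Mon_l A) UL f \<and> Mcod s = Comp1 (Mon_l A) UL g"
   and eq: "Vcomp (Mon_l A) s (\<beta>L \<lhd>\<^bsub>Mon_l A\<^esub> f) = Vcomp (Mon_l A) (\<beta>L \<lhd>\<^bsub>Mon_l A\<^esub> g) (Mend T \<rhd>\<^bsub>Mon_l A\<^esub> s)"
  show "\<exists>t. (monoidal_two_cell A t \<and> Mdom t = f \<and> Mcod t = g) \<and> UL \<rhd>\<^bsub>Mon_l A\<^esub> t = s"
    using EM_ex2[of f g s] f g s eq by (auto simp: Mon_l_pre Mon_l_post)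
qed simp_all

end

section \<open>The free 1-cell and the monoidal adjunction\<close>

context em_standard
begin

interpretation Ml: two_category "Mon_l A" by (rule two_category_Mon_l)

abbreviation "FL \<equiv> em_free (Mon_l A) T EM"

lemma FL_props: "lax_monoidal A FL" "Lsrc FL = M" "Ltrg FL = N" "lax_comp A UL FL = L" "\<beta> \<lhd> Lcell FL = \<mu>"
proof -
  note p = Ml.em_free_mem[OF monad_T(1) em_object_Mon_l, unfolded EM_simps]
  show 1: "lax_monoidal A FL" "Lsrc FL = M" "Ltrg FL = N" "lax_comp A UL FL = L" using p by simp_all
  show "\<beta> \<lhd> Lcell FL = \<mu>" using arg_cong[OF p(5), of Mcell] by (simp add: Mon_l_pre)
qed

lemma Lcell_FL: "Lcell FL = F"
proof (rule em_inj1)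
  show "U \<odot> Lcell FL = U \<odot> F" using arg_cong[OF FL_props(4), of Lcell] by simp
qed (use FL_props lax_mem[OF FL_props(1)] in simp_all)

lemma epsilon_mem [simp]: "\<epsilon> \<in> Two A" "Dom A \<epsilon> = F \<odot> U" "Cod A \<epsilon> = Id1 A D" "U \<rhd> \<epsilon> = \<beta>"
  using em_counit_mem[OF monad_T(2) E] by simp_all

lemma counit_Mon_l: "em_counit (Mon_l A) T EM = \<lparr>Mdom = lax_comp A FL UL, Mcod = lax_id A N, Mcell = \<epsilon>\<rparr>"
proof -
  let ?e = "em_counit (Mon_l A) T EM"
  note p = Ml.em_counit_mem[OF monad_T(1) em_object_Mon_l, unfolded EM_simps]
  have e: "monoidal_two_cell A ?e" "Mdom ?e = lax_comp A FL UL" "Mcod ?e = lax_id A N" using p by simp_all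
  have m: "Mcell ?e \<in> Two A" "Dom A (Mcell ?e) = F \<odot> U" "Cod A (Mcell ?e) = Id1 A D"
    using mon2_mem[OF e(1)] e(2,3) by (simp_all add: Lcell_FL)
  have "U \<rhd> Mcell ?e = U \<rhd> \<epsilon>" using arg_cong[OF p(4), of Mcell] by (simp add: Mon_l_post)
  then have "Mcell ?e = \<epsilon>" by (rule em_inj2[rotated 5]) (use m in simp_all)
  with e show ?thesis by (intro mon_two_data.equality) simp_all
qed

abbreviation "v \<equiv> Lphi FL"
abbreviation "v0 \<equiv> Lphi0 FL"
abbreviation "x1 \<equiv> Pr1 A C C"
abbreviation "x2 \<equiv> Pr2 A C C"

lemma v_mem [simp]: "v \<in> Two A" "Dom A v = ten1 A N (F \<odot> x1) (F \<odot> x2)" "Cod A v = F \<odot> Ten M"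
  "v0 \<in> Two A" "Dom A v0 = F \<odot> Unt M" "Cod A v0 = F \<odot> Unt M"
  using Lphi_mem[OF FL_props(1)] by (simp_all add: FL_props(2,3) Lcell_FL)

lemma v_eqs: "(U \<rhd> v) \<cdot> uu (F \<odot> x1) (F \<odot> x2) = \<phi>" "(U \<rhd> v0) \<cdot> (\<eta> \<lhd> Unt M) = \<eta> \<lhd> Unt M"
  using arg_cong[OF FL_props(4), of Lphi] arg_cong[OF FL_props(4), of Lphi0]
  by (simp_all add: lax_comp_def Let_def FL_props(2) Lcell_FL phi0_eq)

text \<open>Under \<open>U\<close>, the induced oplax structure restricts along \<open>\<eta>\<close> to \<open>u \<cdot> (\<eta> \<otimes> \<eta>)\<close>, and \<open>v\<close> takes this
  cell back to \<open>\<phi> \<cdot> (\<eta> \<otimes> \<eta>) = \<eta>\<close>. Both cells are dense, so the two structures are inverse to each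
  other.\<close>

lemma v_inverse: "inverse_cells A (induced_oplax A F UL \<eta> \<epsilon>) v"
proof -
  let ?J = "ten1 A N (F \<odot> x1) (F \<odot> x2)" let ?u = "uu (F \<odot> x1) (F \<odot> x2)" let ?h = "ten2 A M (\<eta> \<lhd> x1) (\<eta> \<lhd> x2)"
  let ?o = "induced_oplax A F UL \<eta> \<epsilon>" let ?X = "Prod A C C"
  have hob: "hob ?X x1" "hob ?X x2" "hob ?X (Ten M)" by (simp_all add: hob_def)
  have o: "?o = (\<epsilon> \<lhd> ?J) \<cdot> (F \<rhd> ?u) \<cdot> (F \<rhd> ?h)" by (simp add: induced_oplax_def Let_def)
  have om [simp]: "?o \<in> Two A" "Dom A ?o = F \<odot> Ten M" "Cod A ?o = ?J" unfolding o by simp_all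
  have UF: "U \<rhd> F \<rhd> s = R \<rhd> s" if "s \<in> Two A" "Trg A (Dom A s) = C" for s
    unfolding F_mem(4)[symmetric] by (rule post_post[symmetric]) (use that in simp_all)
  have Ue: "U \<rhd> (\<epsilon> \<lhd> ?J) = \<beta> \<lhd> ?J"
    unfolding epsilon_mem(4)[symmetric] by (rule post_pre[symmetric]) simp_all
  have Uo: "U \<rhd> ?o = (\<beta> \<lhd> ?J) \<cdot> (R \<rhd> (?u \<cdot> ?h))" unfolding o by (simp add: UF Ue)
  have en: "(R \<rhd> (?u \<cdot> ?h)) \<cdot> (\<eta> \<lhd> Ten M) = (\<eta> \<lhd> (U \<odot> ?J)) \<cdot> (?u \<cdot> ?h)"
    using whisker_exchange[of "?u \<cdot> ?h" \<eta>] by simp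
  have Uoe: "(U \<rhd> ?o) \<cdot> (\<eta> \<lhd> Ten M) = ?u \<cdot> ?h"
  proof -
    have "(U \<rhd> ?o) \<cdot> (\<eta> \<lhd> Ten M) = (\<beta> \<lhd> ?J) \<cdot> ((R \<rhd> (?u \<cdot> ?h)) \<cdot> (\<eta> \<lhd> Ten M))"
      unfolding Uo by simp
    also have "\<dots> = ((\<beta> \<lhd> ?J) \<cdot> (\<eta> \<lhd> (U \<odot> ?J))) \<cdot> (?u \<cdot> ?h)" unfolding en by simp
    also have "\<dots> = ?u \<cdot> ?h" by (subst beta_el) simp_all
    finally show ?thesis .
  qed
  have pe: "\<phi> \<cdot> ?h = \<eta> \<lhd> Ten M"
    using eta_ten[of x1 x2] Lphi_at2[OF L(1)] by simp
  have phim [simp]: "\<phi> \<in> Two A" "Dom A \<phi> = ten1 A M (R \<odot> x1) (R \<odot> x2)" using Lphi_mem[OF L(1)] by simp_all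
  have vuh: "(U \<rhd> v) \<cdot> ?u \<cdot> ?h = \<eta> \<lhd> Ten M"
    using vcomp_reduce[OF v_eqs(1), of ?h] pe by simp
  have "v \<cdot> ?o = Id2 A (F \<odot> Ten M)"
  proof (rule eta_cancel[OF _ hob(3)])
    have "(U \<rhd> (v \<cdot> ?o)) \<cdot> (\<eta> \<lhd> Ten M) = (U \<rhd> v) \<cdot> ((U \<rhd> ?o) \<cdot> (\<eta> \<lhd> Ten M))" by simp
    then show "(U \<rhd> (v \<cdot> ?o)) \<cdot> (\<eta> \<lhd> Ten M) = (U \<rhd> Id2 A (F \<odot> Ten M)) \<cdot> (\<eta> \<lhd> Ten M)"
      unfolding Uoe vuh by simp
  qed simp_all
  moreover have "?o \<cdot> v = Id2 A ?J"
  proof (rule uu_eta_cancel[OF _ hob(1,2)])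
    have "(U \<rhd> (?o \<cdot> v)) \<cdot> ?u \<cdot> ?h = (U \<rhd> ?o) \<cdot> ((U \<rhd> v) \<cdot> ?u \<cdot> ?h)" by simp
    then show "(U \<rhd> (?o \<cdot> v)) \<cdot> ?u \<cdot> ?h = (U \<rhd> Id2 A ?J) \<cdot> ?u \<cdot> ?h"
      unfolding vuh Uoe by simp
  qed simp_all
  ultimately show ?thesis unfolding inverse_cells_def cell_defs
    by (intro exI[of _ "F \<odot> Ten M"] exI[of _ ?J]) simp
qed

text \<open>Both cells are identities: the first by a triangle identity, the second because it fixes the
  dense cell \<open>\<eta>\<close>.\<close>

lemma v0_inverse: "inverse_cells A (induced_oplax0 A F UL \<epsilon>) v0"
proof -
  have adj: "(\<epsilon> \<lhd> F) \<cdot> (F \<rhd> \<eta>) = Id2 A F"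
    using em_adjunction[OF monad_T(2) E] by (auto simp: adjunction_def underlying_monad_def)
  have o: "induced_oplax0 A F UL \<epsilon> = Id2 A (F \<odot> Unt M)"
    using arg_cong[OF adj, of "\<lambda>s. s \<lhd> Unt M"] by (simp add: induced_oplax0_def)
  have "v0 = Id2 A (F \<odot> Unt M)"
    by (rule eta_cancel[of "Term A" "Unt M"]) (use v_eqs(2) in \<open>simp_all add: hob_def\<close>)
  then show ?thesis unfolding o inverse_cells_def cell_defs by simp
qed

lemma strong_FL: "strong_monoidal A FL"
proof -
  have "invertible A v" "invertible A v0"
    using v_inverse v0_inverse unfolding invertible_def inverse_cells_def by blast+
  then show ?thesis using FL_props(1) by (simp add: strong_monoidal_def)
qed

lemma monoidal_adjunction: "adjunction (Mon_l A) FL UL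
   \<lparr>Mdom = lax_id A M, Mcod = lax_comp A UL FL, Mcell = \<eta>\<rparr> \<lparr>Mdom = lax_comp A FL UL, Mcod = lax_id A N, Mcell = \<epsilon>\<rparr>"
proof -
  have "Meta T = \<lparr>Mdom = lax_id A M, Mcod = lax_comp A UL FL, Mcell = \<eta>\<rparr>"
    by (rule mon_two_data.equality) (simp_all add: FL_props(4))
  then show ?thesis using Ml.em_adjunction[OF monad_T(1) em_object_Mon_l] by (simp add: counit_Mon_l)
qed

lemma FL_record: "\<lparr>Lsrc = M, Ltrg = N, Lcell = F, Lphi = v, Lphi0 = v0\<rparr> = FL"
  by (rule lax_data.equality) (simp_all add: FL_props Lcell_FL)

end

theorem theorem4p1:
  fixes A :: "('o, 'a, 't) fp_two_cat"
    and T :: "('o, 'a, 't) lax_monoidal_monad"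
    and E :: "('o, 'a, 't) em_data"
  assumes "fp_two_category A"
    and "rc_lax_monoidal_monad A T"
    and "em_object A (underlying_monad T) E"
  shows "(\<exists>q. standard_coequalizer A T E q) \<and>
    (\<forall>q. standard_coequalizer A T E q \<longrightarrow>
      (\<exists>!N. standard_structure A T E q N) \<and>
      (\<forall>N. standard_structure A T E q N \<longrightarrow>
        em_object (Mon_l A) T (standard_em A T E q N) \<and>
        lax_monoidal A (standard_U A T E q N) \<and>
        (\<exists>v v0.
          let M = Mobj T; \<eta> = Mcell (Meta T);
              F = em_free A (underlying_monad T) E;
              \<epsilon> = em_counit A (underlying_monad T) E;
              UL = standard_U A T E q N;
              FL = \<lparr>Lsrc = M, Ltrg = N, Lcell = F, Lphi = v, Lphi0 = v0\<rparr>
          in inverse_cells A (induced_oplax A F UL \<eta> \<epsilon>) v \<and>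
             inverse_cells A (induced_oplax0 A F UL \<epsilon>) v0 \<and>
             strong_monoidal A FL \<and>
             adjunction (Mon_l A) FL UL
               \<lparr>Mdom = lax_id A M, Mcod = lax_comp A UL FL, Mcell = \<eta>\<rparr>
               \<lparr>Mdom = lax_comp A FL UL, Mcod = lax_id A N, Mcell = \<epsilon>\<rparr>)))"
proof -
  interpret em_setup A T E
    using assms by (simp add: em_setup_def em_setup_axioms_def)
  show ?thesis
  proof (intro conjI allI impI)
    show "\<exists>q. standard_coequalizer A T E q" by (rule standard_coequalizer_exists)
  next
    fix q assume q: "standard_coequalizer A T E q"
    show "\<exists>!N. standard_structure A T E q N"
      using standard_structure_exists[OF q] standard_structure_unique[OF q] by blast
    fix N assume N: "standard_structure A T E q N"
    interpret s: em_standard A T E q N using q N by unfold_locales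
    show "em_object (Mon_l A) T (standard_em A T E q N)" by (rule s.em_object_Mon_l)
    show "lax_monoidal A (standard_U A T E q N)" by (rule s.UL_lax)
    show "\<exists>v v0.
          let M = Mobj T; \<eta> = Mcell (Meta T);
              F = em_free A (underlying_monad T) E;
              \<epsilon> = em_counit A (underlying_monad T) E;
              UL = standard_U A T E q N;
              FL = \<lparr>Lsrc = M, Ltrg = N, Lcell = F, Lphi = v, Lphi0 = v0\<rparr>
          in inverse_cells A (induced_oplax A F UL \<eta> \<epsilon>) v \<and>
             inverse_cells A (induced_oplax0 A F UL \<epsilon>) v0 \<and>
             strong_monoidal A FL \<and>
             adjunction (Mon_l A) FL UL
               \<lparr>Mdom = lax_id A M, Mcod = lax_comp A UL FL, Mcell = \<eta>\<rparr>
               \<lparr>Mdom = lax_comp A FL UL, Mcod = lax_id A N, Mcell = \<epsilon>\<rparr>"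
      unfolding Let_def
    proof (rule exI[of _ s.v], rule exI[of _ s.v0], unfold s.FL_record, intro conjI)
    qed (rule s.v_inverse s.v0_inverse s.strong_FL s.monoidal_adjunction)+
  qed
qed

end
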